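(* Assume that $$\lim_{\varepsilon\to 0}\frac{\varepsilon^2}{d_\varepsilon}\left(\ln\left(\frac{\varepsilon}{d_\varepsilon}\right)\right)^{1/2}=0 .$$ Then $\mathsf D_\varepsilon$ converges to $\mathsf D$ in the norm resolvent sense as $\varepsilon\to 0$, and there is a constant $C>0$, depending only on $\varepsilon_0$, $m_\star$, $\rho$, $C_{\rm tr}$ and $\Lambda_{\rm N}$, such that for all $\varepsilon\in(0,\varepsilon_0]$ $$\big\|(\mathsf D_\varepsilon-\mathrm i)^{-1}-(\mathsf D-\mathrm i)^{-1}\big\|\le C\,\frac{\varepsilon^2}{d_\varepsilon}\left(\ln\left(\frac{\varepsilon}{d_\varepsilon}\right)\right)^{1/2},$$ where $\|\cdot\|$ is the operator norm on $L^2(\mathbb R^2;\mathbb C^2)$.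
   Context: Geometric setting. Let $\mathbf Y=(-\tfrac12,\tfrac12)^2\subset\mathbb R^2$ be the open unit square centred at the origin, and for $\varepsilon>0$, $k\in\mathbb Z^2$ set $Y_{k,\varepsilon}=\varepsilon\mathbf Y+\varepsilon k$. Let $0<\varepsilon_0<1$. For each $\varepsilon\in(0,\varepsilon_0]$ we are given a family $\{D_{k,\varepsilon}\}_{k\in\mathbb Z^2}$ of $C^{2,1}$-smooth connected domains (open sets) in $\mathbb R^2$ with $D_{k,\varepsilon}\subset Y_{k,\varepsilon}$. Let $d_{k,\varepsilon}>0$ be the radius of the smallest disk containing $D_{k,\varepsilon}$ (so $d_{k,\varepsilon}\le\varepsilon/\sqrt2$), and let $\mathbf D_{k,\varepsilon}=d_{k,\varepsilon}^{-1}D_{k,\varepsilon}$ be the upscaled set. For a bounded connected open set $\Omega\subset\mathbb R^2$ with Lipschitz boundary, $\Lambda_{\rm N}(\Omega)>0$ is the smallest non-zero eigenvalue of the Neumann Laplacian on $\Omega$. Standing assumptions: (1) for each $\varepsilon\in(0,\varepsilon_0]$: $d_\varepsilon:=\inf_{k\in\mathbb Z^2}d_{k,\varepsilon}>0$; (2) there is $\rho\in(0,1)$ such that for all $\varepsilon\in(0,\varepsilon_0]$, $k\in\mathbb Z^2$ there is $x_{k,\varepsilon}\in\mathbf D_{k,\varepsilon}$ with $\{x\in\mathbb R^2:|x-x_{k,\varepsilon}|<\rho\}\subset\mathbf D_{k,\varepsilon}$; (3) there is $C_{\rm tr}>0$ such that for all $\varepsilon\in(0,\varepsilon_0]$, $k\in\mathbb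 Z^2$ and $u\in H^1(\mathbf D_{k,\varepsilon})$: $\|u\|_{L^2(\partial\mathbf D_{k,\varepsilon})}\le C_{\rm tr}\|u\|_{H^1(\mathbf D_{k,\varepsilon})}$, where $\|u\|_{H^1}^2=\|\nabla u\|_{L^2}^2+\|u\|_{L^2}^2$ and on the left $u$ denotes the trace; (4) there is $\Lambda_{\rm N}>0$ such that $\Lambda_{\rm N}(\mathbf D_{k,\varepsilon})\ge\Lambda_{\rm N}$ for all $\varepsilon\in(0,\varepsilon_0]$, $k\in\mathbb Z^2$. Operators. Let $\sigma_1=\begin{pmatrix}0&1\\1&0\end{pmatrix}$, $\sigma_2=\begin{pmatrix}0&-\mathrm i\\\mathrm i&0\end{pmatrix}$, $\sigma_3=\begin{pmatrix}1&0\\0&-1\end{pmatrix}$ and $\sigma\cdot\nabla=\sigma_1\partial_1+\sigma_2\partial_2$. Fix $m_\star>0$ and set $m_{k,\varepsilon}=m_\star\frac{|Y_{k,\varepsilon}|}{|D_{k,\varepsilon}|}$ ($|\cdot|$ denotes area) and $m_\varepsilon=\sum_{k\in\mathbb Z^2}m_{k,\varepsilon}\chi_{k,\varepsilon}$, where $\chi_{k,\varepsilon}$ is the characteristic function of $D_{k,\varepsilon}$; then $m_\varepsilon\in L^\infty(\mathbb R^2)$. In $L^2(\mathbb R^2;\mathbb C^2)$ define the self-adjoint operators $$\mathsf D_\varepsilon u=-\mathrm i(\sigma\cdot\nabla)u+m_\varepsilon\sigma_3u,\qquad \mathsf Du=-\mathrm i(\sigma\cdot\nabla)u+m_\star\sigma_3u,$$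 both with domain $H^1(\mathbb R^2;\mathbb C^2)$. *)

theory Defs
  imports "HOL-Analysis.Analysis"
begin

section \<open>Square-integrable functions\<close>

definition sq_integrable :: "'a measure \<Rightarrow> ('a \<Rightarrow> 'b::euclidean_space) set" where
  "sq_integrable M = {u \<in> borel_measurable M. integrable M (\<lambda>x. (norm (u x))\<^sup>2)}"

definition l2norm :: "'a measure \<Rightarrow> ('a \<Rightarrow> 'b::euclidean_space) \<Rightarrow> real" where
  "l2norm M u = sqrt (LINT x|M. (norm (u x))\<^sup>2)"


section \<open>Sobolev functions on open subsets of the plane\<close>

definition pd :: "2 \<Rightarrow> (real^2 \<Rightarrow> 'b::real_normed_vector) \<Rightarrow> real^2 \<Rightarrow> 'b" where
  "pd i f x = frechet_derivative f (at x) (axis i 1)"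

primrec Ck :: "nat \<Rightarrow> (real^2 \<Rightarrow> 'b::real_normed_vector) \<Rightarrow> bool" where
  "Ck 0 f \<longleftrightarrow> continuous_on UNIV f"
| "Ck (Suc n) f \<longleftrightarrow> (\<forall>x. f differentiable (at x)) \<and> (\<forall>i. Ck n (pd i f))"

definition smooth :: "(real^2 \<Rightarrow> 'b::real_normed_vector) \<Rightarrow> bool" where
  "smooth f \<longleftrightarrow> (\<forall>n. Ck n f)"

definition test_functions :: "(real^2) set \<Rightarrow> (real^2 \<Rightarrow> real) set" where
  "test_functions \<Omega> = {\<phi>. smooth \<phi> \<and> (\<exists>K. compact K \<and> K \<subseteq> \<Omega> \<and> (\<forall>x. x \<notin> K \<longrightarrow> \<phi> x = 0))}"

definition has_weak_pd ::
  "(real^2) set \<Rightarrow> 2 \<Rightarrow> (real^2 \<Rightarrow> 'b::euclidean_space) \<Rightarrow> (real^2 \<Rightarrow> 'b) \<Rightarrow> bool" where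
  "has_weak_pd \<Omega> i u g \<longleftrightarrow>
     (\<forall>\<phi>\<in>test_functions \<Omega>.
        (LINT x|lebesgue_on \<Omega>. pd i \<phi> x *\<^sub>R u x) = - (LINT x|lebesgue_on \<Omega>. \<phi> x *\<^sub>R g x))"

definition H1 :: "(real^2) set \<Rightarrow> (real^2 \<Rightarrow> 'b::euclidean_space) set" where
  "H1 \<Omega> = {u \<in> sq_integrable (lebesgue_on \<Omega>).
             \<forall>i. \<exists>g \<in> sq_integrable (lebesgue_on \<Omega>). has_weak_pd \<Omega> i u g}"

text \<open>For \<open>u \<in> H1 \<Omega>\<close> with \<open>\<Omega>\<close> open, the weak derivative is unique up to equality almost
  everywhere on \<open>\<Omega>\<close>; everything below depends only on its equivalence class.\<close>

definition wpd ::
  "(real^2) set \<Rightarrow> 2 \<Rightarrow> (real^2 \<Rightarrow> 'b::euclidean_space) \<Rightarrow> real^2 \<Rightarrow> 'b" where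
  "wpd \<Omega> i u = (SOME g. g \<in> sq_integrable (lebesgue_on \<Omega>) \<and> has_weak_pd \<Omega> i u g)"

definition H1norm :: "(real^2) set \<Rightarrow> (real^2 \<Rightarrow> 'b::euclidean_space) \<Rightarrow> real" where
  "H1norm \<Omega> u = sqrt ((\<Sum>i\<in>UNIV. (l2norm (lebesgue_on \<Omega>) (wpd \<Omega> i u))\<^sup>2) +
                      (l2norm (lebesgue_on \<Omega>) u)\<^sup>2)"


section \<open>The Neumann Laplacian\<close>

text \<open>The self-adjoint operator in \<open>L\<^sup>2(\<Omega>)\<close> associated with the form \<open>\<integral> \<nabla>u \<cdot> \<nabla>v\<close> on \<open>H\<^sup>1(\<Omega>)\<close>,
  as a graph: \<open>u\<close> is in the domain and is mapped to \<open>f\<close>.\<close>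

definition neumann_laplacian ::
  "(real^2) set \<Rightarrow> (real^2 \<Rightarrow> complex) \<Rightarrow> (real^2 \<Rightarrow> complex) \<Rightarrow> bool" where
  "neumann_laplacian \<Omega> u f \<longleftrightarrow>
     u \<in> H1 \<Omega> \<and> f \<in> sq_integrable (lebesgue_on \<Omega>) \<and>
     (\<forall>v\<in>H1 \<Omega>. (\<Sum>i\<in>UNIV. LINT x|lebesgue_on \<Omega>. wpd \<Omega> i u x * cnj (wpd \<Omega> i v x)) =
                 (LINT x|lebesgue_on \<Omega>. f x * cnj (v x)))"

definition neumann_eigenvalue :: "(real^2) set \<Rightarrow> real \<Rightarrow> bool" where
  "neumann_eigenvalue \<Omega> \<mu> \<longleftrightarrow>
     (\<exists>u. neumann_laplacian \<Omega> u (\<lambda>x. of_real \<mu> * u x) \<and>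
          \<not> (AE x in lebesgue_on \<Omega>. u x = 0))"

text \<open>On a bounded connected Lipschitz domain the spectrum is discrete and unbounded,
  so the infimum is attained.\<close>

definition Lambda_N :: "(real^2) set \<Rightarrow> real" where
  "Lambda_N \<Omega> = Inf {\<mu>. neumann_eigenvalue \<Omega> \<mu> \<and> \<mu> \<noteq> 0}"


section \<open>Boundary measure and traces\<close>

text \<open>One-dimensional Hausdorff measure; on a rectifiable curve it is the arc length.
  Covering sets are required to be bounded because \<^const>\<open>diameter\<close> is unspecified on
  unbounded sets.\<close>

definition hausdorff1_delta :: "real \<Rightarrow> 'a::metric_space set \<Rightarrow> ennreal" where
  "hausdorff1_delta \<delta> A =
     (INF U \<in> {U :: nat \<Rightarrow> 'a set. A \<subseteq> (\<Union>n. U n) \<and> (\<forall>n. bounded (U n) \<and> diameter (U n) \<le> \<delta>)}.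
        \<Sum>n. ennreal (diameter (U n)))"

definition hausdorff1 :: "'a::metric_space set \<Rightarrow> ennreal" where
  "hausdorff1 A = (SUP \<delta> \<in> {0<..}. hausdorff1_delta \<delta> A)"

definition hausdorff_measure1 :: "'a::metric_space measure" where
  "hausdorff_measure1 = measure_of UNIV (sets borel) hausdorff1"

text \<open>\<^const>\<open>hausdorff1\<close> is a Borel measure, so \<^const>\<open>hausdorff_measure1\<close> really has these values.\<close>

lemma hausdorff1_delta_le:
  assumes "A \<subseteq> (\<Union>n::nat. U n)" "\<And>n. bounded (U n)" "\<And>n. diameter (U n) \<le> \<delta>"
  shows "hausdorff1_delta \<delta> A \<le> (\<Sum>n. ennreal (diameter (U n)))"
  unfolding hausdorff1_delta_def using assms by (intro INF_lower) auto

lemma hausdorff1_delta_ge: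
  assumes "\<And>U. A \<subseteq> (\<Union>n::nat. U n) \<Longrightarrow> (\<And>n. bounded (U n)) \<Longrightarrow> (\<And>n. diameter (U n) \<le> \<delta>) \<Longrightarrow>
             c \<le> (\<Sum>n. ennreal (diameter (U n)))"
  shows "c \<le> hausdorff1_delta \<delta> A"
  unfolding hausdorff1_delta_def using assms by (intro INF_greatest) auto

lemma hausdorff1_delta_antimono:
  "\<delta> \<le> \<delta>' \<Longrightarrow> hausdorff1_delta \<delta>' A \<le> hausdorff1_delta \<delta> A"
  by (rule hausdorff1_delta_ge, rule hausdorff1_delta_le) (auto intro: order_trans)

lemma hausdorff1_delta_mono: "A \<subseteq> B \<Longrightarrow> hausdorff1_delta \<delta> A \<le> hausdorff1_delta \<delta> B"
  by (rule hausdorff1_delta_ge, rule hausdorff1_delta_le) auto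

lemma hausdorff1_delta_le_hausdorff1: "0 < \<delta> \<Longrightarrow> hausdorff1_delta \<delta> A \<le> hausdorff1 A"
  unfolding hausdorff1_def by (intro SUP_upper) auto

lemma hausdorff1_leI:
  "(\<And>\<delta>. 0 < \<delta> \<Longrightarrow> hausdorff1_delta \<delta> A \<le> c) \<Longrightarrow> hausdorff1 A \<le> c"
  unfolding hausdorff1_def by (intro SUP_least) auto

lemma hausdorff1_mono: "A \<subseteq> B \<Longrightarrow> hausdorff1 A \<le> hausdorff1 B"
  by (meson hausdorff1_leI hausdorff1_delta_le_hausdorff1 hausdorff1_delta_mono order_trans)

lemma hausdorff1_empty: "hausdorff1 {} = 0"
proof -
  have "hausdorff1_delta \<delta> ({}::'a set) \<le> 0" if "0 < \<delta>" for \<delta>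
    using hausdorff1_delta_le[of "{}" "\<lambda>_. {}" \<delta>] that by simp
  then have "hausdorff1 ({}::'a set) \<le> 0" by (rule hausdorff1_leI)
  then show ?thesis by simp
qed

lemma hausdorff1_delta_subadditive:
  "hausdorff1_delta \<delta> (\<Union>i::nat. A i) \<le> (\<Sum>n. hausdorff1_delta \<delta> (A n))"
proof (rule ennreal_le_epsilon)
  fix e :: real assume e: "0 < e" "(\<Sum>n. hausdorff1_delta \<delta> (A n)) < top"
  have "\<exists>U. A n \<subseteq> (\<Union>i::nat. U i) \<and> (\<forall>i. bounded (U i) \<and> diameter (U i) \<le> \<delta>) \<and>
            (\<Sum>i. ennreal (diameter (U i))) \<le> hausdorff1_delta \<delta> (A n) + e * (1/2)^Suc n" for n
  proof -
    have "hausdorff1_delta \<delta> (A n) < hausdorff1_delta \<delta> (A n) + e * (1/2)^Suc n"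
      using e by (auto simp add: less_top dest!: ennreal_suminf_lessD)
    then show ?thesis
      by (subst (asm) (1) hausdorff1_delta_def) (auto simp: INF_less_iff intro!: less_imp_le)
  qed
  then obtain B where B: "\<And>n. A n \<subseteq> (\<Union>i::nat. B n i)" "\<And>n i. bounded (B n i)"
      "\<And>n i. diameter (B n i) \<le> \<delta>"
      and Ble: "\<And>n. (\<Sum>i. ennreal (diameter (B n i))) \<le> hausdorff1_delta \<delta> (A n) + e * (1/2)^Suc n"
    by metis
  define C where "C = case_prod B \<circ> prod_decode"
  have "(\<Union>i. A i) \<subseteq> (\<Union>i. C i)"
    using B(1) by (auto simp add: C_def subset_eq) (metis prod.case prod_encode_inverse)
  then have "hausdorff1_delta \<delta> (\<Union>i. A i) \<le> (\<Sum>i. ennreal (diameter (C i)))"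
    using B by (intro hausdorff1_delta_le) (auto simp: C_def split: prod.split)
  also have "\<dots> = (\<Sum>i. (\<lambda>p. ennreal (diameter (case_prod B p))) (prod_decode i))"
    by (simp add: C_def)
  also have "\<dots> = (\<Sum>n. \<Sum>i. ennreal (diameter (B n i)))"
    by (intro suminf_ennreal_2dimen) auto
  also have "\<dots> \<le> (\<Sum>n. hausdorff1_delta \<delta> (A n) + e * (1/2) ^ Suc n)"
    by (intro suminf_le allI Ble) auto
  also have "\<dots> = (\<Sum>n. hausdorff1_delta \<delta> (A n)) + (\<Sum>n. ennreal e * ennreal ((1/2) ^ Suc n))"
    using \<open>0 < e\<close> by (subst suminf_add[symmetric])
      (auto simp del: ennreal_suminf_cmult simp add: ennreal_mult[symmetric])
  also have "\<dots> = (\<Sum>n. hausdorff1_delta \<delta> (A n)) + e"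
    unfolding ennreal_suminf_cmult
    by (subst suminf_ennreal_eq[OF zero_le_power power_half_series]) auto
  finally show "hausdorff1_delta \<delta> (\<Union>i. A i) \<le> (\<Sum>n. hausdorff1_delta \<delta> (A n)) + e" .
qed

lemma hausdorff1_subadditive: "hausdorff1 (\<Union>i::nat. A i) \<le> (\<Sum>n. hausdorff1 (A n))"
proof (rule hausdorff1_leI)
  fix \<delta> :: real assume "0 < \<delta>"
  then have "(\<Sum>n. hausdorff1_delta \<delta> (A n)) \<le> (\<Sum>n. hausdorff1 (A n))"
    by (intro suminf_le allI hausdorff1_delta_le_hausdorff1) auto
  with hausdorff1_delta_subadditive[of \<delta> A]
  show "hausdorff1_delta \<delta> (\<Union>i. A i) \<le> (\<Sum>n. hausdorff1 (A n))" by (rule order_trans)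
qed

lemma outer_measure_space_hausdorff1: "outer_measure_space UNIV hausdorff1"
  using hausdorff1_subadditive
  by (auto simp: outer_measure_space_def positive_def increasing_def countably_subadditive_def
      hausdorff1_empty intro: hausdorff1_mono)

lemma hausdorff1_subadditive2: "hausdorff1 (A \<union> B) \<le> hausdorff1 A + hausdorff1 B"
proof -
  have "hausdorff1 (\<Union>i. binaryset A B i) \<le> (\<Sum>n. hausdorff1 (binaryset A B n))"
    by (rule hausdorff1_subadditive)
  also have "\<dots> = hausdorff1 A + hausdorff1 B"
    by (rule suminf_binaryset_eq) (rule hausdorff1_empty)
  finally show ?thesis by (simp add: UN_binaryset_eq)
qed

lemma hausdorff1_separated:
  assumes sep: "\<And>x y. x \<in> A \<Longrightarrow> y \<in> B \<Longrightarrow> \<eta> \<le> dist x y" and "0 < \<eta>"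
  shows "hausdorff1 A + hausdorff1 B \<le> hausdorff1 (A \<union> B)"
proof -
  have delta: "hausdorff1_delta \<delta> A + hausdorff1_delta \<delta> B \<le> hausdorff1_delta \<delta> (A \<union> B)"
    if \<delta>: "0 < \<delta>" "\<delta> < \<eta>" for \<delta>
  proof (rule hausdorff1_delta_ge)
    fix U :: "nat \<Rightarrow> 'a set"
    assume U: "A \<union> B \<subseteq> (\<Union>n. U n)" "\<And>n. bounded (U n)" "\<And>n. diameter (U n) \<le> \<delta>"
    define V where "V n = (if U n \<inter> A = {} then {} else U n)" for n
    define W where "W n = (if U n \<inter> B = {} then {} else U n)" for n
    have VW: "V n = {} \<or> W n = {}" for n
    proof (rule ccontr)
      assume "\<not> (V n = {} \<or> W n = {})"
      then obtain x y where "x \<in> U n" "x \<in> A" "y \<in> U n" "y \<in> B"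
        by (auto simp: V_def W_def split: if_splits)
      then have "\<eta> \<le> diameter (U n)"
        using sep[of x y] diameter_bounded_bound[OF U(2), of x n y] by auto
      with U(3)[of n] \<delta> show False by simp
    qed
    have "hausdorff1_delta \<delta> A \<le> (\<Sum>n. ennreal (diameter (V n)))"
      using U \<delta> by (intro hausdorff1_delta_le) (auto simp: V_def, blast)
    moreover have "hausdorff1_delta \<delta> B \<le> (\<Sum>n. ennreal (diameter (W n)))"
      using U \<delta> by (intro hausdorff1_delta_le) (auto simp: W_def, blast)
    ultimately have "hausdorff1_delta \<delta> A + hausdorff1_delta \<delta> B \<le>
        (\<Sum>n. ennreal (diameter (V n))) + (\<Sum>n. ennreal (diameter (W n)))"
      by (rule add_mono)
    also have "\<dots> = (\<Sum>n. ennreal (diameter (V n)) + ennreal (diameter (W n)))"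
      by (rule suminf_add) auto
    also have "\<dots> \<le> (\<Sum>n. ennreal (diameter (U n)))"
    proof (intro suminf_le)
      fix n show "ennreal (diameter (V n)) + ennreal (diameter (W n)) \<le> ennreal (diameter (U n))"
        using VW[of n] by (auto simp: V_def W_def split: if_splits)
    qed auto
    finally show "hausdorff1_delta \<delta> A + hausdorff1_delta \<delta> B \<le> (\<Sum>n. ennreal (diameter (U n)))" .
  qed
  have "hausdorff1_delta \<delta> A + hausdorff1_delta \<delta>' B \<le> hausdorff1 (A \<union> B)"
    if "0 < \<delta>" "0 < \<delta>'" for \<delta> \<delta>'
  proof -
    define t where "t = min (min \<delta> \<delta>') (\<eta>/2)"
    have t: "0 < t" "t < \<eta>" "t \<le> \<delta>" "t \<le> \<delta>'"
      using that \<open>0 < \<eta>\<close> by (auto simp: t_def)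
    have "hausdorff1_delta \<delta> A + hausdorff1_delta \<delta>' B \<le> hausdorff1_delta t A + hausdorff1_delta t B"
      using t by (intro add_mono hausdorff1_delta_antimono)
    also have "\<dots> \<le> hausdorff1_delta t (A \<union> B)" by (rule delta) fact+
    also have "\<dots> \<le> hausdorff1 (A \<union> B)" by (rule hausdorff1_delta_le_hausdorff1) fact
    finally show ?thesis .
  qed
  then have "hausdorff1_delta \<delta> A + hausdorff1 B \<le> hausdorff1 (A \<union> B)" if "0 < \<delta>" for \<delta>
    using that unfolding hausdorff1_def[of B]
    by (subst ennreal_SUP_add_right) (auto intro!: SUP_least)
  then show ?thesis
    unfolding hausdorff1_def[of A]
    by (subst ennreal_SUP_add_left[symmetric]) (auto intro!: SUP_least)
qed

lemma hausdorff1_level_sets: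
  fixes F :: "'a::metric_space set"
  assumes "\<And>x. x \<in> A \<Longrightarrow> a \<le> infdist x F" "\<And>x. x \<in> B \<Longrightarrow> infdist x F \<le> b" "b < a"
  shows "hausdorff1 A + hausdorff1 B \<le> hausdorff1 (A \<union> B)"
proof (rule hausdorff1_separated)
  fix x y assume "x \<in> A" "y \<in> B"
  then show "a - b \<le> dist x y"
    using assms(1)[of x] assms(2)[of y] infdist_triangle[of x F y] by simp
qed (use assms in simp)

lemma closed_in_lambda_system_hausdorff1:
  assumes "closed (F :: 'a::metric_space set)"
  shows "F \<in> lambda_system UNIV UNIV hausdorff1"
proof (cases "F = {}")
  case True
  then show ?thesis by (simp add: lambda_system_def hausdorff1_empty)
next
  case False
  have "hausdorff1 (S \<inter> F) + hausdorff1 (S - F) \<le> hausdorff1 S" for S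
  proof (cases "hausdorff1 S = top")
    case fin: False
    define R where "R n = {x \<in> S. 1 / real (n + 2) \<le> infdist x F \<and> infdist x F < 1 / real (n + 1)}" for n
    define T where "T n = {x \<in> S. 1 / real (n + 1) \<le> infdist x F}" for n
    have odd_even: "(\<Sum>k<N. hausdorff1 (R (2 * k + p))) \<le> hausdorff1 (\<Union>k<N. R (2 * k + p))" for N p
    proof (induction N)
      case (Suc N)
      have "(\<Sum>k<Suc N. hausdorff1 (R (2 * k + p))) \<le>
          hausdorff1 (\<Union>k<N. R (2 * k + p)) + hausdorff1 (R (2 * N + p))"
        using Suc by (auto intro: add_mono)
      also have "\<dots> \<le> hausdorff1 ((\<Union>k<N. R (2 * k + p)) \<union> R (2 * N + p))"
      proof (cases N)
        case (Suc M)
        show ?thesis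
        proof (rule hausdorff1_level_sets)
          fix x assume "x \<in> (\<Union>k<N. R (2 * k + p))"
          then obtain k where k: "k < N" "1 / real (2 * k + p + 2) \<le> infdist x F"
            by (auto simp: R_def)
          have "1 / real (2 * N + p) \<le> 1 / real (2 * k + p + 2)"
            using k(1) by (intro divide_left_mono) auto
          with k(2) show "1 / real (2 * N + p) \<le> infdist x F" by linarith
        next
          fix x assume "x \<in> R (2 * N + p)"
          then show "infdist x F \<le> 1 / real (2 * N + p + 1)" by (simp add: R_def)
        next
          show "1 / real (2 * N + p + 1) < 1 / real (2 * N + p)"
            using Suc by (intro divide_strict_left_mono) auto
        qed
      qed (simp add: hausdorff1_empty)
      also have "(\<Union>k<N. R (2 * k + p)) \<union> R (2 * N + p) = (\<Union>k<Suc N. R (2 * k + p))"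
        by (auto simp: lessThan_Suc)
      finally show ?case .
    qed simp
    have part: "(\<Sum>k<N. hausdorff1 (R (2 * k + p))) \<le> hausdorff1 S" for N p
      by (rule order_trans[OF odd_even hausdorff1_mono]) (auto simp: R_def)
    have "(\<Sum>n<N. hausdorff1 (R n)) \<le> 2 * hausdorff1 S" for N
    proof -
      have "(\<Sum>n<N. hausdorff1 (R n)) \<le> (\<Sum>n<2*N. hausdorff1 (R n))"
        by (rule sum_mono2) auto
      also have "\<dots> = (\<Sum>k<N. hausdorff1 (R (2 * k + 0))) + (\<Sum>k<N. hausdorff1 (R (2 * k + 1)))"
        by (induction N) (simp_all add: algebra_simps)
      also have "\<dots> \<le> hausdorff1 S + hausdorff1 S" by (intro add_mono part)
      finally show ?thesis by (simp add: mult_2)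
    qed
    then have "(\<Sum>n. hausdorff1 (R n)) \<le> 2 * hausdorff1 S"
      by (intro suminf_le_const) auto
    also have "\<dots> < top" using fin by (simp add: ennreal_mult_less_top less_top)
    finally have Rfin: "(\<Sum>n. hausdorff1 (R n)) < top" .
    have bound: "hausdorff1 (S \<inter> F) + hausdorff1 (S - F) \<le> hausdorff1 S + (\<Sum>k. hausdorff1 (R (k + n)))" for n
    proof -
      have "S - F \<subseteq> T n \<union> (\<Union>k. R (k + n))"
      proof
        fix x assume x: "x \<in> S - F"
        then have pos: "0 < infdist x F"
          using in_closed_iff_infdist_zero[OF assms False, of x] infdist_nonneg[of x F] by auto
        show "x \<in> T n \<union> (\<Union>k. R (k + n))"
        proof (cases "1 / real (n + 1) \<le> infdist x F")
          case True
          with x show ?thesis by (simp add: T_def)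
        next
          case False
          define P where "P j \<longleftrightarrow> 1 / real (j + 1) \<le> infdist x F" for j
          obtain j0 where "inverse (real (Suc j0)) < infdist x F"
            using reals_Archimedean[OF pos] by auto
          then have "P j0" by (simp add: P_def divide_inverse add.commute)
          define j where "j = (LEAST j. P j)"
          have Pj: "P j" unfolding j_def by (rule LeastI) fact
          have jn: "n < j"
          proof (rule ccontr)
            assume "\<not> n < j"
            then have "1 / real (n + 1) \<le> 1 / real (j + 1)" by (intro divide_left_mono) auto
            with Pj False show False by (simp add: P_def)
          qed
          then obtain i where i: "j = Suc i" by (cases j) auto
          have "\<not> P i" using not_less_Least[of i P] i by (auto simp: j_def)
          with Pj i x have "x \<in> R i" by (auto simp: R_def P_def add.commute)
          moreover have "i = (i - n) + n" using i jn by simp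
          ultimately show ?thesis by (metis UN_I UNIV_I UnI2)
        qed
      qed
      then have "hausdorff1 (S - F) \<le> hausdorff1 (T n \<union> (\<Union>k. R (k + n)))"
        by (rule hausdorff1_mono)
      also have "\<dots> \<le> hausdorff1 (T n) + hausdorff1 (\<Union>k. R (k + n))"
        by (rule hausdorff1_subadditive2)
      also have "\<dots> \<le> hausdorff1 (T n) + (\<Sum>k. hausdorff1 (R (k + n)))"
        by (intro add_left_mono hausdorff1_subadditive)
      finally have "hausdorff1 (S \<inter> F) + hausdorff1 (S - F) \<le>
          (hausdorff1 (T n) + hausdorff1 (S \<inter> F)) + (\<Sum>k. hausdorff1 (R (k + n)))"
        using add_left_mono[of "hausdorff1 (S - F)" _ "hausdorff1 (S \<inter> F)"] by (simp add: ac_simps)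
      also have "hausdorff1 (T n) + hausdorff1 (S \<inter> F) \<le> hausdorff1 (T n \<union> (S \<inter> F))"
        by (rule hausdorff1_level_sets[where F = F and a = "1 / real (n + 1)" and b = 0])
          (auto simp: T_def)
      also have "\<dots> \<le> hausdorff1 S"
        by (rule hausdorff1_mono) (auto simp: T_def)
      finally show ?thesis by (simp add: add_right_mono)
    qed
    show ?thesis
    proof (rule ennreal_le_epsilon)
      fix e :: real assume "0 < e"
      define r where "r n = enn2real (hausdorff1 (R n))" for n
      have r: "hausdorff1 (R n) = ennreal (r n)" "0 \<le> r n" for n
        using ennreal_suminf_lessD[OF Rfin, of n] by (simp_all add: r_def)
      have "summable r"
        using Rfin r by (intro summable_suminf_not_top) auto
      then obtain n where n: "\<bar>\<Sum>k. r (k + n)\<bar> < e"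
        using suminf_exist_split[of e r] \<open>0 < e\<close> by auto
      have "(\<Sum>k. hausdorff1 (R (k + n))) = ennreal (\<Sum>k. r (k + n))"
        unfolding r(1) using r(2) \<open>summable r\<close>
        by (intro suminf_ennreal2) (auto simp: summable_iff_shift)
      also have "\<dots> \<le> ennreal e" using n by (intro ennreal_leI) auto
      finally show "hausdorff1 (S \<inter> F) + hausdorff1 (S - F) \<le> hausdorff1 S + ennreal e"
        using order_trans[OF bound[of n] add_left_mono] by simp
    qed
  qed simp
  moreover have "hausdorff1 S \<le> hausdorff1 (S \<inter> F) + hausdorff1 (S - F)" for S
    using hausdorff1_subadditive2[of "S \<inter> F" "S - F"] by (simp add: Int_Diff_Un)
  ultimately show ?thesis
    by (simp add: lambda_system_def Int_commute Diff_eq antisym)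
qed

lemma measure_space_hausdorff1: "measure_space UNIV (sets borel) hausdorff1"
proof -
  have ms: "measure_space UNIV (lambda_system UNIV UNIV hausdorff1) (hausdorff1 :: 'a set \<Rightarrow> ennreal)"
    using sigma_algebra.caratheodory_lemma[of UNIV UNIV "hausdorff1 :: 'a set \<Rightarrow> ennreal"]
      outer_measure_space_hausdorff1 sigma_algebra_Pow[of UNIV] by auto
  then have sa: "sigma_algebra UNIV (lambda_system UNIV UNIV (hausdorff1 :: 'a set \<Rightarrow> ennreal))"
    by (simp add: measure_space_def)
  have "sets (borel :: 'a measure) \<subseteq> lambda_system UNIV UNIV hausdorff1"
    unfolding borel_eq_closed
    using sigma_algebra.sigma_sets_subset[OF sa, of "Collect closed"] closed_in_lambda_system_hausdorff1
    by auto
  then show ?thesis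
    using measure_down[OF ms, of "sets borel"] sets.sigma_algebra_axioms[of "borel :: 'a measure"] by simp
qed

lemma sets_hausdorff_measure1 [simp, measurable_cong]: "sets hausdorff_measure1 = sets borel"
  unfolding hausdorff_measure1_def by (metis sets.sets_measure_of_eq space_borel)

lemma emeasure_hausdorff_measure1:
  "A \<in> sets borel \<Longrightarrow> emeasure hausdorff_measure1 A = hausdorff1 A"
  unfolding hausdorff_measure1_def
  by (rule emeasure_measure_of_sigma)
    (use measure_space_hausdorff1 in \<open>auto simp: measure_space_def\<close>)

definition bdry_measure :: "(real^2) set \<Rightarrow> (real^2) measure" where
  "bdry_measure \<Omega> = restrict_space hausdorff_measure1 (frontier \<Omega>)"

text \<open>The trace operator is the continuous extension to \<open>H\<^sup>1(\<Omega>)\<close> of the restriction of smooth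
  functions to the boundary: \<open>g\<close> is the trace of \<open>u\<close> iff some sequence of functions smooth up to
  the boundary converges to \<open>u\<close> in \<open>H\<^sup>1(\<Omega>)\<close> while its boundary values converge to \<open>g\<close>
  in \<open>L\<^sup>2(\<partial>\<Omega>)\<close>.\<close>

definition is_trace ::
  "(real^2) set \<Rightarrow> (real^2 \<Rightarrow> complex) \<Rightarrow> (real^2 \<Rightarrow> complex) \<Rightarrow> bool" where
  "is_trace \<Omega> u g \<longleftrightarrow>
     g \<in> sq_integrable (bdry_measure \<Omega>) \<and>
     (\<exists>w. (\<forall>n::nat. smooth (w n)) \<and>
          (\<lambda>n. H1norm \<Omega> (\<lambda>x. w n x - u x)) \<longlonglongrightarrow> 0 \<and>
          (\<lambda>n. l2norm (bdry_measure \<Omega>) (\<lambda>x. w n x - g x)) \<longlonglongrightarrow> 0)"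


section \<open>Smooth domains and the geometric setting\<close>

text \<open>Near each boundary point, after an orthogonal change of coordinates, the domain is the
  strict epigraph of a \<open>C\<^sup>2\<^sup>,\<^sup>1\<close> function.\<close>

definition C21 :: "(real \<Rightarrow> real) \<Rightarrow> bool" where
  "C21 \<gamma> \<longleftrightarrow> (\<exists>\<gamma>' \<gamma>'' L.
     (\<forall>t. (\<gamma> has_real_derivative \<gamma>' t) (at t)) \<and>
     (\<forall>t. (\<gamma>' has_real_derivative \<gamma>'' t) (at t)) \<and>
     L-lipschitz_on UNIV \<gamma>'')"

definition C21_domain :: "(real^2) set \<Rightarrow> bool" where
  "C21_domain \<Omega> \<longleftrightarrow> open \<Omega> \<and> connected \<Omega> \<and> \<Omega> \<noteq> {} \<and>
     (\<forall>p\<in>frontier \<Omega>. \<exists>r>0. \<exists>(T :: real^2 \<Rightarrow> real^2) \<gamma>. orthogonal_transformation T \<and> C21 \<gamma> \<and>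
        \<Omega> \<inter> ball p r = {x \<in> ball p r. T x $ 2 > \<gamma> (T x $ 1)})"

definition unit_cell :: "(real^2) set" where
  "unit_cell = {x. \<forall>i. - 1/2 < x $ i \<and> x $ i < 1/2}"

definition cell :: "real \<Rightarrow> int^2 \<Rightarrow> (real^2) set" where
  "cell \<epsilon> k = (\<lambda>y. \<epsilon> *\<^sub>R y + \<epsilon> *\<^sub>R (\<chi> i. of_int (k $ i))) ` unit_cell"

text \<open>The radius of the smallest disk containing \<open>A\<close>; for nonempty bounded \<open>A\<close> in the plane
  the infimum is attained.\<close>

definition circumradius :: "'a::metric_space set \<Rightarrow> real" where
  "circumradius A = Inf {r. 0 \<le> r \<and> (\<exists>c. A \<subseteq> cball c r)}"

definition upscaled :: "(real^2) set \<Rightarrow> (real^2) set" where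
  "upscaled A = (\<lambda>x. x /\<^sub>R circumradius A) ` A"

definition d_inf :: "(real \<Rightarrow> int^2 \<Rightarrow> (real^2) set) \<Rightarrow> real \<Rightarrow> real" where
  "d_inf D \<epsilon> = (INF k. circumradius (D \<epsilon> k))"

text \<open>In the trace inequality \<open>g\<close> is the trace of \<open>u\<close>, which on a bounded Lipschitz domain
  exists and is unique almost everywhere on the boundary.\<close>

definition admissible ::
  "real \<Rightarrow> real \<Rightarrow> real \<Rightarrow> real \<Rightarrow> (real \<Rightarrow> int^2 \<Rightarrow> (real^2) set) \<Rightarrow> bool" where
  "admissible \<epsilon>\<^sub>0 \<rho> C\<^sub>t\<^sub>r \<Lambda> D \<longleftrightarrow>
     (\<forall>\<epsilon>\<in>{0<..\<epsilon>\<^sub>0}.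
        d_inf D \<epsilon> > 0 \<and>
        (\<forall>k. C21_domain (D \<epsilon> k) \<and> D \<epsilon> k \<subseteq> cell \<epsilon> k \<and>
             (\<exists>x\<in>upscaled (D \<epsilon> k). ball x \<rho> \<subseteq> upscaled (D \<epsilon> k)) \<and>
             (\<forall>u\<in>H1 (upscaled (D \<epsilon> k)). \<forall>g. is_trace (upscaled (D \<epsilon> k)) u g \<longrightarrow>
                l2norm (bdry_measure (upscaled (D \<epsilon> k))) g \<le> C\<^sub>t\<^sub>r * H1norm (upscaled (D \<epsilon> k)) u) \<and>
             \<Lambda> \<le> Lambda_N (upscaled (D \<epsilon> k))))"


section \<open>The Hilbert space of square-integrable spinors\<close>

lemma integrable_inner_sq_integrable:
  assumes "u \<in> sq_integrable M" "v \<in> sq_integrable M"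
  shows "integrable M (\<lambda>x. inner (u x) (v x))"
proof (rule Bochner_Integration.integrable_bound)
  show "integrable M (\<lambda>x. (norm (u x))\<^sup>2 + (norm (v x))\<^sup>2)"
    using assms by (auto simp: sq_integrable_def)
  show "(\<lambda>x. inner (u x) (v x)) \<in> borel_measurable M"
    using assms by (auto simp: sq_integrable_def)
  show "AE x in M. norm (inner (u x) (v x)) \<le> norm ((norm (u x))\<^sup>2 + (norm (v x))\<^sup>2)"
  proof (rule AE_I2)
    fix x
    have "\<bar>inner (u x) (v x)\<bar> \<le> norm (u x) * norm (v x)" by (rule Cauchy_Schwarz_ineq2)
    also have "\<dots> \<le> 2 * norm (u x) * norm (v x)" by simp
    also have "\<dots> \<le> (norm (u x))\<^sup>2 + (norm (v x))\<^sup>2" by (rule sum_squares_bound)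
    finally show "norm (inner (u x) (v x)) \<le> norm ((norm (u x))\<^sup>2 + (norm (v x))\<^sup>2)" by simp
  qed
qed

lemma sq_integrable_add:
  assumes "u \<in> sq_integrable M" "v \<in> sq_integrable M"
  shows "(\<lambda>x. u x + v x) \<in> sq_integrable M"
proof -
  have "(\<lambda>x. (norm (u x + v x))\<^sup>2) =
        (\<lambda>x. (norm (u x))\<^sup>2 + (norm (v x))\<^sup>2 + 2 * inner (u x) (v x))"
    by (rule ext) (simp add: power2_norm_eq_inner inner_add_left inner_add_right inner_commute)
  moreover have "integrable M \<dots>"
    using assms integrable_inner_sq_integrable[OF assms] by (auto simp: sq_integrable_def)
  ultimately show ?thesis
    using assms by (auto simp: sq_integrable_def)
qed

lemma sq_integrable_linear_image:
  assumes "u \<in> sq_integrable M" "bounded_linear f"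
  shows "(\<lambda>x. f (u x)) \<in> sq_integrable M"
proof -
  obtain K where K: "\<And>x. norm (f x) \<le> norm x * K" "0 < K"
    using bounded_linear.pos_bounded[OF assms(2)] by auto
  have meas: "(\<lambda>x. f (u x)) \<in> borel_measurable M"
    using assms(1) by (intro borel_measurable_continuous_on[OF linear_continuous_on[OF assms(2)]])
      (simp add: sq_integrable_def)
  have "integrable M (\<lambda>x. (norm (f (u x)))\<^sup>2)"
  proof (rule Bochner_Integration.integrable_bound)
    show "integrable M (\<lambda>x. K\<^sup>2 * (norm (u x))\<^sup>2)"
      using assms(1) by (auto simp: sq_integrable_def)
    show "(\<lambda>x. (norm (f (u x)))\<^sup>2) \<in> borel_measurable M" using meas by auto
    show "AE x in M. norm ((norm (f (u x)))\<^sup>2) \<le> norm (K\<^sup>2 * (norm (u x))\<^sup>2)"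
    proof (rule AE_I2)
      fix x
      have "(norm (f (u x)))\<^sup>2 \<le> (norm (u x) * K)\<^sup>2"
        using K(1) by (intro power_mono) auto
      then show "norm ((norm (f (u x)))\<^sup>2) \<le> norm (K\<^sup>2 * (norm (u x))\<^sup>2)"
        by (simp add: power_mult_distrib mult.commute)
    qed
  qed
  with meas show ?thesis by (auto simp: sq_integrable_def)
qed

lemma bounded_linear_vector_scalar_mult: "bounded_linear (\<lambda>v. (c::complex) *s (v::complex^2))"
  unfolding linear_conv_bounded_linear[symmetric]
  by (rule linearI) (simp_all add: vec_eq_iff algebra_simps)

lemmas sq_integrable_intros =
  sq_integrable_add
  sq_integrable_linear_image[OF _ bounded_linear_scaleR_right]
  sq_integrable_linear_image[OF _ bounded_linear_minus[OF bounded_linear_ident]]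
  sq_integrable_linear_image[OF _ bounded_linear_vector_scalar_mult]

definition spinor_eq :: "(real^2 \<Rightarrow> complex^2) \<Rightarrow> (real^2 \<Rightarrow> complex^2) \<Rightarrow> bool" where
  "spinor_eq u v \<longleftrightarrow> u \<in> sq_integrable lebesgue \<and> v \<in> sq_integrable lebesgue \<and>
                     (AE x in lebesgue. u x = v x)"

lemma zero_sq_integrable: "(\<lambda>x. 0) \<in> sq_integrable M"
  by (auto simp: sq_integrable_def)

quotient_type spinor_L2 = "real^2 \<Rightarrow> complex^2" / partial: spinor_eq
proof (rule part_equivpI)
  show "\<exists>x. spinor_eq x x"
    by (rule exI[of _ "\<lambda>x. 0"]) (auto simp: spinor_eq_def zero_sq_integrable)
  show "symp spinor_eq"
    by (simp add: symp_def spinor_eq_def eq_commute)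
  show "transp spinor_eq"
    unfolding transp_def spinor_eq_def
  proof (intro allI impI conjI; elim conjE)
    fix u v w :: "real^2 \<Rightarrow> complex^2"
    assume "AE x in lebesgue. u x = v x" "AE x in lebesgue. v x = w x"
    then show "AE x in lebesgue. u x = w x" by eventually_elim simp
  qed assumption+
qed

lemma spinor_eqI:
  assumes "u \<in> sq_integrable lebesgue" "v \<in> sq_integrable lebesgue" "AE x in lebesgue. u x = v x"
  shows "spinor_eq u v"
  using assms by (simp add: spinor_eq_def)

lemma spinor_eqD:
  assumes "spinor_eq u v"
  shows "u \<in> sq_integrable lebesgue" "v \<in> sq_integrable lebesgue" "AE x in lebesgue. u x = v x"
  using assms by (simp_all add: spinor_eq_def)

instantiation spinor_L2 :: real_inner
begin

lift_definition zero_spinor_L2 :: spinor_L2 is "\<lambda>x. 0"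
  by (simp add: spinor_eq_def zero_sq_integrable)

lift_definition plus_spinor_L2 :: "spinor_L2 \<Rightarrow> spinor_L2 \<Rightarrow> spinor_L2" is "\<lambda>u v x. u x + v x"
  subgoal premises prems
    using spinor_eqD[OF prems(1)] spinor_eqD[OF prems(2)]
    by (intro spinor_eqI sq_integrable_intros) auto
  done

lift_definition uminus_spinor_L2 :: "spinor_L2 \<Rightarrow> spinor_L2" is "\<lambda>u x. - u x"
  subgoal premises prems
    using spinor_eqD[OF prems] by (intro spinor_eqI sq_integrable_intros) auto
  done

lift_definition scaleR_spinor_L2 :: "real \<Rightarrow> spinor_L2 \<Rightarrow> spinor_L2" is "\<lambda>r u x. r *\<^sub>R u x"
  subgoal premises prems
    using spinor_eqD[OF prems] by (intro spinor_eqI sq_integrable_intros) auto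
  done

lift_definition inner_spinor_L2 :: "spinor_L2 \<Rightarrow> spinor_L2 \<Rightarrow> real"
  is "\<lambda>u v. LINT x|lebesgue. inner (u x) (v x)"
  subgoal premises prems
    using spinor_eqD[OF prems(1)] spinor_eqD[OF prems(2)]
    by (intro integral_cong_AE) (auto simp: sq_integrable_def)
  done

definition minus_spinor_L2 :: "spinor_L2 \<Rightarrow> spinor_L2 \<Rightarrow> spinor_L2" where
  "minus_spinor_L2 u v = u + - v"

definition norm_spinor_L2 :: "spinor_L2 \<Rightarrow> real" where
  "norm_spinor_L2 u = sqrt (inner u u)"

definition dist_spinor_L2 :: "spinor_L2 \<Rightarrow> spinor_L2 \<Rightarrow> real" where
  "dist_spinor_L2 u v = norm (u - v)"

definition sgn_spinor_L2 :: "spinor_L2 \<Rightarrow> spinor_L2" where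
  "sgn_spinor_L2 u = inverse (norm u) *\<^sub>R u"

definition uniformity_spinor_L2 :: "(spinor_L2 \<times> spinor_L2) filter" where
  "uniformity_spinor_L2 = (INF e\<in>{0<..}. principal {(x, y). dist x y < e})"

definition open_spinor_L2 :: "spinor_L2 set \<Rightarrow> bool" where
  "open_spinor_L2 U \<longleftrightarrow> (\<forall>x\<in>U. eventually (\<lambda>(x', y). x' = x \<longrightarrow> y \<in> U) uniformity)"

instance
proof
  fix x y z :: spinor_L2 and a b r :: real
  show "x + y + z = x + (y + z)"
    by transfer (rule spinor_eqI, (intro sq_integrable_intros; simp add: spinor_eq_def)+,
        simp add: algebra_simps)
  show "x + y = y + x"
    by transfer (rule spinor_eqI, (intro sq_integrable_intros; simp add: spinor_eq_def)+,
        simp add: algebra_simps)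
  show "0 + x = x"
    by transfer simp
  show "- x + x = 0"
    by transfer (simp add: spinor_eq_def zero_sq_integrable)
  show "x - y = x + - y" by (rule minus_spinor_L2_def)
  show "a *\<^sub>R (x + y) = a *\<^sub>R x + a *\<^sub>R y"
    by transfer (rule spinor_eqI, (intro sq_integrable_intros; simp add: spinor_eq_def)+,
        simp add: algebra_simps)
  show "(a + b) *\<^sub>R x = a *\<^sub>R x + b *\<^sub>R x"
    by transfer (rule spinor_eqI, (intro sq_integrable_intros; simp add: spinor_eq_def)+,
        simp add: algebra_simps)
  show "a *\<^sub>R b *\<^sub>R x = (a * b) *\<^sub>R x"
    by transfer (rule spinor_eqI, (intro sq_integrable_intros; simp add: spinor_eq_def)+,
        simp add: algebra_simps)
  show "1 *\<^sub>R x = x"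
    by transfer simp
  show "dist x y = norm (x - y)" by (rule dist_spinor_L2_def)
  show "sgn x = inverse (norm x) *\<^sub>R x" by (rule sgn_spinor_L2_def)
  show "uniformity = (INF e\<in>{0<..}. principal {(x::spinor_L2, y). dist x y < e})"
    by (rule uniformity_spinor_L2_def)
  show "open U \<longleftrightarrow> (\<forall>x\<in>U. eventually (\<lambda>(x', y). x' = x \<longrightarrow> y \<in> U) uniformity)"
    for U :: "spinor_L2 set" by (rule open_spinor_L2_def)
  show "inner x y = inner y x"
    by transfer (auto simp: inner_commute)
  show "inner (x + y) z = inner x z + inner y z"
    by transfer (simp add: spinor_eq_def inner_add_left integrable_inner_sq_integrable)
  show "inner (r *\<^sub>R x) y = r * inner x y"
    by transfer (simp add: spinor_eq_def)
  show "0 \<le> inner x x"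
    by transfer simp
  show "inner x x = 0 \<longleftrightarrow> x = 0"
    by transfer (auto simp: spinor_eq_def zero_sq_integrable integrable_inner_sq_integrable
        integral_nonneg_eq_0_iff_AE)
  show "norm x = sqrt (inner x x)" by (rule norm_spinor_L2_def)
qed

end

text \<open>Multiplication by complex scalars.\<close>

lift_definition scaleC_spinor :: "complex \<Rightarrow> spinor_L2 \<Rightarrow> spinor_L2" is "\<lambda>c u x. c *s u x"
  subgoal premises prems
    using spinor_eqD[OF prems] by (intro spinor_eqI sq_integrable_intros) auto
  done


section \<open>Unbounded operators and norm resolvent convergence\<close>

text \<open>An operator is given by its domain and its action there.\<close>

type_synonym spinor_op = "spinor_L2 set \<times> (spinor_L2 \<Rightarrow> spinor_L2)"

definition resolvent :: "spinor_op \<Rightarrow> complex \<Rightarrow> spinor_L2 \<Rightarrow> spinor_L2" where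
  "resolvent A z = inv_into (fst A) (\<lambda>u. snd A u - scaleC_spinor z u)"

definition resolvent_set :: "spinor_op \<Rightarrow> complex set" where
  "resolvent_set A = {z. bij_betw (\<lambda>u. snd A u - scaleC_spinor z u) (fst A) UNIV \<and>
                         bounded_linear (resolvent A z)}"

definition norm_resolvent_convergence ::
  "('i \<Rightarrow> spinor_op) \<Rightarrow> spinor_op \<Rightarrow> 'i filter \<Rightarrow> bool" where
  "norm_resolvent_convergence A B F \<longleftrightarrow>
     (\<forall>z. Im z \<noteq> 0 \<longrightarrow>
        z \<in> resolvent_set B \<and> (\<forall>\<^sub>F i in F. z \<in> resolvent_set (A i)) \<and>
        ((\<lambda>i. onorm (\<lambda>f. resolvent (A i) z f - resolvent B z f)) \<longlongrightarrow> 0) F)"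


section \<open>Dirac operators\<close>

definition sigma1 :: "complex^2^2" where
  "sigma1 = vector [vector [0, 1], vector [1, 0]]"

definition sigma2 :: "complex^2^2" where
  "sigma2 = vector [vector [0, - \<i>], vector [\<i>, 0]]"

definition sigma3 :: "complex^2^2" where
  "sigma3 = vector [vector [1, 0], vector [0, - 1]]"

definition dirac_expr ::
  "(real^2 \<Rightarrow> real) \<Rightarrow> (real^2 \<Rightarrow> complex^2) \<Rightarrow> real^2 \<Rightarrow> complex^2" where
  "dirac_expr m u x =
     - (\<i> *s (sigma1 *v wpd UNIV 1 u x + sigma2 *v wpd UNIV 2 u x)) +
     of_real (m x) *s (sigma3 *v u x)"

text \<open>The domain is \<open>H\<^sup>1(\<real>\<^sup>2; \<complex>\<^sup>2)\<close>. For bounded measurable \<open>m\<close> the expression is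
  square-integrable on it and independent of the chosen representative.\<close>

definition dirac :: "(real^2 \<Rightarrow> real) \<Rightarrow> spinor_op" where
  "dirac m = ({u. rep_spinor_L2 u \<in> H1 UNIV},
              \<lambda>u. abs_spinor_L2 (dirac_expr m (rep_spinor_L2 u)))"

text \<open>At every point at most one summand is nonzero, as the cells are disjoint.\<close>

definition mass :: "real \<Rightarrow> (real \<Rightarrow> int^2 \<Rightarrow> (real^2) set) \<Rightarrow> real \<Rightarrow> real^2 \<Rightarrow> real" where
  "mass m D \<epsilon> x = (\<Sum>\<^sub>\<infinity>k. m * (measure lebesgue (cell \<epsilon> k) / measure lebesgue (D \<epsilon> k)) *
                            indicator (D \<epsilon> k) x)"

end

theory Submission
  imports Defs
begin

text \<open>
  Write \<open>P\<close> for multiplication by \<open>m\<^sub>\<epsilon>\<close>, \<open>S\<close> for \<open>\<sigma>\<^sub>3\<close>, \<open>T\<close> for the massless Dirac operator,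
  \<open>q(u) = \<langle>P u, u\<rangle>\<close> and \<open>\<eta> = \<epsilon>\<^sup>2 / d\<^sub>\<epsilon> (ln (\<epsilon> / d\<^sub>\<epsilon>))\<^sup>1\<^sup>/\<^sup>2\<close>. Since \<open>\<parallel>\<nabla>u\<parallel> = \<parallel>T u\<parallel>\<close>, two inequalities
  on the cells suffice:
  \<^item> \<open>q(u) \<le> C (\<parallel>u\<parallel>\<^sup>2 + \<epsilon>\<^sup>2 ln (\<epsilon> / d\<^sub>\<epsilon>) \<parallel>\<nabla>u\<parallel>\<^sup>2)\<close>, by contracting a cell onto a square of side
    comparable to \<open>d\<close> that contains the inclusion;
  \<^item> \<open>\<bar>\<langle>(P - m) S u, w\<rangle>\<bar> \<le> C \<epsilon>\<^sup>2 / d\<^sub>\<epsilon> \<parallel>u\<parallel>\<^bsub>H1\<^esub> \<parallel>w\<parallel>\<^bsub>H1\<^esub>\<close>, by comparing the averages of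
    \<open>\<langle>S u, w\<rangle>\<close> over the inclusion and over the cell along axis-parallel lines.

  As \<open>\<parallel>P v\<parallel>\<^sup>2 \<le> C (\<epsilon> / d\<^sub>\<epsilon>)\<^sup>2 q(v)\<close>, the first inequality and the equation bound \<open>q(v)\<close> for \<open>v\<close> in the
  range of the resolvent of \<open>T + S P\<close> uniformly when \<open>\<eta>\<close> is small, although \<open>\<parallel>\<nabla>v\<parallel>\<close> is not bounded.
  Let \<open>R\<close>, \<open>R\<^sub>\<epsilon>\<close> be the two resolvents, \<open>u = R f\<close>, \<open>v = R\<^sub>\<epsilon>\<^sup>* g\<close> and \<open>y = R (P - m) S u\<close>. Then
  \<open>\<langle>(R\<^sub>\<epsilon> - R) f, g\<rangle> = - \<langle>y, g\<rangle> + \<langle>y, (P - m) S v\<rangle>\<close>, where \<open>\<parallel>y\<parallel>\<close> is small by duality from the second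
  inequality and \<open>q(y)\<close> is of order \<open>\<eta>\<^sup>2\<close> by the first one. If \<open>\<eta>\<close> is not small, the bound is trivial.

  Self-adjointness on \<open>H\<^sup>1\<close> rests on the fact that a square-integrable distributional solution of
  \<open>g = \<Delta> g\<close> vanishes.
\<close>

section \<open>Smooth functions on the plane\<close>

text \<open>The single resolvent identity, with value
  \<open>- \<langle>(P - m) S u, v\<rangle>\<close>, is not enough: averaging would need both
  arguments in H1, but the equation bounds the gradient of \<open>v\<close> only through
  \<open>P v\<close>, which may grow like \<epsilon> / d. Passing to \<open>y\<close> moves the
  constant-mass operator onto \<open>v\<close>; averaging then meets only solutions of the
  constant-mass problem, and \<open>v\<close> survives inside the form alone. This fixes the rate: a
  squared gradient is charged with \<open>\<epsilon>\<^sup>2 ln (\<epsilon> / d)\<close>, trading it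
  for the form costs \<open>(\<epsilon> / d)\<^sup>2\<close>, and the product is
  \<open>\<eta>\<^sup>2\<close>. The averaging rate \<open>\<epsilon>\<^sup>2 / d\<close> is no
  larger up to a constant: a cell lies in a disk of radius \<open>\<epsilon> / sqrt 2\<close>, so
  the logarithm is at least \<open>ln (sqrt 2)\<close>.

  Both inequalities are proved for compactly supported smooth spinors. Self-adjointness carries them
  over: the graph of the adjoint is the closure of this core, and resolvents at non-real points
  exist for the bounded mass terms.\<close>

lemma pd_eqI: "(f has_derivative f') (at x) \<Longrightarrow> pd i f x = f' (axis i 1)"
  unfolding pd_def using frechet_derivative_at[of f f' x] by simp

lemma has_derivative_pd:
  assumes "f differentiable (at x)"
  shows "(f has_derivative (\<lambda>h. \<Sum>i\<in>UNIV. h $ i *\<^sub>R pd i f x)) (at x)"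
proof -
  let ?f' = "frechet_derivative f (at x)"
  have d: "(f has_derivative ?f') (at x)"
    using assms frechet_derivative_works by blast
  then have lin: "linear ?f'" by (rule has_derivative_linear)
  have "?f' h = (\<Sum>i\<in>UNIV. h $ i *\<^sub>R pd i f x)" for h
  proof -
    have "h = (\<Sum>i\<in>UNIV. h $ i *\<^sub>R axis i 1)"
      using basis_expansion[of h] by (simp add: scalar_mult_eq_scaleR)
    then have "?f' h = ?f' (\<Sum>i\<in>UNIV. h $ i *\<^sub>R axis i 1)" by simp
    also have "\<dots> = (\<Sum>i\<in>UNIV. h $ i *\<^sub>R ?f' (axis i 1))"
      by (simp add: linear_sum[OF lin] linear_scale[OF lin])
    finally show ?thesis by (simp add: pd_def)
  qed
  then have "?f' = (\<lambda>h. \<Sum>i\<in>UNIV. h $ i *\<^sub>R pd i f x)" by (rule ext)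
  with d show ?thesis by simp
qed

lemma Ck_0D: "Ck n f \<Longrightarrow> continuous_on UNIV f"
  by (cases n) (auto simp: differentiable_imp_continuous_on differentiable_on_def
      differentiable_at_withinI)

lemma Ck_SucD: "Ck (Suc n) f \<Longrightarrow> Ck n f"
proof (induction n arbitrary: f)
  case 0
  then show ?case using Ck_0D[of "Suc 0" f] by simp
next
  case (Suc n)
  then show ?case by (metis Ck.simps(2))
qed

lemma Ck_add:
  assumes "Ck n f" "Ck n g" shows "Ck n (\<lambda>x. f x + g x)"
  using assms
proof (induction n arbitrary: f g)
  case 0
  then show ?case by (auto intro: continuous_intros)
next
  case (Suc n)
  have "pd i (\<lambda>x. f x + g x) = (\<lambda>x. pd i f x + pd i g x)" for i
  proof
    fix x
    have "((\<lambda>x. f x + g x) has_derivative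
        (\<lambda>h. (\<Sum>i\<in>UNIV. h $ i *\<^sub>R pd i f x) + (\<Sum>i\<in>UNIV. h $ i *\<^sub>R pd i g x))) (at x)"
      using Suc.prems by (intro has_derivative_add has_derivative_pd) auto
    from pd_eqI[OF this] show "pd i (\<lambda>x. f x + g x) x = pd i f x + pd i g x"
      by (simp add: axis_def if_distrib [where f = "\<lambda>c. c *\<^sub>R _"] cong: if_cong)
  qed
  with Suc show ?case by (auto intro: differentiable_add)
qed

lemma pd_linear:
  assumes "bounded_linear L" "f differentiable (at x)"
  shows "pd i (\<lambda>x. L (f x)) x = L (pd i f x)"
proof -
  interpret L: bounded_linear L by fact
  have "((\<lambda>x. L (f x)) has_derivative (\<lambda>h. L (\<Sum>i\<in>UNIV. h $ i *\<^sub>R pd i f x))) (at x)"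
    by (rule L.has_derivative[OF has_derivative_pd[OF assms(2)]])
  from pd_eqI[OF this] show ?thesis
    by (simp add: axis_def if_distrib [where f = "\<lambda>c. c *\<^sub>R _"] cong: if_cong)
qed

lemma pd_bilinear:
  assumes "bounded_bilinear B" "f differentiable (at x)" "g differentiable (at x)"
  shows "pd i (\<lambda>x. B (f x) (g x)) x = B (f x) (pd i g x) + B (pd i f x) (g x)"
proof -
  have "((\<lambda>x. B (f x) (g x)) has_derivative
     (\<lambda>h. B (f x) (\<Sum>i\<in>UNIV. h $ i *\<^sub>R pd i g x) + B (\<Sum>i\<in>UNIV. h $ i *\<^sub>R pd i f x) (g x))) (at x)"
    by (rule bounded_bilinear.FDERIV[OF assms(1) has_derivative_pd[OF assms(2)]
          has_derivative_pd[OF assms(3)]])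
  from pd_eqI[OF this] show ?thesis
    by (simp add: axis_def if_distrib [where f = "\<lambda>c. c *\<^sub>R _"] cong: if_cong)
qed

lemma pd_add:
  assumes "f differentiable (at x)" "g differentiable (at x)"
  shows "pd i (\<lambda>x. f x + g x) x = pd i f x + pd i g x"
proof -
  have "((\<lambda>x. f x + g x) has_derivative
      (\<lambda>h. (\<Sum>i\<in>UNIV. h $ i *\<^sub>R pd i f x) + (\<Sum>i\<in>UNIV. h $ i *\<^sub>R pd i g x))) (at x)"
    by (intro has_derivative_add has_derivative_pd assms)
  from pd_eqI[OF this] show ?thesis
    by (simp add: axis_def if_distrib [where f = "\<lambda>c. c *\<^sub>R _"] cong: if_cong)
qed

lemma Ck_linear:
  assumes "bounded_linear L" "Ck n f" shows "Ck n (\<lambda>x. L (f x))"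
  using assms(2)
proof (induction n arbitrary: f)
  case 0
  then show ?case by (auto intro: bounded_linear.continuous_on[OF assms(1)])
next
  case (Suc n)
  interpret L: bounded_linear L by fact
  have "pd i (\<lambda>x. L (f x)) = (\<lambda>x. L (pd i f x))" for i
    using Suc.prems by (auto intro!: ext pd_linear assms)
  moreover have "(\<lambda>x. L (f x)) differentiable (at x)" for x
  proof -
    have "f differentiable (at x)" using Suc.prems by simp
    from L.has_derivative[OF has_derivative_pd[OF this]] show ?thesis
      unfolding differentiable_def by blast
  qed
  ultimately show ?case using Suc by auto
qed

text \<open>One rule for all products in use: products of reals, scalar multiples and inner
  products. The derivative contains the undifferentiated factors, so the induction also needs the
  hypotheses one order lower.\<close>

lemma Ck_bilinear:
  assumes "bounded_bilinear B" "Ck n f" "Ck n g" shows "Ck n (\<lambda>x. B (f x) (g x))"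
  using assms(2,3)
proof (induction n arbitrary: f g)
  case 0
  then show ?case by (auto intro: bounded_bilinear.continuous_on[OF assms(1)])
next
  case (Suc n)
  have "pd i (\<lambda>x. B (f x) (g x)) = (\<lambda>x. B (f x) (pd i g x) + B (pd i f x) (g x))" for i
    using Suc.prems by (auto intro!: ext pd_bilinear assms)
  moreover have "(\<lambda>x. B (f x) (g x)) differentiable (at x)" for x
    using Suc.prems bounded_bilinear.FDERIV[OF assms(1) has_derivative_pd has_derivative_pd, of f x g]
    by (auto simp: differentiable_def)
  moreover have "Ck n f" "Ck n g" using Suc.prems Ck_SucD by blast+
  ultimately show ?case using Suc by (auto intro!: Ck_add)
qed

lemma Ck_const: "Ck n (\<lambda>x. c)"
proof (induction n arbitrary: c)
  case (Suc n)
  have "pd i (\<lambda>x. c) = (\<lambda>x. 0)" for i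
    by (rule ext, rule pd_eqI[OF has_derivative_const, THEN trans]) simp
  with Suc show ?case by simp
qed simp

lemma pd_translate:
  assumes "\<And>x. f differentiable (at x)"
  shows "pd i (\<lambda>x. f (x + a)) = (\<lambda>x. pd i f (x + a))"
proof
  fix x
  have "((\<lambda>x. f (x + a)) has_derivative (\<lambda>h. \<Sum>i\<in>UNIV. h $ i *\<^sub>R pd i f (x + a))) (at x)"
    by (rule has_derivative_compose[where f = "\<lambda>x. x + a" and f' = "\<lambda>h. h", simplified])
      (auto intro!: derivative_eq_intros has_derivative_pd assms)
  from pd_eqI[OF this] show "pd i (\<lambda>x. f (x + a)) x = pd i f (x + a)"
    by (simp add: axis_def if_distrib [where f = "\<lambda>c. c *\<^sub>R _"] cong: if_cong)
qed

lemma Ck_translate: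
  assumes "Ck n f" shows "Ck n (\<lambda>x. f (x + a))"
  using assms
proof (induction n arbitrary: f)
  case 0
  then show ?case
    by (auto intro!: continuous_on_compose2[of UNIV f] continuous_intros)
next
  case (Suc n)
  have "(\<lambda>x. f (x + a)) differentiable (at x)" for x
    using Suc.prems by (intro differentiable_compose[where f = f and g = "\<lambda>x. x + a"]) auto
  with Suc show ?case by (simp add: pd_translate)
qed

lemma smooth_differentiable: "smooth f \<Longrightarrow> f differentiable (at x)"
  by (auto simp: smooth_def dest: spec[of _ "Suc 0"])

lemma smooth_pd: "smooth f \<Longrightarrow> smooth (pd i f)"
  unfolding smooth_def by (metis Ck.simps(2))

lemma smooth_continuous: "smooth f \<Longrightarrow> continuous_on S f"
  unfolding smooth_def using Ck_0D continuous_on_subset by blast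

lemma smooth_add: "smooth f \<Longrightarrow> smooth g \<Longrightarrow> smooth (\<lambda>x. f x + g x)"
  by (simp add: smooth_def Ck_add)

lemma smooth_linear: "bounded_linear L \<Longrightarrow> smooth f \<Longrightarrow> smooth (\<lambda>x. L (f x))"
  by (simp add: smooth_def Ck_linear)

lemma smooth_bilinear:
  "bounded_bilinear B \<Longrightarrow> smooth f \<Longrightarrow> smooth g \<Longrightarrow> smooth (\<lambda>x. B (f x) (g x))"
  by (simp add: smooth_def Ck_bilinear)

lemma smooth_const: "smooth (\<lambda>x. c)"
  by (simp add: smooth_def Ck_const)

lemma smooth_translate: "smooth f \<Longrightarrow> smooth (\<lambda>x. f (x + a))"
  by (simp add: smooth_def Ck_translate)

section \<open>Bump functions\<close>

text \<open>The functions P(1/t) exp(-1/t), continued by zero. The class is closed under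
  differentiation, so smoothness of exp(-1/t) at 0 becomes an induction over the polynomial.\<close>

definition flat_exp :: "real poly \<Rightarrow> real \<Rightarrow> real" where
  "flat_exp P t = (if 0 < t then poly P (1 / t) * exp (- 1 / t) else 0)"

lemma poly_exp_minus_tendsto_0: "((\<lambda>s. poly P s * exp (- s)) \<longlongrightarrow> (0::real)) at_top"
proof -
  have "((\<lambda>s. \<Sum>i\<le>degree P. coeff P i * (s ^ i / exp s)) \<longlongrightarrow> (\<Sum>i\<le>degree P. coeff P i * 0)) at_top"
    by (intro tendsto_intros tendsto_power_div_exp_0)
  moreover have "(\<Sum>i\<le>degree P. coeff P i * (s ^ i / exp s)) = poly P s * exp (- s)" for s
    by (simp add: poly_altdef exp_minus sum_distrib_right divide_inverse mult.assoc)
  ultimately show ?thesis by simp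
qed

text \<open>In s = 1/t the derivative with respect to t is -s^2 d/ds, which turns P(s) exp(-s) into
  s^2 (P - P')(s) exp(-s). Only t = 0 needs a limit.\<close>

lemma flat_exp_derivative:
  "(flat_exp P has_real_derivative flat_exp ([:0, 0, 1:] * (P - pderiv P)) t) (at t)"
proof (cases "t = 0")
  case True
  have right: "((\<lambda>h. flat_exp P h / h) \<longlongrightarrow> 0) (at_right 0)"
  proof -
    \<comment> \<open>The difference quotient at 0 carries one further factor 1/h, which
      \<open>pCons 0\<close> supplies.\<close>
    have "((\<lambda>s. poly (pCons 0 P) s * exp (- s)) \<longlongrightarrow> 0) at_top"
      by (rule poly_exp_minus_tendsto_0)
    then have "((\<lambda>h. poly (pCons 0 P) (inverse h) * exp (- inverse h)) \<longlongrightarrow> 0) (at_right 0)"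
      by (rule filterlim_compose[OF _ filterlim_inverse_at_top_right])
    then show ?thesis
      by (rule filterlim_cong[THEN iffD1, rotated -1])
        (auto simp: eventually_at_right_field flat_exp_def field_simps intro!: exI[of _ 1])
  qed
  have left: "((\<lambda>h. flat_exp P h / h) \<longlongrightarrow> 0) (at_left 0)"
    by (rule filterlim_cong[THEN iffD1, OF refl refl _ tendsto_const])
      (auto simp: eventually_at_left_field flat_exp_def intro!: exI[of _ "-1"])
  have "((\<lambda>h. flat_exp P h / h) \<longlongrightarrow> 0) (at 0)"
    using left right by (simp add: filterlim_at_split)
  then show ?thesis
    using True by (simp add: DERIV_def flat_exp_def)
next
  case False
  show ?thesis
  proof (cases "0 < t")
    case True
    have "((\<lambda>t. poly P (1 / t) * exp (- 1 / t)) has_real_derivative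
        poly P (1 / t) * (exp (- 1 / t) * (1 / t\<^sup>2)) + (poly (pderiv P) (1 / t) * (- 1 / t\<^sup>2)) * exp (- 1 / t)) (at t)"
      using True
      by (auto intro!: derivative_eq_intros DERIV_chain'[OF _ poly_DERIV] simp: power2_eq_square)
    moreover have "poly P (1 / t) * (exp (- 1 / t) * (1 / t\<^sup>2)) + (poly (pderiv P) (1 / t) * (- 1 / t\<^sup>2)) * exp (- 1 / t)
        = flat_exp ([:0, 0, 1:] * (P - pderiv P)) t"
      using True by (simp add: flat_exp_def power2_eq_square field_simps)
    ultimately have "((\<lambda>t. poly P (1 / t) * exp (- 1 / t)) has_real_derivative
        flat_exp ([:0, 0, 1:] * (P - pderiv P)) t) (at t)" by simp
    then show ?thesis
      by (rule has_field_derivative_transform_within_open[where S = "{0<..}"])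
        (use True in \<open>auto simp: flat_exp_def\<close>)
  next
    case f: False
    have "((\<lambda>t. 0) has_real_derivative flat_exp ([:0, 0, 1:] * (P - pderiv P)) t) (at t)"
      using f by (simp add: flat_exp_def)
    then show ?thesis
      by (rule has_field_derivative_transform_within_open[where S = "{..<0}"])
        (use f False in \<open>auto simp: flat_exp_def\<close>)
  qed
qed

text \<open>The constant and the polynomial vary in the induction: a derivative in direction
  \<open>j\<close> multiplies \<open>c\<close> by \<open>b\<close> or by 0, according to whether
  \<open>j\<close> is \<open>i\<close>.\<close>

lemma Ck_flat_exp: "Ck n (\<lambda>x. c * flat_exp P (b * x $ i + a))"
proof (induction n arbitrary: P c)
  case 0
  have "continuous_on UNIV (flat_exp P)"
    by (rule DERIV_continuous_on[OF DERIV_subset[OF flat_exp_derivative]]) auto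
  then show ?case by (auto intro!: continuous_intros continuous_on_compose2[of UNIV "flat_exp P"])
next
  case (Suc n)
  let ?Q = "[:0, 0, 1:] * (P - pderiv P)"
  have d: "((\<lambda>x. c * flat_exp P (b * x $ i + a)) has_derivative
      (\<lambda>h. (c * b * (h $ i)) * flat_exp ?Q (b * x $ i + a))) (at x)" for x
  proof -
    have "((\<lambda>x::real^2. b * x $ i + a) has_derivative (\<lambda>h. b * h $ i)) (at x)"
      by (auto intro!: derivative_eq_intros bounded_linear.has_derivative[OF bounded_linear_vec_nth])
    from has_derivative_compose[OF this flat_exp_derivative[unfolded has_field_derivative_def]]
    have "((\<lambda>x. flat_exp P (b * x $ i + a)) has_derivative
       (\<lambda>h. flat_exp ?Q (b * x $ i + a) * (b * h $ i))) (at x)" .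
    from has_derivative_mult_right[OF this, of c] show ?thesis
      by (rule has_derivative_eq_rhs) (simp add: algebra_simps)
  qed
  have "pd j (\<lambda>x. c * flat_exp P (b * x $ i + a)) =
      (\<lambda>x. (if j = i then c * b else 0) * flat_exp ?Q (b * x $ i + a))" for j
    by (rule ext) (subst pd_eqI[OF d], simp add: axis_def)
  moreover have "(\<lambda>x. c * flat_exp P (b * x $ i + a)) differentiable (at x)" for x
    using d differentiable_def by blast
  ultimately show ?case using Suc.IH by simp
qed

lemma flat_exp_1_bounds: "0 \<le> flat_exp 1 t" "flat_exp 1 t \<le> 1"
  by (auto simp: flat_exp_def)

text \<open>A product of one-variable cut-offs. For growing \<open>s\<close> it tends pointwise to
  the indicator of the open box, and the product form makes its mixed partials commute by
  inspection.\<close>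

definition box_bump :: "real^2 \<Rightarrow> real^2 \<Rightarrow> real \<Rightarrow> real^2 \<Rightarrow> real" where
  "box_bump a b s x = (\<Prod>i\<in>UNIV. flat_exp 1 (s * (x $ i - a $ i)) * flat_exp 1 (s * (b $ i - x $ i)))"

lemma smooth_box_bump: "smooth (box_bump a b s)"
proof -
  have 1: "smooth (\<lambda>x. flat_exp 1 (s * (x $ i - a $ i)))" for i
    using Ck_flat_exp[of _ 1 1 s i "- s * a $ i"] by (simp add: smooth_def algebra_simps)
  have 2: "smooth (\<lambda>x. flat_exp 1 (s * (b $ i - x $ i)))" for i
    using Ck_flat_exp[of _ 1 1 "- s" i "s * b $ i"] by (simp add: smooth_def algebra_simps)
  show ?thesis
    unfolding box_bump_def[abs_def] UNIV_2
    by (simp add: smooth_bilinear[OF bounded_bilinear_mult] 1 2)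
qed

lemma box_bump_bounds: "0 \<le> box_bump a b s x" "box_bump a b s x \<le> 1"
  unfolding box_bump_def
  by (auto intro!: prod_nonneg prod_le_1 mult_le_one simp: flat_exp_1_bounds)

lemma box_bump_eq_0: "0 < s \<Longrightarrow> x \<notin> box a b \<Longrightarrow> box_bump a b s x = 0"
  by (auto simp: box_bump_def mem_box_cart flat_exp_def zero_less_mult_iff)

lemma box_bump_test: "0 < s \<Longrightarrow> box_bump a b s \<in> test_functions UNIV"
  unfolding test_functions_def
  by (auto simp: smooth_box_bump intro!: exI[of _ "cbox a b"])
    (metis box_bump_eq_0 box_subset_cbox subsetD)

lemma flat_exp_1_limit: "0 < r \<Longrightarrow> (\<lambda>n. flat_exp 1 (real n * r)) \<longlonglongrightarrow> 1"
proof -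
  assume r: "0 < r"
  have "(\<lambda>n. exp (- inverse (real n) * inverse r)) \<longlonglongrightarrow> 1"
    using tendsto_exp[OF tendsto_mult[OF tendsto_minus[OF lim_inverse_n] tendsto_const, of "inverse r"]]
    by simp
  then show ?thesis
    by (rule Lim_transform_eventually)
      (auto simp: flat_exp_def r field_simps eventually_sequentially intro!: exI[of _ 1])
qed

lemma box_bump_limit: "(\<lambda>n. box_bump a b (real n) x) \<longlonglongrightarrow> indicator (box a b) x"
proof (cases "x \<in> box a b")
  case True
  then have "(\<lambda>n. box_bump a b (real n) x) \<longlonglongrightarrow> (\<Prod>i\<in>(UNIV :: 2 set). 1 * 1)"
    unfolding box_bump_def
    by (intro tendsto_intros flat_exp_1_limit) (auto simp: mem_box_cart)
  with True show ?thesis by simp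
next
  case False
  have "(\<lambda>n. box_bump a b (real n) x) \<longlonglongrightarrow> 0"
    by (rule tendsto_eventually)
      (use False in \<open>auto simp: eventually_sequentially box_bump_eq_0 intro!: exI[of _ 1]\<close>)
  with False show ?thesis by simp
qed

section \<open>Compactly supported smooth functions\<close>

text \<open>Any normed space is allowed as target, since spinor fields serve as test fields
  too.\<close>

definition cc_smooth :: "(real^2 \<Rightarrow> 'b::real_normed_vector) \<Rightarrow> bool" where
  "cc_smooth f \<longleftrightarrow> smooth f \<and> (\<exists>r. \<forall>x. r < norm x \<longrightarrow> f x = 0)"

lemma cc_smooth_imp_smooth: "cc_smooth f \<Longrightarrow> smooth f"
  by (simp add: cc_smooth_def)

lemma test_functions_UNIV: "test_functions UNIV = {f. cc_smooth f}"
proof (intro equalityI subsetI)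
  fix f :: "real^2 \<Rightarrow> real" assume "f \<in> test_functions UNIV"
  then obtain K where K: "smooth f" "compact K" "\<And>x. x \<notin> K \<Longrightarrow> f x = 0"
    by (auto simp: test_functions_def)
  then obtain r where "\<And>x. x \<in> K \<Longrightarrow> norm x \<le> r"
    using compact_imp_bounded bounded_iff by metis
  with K show "f \<in> {f. cc_smooth f}" by (auto simp: cc_smooth_def) (meson not_less)
next
  fix f :: "real^2 \<Rightarrow> real" assume "f \<in> {f. cc_smooth f}"
  then obtain r where "smooth f" "\<And>x. r < norm x \<Longrightarrow> f x = 0" by (auto simp: cc_smooth_def)
  then show "f \<in> test_functions UNIV"
    by (auto simp: test_functions_def intro!: exI[of _ "cball 0 r"])
qed

lemma cc_smooth_pd: "cc_smooth f \<Longrightarrow> cc_smooth (pd i f)"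
proof -
  assume f: "cc_smooth f"
  then obtain r where r: "\<And>x. r < norm x \<Longrightarrow> f x = 0" by (auto simp: cc_smooth_def)
  have "pd i f x = 0" if x: "r < norm x" for x
  proof -
    have "((\<lambda>x. 0) has_derivative (\<lambda>h. 0)) (at x)" by simp
    then have "(f has_derivative (\<lambda>h. 0)) (at x)"
    proof (rule has_derivative_transform_within_open)
      show "open {x. r < norm x}" by (intro open_Collect_less continuous_intros)
    qed (use x r in auto)
    from pd_eqI[OF this] show ?thesis .
  qed
  with f show ?thesis by (auto simp: cc_smooth_def smooth_pd)
qed

lemma cc_smooth_add:
  assumes "cc_smooth f" "cc_smooth g" shows "cc_smooth (\<lambda>x. f x + g x)"
proof -
  obtain r s where "\<And>x. r < norm x \<Longrightarrow> f x = 0" "\<And>x. s < norm x \<Longrightarrow> g x = 0"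
    using assms by (auto simp: cc_smooth_def)
  then have "\<forall>x. max r s < norm x \<longrightarrow> f x + g x = 0" by auto
  with assms show ?thesis unfolding cc_smooth_def by (blast intro: smooth_add)
qed

lemma cc_smooth_linear:
  assumes "bounded_linear L" "cc_smooth f" shows "cc_smooth (\<lambda>x. L (f x))"
proof -
  interpret L: bounded_linear L by fact
  obtain r where "\<forall>x. r < norm x \<longrightarrow> f x = 0" using assms by (auto simp: cc_smooth_def)
  then have "\<forall>x. r < norm x \<longrightarrow> L (f x) = 0" by (simp add: L.zero)
  with assms show ?thesis by (auto simp: cc_smooth_def smooth_linear)
qed

lemma cc_smooth_bilinear1:
  assumes "bounded_bilinear B" "cc_smooth f" "smooth g" shows "cc_smooth (\<lambda>x. B (f x) (g x))"
proof -
  interpret B: bounded_bilinear B by fact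
  obtain r where "\<forall>x. r < norm x \<longrightarrow> f x = 0" using assms by (auto simp: cc_smooth_def)
  then have "\<forall>x. r < norm x \<longrightarrow> B (f x) (g x) = 0" by (simp add: B.zero_left)
  with assms show ?thesis by (auto simp: cc_smooth_def smooth_bilinear)
qed

lemma cc_smooth_translate:
  assumes "cc_smooth f" shows "cc_smooth (\<lambda>x. f (x + a))"
proof -
  obtain r where r: "\<And>x. r < norm x \<Longrightarrow> f x = 0" using assms by (auto simp: cc_smooth_def)
  have "f (x + a) = 0" if "r + norm a < norm x" for x
    by (rule r) (use that norm_triangle_ineq4[of "x + a" a] in simp)
  with assms show ?thesis by (auto simp: cc_smooth_def smooth_translate)
qed

lemma cc_smooth_bounded:
  assumes "cc_smooth f" obtains B where "0 \<le> B" "\<And>x. norm (f x) \<le> B"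
proof -
  obtain r where r: "\<And>x. r < norm x \<Longrightarrow> f x = 0" using assms by (auto simp: cc_smooth_def)
  have "compact (f ` cball 0 r)"
    using assms by (intro compact_continuous_image smooth_continuous) (auto simp: cc_smooth_def)
  then obtain B where B: "\<And>x. norm x \<le> r \<Longrightarrow> norm (f x) \<le> B"
    using compact_imp_bounded bounded_iff by (metis image_eqI mem_cball_0)
  have "norm (f x) \<le> max 0 B" for x
    using B[of x] r[of x] by (cases "norm x \<le> r") auto
  then show thesis by (intro that[of "max 0 B"]) auto
qed

lemma cc_smooth_measurable: "cc_smooth f \<Longrightarrow> f \<in> borel_measurable borel"
  by (intro borel_measurable_continuous_onI smooth_continuous) (simp add: cc_smooth_def)

lemma cc_smooth_measurable_lebesgue: "cc_smooth f \<Longrightarrow> f \<in> borel_measurable lebesgue"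
  using measurable_completion[of f lborel borel] cc_smooth_measurable[of f] by simp

lemma cc_smooth_integrable:
  fixes f :: "real^2 \<Rightarrow> 'b::euclidean_space"
  assumes "cc_smooth f" shows "integrable lborel f"
proof -
  obtain r where r: "\<And>x. r < norm x \<Longrightarrow> f x = 0" using assms by (auto simp: cc_smooth_def)
  have "integrable lborel (\<lambda>x. indicator (cball 0 r) x *\<^sub>R f x)"
    using assms by (intro borel_integrable_compact smooth_continuous) (auto simp: cc_smooth_def)
  also have "(\<lambda>x. indicator (cball 0 r) x *\<^sub>R f x) = f"
    using r by (auto simp: indicator_def fun_eq_iff)
  finally show ?thesis .
qed

lemma cc_smooth_sq_integrable:
  fixes f :: "real^2 \<Rightarrow> 'b::euclidean_space"
  assumes "cc_smooth f" shows "f \<in> sq_integrable lebesgue"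
proof -
  have "cc_smooth (\<lambda>x. f x \<bullet> f x)"
    using assms by (intro cc_smooth_bilinear1[OF bounded_bilinear_inner]) (auto simp: cc_smooth_def)
  from cc_smooth_integrable[OF this] have "integrable lebesgue (\<lambda>x. f x \<bullet> f x)"
    using cc_smooth_measurable[OF \<open>cc_smooth (\<lambda>x. f x \<bullet> f x)\<close>] by (subst integrable_completion) auto
  with assms show ?thesis
    by (simp add: sq_integrable_def power2_norm_eq_inner cc_smooth_measurable_lebesgue)
qed

lemma box_bump_cc_smooth: "0 < s \<Longrightarrow> cc_smooth (box_bump a b s)"
  using box_bump_test test_functions_UNIV by blast

section \<open>Integration by parts\<close>

lemma smooth_line_derivative:
  fixes f :: "real^2 \<Rightarrow> real"
  assumes "smooth f"
  shows "((\<lambda>t. f (x + t *\<^sub>R axis i 1)) has_real_derivative pd i f (x + t *\<^sub>R axis i 1)) (at t)"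
proof -
  have "((\<lambda>t. x + t *\<^sub>R axis i 1) has_derivative (\<lambda>h. h *\<^sub>R axis i 1)) (at t)"
    by (auto intro!: derivative_eq_intros)
  from has_derivative_compose[OF this has_derivative_pd[OF smooth_differentiable[OF assms]]]
  have "((\<lambda>t. f (x + t *\<^sub>R axis i 1)) has_derivative
      (\<lambda>h. \<Sum>j\<in>UNIV. (h *\<^sub>R axis i 1) $ j *\<^sub>R pd j f (x + t *\<^sub>R axis i 1))) (at t)" .
  then show ?thesis
    unfolding has_field_derivative_def
    by (rule has_derivative_eq_rhs)
      (auto simp: axis_def fun_eq_iff if_distrib [where f = "\<lambda>c. c *\<^sub>R _"]
        if_distrib [where f = "\<lambda>c. c * _"] if_distrib [where f = "\<lambda>c. _ * c"] cong: if_cong)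
qed

lemma lborel_integral_translate:
  fixes f :: "'a::euclidean_space \<Rightarrow> 'b::{banach, second_countable_topology}"
  assumes "f \<in> borel_measurable borel"
  shows "(LINT x|lborel. f (x + a)) = (LINT x|lborel. f x)"
proof -
  have "(LINT x|lborel. f x) = (LINT x|distr lborel borel ((+) a). f x)"
    by (simp add: lborel_distr_plus)
  also have "\<dots> = (LINT x|lborel. f (a + x))"
    using assms by (subst integral_distr) auto
  finally show ?thesis by (simp add: add.commute)
qed

lemma lborel_integrable_translate:
  fixes f :: "'a::euclidean_space \<Rightarrow> 'b::{banach, second_countable_topology}"
  assumes "integrable lborel f"
  shows "integrable lborel (\<lambda>x. f (x + a))"
proof -
  have "integrable (distr lborel borel ((+) a)) f" using assms by (simp add: lborel_distr_plus)
  then show ?thesis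
    using assms by (subst (asm) integrable_distr_eq) (auto simp: add.commute)
qed

text \<open>Difference quotients have integral zero by translation invariance of Lebesgue measure,
  and dominated convergence passes to the derivative. The mean value theorem supplies the majorant,
  supported in a ball one unit larger because the steps are at most 1.\<close>

lemma integral_pd_eq_0:
  fixes f :: "real^2 \<Rightarrow> real"
  assumes f: "cc_smooth f" shows "(LINT x|lborel. pd i f x) = 0"
proof -
  let ?e = "axis i 1 :: real^2"
  obtain r where r: "\<And>x. r < norm x \<Longrightarrow> f x = 0" using f by (auto simp: cc_smooth_def)
  obtain B where B: "0 \<le> B" "\<And>x. norm (pd i f x) \<le> B"
    using cc_smooth_bounded[OF cc_smooth_pd[OF f]] by blast
  note sm = cc_smooth_imp_smooth[OF f]
  note [measurable] = cc_smooth_measurable[OF f] cc_smooth_measurable[OF cc_smooth_pd[OF f]]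
  define h where "h n = inverse (real (Suc n))" for n
  have h: "0 < h n" "h n \<le> 1" for n by (auto simp: h_def field_simps)
  have h0: "h \<longlonglongrightarrow> 0" unfolding h_def by (rule LIMSEQ_inverse_real_of_nat)
  define q where "q n x = (f (x + h n *\<^sub>R ?e) - f x) / h n" for n x
  have [measurable]: "q n \<in> borel_measurable borel" for n unfolding q_def by measurable
  have int_q: "(LINT x|lborel. q n x) = 0" for n
  proof -
    have "(LINT x|lborel. f (x + h n *\<^sub>R ?e) - f x) = 0"
      using cc_smooth_integrable[OF f] lborel_integrable_translate[OF cc_smooth_integrable[OF f]]
      by (simp add: lborel_integral_translate)
    then show ?thesis unfolding q_def by simp
  qed
  have "(\<lambda>n. LINT x|lborel. q n x) \<longlonglongrightarrow> (LINT x|lborel. pd i f x)"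
  proof (rule integral_dominated_convergence[where w = "\<lambda>x. indicator (cball 0 (r + 1)) x *\<^sub>R B"])
    show "integrable lborel (\<lambda>x::real^2. indicator (cball 0 (r + 1)) x *\<^sub>R B)"
      by (intro borel_integrable_compact) auto
    show "AE x in lborel. (\<lambda>n. q n x) \<longlonglongrightarrow> pd i f x"
    proof (rule AE_I2)
      fix x
      have "((\<lambda>t. (f (x + t *\<^sub>R ?e) - f x) / t) \<longlongrightarrow> pd i f x) (at 0)"
        using smooth_line_derivative[OF sm, of x i 0] by (simp add: DERIV_def)
      moreover have "filterlim h (at 0) sequentially"
        using h0 h(1) by (auto simp: filterlim_at eventually_sequentially) (metis less_irrefl)
      ultimately show "(\<lambda>n. q n x) \<longlonglongrightarrow> pd i f x"
        unfolding q_def by (rule filterlim_compose)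
    qed
    show "AE x in lborel. norm (q n x) \<le> indicator (cball 0 (r + 1)) x *\<^sub>R B" for n
    proof (rule AE_I2)
      fix x
      show "norm (q n x) \<le> indicator (cball 0 (r + 1)) x *\<^sub>R B"
      proof (cases "norm x \<le> r + 1")
        case True
        obtain z where "f (x + h n *\<^sub>R ?e) - f (x + 0 *\<^sub>R ?e) = (h n - 0) * pd i f (x + z *\<^sub>R ?e)"
          using MVT2[OF h(1)[of n], of "\<lambda>t. f (x + t *\<^sub>R ?e)" "\<lambda>t. pd i f (x + t *\<^sub>R ?e)"]
            smooth_line_derivative[OF sm, of x i] by blast
        then have "q n x = pd i f (x + z *\<^sub>R ?e)" using h(1)[of n] by (simp add: q_def)
        with True B(2)[of "x + z *\<^sub>R ?e"] show ?thesis by simp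
      next
        case False
        have "norm (h n *\<^sub>R ?e) \<le> 1" using h[of n] by simp
        with False have "r < norm (x + h n *\<^sub>R ?e)"
          using norm_triangle_ineq4[of "x + h n *\<^sub>R ?e" "h n *\<^sub>R ?e"] by simp
        with False r show ?thesis by (simp add: q_def)
      qed
    qed
  qed auto
  then show ?thesis by (simp add: int_q LIMSEQ_const_iff)
qed

lemma integration_by_parts:
  fixes B :: "'a::real_normed_vector \<Rightarrow> 'b::real_normed_vector \<Rightarrow> real"
  assumes B: "bounded_bilinear B" and fg: "cc_smooth f" "cc_smooth g"
  shows "(LINT x|lborel. B (pd i f x) (g x)) = - (LINT x|lborel. B (f x) (pd i g x))"
proof -
  have s: "smooth f" "smooth g" using fg by (auto simp: cc_smooth_imp_smooth)
  have cc: "cc_smooth (\<lambda>x. B (f x) (g x))" by (rule cc_smooth_bilinear1[OF B fg(1) s(2)])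
  have i: "integrable lborel (\<lambda>x. B (pd i f x) (g x))" "integrable lborel (\<lambda>x. B (f x) (pd i g x))"
    using fg s by (auto intro!: cc_smooth_integrable cc_smooth_bilinear1[OF B] smooth_pd cc_smooth_pd)
  have "pd i (\<lambda>x. B (f x) (g x)) = (\<lambda>x. B (f x) (pd i g x) + B (pd i f x) (g x))"
    using s by (auto intro!: pd_bilinear[OF B] smooth_differentiable)
  with integral_pd_eq_0[OF cc, of i] i show ?thesis by simp
qed

section \<open>The fundamental lemma of the calculus of variations\<close>

lemma sq_integrable_set_integrable:
  fixes g :: "real^2 \<Rightarrow> real"
  assumes "g \<in> sq_integrable lebesgue" "bounded A" "A \<in> sets lebesgue"
  shows "set_integrable lebesgue A g"
  unfolding set_integrable_def
proof (rule Bochner_Integration.integrable_bound)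
  show "integrable lebesgue (\<lambda>x. indicator A x + (norm (g x))\<^sup>2)"
    using assms bounded_set_imp_lmeasurable[OF assms(2,3)]
    by (intro Bochner_Integration.integrable_add)
      (auto simp: sq_integrable_def fmeasurable_def)
  show "(\<lambda>x. indicat_real A x *\<^sub>R g x) \<in> borel_measurable lebesgue"
    using assms by (auto simp: sq_integrable_def)
  have "\<bar>t\<bar> \<le> 1 + t\<^sup>2" for t :: real
    using sum_squares_bound[of "\<bar>t\<bar>" 1] by (simp add: abs_le_iff) linarith
  then show "AE x in lebesgue. norm (indicat_real A x *\<^sub>R g x) \<le> norm (indicat_real A x + (norm (g x))\<^sup>2)"
    by (intro AE_I2) (auto simp: indicator_def)
qed

text \<open>The restriction to explicit bumps matters: their mixed partials are known to commute,
  and this version extends that to all test functions. In the limit the bumps become indicators of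
  boxes, an intersection-stable generator of the Borel sets.\<close>

lemma fundamental_lemma_bump:
  fixes g :: "real^2 \<Rightarrow> real"
  assumes g: "g \<in> sq_integrable lebesgue"
    and test: "\<And>a b s. 0 < s \<Longrightarrow> (LINT x|lebesgue. box_bump a b s x * g x) = 0"
  shows "AE x in lebesgue. g x = 0"
proof -
  have gm [measurable]: "g \<in> borel_measurable lebesgue" using g by (simp add: sq_integrable_def)
  have box0: "(LINT x|lebesgue. indicator (box a b) x * g x) = 0" for a b
  proof -
    have int: "integrable lebesgue (\<lambda>x. indicator (box a b) x *\<^sub>R g x)"
      using sq_integrable_set_integrable[OF g, of "box a b"]
      by (simp add: set_integrable_def)
    have "(\<lambda>n. LINT x|lebesgue. box_bump a b (real (Suc n)) x * g x) \<longlonglongrightarrow>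
        (LINT x|lebesgue. indicator (box a b) x * g x)"
    proof (rule integral_dominated_convergence[where w = "\<lambda>x. norm (indicator (box a b) x *\<^sub>R g x)"])
      show "AE x in lebesgue. (\<lambda>n. box_bump a b (real (Suc n)) x * g x) \<longlonglongrightarrow> indicator (box a b) x * g x"
        by (intro AE_I2 tendsto_intros box_bump_limit[THEN LIMSEQ_Suc])
      show "AE x in lebesgue. norm (box_bump a b (real (Suc n)) x * g x) \<le> norm (indicat_real (box a b) x *\<^sub>R g x)" for n
      proof (rule AE_I2)
        fix x
        show "norm (box_bump a b (real (Suc n)) x * g x) \<le> norm (indicat_real (box a b) x *\<^sub>R g x)"
          using box_bump_bounds[of a b "real (Suc n)" x] box_bump_eq_0[of "real (Suc n)" x a b]
          by (cases "x \<in> box a b") (auto simp: abs_mult intro: mult_left_le_one_le)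
      qed
      show "(\<lambda>x. box_bump a b (real (Suc n)) x * g x) \<in> borel_measurable lebesgue" for n
        by (intro borel_measurable_times cc_smooth_measurable_lebesgue box_bump_cc_smooth gm) simp
      show "(\<lambda>x. indicat_real (box a b) x * g x) \<in> borel_measurable lebesgue"
        by (intro borel_measurable_times borel_measurable_indicator gm) simp
      show "integrable lebesgue (\<lambda>x. norm (indicat_real (box a b) x *\<^sub>R g x))"
        using int by (rule integrable_norm)
    qed
    moreover have "(LINT x|lebesgue. box_bump a b (real (Suc n)) x * g x) = 0" for n
      by (intro test) simp
    ultimately show ?thesis by (simp add: LIMSEQ_const_iff del: of_nat_Suc)
  qed
  \<comment> \<open>The induction over generated sets lives in the Borel sets, so \<open>g\<close>
    is replaced by a Borel representative.\<close>
  obtain g' where g' [measurable]: "g' \<in> borel_measurable lborel" and "AE x in lborel. g x = g' x"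
    using completion_ex_borel_measurable_real[OF gm] by auto
  then have gg': "AE x in lebesgue. g x = g' x" by (intro AE_completion)
  have g'm: "g' \<in> borel_measurable lebesgue" using measurable_completion[OF g'] by simp
  define bx :: "nat \<Rightarrow> (real^2) set" where "bx n = box (\<chi> i. - real n) (\<chi> i. real n)" for n
  have box_int: "(LINT x|lborel. indicator (box a b) x * g' x) = 0"
    and box_intble: "integrable lborel (\<lambda>x. indicator (box a b) x *\<^sub>R g' x)" for a b
  proof -
    have "(LINT x|lborel. indicator (box a b) x * g' x) = (LINT x|lebesgue. indicator (box a b) x * g' x)"
      by (rule integral_completion[symmetric]) measurable
    also have "\<dots> = (LINT x|lebesgue. indicator (box a b) x * g x)"
      using gg' by (intro integral_cong_AE) (auto intro!: borel_measurable_times borel_measurable_indicator gm g'm)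
    finally show "(LINT x|lborel. indicator (box a b) x * g' x) = 0" using box0 by simp
    have "integrable lebesgue (\<lambda>x. indicator (box a b) x *\<^sub>R g x)"
      using sq_integrable_set_integrable[OF g, of "box a b"] by (simp add: set_integrable_def)
    then have "integrable lebesgue (\<lambda>x. indicator (box a b) x *\<^sub>R g' x)"
      using gg'
      by (rule_tac integrable_cong_AE_imp) (auto intro!: borel_measurable_times borel_measurable_indicator g'm)
    then show "integrable lborel (\<lambda>x. indicator (box a b) x *\<^sub>R g' x)"
      by (subst (asm) integrable_completion) auto
  qed
  have sets_b: "sets (borel :: (real^2) measure) = sigma_sets UNIV (range (\<lambda>(a, b). box a b))"
    by (subst borel_eq_box) (simp add: sets_measure_of)
  \<comment> \<open>Cutting with a bounded box makes the function integrable. As \<open>bx n\<close>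
    is itself a box, the total integral is 0, which the complement case needs.\<close>
  have "AE x in lborel. indicator (bx n) x * g' x = 0" for n
  proof -
    let ?f = "\<lambda>x. indicator (bx n) x * g' x"
    have f: "integrable lborel ?f" using box_intble by (simp add: bx_def)
    have "(LINT x:A|lborel. ?f x) = 0" if "A \<in> sets lborel" for A
    proof -
      have "Int_stable (range (\<lambda>(a, b). box a b :: (real^2) set))"
        by (auto simp: Int_stable_def box_Int_box)
      moreover have "range (\<lambda>(a, b). box a b :: (real^2) set) \<subseteq> Pow UNIV" by simp
      moreover have "A \<in> sigma_sets UNIV (range (\<lambda>(a, b). box a b))"
        using that sets_b by simp
      ultimately show ?thesis
      proof (induction rule: sigma_sets_induct_disjoint)
        case (basic A)
        then obtain a b where A: "A = box a b" by auto
        obtain c d where cd: "box a b \<inter> bx n = box c d" unfolding bx_def box_Int_box by blast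
        have "(LINT x:A|lborel. ?f x) = (LINT x|lborel. indicator (box c d) x * g' x)"
          unfolding set_lebesgue_integral_def cd[symmetric] A
          by (intro Bochner_Integration.integral_cong) (auto simp: indicator_def)
        then show ?case using box_int by simp
      next
        case (compl A)
        have mA: "A \<in> sets lborel" using compl sets_b by simp
        have "(LINT x:UNIV - A|lborel. ?f x) = (LINT x|lborel. ?f x) - (LINT x:A|lborel. ?f x)"
        proof -
          have "integrable lborel (\<lambda>x. indicator A x *\<^sub>R ?f x)"
            using f mA by (intro integrable_mult_indicator) auto
          then have "(LINT x|lborel. ?f x) - (LINT x:A|lborel. ?f x) = (LINT x|lborel. ?f x - indicator A x *\<^sub>R ?f x)"
            unfolding set_lebesgue_integral_def using f by simp
          also have "\<dots> = (LINT x:UNIV - A|lborel. ?f x)"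
            unfolding set_lebesgue_integral_def
            by (intro Bochner_Integration.integral_cong) (auto simp: indicator_def)
          finally show ?thesis by simp
        qed
        then show ?case using compl box_int by (simp add: bx_def)
      next
        case (union A)
        have mA: "A i \<in> sets lborel" for i using union sets_b by auto
        have "(LINT x:(\<Union>i. A i)|lborel. ?f x) = (\<Sum>i. (LINT x:A i|lborel. ?f x))"
          using union(1) mA f
          by (intro lebesgue_integral_countable_add)
            (auto simp: disjoint_family_on_def set_integrable_def
              intro!: integrable_mult_indicator[where 'b = real, unfolded real_scaleR_def])
        with union show ?case by simp
      qed (auto simp: set_lebesgue_integral_def)
    qed
    then show ?thesis
      using density_unique_real[OF f, of "\<lambda>x. 0"] by (auto simp: set_lebesgue_integral_def)
  qed
  then have "AE x in lborel. \<forall>n. indicator (bx n) x * g' x = 0"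
    by (subst AE_all_countable) auto
  then have "AE x in lborel. g' x = 0"
  proof eventually_elim
    case (elim x)
    obtain n where "norm x < real n" using reals_Archimedean2 by blast
    then have "x \<in> bx n"
      using component_le_norm_cart[of x] by (auto simp: bx_def mem_box_cart abs_less_iff) 
       (smt (verit) component_le_norm_cart)+
    with elim[rule_format, of n] show ?case by simp
  qed
  then have "AE x in lebesgue. g' x = 0" by (rule AE_completion)
  with gg' show ?thesis by eventually_elim simp
qed

lemma fundamental_lemma:
  fixes g :: "real^2 \<Rightarrow> real"
  assumes "g \<in> sq_integrable lebesgue"
    and "\<And>\<psi>. cc_smooth \<psi> \<Longrightarrow> (LINT x|lebesgue. \<psi> x * g x) = 0"
  shows "AE x in lebesgue. g x = 0"
  by (rule fundamental_lemma_bump[OF assms(1)]) (intro assms(2) box_bump_cc_smooth)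

section \<open>The kernel of the Helmholtz operator\<close>

text \<open>The Taylor remainders at \<open>t\<close> and \<open>- t\<close> sit at different
  points, hence \<open>a\<close> and \<open>b\<close>; the first-order terms cancel in the
  sum.\<close>

lemma second_difference:
  fixes q q' q'' :: "real \<Rightarrow> real"
  assumes "\<And>t. (q has_real_derivative q' t) (at t)" "\<And>t. (q' has_real_derivative q'' t) (at t)"
  obtains a b where "\<bar>a\<bar> \<le> \<bar>t\<bar>" "\<bar>b\<bar> \<le> \<bar>t\<bar>" "q t + q (- t) - 2 * q 0 = t\<^sup>2 / 2 * (q'' a + q'' b)"
proof -
  define df where "df m = (if m = 0 then q else if m = 1 then q' else q'')" for m :: nat
  have "\<exists>a. \<bar>a\<bar> \<le> \<bar>s\<bar> \<and> q s = (\<Sum>m<2. df m 0 / fact m * s ^ m) + df 2 a / fact 2 * s ^ 2" for s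
    using assms by (intro Maclaurin_bi_le) (auto simp: df_def less_2_cases_iff)
  then have "\<exists>a. \<bar>a\<bar> \<le> \<bar>s\<bar> \<and> q s = q 0 + q' 0 * s + q'' a / 2 * s\<^sup>2" for s
    by (simp add: df_def numeral_2_eq_2)
  from this[of t] this[of "- t"] obtain a b where "\<bar>a\<bar> \<le> \<bar>t\<bar>" "q t = q 0 + q' 0 * t + q'' a / 2 * t\<^sup>2"
    "\<bar>b\<bar> \<le> \<bar>t\<bar>" "q (- t) = q 0 + q' 0 * (- t) + q'' b / 2 * (- t)\<^sup>2" by auto
  then show thesis by (intro that[of a b]) (auto simp: algebra_simps)
qed

lemma second_difference_limit:
  fixes q q' q'' :: "real \<Rightarrow> real"
  assumes d: "\<And>t. (q has_real_derivative q' t) (at t)" "\<And>t. (q' has_real_derivative q'' t) (at t)"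
    and c: "isCont q'' 0" and h: "h \<longlonglongrightarrow> 0" "\<And>n::nat. 0 < h n"
  shows "(\<lambda>n. (q (h n) + q (- h n) - 2 * q 0) / (h n)\<^sup>2) \<longlonglongrightarrow> q'' 0"
proof -
  have "\<exists>a b. \<bar>a\<bar> \<le> \<bar>h n\<bar> \<and> \<bar>b\<bar> \<le> \<bar>h n\<bar> \<and>
      q (h n) + q (- h n) - 2 * q 0 = (h n)\<^sup>2 / 2 * (q'' a + q'' b)" for n
    by (metis second_difference[OF d])
  then obtain a b where ab: "\<And>n. \<bar>a n\<bar> \<le> \<bar>h n\<bar>" "\<And>n. \<bar>b n\<bar> \<le> \<bar>h n\<bar>"
      "\<And>n. q (h n) + q (- h n) - 2 * q 0 = (h n)\<^sup>2 / 2 * (q'' (a n) + q'' (b n))"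
    by metis
  have "a \<longlonglongrightarrow> 0" "b \<longlonglongrightarrow> 0"
    using ab(1,2) by (auto intro!: tendsto_rabs_zero_cancel[OF tendsto_sandwich[OF _ _ tendsto_const tendsto_rabs_zero[OF h(1)]]] always_eventually)
  then have "(\<lambda>n. (q'' (a n) + q'' (b n)) / 2) \<longlonglongrightarrow> (q'' 0 + q'' 0) / 2"
    by (intro tendsto_intros isCont_tendsto_compose[OF c]) simp_all
  moreover have eq: "(q (h n) + q (- h n) - 2 * q 0) / (h n)\<^sup>2 = (q'' (a n) + q'' (b n)) / 2" for n
    using h(2)[of n] by (simp add: ab(3))
  ultimately show ?thesis by (simp only: eq) simp
qed

lemma integrable_times_sq_integrable:
  fixes g :: "'a \<Rightarrow> real"
  assumes "f \<in> sq_integrable M" "g \<in> sq_integrable M" shows "integrable M (\<lambda>x. f x * g x)"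
  using integrable_inner_sq_integrable[OF assms] by simp

text \<open>Maximum principle: a positive value of the bounded function \<open>G x = \<integral> \<psi> (y - x) g y dy\<close>,
  which solves \<open>G = \<Delta> G\<close>, would produce a positive maximum of
  \<open>G x - e (cosh x\<^sub>1 + cosh x\<^sub>2)\<close> for small \<open>e\<close>.\<close>

lemma helmholtz_kernel:
  fixes g :: "real^2 \<Rightarrow> real"
  assumes g: "g \<in> sq_integrable lebesgue"
    and H: "\<And>\<psi>. cc_smooth \<psi> \<Longrightarrow> (LINT x|lebesgue. \<psi> x * g x) = (\<Sum>i\<in>UNIV. LINT x|lebesgue. pd i (pd i \<psi>) x * g x)"
  shows "AE x in lebesgue. g x = 0"
proof (rule fundamental_lemma[OF g])
  have gm: "g \<in> borel_measurable lebesgue" using g by (simp add: sq_integrable_def)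
  have int: "integrable lebesgue (\<lambda>y. \<psi> y * g y)" if "cc_smooth \<psi>" for \<psi>
    by (rule integrable_times_sq_integrable[OF cc_smooth_sq_integrable[OF that] g])
  have le0: "(LINT x|lebesgue. \<psi> x * g x) \<le> 0" if \<psi>: "cc_smooth \<psi>" for \<psi>
  proof -
    define G where "G x = (LINT y|lebesgue. \<psi> (y - x) * g y)" for x
    have tr: "cc_smooth (\<lambda>y. \<phi> (y - x))" if "cc_smooth \<phi>" for \<phi> :: "real^2 \<Rightarrow> real" and x
      using cc_smooth_translate[OF that, of "- x"] by simp
    obtain r where r: "\<And>x. r < norm x \<Longrightarrow> \<psi> x = 0" using \<psi> by (auto simp: cc_smooth_def)
    obtain B where B: "0 \<le> B" "\<And>x. \<bar>\<psi> x\<bar> \<le> B" using cc_smooth_bounded[OF \<psi>] by (auto simp: real_norm_def)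
    have domint: "integrable lebesgue (\<lambda>y. norm (indicator (cball 0 R) y *\<^sub>R g y) * B')" for R B'
    proof -
      have "set_integrable lebesgue (cball 0 R) g"
        by (intro sq_integrable_set_integrable[OF g]) (auto intro: lmeasurable_cball fmeasurableD)
      then show ?thesis unfolding set_integrable_def by (intro integrable_mult_left integrable_norm)
    qed
    \<comment> \<open>A product is at most the sum of the two squares, and the integral of the
      squared translate of \<psi> does not depend on the translation. So \<open>C\<close> bounds
      \<open>G\<close> everywhere.\<close>
    define C where "C = (LINT y|lborel. (\<psi> y)\<^sup>2) + (LINT y|lebesgue. (g y)\<^sup>2)"
    have Gb: "G x \<le> C" for x
    proof -
      have c2: "cc_smooth (\<lambda>y. (\<psi> (y - x))\<^sup>2)" for x
        unfolding power2_eq_square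
        using cc_smooth_bilinear1[OF bounded_bilinear_mult tr[OF \<psi>] cc_smooth_imp_smooth[OF tr[OF \<psi>]]] .
      have i2: "integrable lebesgue (\<lambda>y. (\<psi> (y - x))\<^sup>2)" "integrable lebesgue (\<lambda>y. (g y)\<^sup>2)"
        using cc_smooth_sq_integrable[OF tr[OF \<psi>, of x]] g by (auto simp: sq_integrable_def)
      have "G x \<le> (LINT y|lebesgue. (\<psi> (y - x))\<^sup>2 + (g y)\<^sup>2)"
        unfolding G_def
      proof (intro integral_mono int tr \<psi> Bochner_Integration.integrable_add i2)
        fix y
        have "2 * \<psi> (y - x) * g y \<le> (\<psi> (y - x))\<^sup>2 + (g y)\<^sup>2" by (rule sum_squares_bound)
        moreover have "0 \<le> (\<psi> (y - x))\<^sup>2 + (g y)\<^sup>2" by simp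
        ultimately show "\<psi> (y - x) * g y \<le> (\<psi> (y - x))\<^sup>2 + (g y)\<^sup>2" by linarith
      qed
      also have "\<dots> = (LINT y|lebesgue. (\<psi> (y - x))\<^sup>2) + (LINT y|lebesgue. (g y)\<^sup>2)"
        using i2 by simp
      also have "(LINT y|lebesgue. (\<psi> (y - x))\<^sup>2) = (LINT y|lborel. (\<psi> (y + (- x)))\<^sup>2)"
        using cc_smooth_measurable[OF c2[of x]] by (subst integral_completion) auto
      also have "\<dots> = (LINT y|lborel. (\<psi> y)\<^sup>2)"
        using cc_smooth_measurable[OF c2[of 0]] by (subst lborel_integral_translate[where f = "\<lambda>y. (\<psi> y)\<^sup>2"]) auto
      finally show ?thesis by (simp add: C_def)
    qed
    have Gc: "continuous_on UNIV G"
    proof (rule continuous_on_sequentiallyI)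
      fix X :: "nat \<Rightarrow> real^2" and x assume X: "X \<longlonglongrightarrow> x"
      then obtain M where M: "\<And>n. norm (X n) \<le> M"
        using convergent_imp_Bseq[OF convergentI[OF X]] by (auto simp: Bseq_def)
      show "(\<lambda>n. G (X n)) \<longlonglongrightarrow> G x"
        unfolding G_def
      proof (rule integral_dominated_convergence[where w = "\<lambda>y. norm (indicator (cball 0 (r + M)) y *\<^sub>R g y) * B"])
        show "AE y in lebesgue. (\<lambda>n. \<psi> (y - X n) * g y) \<longlonglongrightarrow> \<psi> (y - x) * g y"
          by (intro AE_I2 tendsto_intros isCont_tendsto_compose[where g = \<psi>] X)
            (use smooth_continuous[OF cc_smooth_imp_smooth[OF \<psi>], of UNIV] in \<open>auto simp: continuous_on_eq_continuous_at\<close>)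
        show "AE y in lebesgue. norm (\<psi> (y - X n) * g y) \<le> norm (indicator (cball 0 (r + M)) y *\<^sub>R g y) * B" for n
        proof (rule AE_I2)
          fix y
          show "norm (\<psi> (y - X n) * g y) \<le> norm (indicator (cball 0 (r + M)) y *\<^sub>R g y) * B"
          proof (cases "norm y \<le> r + M")
            case True
            then show ?thesis using mult_left_mono[OF B(2)[of "y - X n"], of "\<bar>g y\<bar>"] by (simp add: abs_mult mult.commute)
          next
            case False
            then have "r < norm (y - X n)" using M[of n] norm_triangle_ineq2[of y "X n"] by simp
            then show ?thesis using r False by simp
          qed
        qed
      qed (rule domint borel_measurable_times[OF cc_smooth_measurable_lebesgue gm] \<psi> tr)+
    qed
    \<comment> \<open>The barrier: cosh is its own second derivative, so \<open>h\<close> solves the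
      same equation as \<open>G\<close>, and it grows in every direction.\<close>
    define h :: "real^2 \<Rightarrow> real" where "h x = cosh (x $ 1) + cosh (x $ 2)" for x
    have hc: "continuous_on UNIV h" unfolding h_def by (intro continuous_intros)
    have hge: "norm x / 2 \<le> h x" for x
    proof -
      have c: "\<bar>t\<bar> / 2 \<le> cosh t" for t :: real
      proof -
        have "\<bar>t\<bar> \<le> exp \<bar>t\<bar>" using exp_ge_add_one_self[of "\<bar>t\<bar>"] by linarith
        also have "\<dots> \<le> 2 * cosh \<bar>t\<bar>" by (simp add: cosh_def)
        finally show ?thesis by simp
      qed
      have "norm x \<le> \<bar>x $ 1\<bar> + \<bar>x $ 2\<bar>" using norm_le_l1_cart[of x] by (simp add: UNIV_2)
      with c[of "x $ 1"] c[of "x $ 2"] show ?thesis by (simp add: h_def)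
    qed
    have main: "G x1 \<le> e * h x1" if e: "0 < e" for e x1
    proof (rule ccontr)
      assume "\<not> G x1 \<le> e * h x1"
      then have x1: "0 < G x1 - e * h x1" by simp
      \<comment> \<open>Beyond \<open>2 * C / e\<close> the barrier term exceeds \<open>C\<close>,
        the bound for \<open>G\<close>, so the maximum over the ball is global. Keeping
        \<open>x1\<close> in the ball makes this maximum positive.\<close>
      define R where "R = max (norm x1) (2 * C / e)"
      obtain x0 where x0: "norm x0 \<le> R" "\<And>x. norm x \<le> R \<Longrightarrow> G x - e * h x \<le> G x0 - e * h x0"
      proof -
        have "\<exists>x\<in>cball 0 R. \<forall>y\<in>cball 0 R. G y - e * h y \<le> G x - e * h x"
          by (intro continuous_attains_sup continuous_intros continuous_on_subset[OF Gc] continuous_on_subset[OF hc])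
            (auto simp: R_def intro: le_max_iff_disj[THEN iffD2])
        then show thesis using that by auto
      qed
      have pos: "0 < G x0 - e * h x0" using x0(2)[of x1] x1 by (simp add: R_def)
      have glob: "G x - e * h x \<le> G x0 - e * h x0" for x
      proof (cases "norm x \<le> R")
        case False
        then have "2 * C / e < norm x" by (simp add: R_def)
        then have "C < e * (norm x / 2)" using e by (simp add: field_simps)
        also have "\<dots> \<le> e * h x" using e hge[of x] by (intro mult_left_mono) auto
        finally show ?thesis using Gb[of x] pos by linarith
      qed (rule x0)
      define t where "t n = inverse (real (Suc n))" for n
      have t: "0 < t n" "t n \<le> 1" for n by (auto simp: t_def field_simps)
      have t0: "t \<longlonglongrightarrow> 0" unfolding t_def by (rule LIMSEQ_inverse_real_of_nat)
      \<comment> \<open>At a maximum of \<open>G - e h\<close> second differences are nonpositive.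
        They are formed under the integral, on \<psi>, where the smoothness is, and only then is the
        step sent to 0.\<close>
      have L: "(LINT y|lebesgue. pd i (pd i \<psi>) (y - x0) * g y) \<le> e * cosh (x0 $ i)" for i
      proof -
        let ?e = "axis i 1 :: real^2"
        note sm = cc_smooth_imp_smooth[OF \<psi>]
        have d1: "((\<lambda>s. \<psi> (x + s *\<^sub>R ?e)) has_real_derivative pd i \<psi> (x + s *\<^sub>R ?e)) (at s)" for x s
          by (rule smooth_line_derivative[OF sm])
        have d2: "((\<lambda>s. pd i \<psi> (x + s *\<^sub>R ?e)) has_real_derivative pd i (pd i \<psi>) (x + s *\<^sub>R ?e)) (at s)" for x s
          by (rule smooth_line_derivative[OF smooth_pd[OF sm]])
        obtain B2 where B2: "0 \<le> B2" "\<And>x. \<bar>pd i (pd i \<psi>) x\<bar> \<le> B2"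
          using cc_smooth_bounded[OF cc_smooth_pd[OF cc_smooth_pd[OF \<psi>]]] by (auto simp: real_norm_def)
        define S where "S n y = (\<psi> (y - (x0 - t n *\<^sub>R ?e)) + \<psi> (y - (x0 + t n *\<^sub>R ?e)) - 2 * \<psi> (y - x0)) / (t n)\<^sup>2" for n y
        have Salt: "S n y = (\<psi> ((y - x0) + t n *\<^sub>R ?e) + \<psi> ((y - x0) + (- t n) *\<^sub>R ?e) - 2 * \<psi> ((y - x0) + 0 *\<^sub>R ?e)) / (t n)\<^sup>2" for n y
          by (simp add: S_def algebra_simps)
        have Slim: "(\<lambda>n. S n y) \<longlonglongrightarrow> pd i (pd i \<psi>) (y - x0)" for y
        proof -
          have cont: "continuous_on UNIV (\<lambda>s. pd i (pd i \<psi>) (y - x0 + s *\<^sub>R ?e))"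
            by (intro continuous_on_compose2[OF smooth_continuous[OF smooth_pd[OF smooth_pd[OF sm]], of UNIV]] continuous_intros) auto
          then have "isCont (\<lambda>s. pd i (pd i \<psi>) (y - x0 + s *\<^sub>R ?e)) 0"
            by (simp add: continuous_on_eq_continuous_at)
          from second_difference_limit[OF d1 d2 this t0 t(1)] show ?thesis
            unfolding Salt by simp
        qed
        have Sb: "\<bar>S n y\<bar> \<le> B2" for n y
        proof -
          obtain a b where "\<psi> ((y - x0) + t n *\<^sub>R ?e) + \<psi> ((y - x0) + (- t n) *\<^sub>R ?e) - 2 * \<psi> ((y - x0) + 0 *\<^sub>R ?e) =
             (t n)\<^sup>2 / 2 * (pd i (pd i \<psi>) ((y - x0) + a *\<^sub>R ?e) + pd i (pd i \<psi>) ((y - x0) + b *\<^sub>R ?e))"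
            using second_difference[OF d1 d2, of "t n" "y - x0"] by metis
          then have "S n y = (pd i (pd i \<psi>) ((y - x0) + a *\<^sub>R ?e) + pd i (pd i \<psi>) ((y - x0) + b *\<^sub>R ?e)) / 2"
            unfolding Salt using t(1)[of n] by simp
          with B2(2)[of "(y - x0) + a *\<^sub>R ?e"] B2(2)[of "(y - x0) + b *\<^sub>R ?e"] show ?thesis
            unfolding abs_le_iff by (simp add: field_simps)
        qed
        have S0: "S n y = 0" if "r + norm x0 + 1 < norm y" for n y
        proof -
          have te: "norm (t n *\<^sub>R ?e) \<le> 1" using t[of n] by simp
          have "r < norm ((y - x0) + s *\<^sub>R ?e)" if "norm (s *\<^sub>R ?e) \<le> 1" for s
            using \<open>r + norm x0 + 1 < norm y\<close> that norm_triangle_ineq4[of "(y - x0) + s *\<^sub>R ?e" "s *\<^sub>R ?e"]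
              norm_triangle_ineq2[of y x0] by simp
          from this[of "t n"] this[of "- t n"] this[of 0] te show ?thesis by (simp add: Salt r)
        qed
        have Scc: "cc_smooth (S n)" for n
        proof -
          have eq: "S n = (\<lambda>y. inverse ((t n)\<^sup>2) * (\<psi> (y - (x0 - t n *\<^sub>R ?e)) + (\<psi> (y - (x0 + t n *\<^sub>R ?e)) + (- 2) * \<psi> (y - x0))))"
            by (auto simp: S_def fun_eq_iff divide_inverse algebra_simps)
          show ?thesis
            unfolding eq by (intro cc_smooth_linear[OF bounded_linear_mult_right] cc_smooth_add tr \<psi>)
        qed
        have lim1: "(\<lambda>n. LINT y|lebesgue. S n y * g y) \<longlonglongrightarrow> (LINT y|lebesgue. pd i (pd i \<psi>) (y - x0) * g y)"
        proof (rule integral_dominated_convergence[where w = "\<lambda>y. norm (indicator (cball 0 (r + norm x0 + 1)) y *\<^sub>R g y) * B2"])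
          show "AE y in lebesgue. (\<lambda>n. S n y * g y) \<longlonglongrightarrow> pd i (pd i \<psi>) (y - x0) * g y"
            by (intro AE_I2 tendsto_intros Slim)
          show "AE y in lebesgue. norm (S n y * g y) \<le> norm (indicator (cball 0 (r + norm x0 + 1)) y *\<^sub>R g y) * B2" for n
          proof (rule AE_I2)
            fix y
            show "norm (S n y * g y) \<le> norm (indicator (cball 0 (r + norm x0 + 1)) y *\<^sub>R g y) * B2"
              using mult_left_mono[OF Sb[of n y], of "\<bar>g y\<bar>"] S0[of y n]
              by (cases "norm y \<le> r + norm x0 + 1") (auto simp: abs_mult mult.commute)
          qed
        qed (rule domint borel_measurable_times[OF cc_smooth_measurable_lebesgue gm] \<psi> Scc cc_smooth_pd tr)+
        have le: "(LINT y|lebesgue. S n y * g y) \<le> e * ((cosh (x0 $ i + t n) + cosh (x0 $ i + - t n) - 2 * cosh (x0 $ i + 0)) / (t n)\<^sup>2)" for n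
        proof -
          have "S n y * g y = (\<psi> (y - (x0 - t n *\<^sub>R ?e)) * g y + \<psi> (y - (x0 + t n *\<^sub>R ?e)) * g y - 2 * (\<psi> (y - x0) * g y)) / (t n)\<^sup>2" for y
            by (simp add: S_def algebra_simps diff_divide_distrib add_divide_distrib)
          then have "(LINT y|lebesgue. S n y * g y) = (G (x0 - t n *\<^sub>R ?e) + G (x0 + t n *\<^sub>R ?e) - 2 * G x0) / (t n)\<^sup>2"
            unfolding G_def using int tr[OF \<psi>] by simp
          also have "\<dots> \<le> (e * (h (x0 - t n *\<^sub>R ?e) + h (x0 + t n *\<^sub>R ?e) - 2 * h x0)) / (t n)\<^sup>2"
            using glob[of "x0 - t n *\<^sub>R ?e"] glob[of "x0 + t n *\<^sub>R ?e"]
            by (intro divide_right_mono) (auto simp: algebra_simps)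
          also have "h (x0 - t n *\<^sub>R ?e) + h (x0 + t n *\<^sub>R ?e) - 2 * h x0 =
              cosh (x0 $ i + t n) + cosh (x0 $ i + - t n) - 2 * cosh (x0 $ i + 0)"
            using exhaust_2[of i] by (auto simp: h_def axis_def)
          finally show ?thesis by simp
        qed
        have lim2: "(\<lambda>n. e * ((cosh (x0 $ i + t n) + cosh (x0 $ i + - t n) - 2 * cosh (x0 $ i + 0)) / (t n)\<^sup>2)) \<longlonglongrightarrow> e * cosh (x0 $ i + 0)"
          by (intro tendsto_intros second_difference_limit[where q = "\<lambda>s. cosh (x0 $ i + s)" and q' = "\<lambda>s. sinh (x0 $ i + s)" and q'' = "\<lambda>s. cosh (x0 $ i + s)"] t0 t)
            (auto intro!: derivative_eq_intros continuous_intros)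
        have "(LINT y|lebesgue. pd i (pd i \<psi>) (y - x0) * g y) \<le> e * cosh (x0 $ i + 0)"
          by (rule LIMSEQ_le[OF lim1 lim2]) (use le in blast)
        then show ?thesis by simp
      qed
      have tpd: "pd i (pd i (\<lambda>y. \<psi> (y - x0))) = (\<lambda>y. pd i (pd i \<psi>) (y - x0))" for i
        using pd_translate[of \<psi> i "- x0"] pd_translate[of "pd i \<psi>" i "- x0"] cc_smooth_imp_smooth[OF \<psi>]
        by (simp add: smooth_differentiable smooth_pd)
      \<comment> \<open>The equation, applied to the translated test function, expresses
        \<open>G x0\<close> by second derivatives; their bounds add up to \<open>e * h x0\<close>,
        because \<open>h\<close> equals its Laplacian.\<close>
      have "G x0 = (\<Sum>i\<in>UNIV. LINT y|lebesgue. pd i (pd i \<psi>) (y - x0) * g y)"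
        using H[OF tr[OF \<psi>, of x0]] by (simp add: G_def tpd)
      also have "\<dots> \<le> e * h x0" using L[of 1] L[of 2] by (simp add: UNIV_2 h_def algebra_simps)
      finally show False using pos by simp
    qed
    have h0: "0 < h 0" by (simp add: h_def)
    have "G 0 \<le> 0"
    proof (rule ccontr)
      assume "\<not> G 0 \<le> 0"
      then have "0 < G 0 / (2 * h 0)" using h0 by simp
      from main[OF this, of 0] h0 \<open>\<not> G 0 \<le> 0\<close> show False by simp
    qed
    then show ?thesis by (simp add: G_def)
  qed
  fix \<psi> :: "real^2 \<Rightarrow> real" assume \<psi>: "cc_smooth \<psi>"
  then have "cc_smooth (\<lambda>x. - \<psi> x)" by (intro cc_smooth_linear[OF bounded_linear_minus[OF bounded_linear_ident]])
  from le0[OF this] le0[OF \<psi>] show "(LINT x|lebesgue. \<psi> x * g x) = 0" by simp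
qed

section \<open>The space of square-integrable spinors is complete\<close>

lemma spinor_eq_refl: "spinor_eq u u \<longleftrightarrow> u \<in> sq_integrable lebesgue"
  by (simp add: spinor_eq_def)

lemma rep_spinor_sq_integrable: "rep_spinor_L2 x \<in> sq_integrable lebesgue"
  using Quotient_rep_reflp[OF Quotient_spinor_L2] by (simp add: spinor_eq_refl)

lemma abs_rep_spinor: "abs_spinor_L2 (rep_spinor_L2 x) = x"
  using Quotient_abs_rep[OF Quotient_spinor_L2] .

lemma abs_spinor_eqI:
  assumes "u \<in> sq_integrable lebesgue" "v \<in> sq_integrable lebesgue" "AE x in lebesgue. u x = v x"
  shows "abs_spinor_L2 u = abs_spinor_L2 v"
  using Quotient_rel_abs[OF Quotient_spinor_L2] spinor_eqI[OF assms] by (simp add: spinor_eqI)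

lemma rep_abs_spinor:
  assumes "u \<in> sq_integrable lebesgue" shows "AE x in lebesgue. rep_spinor_L2 (abs_spinor_L2 u) x = u x"
proof -
  have "spinor_eq (rep_spinor_L2 (abs_spinor_L2 u)) u"
    using Quotient_rel_rep[OF Quotient_spinor_L2] Quotient_rep_abs[OF Quotient_spinor_L2, of u] assms
    by (simp add: spinor_eq_refl)
  then show ?thesis by (rule spinor_eqD)
qed

lemma abs_spinor_cases: obtains u where "u \<in> sq_integrable lebesgue" "x = abs_spinor_L2 u"
  using rep_spinor_sq_integrable abs_rep_spinor by metis

lemma abs_spinor_add:
  "u \<in> sq_integrable lebesgue \<Longrightarrow> v \<in> sq_integrable lebesgue \<Longrightarrow>
   abs_spinor_L2 u + abs_spinor_L2 v = abs_spinor_L2 (\<lambda>x. u x + v x)"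
  by (simp add: plus_spinor_L2.abs_eq spinor_eq_refl)

lemma abs_spinor_uminus:
  "u \<in> sq_integrable lebesgue \<Longrightarrow> - abs_spinor_L2 u = abs_spinor_L2 (\<lambda>x. - u x)"
  by (simp add: uminus_spinor_L2.abs_eq spinor_eq_refl)

lemma sq_integrable_diff:
  "u \<in> sq_integrable M \<Longrightarrow> v \<in> sq_integrable M \<Longrightarrow> (\<lambda>x. u x - v x) \<in> sq_integrable M"
  using sq_integrable_add[OF _ sq_integrable_intros(3), of u M v] by simp

lemma abs_spinor_diff:
  "u \<in> sq_integrable lebesgue \<Longrightarrow> v \<in> sq_integrable lebesgue \<Longrightarrow>
   abs_spinor_L2 u - abs_spinor_L2 v = abs_spinor_L2 (\<lambda>x. u x - v x)"
  by (simp add: minus_spinor_L2_def abs_spinor_uminus abs_spinor_add sq_integrable_intros)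

lemma abs_spinor_scaleR:
  "u \<in> sq_integrable lebesgue \<Longrightarrow> r *\<^sub>R abs_spinor_L2 u = abs_spinor_L2 (\<lambda>x. r *\<^sub>R u x)"
  by (simp add: scaleR_spinor_L2.abs_eq spinor_eq_refl)

lemma abs_spinor_scaleC:
  "u \<in> sq_integrable lebesgue \<Longrightarrow> scaleC_spinor c (abs_spinor_L2 u) = abs_spinor_L2 (\<lambda>x. c *s u x)"
  by (simp add: scaleC_spinor.abs_eq spinor_eq_refl)

lemma abs_spinor_inner:
  "u \<in> sq_integrable lebesgue \<Longrightarrow> v \<in> sq_integrable lebesgue \<Longrightarrow>
   abs_spinor_L2 u \<bullet> abs_spinor_L2 v = (LINT x|lebesgue. u x \<bullet> v x)"
  by (simp add: inner_spinor_L2.abs_eq spinor_eq_refl)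

lemma abs_spinor_norm:
  "u \<in> sq_integrable lebesgue \<Longrightarrow> (norm (abs_spinor_L2 u))\<^sup>2 = (LINT x|lebesgue. (norm (u x))\<^sup>2)"
  by (simp add: power2_norm_eq_inner abs_spinor_inner)

lemma abs_spinor_norm_ennreal:
  assumes "u \<in> sq_integrable lebesgue"
  shows "ennreal ((norm (abs_spinor_L2 u))\<^sup>2) = (\<integral>\<^sup>+x. ennreal ((norm (u x))\<^sup>2) \<partial>lebesgue)"
  unfolding abs_spinor_norm[OF assms] using assms
  by (subst nn_integral_eq_integral) (auto simp: sq_integrable_def)

text \<open>Riesz-Fischer: a rapidly converging subsequence converges almost everywhere, Fatou's
  lemma turns this into convergence in norm, and a Cauchy sequence follows its subsequence.\<close>

lemma spinor_Cauchy_convergent: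
  fixes X :: "nat \<Rightarrow> spinor_L2"
  assumes X: "Cauchy X" shows "convergent X"
proof -
  have "\<exists>N. \<forall>m\<ge>N. \<forall>n\<ge>N. norm (X m - X n) < (1/4) ^ k" for k :: nat
    using X by (intro CauchyD) auto
  then obtain N where N: "\<And>k m n. N k \<le> m \<Longrightarrow> N k \<le> n \<Longrightarrow> norm (X m - X n) < (1/4) ^ k" by metis
  \<comment> \<open>A sum, so that \<open>M k\<close> dominates \<open>N j\<close> for all
    \<open>j \<le> k\<close>.\<close>
  define M where "M k = (\<Sum>i\<le>k. N i)" for k
  have MN: "N j \<le> M k" if "j \<le> k" for j k unfolding M_def using that by (intro member_le_sum) auto
  define u where "u k = rep_spinor_L2 (X (M k))" for k
  have u: "u k \<in> sq_integrable lebesgue" for k unfolding u_def by (rule rep_spinor_sq_integrable)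
  have um [measurable]: "u k \<in> borel_measurable lebesgue" for k using u by (simp add: sq_integrable_def)
  have Xu: "X (M k) = abs_spinor_L2 (u k)" for k unfolding u_def by (simp add: abs_rep_spinor)
  have small: "(\<integral>\<^sup>+x. ennreal ((norm (u m x - u n x))\<^sup>2) \<partial>lebesgue) \<le> ennreal ((1/16) ^ k)" if "k \<le> m" "k \<le> n" for k m n
  proof -
    have "(\<integral>\<^sup>+x. ennreal ((norm (u m x - u n x))\<^sup>2) \<partial>lebesgue) = ennreal ((norm (X (M m) - X (M n)))\<^sup>2)"
      unfolding Xu by (simp add: abs_spinor_diff u abs_spinor_norm_ennreal sq_integrable_diff)
    also have "(norm (X (M m) - X (M n)))\<^sup>2 \<le> ((1/4) ^ k)\<^sup>2"
      using N[OF MN[OF that(1)] MN[OF that(2)]] by (intro power_mono) auto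
    also have "((1/4::real) ^ k)\<^sup>2 = (1/16) ^ k"
      by (simp add: power2_eq_square power_mult_distrib[symmetric])
    finally show ?thesis by (simp add: ennreal_leI)
  qed
  \<comment> \<open>The integral of \<open>w n\<close> is at most \<open>(1/16) ^ n\<close>.
    Weighting with \<open>4 ^ n\<close> spends part of this decay: where the weighted sum is finite,
    the n-th step is at most a multiple of \<open>(1/2) ^ n\<close>.\<close>
  define w where "w n x = (norm (u (Suc n) x - u n x))\<^sup>2" for n x
  have [measurable]: "w n \<in> borel_measurable lebesgue" for n unfolding w_def by measurable
  have "(\<integral>\<^sup>+x. (\<Sum>n. ennreal (4 ^ n * w n x)) \<partial>lebesgue) = (\<Sum>n. \<integral>\<^sup>+x. ennreal (4 ^ n * w n x) \<partial>lebesgue)"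
    by (rule nn_integral_suminf) measurable
  also have "\<dots> \<le> (\<Sum>n. ennreal ((1/4) ^ n))"
  proof (intro suminf_le)
    fix n
    have "(\<integral>\<^sup>+x. ennreal (4 ^ n * w n x) \<partial>lebesgue) = ennreal (4 ^ n) * (\<integral>\<^sup>+x. ennreal (w n x) \<partial>lebesgue)"
      by (subst nn_integral_cmult[symmetric]) (auto simp: ennreal_mult w_def)
    also have "\<dots> \<le> ennreal (4 ^ n) * ennreal ((1/16) ^ n)"
      unfolding w_def by (intro mult_left_mono small) auto
    also have "\<dots> = ennreal ((1/4) ^ n)"
      by (simp add: ennreal_mult[symmetric] power_mult_distrib[symmetric])
    finally show "(\<integral>\<^sup>+x. ennreal (4 ^ n * w n x) \<partial>lebesgue) \<le> ennreal ((1/4) ^ n)" .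
  qed auto
  also have "\<dots> < \<infinity>"
    by (subst suminf_ennreal2) (auto intro: summable_geometric)
  finally have "AE x in lebesgue. (\<Sum>n. ennreal (4 ^ n * w n x)) \<noteq> \<infinity>"
    by (intro nn_integral_noteq_infinite) auto
  then have conv: "AE x in lebesgue. convergent (\<lambda>n. u n x)"
  proof eventually_elim
    case (elim x)
    then obtain T where T: "(\<Sum>n. ennreal (4 ^ n * w n x)) = ennreal T" "0 \<le> T"
      by (cases "\<Sum>n. ennreal (4 ^ n * w n x)") auto
    have "norm (u (Suc n) x - u n x) \<le> sqrt T * (1/2) ^ n" for n
    proof -
      have p24: "((2::real) ^ n)\<^sup>2 = 4 ^ n" by (simp add: power2_eq_square power_mult_distrib[symmetric])
      have "ennreal (4 ^ n * w n x) \<le> (\<Sum>n. ennreal (4 ^ n * w n x))"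
        using sum_le_suminf[of "\<lambda>n. ennreal (4 ^ n * w n x)" "{n}"] by simp
      then have "4 ^ n * w n x \<le> T" using T by simp
      then have "(2 ^ n * norm (u (Suc n) x - u n x))\<^sup>2 \<le> T"
        by (simp add: w_def power_mult_distrib p24)
      then have "2 ^ n * norm (u (Suc n) x - u n x) \<le> sqrt T"
        by (rule real_le_rsqrt)
      then show ?thesis by (simp add: power_one_over pos_le_divide_eq mult.commute)
    qed
    moreover have "summable (\<lambda>n. sqrt T * (1/2) ^ n)"
      by (intro summable_mult summable_geometric) simp
    ultimately have "summable (\<lambda>n. u (Suc n) x - u n x)"
      using summable_comparison_test'[of _ 0 "\<lambda>n. u (Suc n) x - u n x"] by blast
    then have "convergent (\<lambda>n. \<Sum>i<n. u (Suc i) x - u i x)" by (simp add: summable_iff_convergent)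
    then have "convergent (\<lambda>n. (u n x - u 0 x) + u 0 x)"
      using sum_lessThan_telescope[of "\<lambda>n. u n x"] by (intro convergent_add convergent_const) simp
    then show ?case by simp
  qed
  \<comment> \<open>On the null set without convergence \<open>lim\<close> is an unspecified value;
    only measurability matters there.\<close>
  define U where "U x = lim (\<lambda>n. u n x)" for x
  have [measurable]: "U \<in> borel_measurable lebesgue" unfolding U_def by measurable
  have close: "(\<integral>\<^sup>+x. ennreal ((norm (U x - u n x))\<^sup>2) \<partial>lebesgue) \<le> ennreal ((1/16) ^ n)" for n
  proof -
    have "(\<integral>\<^sup>+x. ennreal ((norm (U x - u n x))\<^sup>2) \<partial>lebesgue) \<le>
        (\<integral>\<^sup>+x. liminf (\<lambda>m. ennreal ((norm (u m x - u n x))\<^sup>2)) \<partial>lebesgue)"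
    proof (rule nn_integral_mono_AE)
      show "AE x in lebesgue. ennreal ((norm (U x - u n x))\<^sup>2) \<le> liminf (\<lambda>m. ennreal ((norm (u m x - u n x))\<^sup>2))"
        using conv
      proof eventually_elim
        case (elim x)
        then have "(\<lambda>m. u m x) \<longlonglongrightarrow> U x" by (simp add: U_def convergent_LIMSEQ_iff)
        then have "(\<lambda>m. ennreal ((norm (u m x - u n x))\<^sup>2)) \<longlonglongrightarrow> ennreal ((norm (U x - u n x))\<^sup>2)"
          by (intro tendsto_ennrealI tendsto_intros)
        from lim_imp_Liminf[OF sequentially_bot this] show ?case by simp
      qed
    qed
    also have "\<dots> \<le> liminf (\<lambda>m. \<integral>\<^sup>+x. ennreal ((norm (u m x - u n x))\<^sup>2) \<partial>lebesgue)"
      by (rule nn_integral_liminf) measurable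
    also have "\<dots> \<le> ennreal ((1/16) ^ n)"
    proof (rule Liminf_le)
      show "\<forall>\<^sub>F m in sequentially. (\<integral>\<^sup>+x. ennreal ((norm (u m x - u n x))\<^sup>2) \<partial>lebesgue) \<le> ennreal ((1/16) ^ n)"
        using small by (auto simp: eventually_sequentially intro!: exI[of _ n])
    qed simp
    finally show ?thesis .
  qed
  have diff_sq: "(\<lambda>x. U x - u n x) \<in> sq_integrable lebesgue" for n
    unfolding sq_integrable_def
    using le_less_trans[OF close[of n]] by (auto intro!: integrableI_bounded)
  have U: "U \<in> sq_integrable lebesgue"
    using sq_integrable_add[OF diff_sq[of 0] u[of 0]] by simp
  have XM: "norm (abs_spinor_L2 U - X (M n)) \<le> (1/4) ^ n" for n
  proof (rule power2_le_imp_le)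
    have "ennreal ((norm (abs_spinor_L2 U - X (M n)))\<^sup>2) \<le> ennreal ((1/16) ^ n)"
      unfolding Xu using close by (simp add: abs_spinor_diff U u abs_spinor_norm_ennreal diff_sq)
    then have "(norm (abs_spinor_L2 U - X (M n)))\<^sup>2 \<le> (1/16) ^ n" by simp
    also have "(1/16::real) ^ n = ((1/4) ^ n)\<^sup>2"
      by (simp add: power2_eq_square power_mult_distrib[symmetric])
    finally show "(norm (abs_spinor_L2 U - X (M n)))\<^sup>2 \<le> ((1/4) ^ n)\<^sup>2" .
  qed simp
  have "X \<longlonglongrightarrow> abs_spinor_L2 U"
  proof (rule LIMSEQ_I)
    fix r :: real assume r: "0 < r"
    obtain k where k: "(1/4::real) ^ k < r / 2"
      using real_arch_pow_inv[of "r / 2" "1/4"] r by auto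
    have "norm (X n - abs_spinor_L2 U) < r" if "M k \<le> n" for n
    proof -
      have "norm (X n - X (M k)) < (1/4) ^ k"
        using that MN[of k k] by (intro N) auto
      moreover have "norm (X (M k) - abs_spinor_L2 U) \<le> (1/4) ^ k"
        using XM[of k] by (simp add: norm_minus_commute)
      ultimately show ?thesis
        using norm_triangle_ineq[of "X n - X (M k)" "X (M k) - abs_spinor_L2 U"] k by simp
    qed
    then show "\<exists>no. \<forall>n\<ge>no. norm (X n - abs_spinor_L2 U) < r" by blast
  qed
  then show ?thesis by (rule convergentI)
qed

instance spinor_L2 :: complete_space
  by standard (rule spinor_Cauchy_convergent)

section \<open>Self-adjointness in an abstract Hilbert space\<close>

text \<open>Orthogonal projection by hand: a minimising sequence in \<open>V\<close> is Cauchy by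
  the parallelogram law, and the difference of \<open>f\<close> and its limit is orthogonal to
  \<open>V\<close>.\<close>

lemma dense_if_orthogonal_trivial:
  fixes V :: "'a::{real_inner, complete_space} set"
  assumes V: "subspace V" and triv: "\<And>g. (\<And>v. v \<in> V \<Longrightarrow> v \<bullet> g = 0) \<Longrightarrow> g = 0"
  shows "closure V = UNIV"
proof (intro equalityI subset_UNIV subsetI)
  fix f :: 'a
  have ne: "V \<noteq> {}" using subspace_0[OF V] by auto
  define d where "d = infdist f V"
  have d0: "0 \<le> d" unfolding d_def by (rule infdist_nonneg)
  have dle: "d \<le> norm (f - v)" if "v \<in> V" for v
    using infdist_le[OF that, of f] by (simp add: d_def dist_norm)
  have "\<exists>v\<in>V. norm (f - v) < d + inverse (real (Suc n))" for n
  proof (rule ccontr)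
    assume "\<not> ?thesis"
    then have "d + inverse (real (Suc n)) \<le> dist f v" if "v \<in> V" for v
      using that by (force simp: dist_norm not_less)
    then have "d + inverse (real (Suc n)) \<le> infdist f V"
      unfolding infdist_notempty[OF ne] using ne by (intro cINF_greatest) auto
    then show False by (simp add: d_def)
  qed
  then obtain v where v: "\<And>n. v n \<in> V" "\<And>n. norm (f - v n) < d + inverse (real (Suc n))" by metis
  have par: "(norm (v m - v n))\<^sup>2 \<le> 2 * (norm (f - v m))\<^sup>2 + 2 * (norm (f - v n))\<^sup>2 - 4 * d\<^sup>2" for m n
  proof -
    have "(1/2) *\<^sub>R (v m + v n) \<in> V" by (intro subspace_scale subspace_add V v)
    from dle[OF this] have "d\<^sup>2 \<le> (norm (f - (1/2) *\<^sub>R (v m + v n)))\<^sup>2"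
      using d0 by (intro power_mono) auto
    moreover have "(norm (v m - v n))\<^sup>2 = 2 * (norm (f - v m))\<^sup>2 + 2 * (norm (f - v n))\<^sup>2 - 4 * (norm (f - (1/2) *\<^sub>R (v m + v n)))\<^sup>2"
      by (simp add: power2_norm_eq_inner inner_diff_left inner_diff_right inner_add_left inner_add_right inner_commute algebra_simps)
    ultimately show ?thesis by linarith
  qed
  have lim: "(\<lambda>n. d + inverse (real (Suc n))) \<longlonglongrightarrow> d + 0"
    by (intro tendsto_intros LIMSEQ_inverse_real_of_nat)
  have "Cauchy v"
  proof (rule CauchyI)
    fix e :: real assume e: "0 < e"
    have "(\<lambda>n. (d + inverse (real (Suc n)))\<^sup>2) \<longlonglongrightarrow> (d + 0)\<^sup>2" by (intro tendsto_power lim)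
    then have "\<forall>\<^sub>F n in sequentially. (d + inverse (real (Suc n)))\<^sup>2 < d\<^sup>2 + e\<^sup>2 / 4"
      using e by (intro order_tendstoD(2)) auto
    then obtain M where M: "\<And>n. M \<le> n \<Longrightarrow> (d + inverse (real (Suc n)))\<^sup>2 < d\<^sup>2 + e\<^sup>2 / 4"
      by (auto simp: eventually_sequentially)
    have s: "(norm (f - v n))\<^sup>2 < d\<^sup>2 + e\<^sup>2 / 4" if "M \<le> n" for n
    proof -
      have "(norm (f - v n))\<^sup>2 \<le> (d + inverse (real (Suc n)))\<^sup>2"
        using v(2)[of n] by (intro power_mono) auto
      with M[OF that] show ?thesis by linarith
    qed
    have "norm (v m - v n) < e" if "M \<le> m" "M \<le> n" for m n
    proof (rule power2_less_imp_less)
      show "(norm (v m - v n))\<^sup>2 < e\<^sup>2" using par[of m n] s[OF that(1)] s[OF that(2)] by linarith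
    qed (use e in simp)
    then show "\<exists>M. \<forall>m\<ge>M. \<forall>n\<ge>M. norm (v m - v n) < e" by blast
  qed
  then obtain p where p: "v \<longlonglongrightarrow> p" using Cauchy_convergent convergent_def by blast
  have pV: "p \<in> closure V" using p v(1) closure_sequential by blast
  have "(\<lambda>n. norm (f - v n)) \<longlonglongrightarrow> norm (f - p)" by (intro tendsto_intros p)
  then have np: "norm (f - p) \<le> d"
    by (rule LIMSEQ_le[OF _ lim[unfolded add_0_right]]) (use v(2) less_imp_le in blast)
  have "w \<bullet> (f - p) = 0" if w: "w \<in> V" for w
  proof -
    have "d \<le> norm (f - p - t *\<^sub>R w)" for t
    proof -
      have "(\<lambda>n. norm (f - (v n + t *\<^sub>R w))) \<longlonglongrightarrow> norm (f - (p + t *\<^sub>R w))"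
        by (intro tendsto_intros p)
      moreover have "d \<le> norm (f - (v n + t *\<^sub>R w))" for n
        by (intro dle subspace_add subspace_scale V v w)
      ultimately have "d \<le> norm (f - (p + t *\<^sub>R w))"
        by (intro LIMSEQ_le_const) auto
      then show ?thesis by (simp add: algebra_simps)
    qed
    then have "(norm (f - p))\<^sup>2 \<le> (norm (f - p - t *\<^sub>R w))\<^sup>2" for t
      using np by (intro power_mono) (auto intro: order_trans)
    moreover have "(norm (e - t *\<^sub>R w))\<^sup>2 = (norm e)\<^sup>2 + (t\<^sup>2 * (w \<bullet> w) - 2 * t * (w \<bullet> e))" for e t
      unfolding power2_norm_eq_inner inner_diff_left inner_diff_right
      by (simp add: inner_commute power2_eq_square algebra_simps)
    ultimately have quad: "0 \<le> t\<^sup>2 * (w \<bullet> w) - 2 * t * (w \<bullet> (f - p))" for t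
      by (metis add_le_cancel_left add.right_neutral)
    show ?thesis
    proof (cases "w = 0")
      case False
      then have w0: "0 < w \<bullet> w" by simp
      \<comment> \<open>The minimiser of the quadratic in \<open>t\<close>.\<close>
      from quad[of "(w \<bullet> (f - p)) / (w \<bullet> w)"] w0
      have "0 \<le> - ((w \<bullet> (f - p))\<^sup>2 / (w \<bullet> w))" by (simp add: power2_eq_square field_simps)
      moreover have "0 \<le> (w \<bullet> (f - p))\<^sup>2 / (w \<bullet> w)" by simp
      ultimately have "(w \<bullet> (f - p))\<^sup>2 / (w \<bullet> w) = 0" by linarith
      with False show ?thesis by simp
    qed simp
  qed
  then have "f - p = 0" by (rule triv)
  with pV show "f \<in> closure V" by simp
qed

lemma Cauchy_dominated:
  fixes x :: "nat \<Rightarrow> 'a::real_normed_vector" and p :: "nat \<Rightarrow> 'b::real_normed_vector"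
  assumes p: "Cauchy p" and le: "\<And>m n. norm (x m - x n) \<le> C * norm (p m - p n)" and C: "0 < C"
  shows "Cauchy x"
proof (rule CauchyI)
  fix e :: real assume "0 < e"
  then have "0 < e / C" using C by simp
  from CauchyD[OF p this] obtain M where M: "\<forall>m\<ge>M. \<forall>n\<ge>M. norm (p m - p n) < e / C" ..
  have "norm (x m - x n) < e" if "M \<le> m" "M \<le> n" for m n
  proof -
    have "C * norm (p m - p n) < e" using M that C by (simp add: pos_less_divide_eq mult.commute)
    with le[of m n] show ?thesis by linarith
  qed
  then show "\<exists>M. \<forall>m\<ge>M. \<forall>n\<ge>M. norm (x m - x n) < e" by blast
qed

text \<open>\<Gamma> is the graph of a symmetric operator and \<open>J\<close> is multiplication by
  the imaginary unit: complex linearity becomes invariance under \<open>J\<close>, and the inner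
  product may stay real. \<open>kernel\<close> says that the operator shifted by \<plusminus> i has
  dense range, the criterion for essential self-adjointness.\<close>

locale symmetric_core =
  fixes \<Gamma> :: "('a::{real_inner, complete_space} \<times> 'a) set" and J :: "'a \<Rightarrow> 'a"
  assumes subspace: "subspace \<Gamma>"
    and J_linear: "linear J" and J_inner: "\<And>x y. J x \<bullet> J y = x \<bullet> y" and J_J: "\<And>x. J (J x) = - x"
    and J_core: "\<And>x y. (x, y) \<in> \<Gamma> \<Longrightarrow> (J x, J y) \<in> \<Gamma>"
    and sym: "\<And>x y x' y'. (x, y) \<in> \<Gamma> \<Longrightarrow> (x', y') \<in> \<Gamma> \<Longrightarrow> y \<bullet> x' = x \<bullet> y'"
    and dense: "\<And>g. (\<And>x y. (x, y) \<in> \<Gamma> \<Longrightarrow> x \<bullet> g = 0) \<Longrightarrow> g = 0"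
    and kernel: "\<And>s g. s = 1 \<or> s = - 1 \<Longrightarrow> (\<And>x y. (x, y) \<in> \<Gamma> \<Longrightarrow> (y + s *\<^sub>R J x) \<bullet> g = 0) \<Longrightarrow> g = 0"
begin

text \<open>The graph of the adjoint. The real inner product suffices to define it because \<Gamma>
  is invariant under \<open>J\<close>.\<close>

definition W :: "('a \<times> 'a) set" where
  "W = {(u, F). \<forall>x y. (x, y) \<in> \<Gamma> \<longrightarrow> y \<bullet> u = x \<bullet> F}"

lemma J_skew: "J x \<bullet> y = - (x \<bullet> J y)"
  using J_inner[of x "J y"] J_J[of y] by simp

lemma J_self: "x \<bullet> J x = 0" "J x \<bullet> x = 0"
  using J_skew[of x x] by (simp_all add: inner_commute)

lemma norm_J: "norm (J x) = norm x"
  by (simp add: norm_eq_sqrt_inner J_inner)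

lemma J_bounded_linear: "bounded_linear J"
  using J_linear norm_J
  by (intro bounded_linear_intro[where K = 1]) (auto simp: linear_add linear_scale)

lemma core_W: "\<Gamma> \<subseteq> W"
  using sym by (auto simp: W_def)

lemma W_add: "(u, F) \<in> W \<Longrightarrow> (v, G) \<in> W \<Longrightarrow> (u + v, F + G) \<in> W"
  by (simp add: W_def inner_add_right)

lemma W_diff: "(u, F) \<in> W \<Longrightarrow> (v, G) \<in> W \<Longrightarrow> (u - v, F - G) \<in> W"
  by (simp add: W_def inner_diff_right)

lemma W_scale: "(u, F) \<in> W \<Longrightarrow> (r *\<^sub>R u, r *\<^sub>R F) \<in> W"
  by (simp add: W_def)

lemma W_J:
  assumes "(u, F) \<in> W" shows "(J u, J F) \<in> W"
  unfolding W_def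
proof clarify
  fix x y assume "(x, y) \<in> \<Gamma>"
  then have "J y \<bullet> u = J x \<bullet> F" using assms J_core by (auto simp: W_def)
  then show "y \<bullet> J u = x \<bullet> J F" using J_skew[of y u] J_skew[of x F] by simp
qed

lemma W_unique: "(u, F) \<in> W \<Longrightarrow> (u, F') \<in> W \<Longrightarrow> F = F'"
  using dense[of "F - F'"] by (auto simp: W_def inner_diff_right)

lemma W_limit:
  assumes "\<And>n. (x n, y n) \<in> W" "x \<longlonglongrightarrow> u" "y \<longlonglongrightarrow> F"
  shows "(u, F) \<in> W"
  unfolding W_def
proof (clarify)
  fix a b assume ab: "(a, b) \<in> \<Gamma>"
  have "(\<lambda>n. b \<bullet> x n) \<longlonglongrightarrow> b \<bullet> u" "(\<lambda>n. a \<bullet> y n) \<longlonglongrightarrow> a \<bullet> F"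
    using assms by (auto intro!: tendsto_intros)
  moreover have "b \<bullet> x n = a \<bullet> y n" for n using assms(1)[of n] ab by (auto simp: W_def)
  ultimately show "b \<bullet> u = a \<bullet> F" using LIMSEQ_unique by simp
qed

text \<open>A symmetric operator has a real quadratic form; in real terms, the image is orthogonal
  to \<open>J x\<close>. Hence the squared norm of \<open>y - J x\<close> is the squared graph
  norm.\<close>

lemma core_orthogonal: "(x, y) \<in> \<Gamma> \<Longrightarrow> y \<bullet> J x = 0"
  using sym[OF _ J_core, of x y x y] J_skew[of x y] by (simp add: inner_commute)

lemma subspace_range:
  assumes "linear (\<lambda>p. L p)" shows "subspace (L ` \<Gamma>)"
  by (rule linear_subspace_image[OF assms subspace])

text \<open>The adjoint is the closure of \<Gamma>. Dense range lets \<open>F - J u\<close> be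
  approximated by values \<open>y - J x\<close> on the core; orthogonality makes \<open>x\<close>
  and \<open>y\<close> converge separately, to some \<open>(u', F')\<close> in \<open>W\<close> with
  the same difference. Then \<open>u - u'\<close> is orthogonal to the range with the opposite sign
  and vanishes.\<close>

lemma W_core:
  assumes uF: "(u, F) \<in> W"
  obtains x y where "\<And>n. (x n, y n) \<in> \<Gamma>" "x \<longlonglongrightarrow> u" "y \<longlonglongrightarrow> F"
proof -
  interpret J: bounded_linear J by (rule J_bounded_linear)
  let ?L = "\<lambda>p. snd p - J (fst p)"
  have "subspace (?L ` \<Gamma>)"
    by (intro subspace_range linearI) (auto simp: J.add J.scaleR algebra_simps)
  then have "closure (?L ` \<Gamma>) = UNIV"
  proof (rule dense_if_orthogonal_trivial)
    fix g assume g: "\<And>v. v \<in> ?L ` \<Gamma> \<Longrightarrow> v \<bullet> g = 0"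
    show "g = 0"
    proof (rule kernel[of "- 1"])
      fix x y assume "(x, y) \<in> \<Gamma>"
      then have "?L (x, y) \<in> ?L ` \<Gamma>" by (rule imageI)
      from g[OF this] show "(y + - 1 *\<^sub>R J x) \<bullet> g = 0" by simp
    qed simp
  qed
  then have "F - J u \<in> closure (?L ` \<Gamma>)" by simp
  then obtain p where p: "\<And>n. p n \<in> ?L ` \<Gamma>" "p \<longlonglongrightarrow> F - J u"
    unfolding closure_sequential by blast
  from p(1) have "\<forall>n. \<exists>q. q \<in> \<Gamma> \<and> p n = ?L q" by blast
  then obtain q where q: "\<And>n. q n \<in> \<Gamma>" "\<And>n. p n = ?L (q n)" by metis
  define x where "x n = fst (q n)" for n
  define y where "y n = snd (q n)" for n
  have xy: "(x n, y n) \<in> \<Gamma>" "p n = y n - J (x n)" for n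
    using q[of n] by (auto simp: x_def y_def)
  have diff: "(x m - x n, y m - y n) \<in> \<Gamma>" for m n
    using subspace_diff[OF subspace xy(1)[of m] xy(1)[of n]] by simp
  have nrm: "(norm (y m - y n))\<^sup>2 + (norm (x m - x n))\<^sup>2 = (norm (p m - p n))\<^sup>2" for m n
  proof -
    let ?a = "y m - y n" and ?b = "J (x m - x n)"
    have e: "p m - p n = ?a - ?b" by (simp add: xy J.diff)
    have "?a \<bullet> ?b = 0" by (rule core_orthogonal[OF diff])
    then have "(norm (?a - ?b))\<^sup>2 = (norm ?a)\<^sup>2 + (norm ?b)\<^sup>2"
      by (simp add: power2_norm_eq_inner inner_diff_left inner_diff_right inner_commute)
    then show ?thesis by (simp add: e norm_J)
  qed
  have Cp: "Cauchy p" using p(2) LIMSEQ_imp_Cauchy by blast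
  have le: "norm (x m - x n) \<le> norm (p m - p n)" "norm (y m - y n) \<le> norm (p m - p n)" for m n
  proof -
    have "(norm (x m - x n))\<^sup>2 \<le> (norm (p m - p n))\<^sup>2" "(norm (y m - y n))\<^sup>2 \<le> (norm (p m - p n))\<^sup>2"
      using nrm[of m n] zero_le_power2[of "norm (x m - x n)"] zero_le_power2[of "norm (y m - y n)"]
      by linarith+
    then show "norm (x m - x n) \<le> norm (p m - p n)" "norm (y m - y n) \<le> norm (p m - p n)"
      by (auto dest: power2_le_imp_le)
  qed
  have "Cauchy x" "Cauchy y"
    by (rule Cauchy_dominated[OF Cp, of _ 1]; simp add: le)+
  then obtain u' F' where l: "x \<longlonglongrightarrow> u'" "y \<longlonglongrightarrow> F'"
    using Cauchy_convergent[of x] Cauchy_convergent[of y] unfolding convergent_def by auto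
  have W': "(u', F') \<in> W" by (rule W_limit[OF _ l]) (use xy core_W in auto)
  have "(\<lambda>n. y n - J (x n)) \<longlonglongrightarrow> F' - J u'" by (intro tendsto_intros J.tendsto l)
  then have "p \<longlonglongrightarrow> F' - J u'" using xy(2) by presburger
  then have eq: "F - J u = F' - J u'" using p(2) LIMSEQ_unique by blast
  have uu: "u - u' = 0"
  proof (rule kernel[of 1])
    fix a b assume ab: "(a, b) \<in> \<Gamma>"
    have "F - F' = J (u - u')" using eq by (simp add: J.diff algebra_simps)
    moreover have "b \<bullet> (u - u') = a \<bullet> (F - F')" using W_diff[OF uF W'] ab by (simp add: W_def)
    ultimately show "(b + 1 *\<^sub>R J a) \<bullet> (u - u') = 0" using J_skew[of a "u - u'"] by (simp add: inner_add_left)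
  qed simp
  with eq have "u' = u" "F' = F" by auto
  with l xy that show thesis by blast
qed

lemma W_sym:
  assumes "(u, F) \<in> W" "(v, G) \<in> W" shows "F \<bullet> v = u \<bullet> G"
proof -
  obtain x y where xy: "\<And>n. (x n, y n) \<in> \<Gamma>" "x \<longlonglongrightarrow> u" "y \<longlonglongrightarrow> F"
    by (rule W_core[OF assms(1)]) (rule that)
  have "(\<lambda>n. y n \<bullet> v) \<longlonglongrightarrow> F \<bullet> v" "(\<lambda>n. x n \<bullet> G) \<longlonglongrightarrow> u \<bullet> G"
    using xy by (auto intro!: tendsto_intros)
  moreover have "y n \<bullet> v = x n \<bullet> G" for n using assms(2) xy(1)[of n] by (auto simp: W_def)
  ultimately show ?thesis using LIMSEQ_unique by simp
qed

text \<open>For \<open>(u, F)\<close> in \<open>W\<close> this is \<open>(T + B - a - b J) u\<close>, where \<open>T\<close> is the adjoint of the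
  operator with graph \<open>\<Gamma>\<close>, so that \<open>T u = F\<close>.\<close>

definition shifted :: "('a \<Rightarrow> 'a) \<Rightarrow> real \<Rightarrow> real \<Rightarrow> 'a \<Rightarrow> 'a \<Rightarrow> 'a" where
  "shifted B a b u F = F + B u - a *\<^sub>R u - b *\<^sub>R J u"

text \<open>Passing to the adjoint conjugates the shift a + i b, hence \<open>- b\<close>.\<close>

lemma shifted_sym:
  assumes "\<And>x y. B x \<bullet> y = x \<bullet> B y" "(u, F) \<in> W" "(v, G) \<in> W"
  shows "shifted B a b u F \<bullet> v = u \<bullet> shifted B a (- b) v G"
  using W_sym[OF assms(2,3)] assms(1)[of u v] J_skew[of u v]
  by (simp add: shifted_def inner_diff_left inner_diff_right inner_add_left inner_add_right)

text \<open>In the inner product with \<open>J u\<close> all symmetric terms drop out, and only the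
  imaginary part \<open>b\<close> of the shift remains.\<close>

lemma shifted_bound:
  assumes B: "\<And>x y. B x \<bullet> y = x \<bullet> B y" "\<And>x. B (J x) = J (B x)" and uF: "(u, F) \<in> W"
  shows "\<bar>b\<bar> * norm u \<le> norm (shifted B a b u F)"
proof -
  have "F \<bullet> J u = u \<bullet> J F" by (rule W_sym[OF uF W_J[OF uF]])
  then have 1: "F \<bullet> J u = 0" using J_skew[of u F] by (simp add: inner_commute)
  have "B u \<bullet> J u = u \<bullet> J (B u)" by (simp add: B)
  then have 2: "B u \<bullet> J u = 0" using J_skew[of u "B u"] by (simp add: inner_commute)
  have "shifted B a b u F \<bullet> J u = - b * (u \<bullet> u)"
    using 1 2 J_self[of u] by (simp add: shifted_def inner_diff_left inner_add_left J_inner)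
  then have "\<bar>b\<bar> * (norm u)\<^sup>2 = \<bar>shifted B a b u F \<bullet> J u\<bar>"
    by (simp add: abs_mult power2_norm_eq_inner)
  also have "\<dots> \<le> norm (shifted B a b u F) * norm u"
    using Cauchy_Schwarz_ineq2[of "shifted B a b u F" "J u"] by (simp add: norm_J)
  finally have "\<bar>b\<bar> * norm u * norm u \<le> norm (shifted B a b u F) * norm u"
    by (simp add: power2_eq_square)
  then show ?thesis by (cases "u = 0") auto
qed

text \<open>The lower bound makes the range closed. It is dense because a vector orthogonal to it
  solves the homogeneous equation with the conjugate shift, to which the same lower bound
  applies.\<close>

lemma shifted_surj:
  assumes B: "bounded_linear B" "\<And>x y. B x \<bullet> y = x \<bullet> B y" "\<And>x. B (J x) = J (B x)" and b: "b \<noteq> 0"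
  obtains u F where "(u, F) \<in> W" "shifted B a b u F = f"
proof -
  interpret J: bounded_linear J by (rule J_bounded_linear)
  interpret B: bounded_linear B by (rule B(1))
  let ?L = "\<lambda>p. shifted B a b (fst p) (snd p)"
  have lin: "linear ?L"
    by (intro linearI) (auto simp: shifted_def J.add J.scaleR B.add B.scaleR algebra_simps)
  have "subspace (?L ` \<Gamma>)" by (rule subspace_range[OF lin])
  then have "closure (?L ` \<Gamma>) = UNIV"
  proof (rule dense_if_orthogonal_trivial)
    fix g assume g: "\<And>v. v \<in> ?L ` \<Gamma> \<Longrightarrow> v \<bullet> g = 0"
    \<comment> \<open>Chosen so that the operator shifted with \<open>- b\<close> annihilates
      \<open>g\<close>.\<close>
    let ?G = "- B g + a *\<^sub>R g - b *\<^sub>R J g"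
    have "(g, ?G) \<in> W"
      unfolding W_def
    proof clarify
      fix x y assume "(x, y) \<in> \<Gamma>"
      then have "?L (x, y) \<in> ?L ` \<Gamma>" by (rule imageI)
      from g[OF this] show "y \<bullet> g = x \<bullet> ?G"
        using B(2)[of x g] J_skew[of x g]
        by (simp add: shifted_def inner_diff_left inner_add_left inner_diff_right inner_add_right) 
    qed
    from shifted_bound[OF B(2,3) this, of "- b" a] b show "g = 0" by (simp add: shifted_def mult_le_0_iff)
  qed
  then have "f \<in> closure (?L ` \<Gamma>)" by simp
  then obtain p where p: "\<And>n. p n \<in> ?L ` \<Gamma>" "p \<longlonglongrightarrow> f"
    unfolding closure_sequential by blast
  from p(1) have "\<forall>n. \<exists>q. q \<in> \<Gamma> \<and> p n = ?L q" by blast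
  then obtain q where q: "\<And>n. q n \<in> \<Gamma>" "\<And>n. p n = ?L (q n)" by metis
  define x where "x n = fst (q n)" for n
  define y where "y n = snd (q n)" for n
  have xy: "(x n, y n) \<in> W" "p n = shifted B a b (x n) (y n)" for n
    using q[of n] core_W by (auto simp: x_def y_def)
  have le: "norm (x m - x n) \<le> norm (p m - p n) / \<bar>b\<bar>" for m n
  proof -
    have "p m - p n = shifted B a b (x m - x n) (y m - y n)"
      by (simp add: xy shifted_def J.diff B.diff algebra_simps)
    with shifted_bound[OF B(2,3) W_diff[OF xy(1)[of m] xy(1)[of n]], of b a] b
    show ?thesis by (simp add: field_simps)
  qed
  have "Cauchy x"
    by (rule Cauchy_dominated[OF LIMSEQ_imp_Cauchy[OF p(2)], of _ "1 / \<bar>b\<bar>"]) (use le b in auto)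
  then obtain u where u: "x \<longlonglongrightarrow> u"
    using Cauchy_convergent[of x] unfolding convergent_def by auto
  have "(\<lambda>n. p n - B (x n) + a *\<^sub>R x n + b *\<^sub>R J (x n)) \<longlonglongrightarrow> f - B u + a *\<^sub>R u + b *\<^sub>R J u"
    by (intro tendsto_intros J.tendsto B.tendsto u p)
  moreover have "(\<lambda>n. p n - B (x n) + a *\<^sub>R x n + b *\<^sub>R J (x n)) = y"
    by (auto simp: xy shifted_def)
  ultimately have "(u, f - B u + a *\<^sub>R u + b *\<^sub>R J u) \<in> W"
    using W_limit[OF xy(1) u] by simp
  then show thesis by (rule that) (simp add: shifted_def)
qed

end

lemma positive_form_Cauchy_Schwarz:
  fixes P :: "'a::real_inner \<Rightarrow> 'a"
  assumes P: "linear P" "\<And>x y. P x \<bullet> y = x \<bullet> P y" "\<And>x. 0 \<le> P x \<bullet> x"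
  shows "\<bar>P x \<bullet> y\<bar> \<le> sqrt (P x \<bullet> x) * sqrt (P y \<bullet> y)"
proof -
  have quad: "0 \<le> P x \<bullet> x + 2 * t * (P x \<bullet> y) + t\<^sup>2 * (P y \<bullet> y)" for t
  proof -
    have "P (x + t *\<^sub>R y) \<bullet> (x + t *\<^sub>R y) = P x \<bullet> x + 2 * t * (P x \<bullet> y) + t\<^sup>2 * (P y \<bullet> y)"
      using P(2)[of y x]
      by (simp add: linear_add[OF P(1)] linear_scale[OF P(1)] inner_add_left inner_add_right
          inner_commute power2_eq_square algebra_simps)
    with P(3)[of "x + t *\<^sub>R y"] show ?thesis by simp
  qed
  have "(P x \<bullet> y)\<^sup>2 \<le> (P x \<bullet> x) * (P y \<bullet> y)"
  proof (cases "P y \<bullet> y = 0")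
    case True
    have "P x \<bullet> y = 0"
    proof (rule ccontr)
      assume "P x \<bullet> y \<noteq> 0"
      \<comment> \<open>In the degenerate case the quadratic is affine in \<open>t\<close>; this
        \<open>t\<close> gives the value -1.\<close>
      with quad[of "- (P x \<bullet> x + 1) / (2 * (P x \<bullet> y))"] True show False by (simp add: field_simps)
    qed
    then show ?thesis using True by simp
  next
    case False
    then have "0 < P y \<bullet> y" using P(3)[of y] by simp
    with quad[of "- (P x \<bullet> y) / (P y \<bullet> y)"] show ?thesis
      by (simp add: power2_eq_square field_simps)
  qed
  then have "sqrt ((P x \<bullet> y)\<^sup>2) \<le> sqrt ((P x \<bullet> x) * (P y \<bullet> y))" by (rule real_sqrt_le_mono)
  then show ?thesis by (simp add: real_sqrt_mult)
qed

lemma norm_add3_sq: "(norm (x + y + z :: 'a::real_inner))\<^sup>2 \<le> 3 * ((norm x)\<^sup>2 + (norm y)\<^sup>2 + (norm z)\<^sup>2)"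
proof -
  have "(norm (x + y + z))\<^sup>2 \<le> (norm x + norm y + norm z)\<^sup>2"
    using norm_triangle_ineq[of "x + y" z] norm_triangle_ineq[of x y] by (intro power_mono) auto
  also have "\<dots> \<le> 3 * ((norm x)\<^sup>2 + (norm y)\<^sup>2 + (norm z)\<^sup>2)"
    using sum_squares_bound[of "norm x" "norm y"] sum_squares_bound[of "norm x" "norm z"]
      sum_squares_bound[of "norm y" "norm z"]
    by (simp add: power2_eq_square algebra_simps)
  finally show ?thesis .
qed

section \<open>The resolvent estimate in an abstract Hilbert space\<close>

text \<open>In the application \<open>P\<close> is multiplication by the mass density,
  \<open>S\<close> is \<sigma>3, \<kappa> bounds the density, \<theta> is
  \<open>\<epsilon>\<^sup>2 * L\<close> with the logarithm \<open>L\<close>, and \<delta> is a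
  multiple of \<open>\<epsilon>\<^sup>2 / d\<close>. The two inequalities are asked on the core
  only; as \<open>P\<close> and \<open>S\<close> are bounded, \<open>W_core\<close> extends them to
  \<open>W\<close>.\<close>

locale perturbed_core = symmetric_core \<Gamma> J
  for \<Gamma> :: "('a::{real_inner, complete_space} \<times> 'a) set" and J +
  fixes P S :: "'a \<Rightarrow> 'a" and m A \<kappa> \<theta> \<delta> :: real
  assumes P: "bounded_linear P" "\<And>x y. P x \<bullet> y = x \<bullet> P y" "\<And>x. P (J x) = J (P x)" "\<And>x. 0 \<le> P x \<bullet> x"
    and S: "bounded_linear S" "\<And>x y. S x \<bullet> y = x \<bullet> S y" "\<And>x. S (J x) = J (S x)" "\<And>x. norm (S x) = norm x"
    and PS: "\<And>x. P (S x) = S (P x)"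
    and m: "0 < m" and nonneg: "0 \<le> A" "0 \<le> \<kappa>" "0 \<le> \<theta>" "0 \<le> \<delta>"
    and P_norm: "\<And>x. (norm (P x))\<^sup>2 \<le> \<kappa> * (P x \<bullet> x)"
    and form_bound_core: "\<And>x y. (x, y) \<in> \<Gamma> \<Longrightarrow> P x \<bullet> x \<le> A * ((norm x)\<^sup>2 + \<theta> * (norm y)\<^sup>2)"
    and averaging_core: "\<And>x y x' y'. (x, y) \<in> \<Gamma> \<Longrightarrow> (x', y') \<in> \<Gamma> \<Longrightarrow>
      \<bar>(S (P x) - m *\<^sub>R S x) \<bullet> x'\<bar> \<le> \<delta> * (norm x + norm y) * (norm x' + norm y')"
begin

lemma form_bound:
  assumes "(u, F) \<in> W" shows "P u \<bullet> u \<le> A * ((norm u)\<^sup>2 + \<theta> * (norm F)\<^sup>2)"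
proof -
  interpret P: bounded_linear P by (rule P)
  obtain x y where xy: "\<And>n. (x n, y n) \<in> \<Gamma>" "x \<longlonglongrightarrow> u" "y \<longlonglongrightarrow> F"
    by (rule W_core[OF assms]) (rule that)
  have "(\<lambda>n. P (x n) \<bullet> x n) \<longlonglongrightarrow> P u \<bullet> u" by (intro tendsto_intros P.tendsto xy)
  moreover have "(\<lambda>n. A * ((norm (x n))\<^sup>2 + \<theta> * (norm (y n))\<^sup>2)) \<longlonglongrightarrow> A * ((norm u)\<^sup>2 + \<theta> * (norm F)\<^sup>2)"
    by (intro tendsto_intros xy)
  ultimately show ?thesis by (rule LIMSEQ_le) (use form_bound_core xy(1) in blast)
qed

lemma averaging:
  assumes "(u, F) \<in> W" "(v, G) \<in> W"
  shows "\<bar>(S (P u) - m *\<^sub>R S u) \<bullet> v\<bar> \<le> \<delta> * (norm u + norm F) * (norm v + norm G)"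
proof -
  interpret P: bounded_linear P by (rule P)
  interpret S: bounded_linear S by (rule S)
  obtain x y where xy: "\<And>n. (x n, y n) \<in> \<Gamma>" "x \<longlonglongrightarrow> u" "y \<longlonglongrightarrow> F"
    by (rule W_core[OF assms(1)]) (rule that)
  obtain x' y' where xy': "\<And>n. (x' n, y' n) \<in> \<Gamma>" "x' \<longlonglongrightarrow> v" "y' \<longlonglongrightarrow> G"
    by (rule W_core[OF assms(2)]) (rule that)
  have "(\<lambda>n. \<bar>(S (P (x n)) - m *\<^sub>R S (x n)) \<bullet> x' n\<bar>) \<longlonglongrightarrow> \<bar>(S (P u) - m *\<^sub>R S u) \<bullet> v\<bar>"
    by (intro tendsto_intros P.tendsto S.tendsto xy xy')
  moreover have "(\<lambda>n. \<delta> * (norm (x n) + norm (y n)) * (norm (x' n) + norm (y' n))) \<longlonglongrightarrow>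
      \<delta> * (norm u + norm F) * (norm v + norm G)"
    by (intro tendsto_intros xy xy')
  ultimately show ?thesis by (rule LIMSEQ_le) (use averaging_core xy(1) xy'(1) in blast)
qed

lemma S_S: "S x \<bullet> S y = x \<bullet> y"
proof -
  interpret S: bounded_linear S by (rule S)
  have "(norm (S (x + y)))\<^sup>2 = (norm (x + y))\<^sup>2" "(norm (S x))\<^sup>2 = (norm x)\<^sup>2" "(norm (S y))\<^sup>2 = (norm y)\<^sup>2"
    by (simp_all add: S)
  then show ?thesis
    by (simp add: S.add power2_norm_eq_inner inner_add_left inner_add_right inner_commute)
qed

lemma mS: "bounded_linear (\<lambda>x. m *\<^sub>R S x)" "(m *\<^sub>R S x) \<bullet> y = x \<bullet> (m *\<^sub>R S y)" "m *\<^sub>R S (J x) = J (m *\<^sub>R S x)"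
proof -
  interpret J: bounded_linear J by (rule J_bounded_linear)
  show "bounded_linear (\<lambda>x. m *\<^sub>R S x)" by (rule bounded_linear_compose[OF bounded_linear_scaleR_right S(1)])
  show "(m *\<^sub>R S x) \<bullet> y = x \<bullet> (m *\<^sub>R S y)" "m *\<^sub>R S (J x) = J (m *\<^sub>R S x)"
    using S by (simp_all add: J.scaleR)
qed

lemma SP: "bounded_linear (\<lambda>x. S (P x))" "S (P x) \<bullet> y = x \<bullet> S (P y)" "S (P (J x)) = J (S (P x))"
proof -
  show "bounded_linear (\<lambda>x. S (P x))" by (rule bounded_linear_compose[OF S(1) P(1)])
  show "S (P x) \<bullet> y = x \<bullet> S (P y)" by (simp add: P S PS[symmetric])
  show "S (P (J x)) = J (S (P x))" by (simp add: P S)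
qed

text \<open>Bound of the constant-mass resolvent into the graph norm:
  \<open>1 / \<bar>b\<bar>\<close> for the solution itself, the rest for its image, which the
  equation expresses by the solution and the data.\<close>

definition resolvent_const :: "real \<Rightarrow> real \<Rightarrow> real" where
  "resolvent_const a b = 1 / \<bar>b\<bar> + 1 + (m + \<bar>a\<bar> + \<bar>b\<bar>) * (1 / \<bar>b\<bar>)"

lemma free_bound:
  assumes "(u, F) \<in> W" "b \<noteq> 0"
  shows "norm u + norm F \<le> resolvent_const a b * norm (shifted (\<lambda>x. m *\<^sub>R S x) a b u F)"
proof -
  let ?f = "shifted (\<lambda>x. m *\<^sub>R S x) a b u F"
  have u: "norm u \<le> 1 / \<bar>b\<bar> * norm ?f"
    using shifted_bound[OF mS(2,3) assms(1), of b a] assms(2) by (simp add: field_simps)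
  have "F = ?f - m *\<^sub>R S u + a *\<^sub>R u + b *\<^sub>R J u" by (simp add: shifted_def)
  then have "norm F = norm (?f - m *\<^sub>R S u + a *\<^sub>R u + b *\<^sub>R J u)" by (rule arg_cong)
  also have "\<dots> \<le> norm ?f + norm (m *\<^sub>R S u) + norm (a *\<^sub>R u) + norm (b *\<^sub>R J u)"
    using norm_triangle_ineq[of "?f - m *\<^sub>R S u + a *\<^sub>R u" "b *\<^sub>R J u"]
      norm_triangle_ineq[of "?f - m *\<^sub>R S u" "a *\<^sub>R u"] norm_triangle_ineq4[of ?f "m *\<^sub>R S u"] by linarith
  also have "\<dots> = norm ?f + (m + \<bar>a\<bar> + \<bar>b\<bar>) * norm u"
    using m by (simp add: S norm_J algebra_simps)
  also have "\<dots> \<le> norm ?f + (m + \<bar>a\<bar> + \<bar>b\<bar>) * (1 / \<bar>b\<bar> * norm ?f)"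
    using m by (intro add_left_mono mult_left_mono u) auto
  finally have F: "norm F \<le> norm ?f + (m + \<bar>a\<bar> + \<bar>b\<bar>) * (1 / \<bar>b\<bar> * norm ?f)" .
  have eq: "(r + 1 + s * r) * t = r * t + (t + s * (r * t))" for r s t :: real
    by (simp add: algebra_simps)
  show ?thesis unfolding resolvent_const_def eq using u F by (rule add_mono)
qed

text \<open>The two conditions on \<theta> have different tasks.
  \<open>\<theta> \<le> \<eta>\<^sup>2\<close> makes terms bounded in norm small, while
  \<open>\<theta> * \<kappa> \<le> k * \<eta>\<^sup>2\<close> trades a squared norm of
  \<open>P x\<close> for the form at \<open>x\<close>. \<open>small\<close> then lets the form at
  \<open>v\<close> be absorbed into its own bound.\<close>

lemma resolvent_difference:
  fixes a b k A' \<eta> :: real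
  assumes b: "b \<noteq> 0" and \<eta>: "0 < \<eta>" "\<eta> \<le> 1" and \<theta>: "\<theta> \<le> \<eta>\<^sup>2" "\<theta> * \<kappa> \<le> k * \<eta>\<^sup>2" and \<delta>: "\<delta> \<le> A' * \<eta>"
    and small: "3 * A * k * \<eta>\<^sup>2 \<le> 1 / 2" and k: "0 \<le> k" "0 \<le> A'"
    and u: "(u, F) \<in> W" "shifted (\<lambda>x. m *\<^sub>R S x) a b u F = f"
    and u': "(u', F') \<in> W" "shifted (\<lambda>x. S (P x)) a b u' F' = f"
  defines "n \<equiv> m + \<bar>a\<bar> + \<bar>b\<bar>" and "\<beta> \<equiv> 1 / \<bar>b\<bar>" and "c \<equiv> resolvent_const a b"
  shows "norm (u' - u) \<le> (A' * c\<^sup>2 * (1 + m * \<beta>) +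
     sqrt (A * (A'\<^sup>2 * c ^ 4 + 3 * (k * A * c\<^sup>2 + m\<^sup>2 * c\<^sup>2 + n\<^sup>2 * A'\<^sup>2 * c ^ 4))) *
     sqrt (2 * A * (\<beta>\<^sup>2 + 3 + 3 * n\<^sup>2 * \<beta>\<^sup>2))) * \<eta> * norm f"
proof -
  interpret J: bounded_linear J by (rule J_bounded_linear)
  interpret P: bounded_linear P by (rule P)
  interpret S: bounded_linear S by (rule S)
  let ?q = "\<lambda>x. P x \<bullet> x"
  have n: "0 \<le> n" "m \<le> n" using m by (auto simp: n_def)
  have \<beta>: "0 \<le> \<beta>" by (simp add: \<beta>_def)
  have c: "0 \<le> c" using m by (simp add: c_def resolvent_const_def)
  have \<eta>2: "\<eta>\<^sup>2 \<le> 1" using \<eta> by (simp add: power_le_one)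
  have l1: "\<theta> \<le> 1" using \<theta> \<eta>2 by linarith
  have uF: "norm u + norm F \<le> c * norm f" using free_bound[OF u(1) b, of a] u(2) by (simp add: c_def)
  have nu: "norm u \<le> c * norm f" "norm F \<le> c * norm f"
    using uF norm_ge_zero[of u] norm_ge_zero[of F] by linarith+
  have nu2: "(norm u)\<^sup>2 \<le> c\<^sup>2 * (norm f)\<^sup>2"
    using power_mono[OF nu(1), of 2] by (simp add: power_mult_distrib)
  \<comment> \<open>Up to sign, the defect of \<open>u\<close> in the perturbed equation;
    \<open>y\<close> is its image under the constant-mass resolvent.\<close>
  define h where "h = S (P u) - m *\<^sub>R S u"
  obtain y Y where y: "(y, Y) \<in> W" "shifted (\<lambda>x. m *\<^sub>R S x) a b y Y = h"
    by (rule shifted_surj[OF mS b, of a h]) (rule that)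
  \<comment> \<open>The dual element: the square of \<open>norm y\<close> equals
    \<open>h \<bullet> w\<close>, so averaging is applied to \<open>u\<close> and \<open>w\<close>,
    whose graph norms are bounded by their data.\<close>
  obtain w V0 where w: "(w, V0) \<in> W" "shifted (\<lambda>x. m *\<^sub>R S x) a (- b) w V0 = y"
    by (rule shifted_surj[OF mS, of "- b" a y]) (use b in simp, rule that)
  have ny: "norm y \<le> \<delta> * c\<^sup>2 * norm f"
  proof -
    have "(norm y)\<^sup>2 = y \<bullet> shifted (\<lambda>x. m *\<^sub>R S x) a (- b) w V0" by (simp add: w power2_norm_eq_inner)
    also have "\<dots> = h \<bullet> w" using shifted_sym[OF mS(2) y(1) w(1), of a b] by (simp add: y)
    also have "\<dots> \<le> \<delta> * (norm u + norm F) * (norm w + norm V0)"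
      using averaging[OF u(1) w(1)] by (simp add: h_def)
    also have "\<dots> \<le> \<delta> * (c * norm f) * (c * norm y)"
    proof (intro mult_mono uF order_refl)
      show "norm w + norm V0 \<le> c * norm y"
        using free_bound[OF w(1), of "- b" a] b by (simp add: w c_def resolvent_const_def)
    qed (use nonneg c in auto)
    finally have "norm y * norm y \<le> (\<delta> * c\<^sup>2 * norm f) * norm y" by (simp add: power2_eq_square algebra_simps)
    then show ?thesis using nonneg by (cases "y = 0") auto
  qed
  then have ny': "norm y \<le> A' * \<eta> * c\<^sup>2 * norm f"
    using \<delta> by (rule_tac order_trans[OF _ mult_right_mono[OF mult_right_mono[OF \<delta>]]]) auto
  have ny2: "(norm y)\<^sup>2 \<le> A'\<^sup>2 * c ^ 4 * \<eta>\<^sup>2 * (norm f)\<^sup>2"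
    using power_mono[OF ny', of 2] by (simp add: power_mult_distrib power_mult[symmetric] mult_ac)
  have qu: "?q u \<le> A * c\<^sup>2 * (norm f)\<^sup>2"
  proof -
    have "?q u \<le> A * ((norm u)\<^sup>2 + \<theta> * (norm F)\<^sup>2)" by (rule form_bound[OF u(1)])
    also have "\<dots> \<le> A * ((norm u)\<^sup>2 + 1 * (norm F)\<^sup>2)"
      using nonneg l1 by (intro mult_left_mono add_left_mono mult_right_mono) auto
    also have "\<dots> \<le> A * (norm u + norm F)\<^sup>2"
      using nonneg by (intro mult_left_mono) (auto simp: power2_eq_square algebra_simps)
    also have "\<dots> \<le> A * (c * norm f)\<^sup>2"
      using nonneg uF by (intro mult_left_mono power_mono) auto
    finally show ?thesis by (simp add: power_mult_distrib algebra_simps)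
  qed
  \<comment> \<open>This is where a gradient is exchanged for the form: in the equations the image
    under the free operator contains \<open>S (P x)\<close>, and \<theta> is the factor that a
    squared gradient carries.\<close>
  have lkq: "\<theta> * (norm (P x))\<^sup>2 \<le> k * \<eta>\<^sup>2 * ?q x" for x
  proof -
    have "\<theta> * (norm (P x))\<^sup>2 \<le> \<theta> * (\<kappa> * ?q x)" using nonneg P_norm by (intro mult_left_mono) auto
    also have "\<dots> \<le> k * \<eta>\<^sup>2 * ?q x" using mult_right_mono[OF \<theta>(2) P(4)[of x]] by (simp add: mult.assoc)
    finally show ?thesis .
  qed
  have lin: "norm (a *\<^sub>R x + b *\<^sub>R J x - m *\<^sub>R S x) \<le> n * norm x"
      "norm (a *\<^sub>R x + b' *\<^sub>R J x) \<le> n * norm x" if "\<bar>b'\<bar> = \<bar>b\<bar>" for x b'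
  proof -
    have 1: "norm (a *\<^sub>R x + b' *\<^sub>R J x) \<le> \<bar>a\<bar> * norm x + \<bar>b\<bar> * norm x" if "\<bar>b'\<bar> = \<bar>b\<bar>" for b'
      using norm_triangle_ineq[of "a *\<^sub>R x" "b' *\<^sub>R J x"] that by (simp add: norm_J)
    have "norm (m *\<^sub>R S x) = m * norm x" using m by (simp add: S)
    then show "norm (a *\<^sub>R x + b *\<^sub>R J x - m *\<^sub>R S x) \<le> n * norm x"
      using norm_triangle_ineq4[of "a *\<^sub>R x + b *\<^sub>R J x" "m *\<^sub>R S x"] 1[OF refl]
      by (simp add: n_def algebra_simps)
    have "0 \<le> m * norm x" using m by simp
    then show "norm (a *\<^sub>R x + b' *\<^sub>R J x) \<le> n * norm x"
      using 1[OF that] by (simp add: n_def algebra_simps)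
  qed
  \<comment> \<open>\<open>Y\<close> contains \<open>S (P u)\<close>, which is controlled only after
    multiplication with \<theta>; that is exactly how \<open>Y\<close> enters the form bound for
    \<open>y\<close>.\<close>
  have lY: "\<theta> * (norm Y)\<^sup>2 \<le> 3 * (k * A * c\<^sup>2 + m\<^sup>2 * c\<^sup>2 + n\<^sup>2 * A'\<^sup>2 * c ^ 4) * \<eta>\<^sup>2 * (norm f)\<^sup>2"
  proof -
    have "Y = S (P u) + - (m *\<^sub>R S u) + (a *\<^sub>R y + b *\<^sub>R J y - m *\<^sub>R S y)"
      using y(2) by (simp add: shifted_def h_def algebra_simps)
    then have "(norm Y)\<^sup>2 \<le> 3 * ((norm (S (P u)))\<^sup>2 + (norm (- (m *\<^sub>R S u)))\<^sup>2 + (norm (a *\<^sub>R y + b *\<^sub>R J y - m *\<^sub>R S y))\<^sup>2)"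
      using norm_add3_sq by metis
    also have "\<dots> \<le> 3 * ((norm (P u))\<^sup>2 + m\<^sup>2 * (norm u)\<^sup>2 + (n * norm y)\<^sup>2)"
      using lin(1)[OF refl, of y] m by (intro mult_left_mono add_mono power_mono) (auto simp: S power_mult_distrib)
    finally have "\<theta> * (norm Y)\<^sup>2 \<le> \<theta> * (3 * ((norm (P u))\<^sup>2 + m\<^sup>2 * (norm u)\<^sup>2 + (n * norm y)\<^sup>2))"
      using nonneg by (intro mult_left_mono)
    also have "\<dots> = 3 * (\<theta> * (norm (P u))\<^sup>2 + \<theta> * (m\<^sup>2 * (norm u)\<^sup>2) + n\<^sup>2 * (\<theta> * (norm y)\<^sup>2))"
      by (simp add: power_mult_distrib algebra_simps)
    also have "\<dots> \<le> 3 * (k * \<eta>\<^sup>2 * (A * c\<^sup>2 * (norm f)\<^sup>2) + \<eta>\<^sup>2 * (m\<^sup>2 * (c\<^sup>2 * (norm f)\<^sup>2)) + n\<^sup>2 * (1 * (A'\<^sup>2 * c ^ 4 * \<eta>\<^sup>2 * (norm f)\<^sup>2)))"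
    proof (intro mult_left_mono add_mono)
      show "\<theta> * (norm (P u))\<^sup>2 \<le> k * \<eta>\<^sup>2 * (A * c\<^sup>2 * (norm f)\<^sup>2)"
        using lkq[of u] mult_left_mono[OF qu, of "k * \<eta>\<^sup>2"] k by simp
      show "\<theta> * (m\<^sup>2 * (norm u)\<^sup>2) \<le> \<eta>\<^sup>2 * (m\<^sup>2 * (c\<^sup>2 * (norm f)\<^sup>2))"
        by (intro mult_mono \<theta> mult_left_mono nu2) auto
      show "\<theta> * (norm y)\<^sup>2 \<le> 1 * (A'\<^sup>2 * c ^ 4 * \<eta>\<^sup>2 * (norm f)\<^sup>2)"
        by (intro mult_mono l1 ny2) auto
    qed auto
    finally show ?thesis by (simp add: algebra_simps)
  qed
  define c2 where "c2 = A * (A'\<^sup>2 * c ^ 4 + 3 * (k * A * c\<^sup>2 + m\<^sup>2 * c\<^sup>2 + n\<^sup>2 * A'\<^sup>2 * c ^ 4))"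
  define c3 where "c3 = 2 * A * (\<beta>\<^sup>2 + 3 + 3 * n\<^sup>2 * \<beta>\<^sup>2)"
  have nn: "0 \<le> c2" "0 \<le> c3" using nonneg k by (auto simp: c2_def c3_def)
  have qy: "?q y \<le> c2 * (\<eta>\<^sup>2 * (norm f)\<^sup>2)"
  proof -
    have "?q y \<le> A * ((norm y)\<^sup>2 + \<theta> * (norm Y)\<^sup>2)" by (rule form_bound[OF y(1)])
    also have "\<dots> \<le> A * (A'\<^sup>2 * c ^ 4 * \<eta>\<^sup>2 * (norm f)\<^sup>2 + 3 * (k * A * c\<^sup>2 + m\<^sup>2 * c\<^sup>2 + n\<^sup>2 * A'\<^sup>2 * c ^ 4) * \<eta>\<^sup>2 * (norm f)\<^sup>2)"
      using nonneg by (intro mult_left_mono add_mono ny2 lY)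
    finally show ?thesis by (simp add: c2_def algebra_simps)
  qed
  define g where "g = u' - u"
  \<comment> \<open>The adjoint perturbed problem with the difference \<open>g\<close> itself as
    data, so that pairing yields the square of \<open>norm g\<close>.\<close>
  obtain v V where v: "(v, V) \<in> W" "shifted (\<lambda>x. S (P x)) a (- b) v V = g"
    by (rule shifted_surj[OF SP, of "- b" a g]) (use b in simp, rule that)
  have nv: "norm v \<le> \<beta> * norm g"
    using shifted_bound[OF SP(2,3) v(1), of "- b" a] b by (simp add: v \<beta>_def field_simps)
  have nv2: "(norm v)\<^sup>2 \<le> \<beta>\<^sup>2 * (norm g)\<^sup>2"
    using power_mono[OF nv, of 2] by (simp add: power_mult_distrib)
  have qv: "?q v \<le> c3 * (norm g)\<^sup>2"
  proof -
    have "V = g + - S (P v) + (a *\<^sub>R v + (- b) *\<^sub>R J v)"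
      using v(2) by (simp add: shifted_def algebra_simps)
    then have "(norm V)\<^sup>2 \<le> 3 * ((norm g)\<^sup>2 + (norm (- S (P v)))\<^sup>2 + (norm (a *\<^sub>R v + (- b) *\<^sub>R J v))\<^sup>2)"
      using norm_add3_sq by metis
    also have "\<dots> \<le> 3 * ((norm g)\<^sup>2 + (norm (P v))\<^sup>2 + (n * norm v)\<^sup>2)"
      using lin(2)[of "- b" v] by (intro mult_left_mono add_mono power_mono) (auto simp: S)
    finally have "\<theta> * (norm V)\<^sup>2 \<le> \<theta> * (3 * ((norm g)\<^sup>2 + (norm (P v))\<^sup>2 + (n * norm v)\<^sup>2))"
      using nonneg by (intro mult_left_mono)
    also have "\<dots> = 3 * (\<theta> * (norm g)\<^sup>2 + \<theta> * (norm (P v))\<^sup>2 + n\<^sup>2 * (\<theta> * (norm v)\<^sup>2))"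
      by (simp add: power_mult_distrib algebra_simps)
    also have "\<dots> \<le> 3 * (1 * (norm g)\<^sup>2 + k * \<eta>\<^sup>2 * ?q v + n\<^sup>2 * (1 * (\<beta>\<^sup>2 * (norm g)\<^sup>2)))"
      by (intro mult_left_mono add_mono lkq mult_mono l1 nv2 order_refl) auto
    finally have lV: "\<theta> * (norm V)\<^sup>2 \<le> 3 * (1 * (norm g)\<^sup>2 + k * \<eta>\<^sup>2 * ?q v + n\<^sup>2 * (1 * (\<beta>\<^sup>2 * (norm g)\<^sup>2)))" .
    have "?q v \<le> A * ((norm v)\<^sup>2 + \<theta> * (norm V)\<^sup>2)" by (rule form_bound[OF v(1)])
    also have "\<dots> \<le> A * (\<beta>\<^sup>2 * (norm g)\<^sup>2 + 3 * (1 * (norm g)\<^sup>2 + k * \<eta>\<^sup>2 * ?q v + n\<^sup>2 * (1 * (\<beta>\<^sup>2 * (norm g)\<^sup>2))))"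
      using nonneg by (intro mult_left_mono add_mono nv2 lV)
    also have "\<dots> = c3 * (norm g)\<^sup>2 / 2 + (3 * A * k * \<eta>\<^sup>2) * ?q v"
      by (simp add: c3_def algebra_simps)
    \<comment> \<open>The form at \<open>v\<close> reappears with a factor at most 1/2 and is
      absorbed on the left; hence the factor 2 in \<open>c3\<close>.\<close>
    also have "\<dots> \<le> c3 * (norm g)\<^sup>2 / 2 + 1 / 2 * ?q v"
      by (intro add_left_mono mult_right_mono small P)
    finally show ?thesis by simp
  qed
  have "(norm g)\<^sup>2 = g \<bullet> shifted (\<lambda>x. S (P x)) a (- b) v V" by (simp add: v power2_norm_eq_inner)
  also have "\<dots> = shifted (\<lambda>x. S (P x)) a b (u' - u) (F' - F) \<bullet> v"
    using shifted_sym[OF SP(2) W_diff[OF u'(1) u(1)] v(1), of a b] by (simp add: g_def)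
  also have "shifted (\<lambda>x. S (P x)) a b (u' - u) (F' - F) = f - shifted (\<lambda>x. S (P x)) a b u F"
    unfolding u'(2)[symmetric] by (simp add: shifted_def J.diff P.diff S.diff algebra_simps)
  also have "f - shifted (\<lambda>x. S (P x)) a b u F = - h"
    unfolding u(2)[symmetric] by (simp add: shifted_def h_def)
  \<comment> \<open>The second resolvent identity: the constant-mass operator leaves
    \<open>y\<close> and acts on \<open>v\<close>, where the perturbed equation replaces it by
    \<open>g\<close> and a zeroth-order difference.\<close>
  also have "- h \<bullet> v = - (shifted (\<lambda>x. m *\<^sub>R S x) a b y Y \<bullet> v)" by (simp add: y)
  also have "\<dots> = - (y \<bullet> shifted (\<lambda>x. m *\<^sub>R S x) a (- b) v V)"
    using shifted_sym[OF mS(2) y(1) v(1), of a b] by simp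
  also have "shifted (\<lambda>x. m *\<^sub>R S x) a (- b) v V = g - S (P v) + m *\<^sub>R S v"
    unfolding v(2)[symmetric] by (simp add: shifted_def)
  also have "- (y \<bullet> (g - S (P v) + m *\<^sub>R S v)) = - (y \<bullet> g) + P (S y) \<bullet> v - m * (y \<bullet> S v)"
    using P(2)[of "S y" v] S(2)[of y "P v"] by (simp add: inner_diff_right inner_add_right)
  also have "\<dots> \<le> norm y * norm g + sqrt c2 * \<eta> * norm f * (sqrt c3 * norm g) + m * (norm y * (\<beta> * norm g))"
  proof -
    have 1: "- (y \<bullet> g) \<le> norm y * norm g" using Cauchy_Schwarz_ineq2[of y g] by linarith
    \<comment> \<open>Cauchy-Schwarz for the form keeps \<open>v\<close> inside it. The factor
      \<eta> comes from the form at \<open>y\<close>, while that at \<open>v\<close> is merely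
      bounded.\<close>
    have "\<bar>P (S y) \<bullet> v\<bar> \<le> sqrt (?q (S y)) * sqrt (?q v)"
      by (rule positive_form_Cauchy_Schwarz[OF P.linear P(2) P(4)])
    also have "?q (S y) = ?q y" by (simp add: PS S_S)
    also have "sqrt (?q y) * sqrt (?q v) \<le> sqrt (c2 * (\<eta>\<^sup>2 * (norm f)\<^sup>2)) * sqrt (c3 * (norm g)\<^sup>2)"
      using P(4) qy qv nn by (intro mult_mono real_sqrt_le_mono) auto
    also have "\<dots> = sqrt c2 * \<eta> * norm f * (sqrt c3 * norm g)"
      using \<eta> by (simp add: real_sqrt_mult)
    finally have 2: "P (S y) \<bullet> v \<le> sqrt c2 * \<eta> * norm f * (sqrt c3 * norm g)" by linarith
    have "- (y \<bullet> S v) \<le> norm y * norm v" using Cauchy_Schwarz_ineq2[of y "S v"] by (simp add: S)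
    also have "\<dots> \<le> norm y * (\<beta> * norm g)" by (intro mult_left_mono nv) auto
    finally have "- (y \<bullet> S v) \<le> norm y * (\<beta> * norm g)" .
    from mult_left_mono[OF this, of m] m 1 2 show ?thesis by simp
  qed
  also have "\<dots> = (norm y * (1 + m * \<beta>) + sqrt c2 * sqrt c3 * \<eta> * norm f) * norm g"
    by (simp add: algebra_simps)
  finally have "norm g * norm g \<le> (norm y * (1 + m * \<beta>) + sqrt c2 * sqrt c3 * \<eta> * norm f) * norm g"
    by (simp add: power2_eq_square)
  then have "norm g \<le> norm y * (1 + m * \<beta>) + sqrt c2 * sqrt c3 * \<eta> * norm f \<or> norm g = 0"
    by (cases "g = 0") auto
  then have "norm g \<le> norm y * (1 + m * \<beta>) + sqrt c2 * sqrt c3 * \<eta> * norm f"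
    using \<eta> m \<beta> nn by auto
  also have "\<dots> \<le> A' * \<eta> * c\<^sup>2 * norm f * (1 + m * \<beta>) + sqrt c2 * sqrt c3 * \<eta> * norm f"
    using m \<beta> by (intro add_right_mono mult_right_mono ny') auto
  finally show ?thesis by (simp add: g_def c2_def c3_def algebra_simps)
qed

end

section \<open>The free Dirac operator\<close>

text \<open>The matrices - i \<sigma>1 and - i \<sigma>2. They are skew for the real inner product,
  have square -1 and anticommute, which makes the first-order operator symmetric with square minus
  the Laplacian.\<close>

definition dirac_coeff :: "2 \<Rightarrow> complex^2 \<Rightarrow> complex^2" where
  "dirac_coeff j v = - (\<i> *s ((if j = 1 then sigma1 else sigma2) *v v))"

lemmas spinor_simps = vec_eq_iff forall_2 matrix_vector_mult_def sum_2 vector_2 sigma1_def sigma2_def sigma3_def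
  inner_vec_def inner_complex_def dirac_coeff_def

lemma sigma3_inner: "(sigma3 *v v) \<bullet> w = v \<bullet> (sigma3 *v w)"
  by (simp add: spinor_simps)

lemma sigma3_norm: "norm (sigma3 *v v) = norm v"
  by (simp add: norm_eq_sqrt_inner spinor_simps)

lemma sigma3_scaleC: "sigma3 *v (c *s v) = c *s (sigma3 *v v)"
  by (simp add: spinor_simps)

lemma bounded_linear_complex_vec:
  fixes f :: "complex^2 \<Rightarrow> complex^2"
  assumes "\<And>x y. f (x + y) = f x + f y" "\<And>r x. f (r *\<^sub>R x) = r *\<^sub>R f x"
  shows "bounded_linear f"
  unfolding linear_conv_bounded_linear[symmetric] by (rule linearI) fact+

lemma sigma3_linear: "bounded_linear (\<lambda>v::complex^2. sigma3 *v v)"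
  by (rule bounded_linear_complex_vec) (simp_all add: spinor_simps)

lemma dirac_coeff_linear: "bounded_linear (dirac_coeff j)"
  using exhaust_2[of j]
  by (intro bounded_linear_complex_vec) (auto simp: spinor_simps algebra_simps)

lemma dirac_coeff_skew: "dirac_coeff j v \<bullet> w = - (v \<bullet> dirac_coeff j w)"
  using exhaust_2[of j] by (auto simp: spinor_simps)

lemma dirac_coeff_square: "dirac_coeff j (dirac_coeff j v) = - v"
  using exhaust_2[of j] by (auto simp: spinor_simps)

lemma dirac_coeff_anticommute: "dirac_coeff 2 (dirac_coeff 1 v) = - dirac_coeff 1 (dirac_coeff 2 v)"
  by (auto simp: spinor_simps)

lemma dirac_coeff_scaleC: "dirac_coeff j (c *s v) = c *s dirac_coeff j v"
  using exhaust_2[of j] by (auto simp: spinor_simps algebra_simps)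

lemma scaleC_inner: "(\<i> *s v) \<bullet> (\<i> *s w) = (v :: complex^2) \<bullet> w"
  by (simp add: spinor_simps)

lemma scaleC_scaleC: "\<i> *s (\<i> *s v) = - (v :: complex^2)"
  by (simp add: spinor_simps)

lemma AE_euclidean_eqI:
  fixes f g :: "'a \<Rightarrow> 'b::euclidean_space"
  assumes "\<And>e. e \<in> Basis \<Longrightarrow> AE x in M. e \<bullet> f x = e \<bullet> g x" shows "AE x in M. f x = g x"
proof -
  have "AE x in M. \<forall>e\<in>Basis. e \<bullet> f x = e \<bullet> g x"
    using assms by (intro AE_ball_countable') (auto simp: countable_finite)
  then show ?thesis
  proof eventually_elim
    case (elim x)
    show ?case by (rule euclidean_eqI) (metis elim inner_commute)
  qed
qed

lemma lebesgue_integral_cc: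
  fixes f :: "real^2 \<Rightarrow> 'b::euclidean_space"
  shows "cc_smooth f \<Longrightarrow> (LINT x|lebesgue. f x) = (LINT x|lborel. f x)"
  using cc_smooth_measurable[of f] by (intro integral_completion) simp

lemma integration_by_parts_inner:
  fixes f g :: "real^2 \<Rightarrow> 'b::euclidean_space"
  assumes "cc_smooth f" "cc_smooth g"
  shows "(LINT x|lebesgue. pd i f x \<bullet> g x) = - (LINT x|lebesgue. f x \<bullet> pd i g x)"
  using integration_by_parts[OF bounded_bilinear_inner assms, of i] assms
  by (subst (1 2) lebesgue_integral_cc)
    (auto intro!: cc_smooth_bilinear1[OF bounded_bilinear_inner] cc_smooth_pd dest: cc_smooth_imp_smooth smooth_pd)

lemma cc_smooth_scale_const:
  fixes e :: "'b::euclidean_space"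
  assumes "cc_smooth \<psi>" shows "cc_smooth (\<lambda>x. \<psi> x *\<^sub>R e)"
  by (rule cc_smooth_linear[OF bounded_linear_scaleR_left assms])

lemma pd_scale_const:
  fixes e :: "'b::euclidean_space"
  assumes "smooth \<psi>" shows "pd i (\<lambda>x. \<psi> x *\<^sub>R e) = (\<lambda>x. pd i \<psi> x *\<^sub>R e)"
  using assms by (auto intro!: pd_linear[OF bounded_linear_scaleR_left] smooth_differentiable)

lemma cc_smooth_inner_integrable:
  fixes f g :: "real^2 \<Rightarrow> 'b::euclidean_space"
  assumes "cc_smooth f" "g \<in> sq_integrable lebesgue"
  shows "integrable lebesgue (\<lambda>x. f x \<bullet> g x)"
  by (rule integrable_inner_sq_integrable[OF cc_smooth_sq_integrable[OF assms(1)] assms(2)])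

section \<open>Commuting mixed partial derivatives\<close>

lemma pd_product:
  fixes p q p' q' :: "real \<Rightarrow> real"
  assumes p: "\<And>t. (p has_real_derivative p' t) (at t)" and q: "\<And>t. (q has_real_derivative q' t) (at t)"
  shows "pd 1 (\<lambda>x. p (x $ 1) * q (x $ 2)) = (\<lambda>x. p' (x $ 1) * q (x $ 2))"
    and "pd 2 (\<lambda>x. p (x $ 1) * q (x $ 2)) = (\<lambda>x. p (x $ 1) * q' (x $ 2))"
proof -
  have nth: "((\<lambda>x::real^2. x $ i) has_derivative (\<lambda>h. h $ i)) (at x)" for i x
    by (rule bounded_linear.has_derivative[OF bounded_linear_vec_nth has_derivative_ident])
  have "((\<lambda>x. p (x $ 1) * q (x $ 2)) has_derivative
      (\<lambda>h. p (x $ 1) * (q' (x $ 2) * h $ 2) + (p' (x $ 1) * h $ 1) * q (x $ 2))) (at x)" for x :: "real^2"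
    using has_derivative_compose[OF nth p[unfolded has_field_derivative_def]]
      has_derivative_compose[OF nth q[unfolded has_field_derivative_def]]
    by (rule has_derivative_mult)
  from pd_eqI[OF this]
  show "pd 1 (\<lambda>x. p (x $ 1) * q (x $ 2)) = (\<lambda>x. p' (x $ 1) * q (x $ 2))"
    and "pd 2 (\<lambda>x. p (x $ 1) * q (x $ 2)) = (\<lambda>x. p (x $ 1) * q' (x $ 2))"
    by (simp_all add: fun_eq_iff axis_def)
qed

lemma mixed_partials_bump: "pd 1 (pd 2 (box_bump a b s)) = pd 2 (pd 1 (box_bump a b s))"
proof -
  define Q :: "real poly" where "Q = [:0, 0, 1:] * (1 - pderiv 1)"
  define p where "p i t = flat_exp 1 (s * (t - a $ i)) * flat_exp 1 (s * (b $ i - t))" for i t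
  define p' where "p' i t = flat_exp Q (s * (t - a $ i)) * s * flat_exp 1 (s * (b $ i - t)) +
      flat_exp Q (s * (b $ i - t)) * - s * flat_exp 1 (s * (t - a $ i))" for i t
  have d: "((\<lambda>t. flat_exp R (s * (t - c))) has_real_derivative
        flat_exp ([:0, 0, 1:] * (R - pderiv R)) (s * (t - c)) * s) (at t)"
      "((\<lambda>t. flat_exp R (s * (c - t))) has_real_derivative
        flat_exp ([:0, 0, 1:] * (R - pderiv R)) (s * (c - t)) * - s) (at t)" for R c t
  proof -
    have e: "((\<lambda>t. s * (t - c)) has_real_derivative s) (at t)" "((\<lambda>t. s * (c - t)) has_real_derivative - s) (at t)"
      by (auto intro!: derivative_eq_intros)
    show "((\<lambda>t. flat_exp R (s * (t - c))) has_real_derivative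
        flat_exp ([:0, 0, 1:] * (R - pderiv R)) (s * (t - c)) * s) (at t)"
      and "((\<lambda>t. flat_exp R (s * (c - t))) has_real_derivative
        flat_exp ([:0, 0, 1:] * (R - pderiv R)) (s * (c - t)) * - s) (at t)"
      by (rule DERIV_chain2[OF flat_exp_derivative e(1)], rule DERIV_chain2[OF flat_exp_derivative e(2)])
  qed
  have p: "(p i has_real_derivative p' i t) (at t)" for i t
    unfolding p_def p'_def Q_def by (rule DERIV_mult[OF d])
  have "\<exists>D. (p' i has_real_derivative D) (at t)" for i t
    unfolding p'_def
    by (rule exI, rule DERIV_add; rule DERIV_mult; (rule DERIV_mult)?; rule d DERIV_const)
  then obtain p'' where p': "\<And>i t. (p' i has_real_derivative p'' i t) (at t)" by metis
  have "box_bump a b s = (\<lambda>x. p 1 (x $ 1) * p 2 (x $ 2))"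
    by (simp add: fun_eq_iff box_bump_def p_def UNIV_2)
  then show ?thesis
    by (simp add: pd_product[OF p p] pd_product[OF p p'] pd_product[OF p' p])
qed

text \<open>Integration by parts moves both derivatives onto a bump, where their order is
  irrelevant. Equality almost everywhere is enough, as only integrals are compared later.\<close>

lemma mixed_partials_real:
  fixes f :: "real^2 \<Rightarrow> real"
  assumes f: "cc_smooth f" shows "AE x in lebesgue. pd 1 (pd 2 f) x = pd 2 (pd 1 f) x"
proof -
  have cc: "cc_smooth (pd i (pd j f))" for i j by (intro cc_smooth_pd f)
  have "AE x in lebesgue. pd 1 (pd 2 f) x - pd 2 (pd 1 f) x = 0"
  proof (rule fundamental_lemma_bump)
    show "(\<lambda>x. pd 1 (pd 2 f) x - pd 2 (pd 1 f) x) \<in> sq_integrable lebesgue"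
      by (intro sq_integrable_diff cc_smooth_sq_integrable cc)
    fix a b :: "real^2" and s :: real assume s: "0 < s"
    let ?b = "box_bump a b s"
    have b: "cc_smooth ?b" by (rule box_bump_cc_smooth[OF s])
    have "(LINT x|lebesgue. pd i (pd j f) x * ?b x) = (LINT x|lebesgue. f x * pd j (pd i ?b) x)" for i j
      using integration_by_parts_inner[OF cc_smooth_pd[OF f] b, of i j]
        integration_by_parts_inner[OF f cc_smooth_pd[OF b], of j i] by simp
    from this[of 1 2] this[of 2 1]
    have "(LINT x|lebesgue. pd 1 (pd 2 f) x * ?b x) = (LINT x|lebesgue. pd 2 (pd 1 f) x * ?b x)"
      by (simp add: mixed_partials_bump)
    moreover have "integrable lebesgue (\<lambda>x. pd i (pd j f) x * ?b x)" for i j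
      using cc_smooth_inner_integrable[OF cc cc_smooth_sq_integrable[OF b]] by simp
    ultimately show "(LINT x|lebesgue. ?b x * (pd 1 (pd 2 f) x - pd 2 (pd 1 f) x)) = 0"
      by (simp add: right_diff_distrib mult.commute)
  qed
  then show ?thesis by simp
qed

lemma mixed_partials:
  fixes f :: "real^2 \<Rightarrow> 'b::euclidean_space"
  assumes f: "cc_smooth f" shows "AE x in lebesgue. pd 1 (pd 2 f) x = pd 2 (pd 1 f) x"
proof (rule AE_euclidean_eqI)
  fix e :: 'b
  note sm = cc_smooth_imp_smooth[OF f]
  have "pd j (\<lambda>x. e \<bullet> g x) = (\<lambda>x. e \<bullet> pd j g x)" if "smooth g" for g :: "real^2 \<Rightarrow> 'b" and j
    using that by (auto intro!: pd_linear[OF bounded_linear_inner_right] smooth_differentiable)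
  from this[OF sm] this[OF smooth_pd[OF sm]]
  show "AE x in lebesgue. e \<bullet> pd 1 (pd 2 f) x = e \<bullet> pd 2 (pd 1 f) x"
    using mixed_partials_real[OF cc_smooth_linear[OF bounded_linear_inner_right f, of e]] by simp
qed

section \<open>The massless Dirac operator on test fields\<close>

definition dirac_field :: "(real^2 \<Rightarrow> complex^2) \<Rightarrow> real^2 \<Rightarrow> complex^2" where
  "dirac_field \<Phi> x = dirac_coeff 1 (pd 1 \<Phi> x) + dirac_coeff 2 (pd 2 \<Phi> x)"

lemma cc_smooth_dirac_field: "cc_smooth \<Phi> \<Longrightarrow> cc_smooth (dirac_field \<Phi>)"
  unfolding dirac_field_def[abs_def]
  by (intro cc_smooth_add cc_smooth_linear[OF dirac_coeff_linear] cc_smooth_pd)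

lemma dirac_field_add:
  assumes "smooth \<Phi>" "smooth \<Psi>"
  shows "dirac_field (\<lambda>x. \<Phi> x + \<Psi> x) = (\<lambda>x. dirac_field \<Phi> x + dirac_field \<Psi> x)"
proof -
  interpret D1: bounded_linear "dirac_coeff 1" by (rule dirac_coeff_linear)
  interpret D2: bounded_linear "dirac_coeff 2" by (rule dirac_coeff_linear)
  show ?thesis
    using assms by (simp add: fun_eq_iff dirac_field_def pd_add smooth_differentiable D1.add D2.add)
qed

lemma dirac_field_linear:
  assumes "smooth \<Phi>" "bounded_linear L" "\<And>j v. L (dirac_coeff j v) = dirac_coeff j (L v)"
  shows "dirac_field (\<lambda>x. L (\<Phi> x)) = (\<lambda>x. L (dirac_field \<Phi> x))"
proof -
  interpret L: bounded_linear L by fact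
  show ?thesis
    using assms by (simp add: fun_eq_iff dirac_field_def pd_linear smooth_differentiable L.add)
qed

lemma dirac_coeff_scaleR: "dirac_coeff j (r *\<^sub>R v) = r *\<^sub>R dirac_coeff j v"
  by (rule linear_scale[OF bounded_linear.linear[OF dirac_coeff_linear]])

lemma dirac_field_scaleR: "smooth \<Phi> \<Longrightarrow> dirac_field (\<lambda>x. r *\<^sub>R \<Phi> x) = (\<lambda>x. r *\<^sub>R dirac_field \<Phi> x)"
  by (rule dirac_field_linear) (auto simp: dirac_coeff_scaleR bounded_linear_scaleR_right)

lemma dirac_field_scaleC: "smooth \<Phi> \<Longrightarrow> dirac_field (\<lambda>x. c *s \<Phi> x) = (\<lambda>x. c *s dirac_field \<Phi> x)"
  by (rule dirac_field_linear) (auto simp: dirac_coeff_scaleC bounded_linear_vector_scalar_mult)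

lemma dirac_field_sym:
  assumes "cc_smooth \<Phi>" "cc_smooth \<Psi>"
  shows "(LINT x|lebesgue. dirac_field \<Phi> x \<bullet> \<Psi> x) = (LINT x|lebesgue. \<Phi> x \<bullet> dirac_field \<Psi> x)"
proof -
  have 1: "(LINT x|lebesgue. dirac_coeff j (pd j \<Phi> x) \<bullet> \<Psi> x) = (LINT x|lebesgue. \<Phi> x \<bullet> dirac_coeff j (pd j \<Psi> x))" for j
  proof -
    have "(LINT x|lebesgue. dirac_coeff j (pd j \<Phi> x) \<bullet> \<Psi> x) = - (LINT x|lebesgue. pd j \<Phi> x \<bullet> dirac_coeff j (\<Psi> x))"
      by (simp add: dirac_coeff_skew)
    also have "\<dots> = (LINT x|lebesgue. \<Phi> x \<bullet> pd j (\<lambda>x. dirac_coeff j (\<Psi> x)) x)"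
      by (subst integration_by_parts_inner) (auto intro: assms cc_smooth_linear[OF dirac_coeff_linear])
    also have "pd j (\<lambda>x. dirac_coeff j (\<Psi> x)) = (\<lambda>x. dirac_coeff j (pd j \<Psi> x))"
      using assms by (auto intro!: pd_linear[OF dirac_coeff_linear] smooth_differentiable cc_smooth_imp_smooth)
    finally show ?thesis .
  qed
  have i: "integrable lebesgue (\<lambda>x. dirac_coeff j (pd j \<Phi> x) \<bullet> \<Psi> x)" "integrable lebesgue (\<lambda>x. \<Phi> x \<bullet> dirac_coeff j (pd j \<Psi> x))" for j
    using assms by (auto intro!: cc_smooth_inner_integrable cc_smooth_sq_integrable cc_smooth_linear[OF dirac_coeff_linear] cc_smooth_pd)
  show ?thesis by (simp add: dirac_field_def inner_add_left inner_add_right i 1)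
qed

text \<open>The mixed terms cancel by anticommutation once the mixed partials agree; the diagonal
  terms get the sign from the squares of the matrices.\<close>

lemma dirac_field_square:
  assumes \<Phi>: "cc_smooth \<Phi>"
  shows "AE x in lebesgue. dirac_field (dirac_field \<Phi>) x = - (\<Sum>i\<in>UNIV. pd i (pd i \<Phi>) x)"
proof -
  interpret D1: bounded_linear "dirac_coeff 1" by (rule dirac_coeff_linear)
  interpret D2: bounded_linear "dirac_coeff 2" by (rule dirac_coeff_linear)
  note sm = cc_smooth_imp_smooth[OF \<Phi>]
  have "pd i (dirac_field \<Phi>) = (\<lambda>x. dirac_coeff 1 (pd i (pd 1 \<Phi>) x) + dirac_coeff 2 (pd i (pd 2 \<Phi>) x))" for i
  proof
    fix x
    have s: "smooth (\<lambda>x. dirac_coeff j (pd j \<Phi> x))" for j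
      by (intro smooth_linear[OF dirac_coeff_linear] smooth_pd sm)
    show "pd i (dirac_field \<Phi>) x = dirac_coeff 1 (pd i (pd 1 \<Phi>) x) + dirac_coeff 2 (pd i (pd 2 \<Phi>) x)"
      unfolding dirac_field_def[abs_def]
      by (simp add: pd_add smooth_differentiable[OF s] pd_linear[OF dirac_coeff_linear] smooth_differentiable[OF smooth_pd[OF sm]])
  qed
  then have eq: "dirac_field (dirac_field \<Phi>) x = dirac_coeff 1 (dirac_coeff 1 (pd 1 (pd 1 \<Phi>) x) + dirac_coeff 2 (pd 1 (pd 2 \<Phi>) x))
      + dirac_coeff 2 (dirac_coeff 1 (pd 2 (pd 1 \<Phi>) x) + dirac_coeff 2 (pd 2 (pd 2 \<Phi>) x))" for x
    by (simp add: dirac_field_def[of "dirac_field \<Phi>"])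
  show ?thesis
    using mixed_partials[OF \<Phi>]
    by eventually_elim (simp add: eq D1.add D2.add dirac_coeff_square dirac_coeff_anticommute sum_2)
qed

text \<open>Both sides are the integral of \<Phi> against minus its Laplacian. Through this identity
  the Dirac image controls every first derivative, which is all the regularity theory
  required.\<close>

lemma dirac_field_norm:
  assumes \<Phi>: "cc_smooth \<Phi>"
  shows "(LINT x|lebesgue. (norm (dirac_field \<Phi> x))\<^sup>2) = (\<Sum>i\<in>UNIV. LINT x|lebesgue. (norm (pd i \<Phi> x))\<^sup>2)"
proof -
  have cc: "cc_smooth (pd i (pd j \<Phi>))" "cc_smooth (pd i \<Phi>)" for i j by (intro cc_smooth_pd \<Phi>)+
  have "(LINT x|lebesgue. (norm (dirac_field \<Phi> x))\<^sup>2) = (LINT x|lebesgue. \<Phi> x \<bullet> dirac_field (dirac_field \<Phi>) x)"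
    using dirac_field_sym[OF \<Phi> cc_smooth_dirac_field[OF \<Phi>]] by (simp add: power2_norm_eq_inner)
  also have "\<dots> = (LINT x|lebesgue. \<Phi> x \<bullet> - (\<Sum>i\<in>UNIV. pd i (pd i \<Phi>) x))"
  proof (rule integral_cong_AE)
    show "AE x in lebesgue. \<Phi> x \<bullet> dirac_field (dirac_field \<Phi>) x = \<Phi> x \<bullet> - (\<Sum>i\<in>UNIV. pd i (pd i \<Phi>) x)"
      using dirac_field_square[OF \<Phi>] by eventually_elim simp
    show "(\<lambda>x. \<Phi> x \<bullet> dirac_field (dirac_field \<Phi>) x) \<in> borel_measurable lebesgue"
      "(\<lambda>x. \<Phi> x \<bullet> - (\<Sum>i\<in>UNIV. pd i (pd i \<Phi>) x)) \<in> borel_measurable lebesgue"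
      by (intro borel_measurable_inner borel_measurable_uminus borel_measurable_sum
          cc_smooth_measurable_lebesgue cc_smooth_dirac_field cc \<Phi>)+
  qed
  also have "\<dots> = - (\<Sum>i\<in>UNIV. LINT x|lebesgue. \<Phi> x \<bullet> pd i (pd i \<Phi>) x)"
    by (simp add: inner_sum_right cc_smooth_inner_integrable[OF \<Phi> cc_smooth_sq_integrable[OF cc(1)]])
  also have "\<dots> = (\<Sum>i\<in>UNIV. LINT x|lebesgue. pd i \<Phi> x \<bullet> pd i \<Phi> x)"
    by (simp add: integration_by_parts_inner[OF \<Phi> cc(2)] sum_negf)
  finally show ?thesis by (simp add: power2_norm_eq_inner)
qed

definition dirac_core :: "(spinor_L2 \<times> spinor_L2) set" where
  "dirac_core = {(abs_spinor_L2 \<Phi>, abs_spinor_L2 (dirac_field \<Phi>)) | \<Phi>. cc_smooth \<Phi>}"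

lemma dirac_coreI: "cc_smooth \<Phi> \<Longrightarrow> (abs_spinor_L2 \<Phi>, abs_spinor_L2 (dirac_field \<Phi>)) \<in> dirac_core"
  by (auto simp: dirac_core_def)

lemma dirac_coreE:
  assumes "(x, y) \<in> dirac_core"
  obtains \<Phi> where "cc_smooth \<Phi>" "x = abs_spinor_L2 \<Phi>" "y = abs_spinor_L2 (dirac_field \<Phi>)"
  using assms by (auto simp: dirac_core_def)

lemma cc_smooth_scaleC:
  fixes \<Phi> :: "real^2 \<Rightarrow> complex^2"
  shows "cc_smooth \<Phi> \<Longrightarrow> cc_smooth (\<lambda>x. c *s \<Phi> x)"
  by (rule cc_smooth_linear[OF bounded_linear_vector_scalar_mult])

lemma cc_smooth_scaleR: "cc_smooth \<Phi> \<Longrightarrow> cc_smooth (\<lambda>x. r *\<^sub>R \<Phi> x)"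
  by (rule cc_smooth_linear[OF bounded_linear_scaleR_right])

lemma inner_sq_integrable:
  fixes u :: "'a \<Rightarrow> 'b::euclidean_space"
  shows "u \<in> sq_integrable M \<Longrightarrow> (\<lambda>x. e \<bullet> u x) \<in> sq_integrable M"
  by (rule sq_integrable_linear_image[OF _ bounded_linear_inner_right])

lemma spinor_eq_0I:
  assumes "\<And>e. AE x in lebesgue. e \<bullet> rep_spinor_L2 g x = 0" shows "g = 0"
proof -
  have "AE x in lebesgue. rep_spinor_L2 g x = 0"
    by (rule AE_euclidean_eqI) (use assms in simp)
  then have "abs_spinor_L2 (rep_spinor_L2 g) = abs_spinor_L2 (\<lambda>x. 0)"
    by (intro abs_spinor_eqI rep_spinor_sq_integrable zero_sq_integrable)
  then show ?thesis by (simp add: abs_rep_spinor zero_spinor_L2.abs_eq)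
qed

lemma abs_inner_rep:
  assumes "u \<in> sq_integrable lebesgue"
  shows "abs_spinor_L2 u \<bullet> g = (LINT x|lebesgue. u x \<bullet> rep_spinor_L2 g x)"
  using abs_spinor_inner[OF assms rep_spinor_sq_integrable[of g]] by (simp add: abs_rep_spinor)

lemma dirac_core_dense:
  assumes "\<And>x y. (x, y) \<in> dirac_core \<Longrightarrow> x \<bullet> g = 0" shows "g = 0"
proof (rule spinor_eq_0I, rule fundamental_lemma)
  fix e :: "complex^2"
  show "(\<lambda>x. e \<bullet> rep_spinor_L2 g x) \<in> sq_integrable lebesgue"
    by (intro inner_sq_integrable rep_spinor_sq_integrable)
  fix \<psi> :: "real^2 \<Rightarrow> real" assume "cc_smooth \<psi>"
  then have cc: "cc_smooth (\<lambda>x. \<psi> x *\<^sub>R e)" by (rule cc_smooth_scale_const)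
  from assms[OF dirac_coreI[OF this]] show "(LINT x|lebesgue. \<psi> x * (e \<bullet> rep_spinor_L2 g x)) = 0"
    by (simp add: abs_inner_rep cc_smooth_sq_integrable[OF cc])
qed

text \<open>With D for the Dirac operator, the test field is (D - s i)(\<psi> e). Since (D + s i)(D
  - s i) = D^2 + 1 = 1 - \<Delta>, every component of \<open>g\<close> solves the Helmholtz equation
  in the sense of distributions.\<close>

lemma dirac_core_kernel:
  assumes s: "s = 1 \<or> s = - 1"
    and g: "\<And>x y. (x, y) \<in> dirac_core \<Longrightarrow> (y + s *\<^sub>R scaleC_spinor \<i> x) \<bullet> g = 0"
  shows "g = 0"
proof (rule spinor_eq_0I, rule helmholtz_kernel)
  fix e :: "complex^2"
  show eg: "(\<lambda>x. e \<bullet> rep_spinor_L2 g x) \<in> sq_integrable lebesgue"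
    by (intro inner_sq_integrable rep_spinor_sq_integrable)
  fix \<psi> :: "real^2 \<Rightarrow> real" assume \<psi>: "cc_smooth \<psi>"
  let ?\<chi> = "\<lambda>x. \<psi> x *\<^sub>R e"
  have \<chi>: "cc_smooth ?\<chi>" by (rule cc_smooth_scale_const[OF \<psi>])
  note cc [intro] = cc_smooth_dirac_field cc_smooth_scaleC cc_smooth_scaleR cc_smooth_imp_smooth cc_smooth_sq_integrable
  define \<Phi> where "\<Phi> x = dirac_field ?\<chi> x + (- s) *\<^sub>R (\<i> *s ?\<chi> x)" for x
  have \<Phi>: "cc_smooth \<Phi>" unfolding \<Phi>_def[abs_def] by (intro cc_smooth_add cc \<chi>)
  have D\<Phi>: "dirac_field \<Phi> = (\<lambda>x. dirac_field (dirac_field ?\<chi>) x + (- s) *\<^sub>R (\<i> *s dirac_field ?\<chi> x))"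
  proof -
    have "dirac_field (\<lambda>x. \<i> *s ?\<chi> x) = (\<lambda>x. \<i> *s dirac_field ?\<chi> x)"
      by (rule dirac_field_scaleC) (intro cc \<chi>)
    moreover have "dirac_field (\<lambda>x. (- s) *\<^sub>R (\<i> *s ?\<chi> x)) = (\<lambda>x. (- s) *\<^sub>R dirac_field (\<lambda>x. \<i> *s ?\<chi> x) x)"
      by (rule dirac_field_scaleR) (intro cc \<chi>)
    moreover have "smooth (dirac_field ?\<chi>)" "smooth (\<lambda>x. (- s) *\<^sub>R (\<i> *s ?\<chi> x))"
      by (intro cc \<chi>)+
    ultimately show ?thesis
      unfolding \<Phi>_def[abs_def] by (simp only: dirac_field_add)
  qed
  have pdpd: "pd i (pd i ?\<chi>) = (\<lambda>x. pd i (pd i \<psi>) x *\<^sub>R e)" for i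
    using \<psi> by (simp add: pd_scale_const cc_smooth_imp_smooth smooth_pd)
  have ae: "AE x in lebesgue. dirac_field \<Phi> x + s *\<^sub>R (\<i> *s \<Phi> x) = ?\<chi> x - (\<Sum>i\<in>UNIV. pd i (pd i \<psi>) x *\<^sub>R e)"
    using dirac_field_square[OF \<chi>]
  proof eventually_elim
    case (elim x)
    have "s *\<^sub>R (\<i> *s \<Phi> x) = s *\<^sub>R (\<i> *s dirac_field ?\<chi> x) + (s * s) *\<^sub>R ?\<chi> x"
      by (simp add: \<Phi>_def vec_eq_iff algebra_simps)
    moreover have "s * s = 1" using s by auto
    ultimately show ?case unfolding D\<Phi> using elim by (simp add: pdpd)
  qed
  have sq: "\<Phi> \<in> sq_integrable lebesgue" "dirac_field \<Phi> \<in> sq_integrable lebesgue"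
      "(\<lambda>x. \<i> *s \<Phi> x) \<in> sq_integrable lebesgue" "(\<lambda>x. s *\<^sub>R (\<i> *s \<Phi> x)) \<in> sq_integrable lebesgue"
    by (intro cc \<Phi>)+
  have "0 = (abs_spinor_L2 (dirac_field \<Phi>) + s *\<^sub>R scaleC_spinor \<i> (abs_spinor_L2 \<Phi>)) \<bullet> g"
    by (rule g[OF dirac_coreI[OF \<Phi>], symmetric])
  also have "\<dots> = (LINT x|lebesgue. (dirac_field \<Phi> x + s *\<^sub>R (\<i> *s \<Phi> x)) \<bullet> rep_spinor_L2 g x)"
    by (simp add: abs_spinor_scaleC abs_spinor_scaleR abs_spinor_add sq abs_inner_rep sq_integrable_add)
  also have "\<dots> = (LINT x|lebesgue. (?\<chi> x - (\<Sum>i\<in>UNIV. pd i (pd i \<psi>) x *\<^sub>R e)) \<bullet> rep_spinor_L2 g x)"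
  proof (rule integral_cong_AE)
    show "AE x in lebesgue. (dirac_field \<Phi> x + s *\<^sub>R (\<i> *s \<Phi> x)) \<bullet> rep_spinor_L2 g x =
        (?\<chi> x - (\<Sum>i\<in>UNIV. pd i (pd i \<psi>) x *\<^sub>R e)) \<bullet> rep_spinor_L2 g x"
      using ae by eventually_elim simp
    have gm: "rep_spinor_L2 g \<in> borel_measurable lebesgue"
      using rep_spinor_sq_integrable[of g] by (simp add: sq_integrable_def)
    show "(\<lambda>x. (dirac_field \<Phi> x + s *\<^sub>R (\<i> *s \<Phi> x)) \<bullet> rep_spinor_L2 g x) \<in> borel_measurable lebesgue"
      using sq_integrable_add[OF sq(2,4)] gm by (intro borel_measurable_inner) (auto simp: sq_integrable_def)
    show "(\<lambda>x. (?\<chi> x - (\<Sum>i\<in>UNIV. pd i (pd i \<psi>) x *\<^sub>R e)) \<bullet> rep_spinor_L2 g x) \<in> borel_measurable lebesgue"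
      by (intro borel_measurable_inner borel_measurable_diff borel_measurable_sum gm
          cc_smooth_measurable_lebesgue[OF \<chi>] cc_smooth_measurable_lebesgue cc_smooth_scale_const cc_smooth_pd \<psi>)
  qed
  also have "\<dots> = (LINT x|lebesgue. \<psi> x * (e \<bullet> rep_spinor_L2 g x) - (\<Sum>i\<in>UNIV. pd i (pd i \<psi>) x * (e \<bullet> rep_spinor_L2 g x)))"
    by (simp add: inner_diff_left inner_sum_left)
  also have "\<dots> = (LINT x|lebesgue. \<psi> x * (e \<bullet> rep_spinor_L2 g x)) - (\<Sum>i\<in>UNIV. LINT x|lebesgue. pd i (pd i \<psi>) x * (e \<bullet> rep_spinor_L2 g x))"
  proof -
    have i: "integrable lebesgue (\<lambda>x. \<phi> x * (e \<bullet> rep_spinor_L2 g x))" if "cc_smooth \<phi>" for \<phi>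
      by (rule integrable_times_sq_integrable[OF cc_smooth_sq_integrable[OF that] eg])
    show ?thesis by (simp add: i \<psi> cc_smooth_pd)
  qed
  finally show "(LINT x|lebesgue. \<psi> x * (e \<bullet> rep_spinor_L2 g x)) = (\<Sum>i\<in>UNIV. LINT x|lebesgue. pd i (pd i \<psi>) x * (e \<bullet> rep_spinor_L2 g x))"
    by simp
qed

lemma scaleC_spinor_add: "scaleC_spinor c (x + y) = scaleC_spinor c x + scaleC_spinor c y"
proof -
  obtain u v where "u \<in> sq_integrable lebesgue" "x = abs_spinor_L2 u" "v \<in> sq_integrable lebesgue" "y = abs_spinor_L2 v"
    by (metis abs_spinor_cases)
  then show ?thesis
    by (simp add: abs_spinor_add abs_spinor_scaleC sq_integrable_intros vector_add_ldistrib)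
qed

lemma scaleC_spinor_scaleR: "scaleC_spinor c (r *\<^sub>R x) = r *\<^sub>R scaleC_spinor c x"
proof -
  obtain u where "u \<in> sq_integrable lebesgue" "x = abs_spinor_L2 u" by (metis abs_spinor_cases)
  moreover have "c *s (r *\<^sub>R v) = r *\<^sub>R (c *s (v::complex^2))" for v by (simp add: vec_eq_iff)
  ultimately show ?thesis
    by (simp add: abs_spinor_scaleR abs_spinor_scaleC sq_integrable_intros)
qed

lemma scaleC_spinor_decompose: "scaleC_spinor z x = Re z *\<^sub>R x + Im z *\<^sub>R scaleC_spinor \<i> x"
proof -
  obtain u where "u \<in> sq_integrable lebesgue" "x = abs_spinor_L2 u" by (metis abs_spinor_cases)
  moreover have "z *s v = Re z *\<^sub>R v + Im z *\<^sub>R (\<i> *s (v::complex^2))" for v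
    by (simp add: vec_eq_iff complex_eq_iff)
  ultimately show ?thesis
    by (simp add: abs_spinor_scaleR abs_spinor_scaleC sq_integrable_intros abs_spinor_add)
qed

text \<open>Essential self-adjointness of the massless Dirac operator on compactly supported smooth
  spinors.\<close>

interpretation free_dirac: symmetric_core dirac_core "scaleC_spinor \<i>"
proof (rule symmetric_core.intro)
  show "subspace dirac_core"
    unfolding subspace_def
  proof (intro conjI ballI allI)
    have "cc_smooth (\<lambda>x. 0 :: complex^2)" by (auto simp: cc_smooth_def smooth_const)
    moreover have "dirac_field (\<lambda>x. 0) = (\<lambda>x. 0)"
      using dirac_field_scaleR[OF smooth_const, of 0 0] by simp
    ultimately show "0 \<in> dirac_core"
      using dirac_coreI[of "\<lambda>x. 0"] by (simp add: zero_prod_def zero_spinor_L2.abs_eq)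
  next
    fix p q assume "p \<in> dirac_core" "q \<in> dirac_core"
    then obtain \<Phi> \<Psi> where *: "cc_smooth \<Phi>" "p = (abs_spinor_L2 \<Phi>, abs_spinor_L2 (dirac_field \<Phi>))"
      "cc_smooth \<Psi>" "q = (abs_spinor_L2 \<Psi>, abs_spinor_L2 (dirac_field \<Psi>))" by (auto simp: dirac_core_def)
    have "(abs_spinor_L2 (\<lambda>x. \<Phi> x + \<Psi> x), abs_spinor_L2 (dirac_field (\<lambda>x. \<Phi> x + \<Psi> x))) \<in> dirac_core"
      by (intro dirac_coreI cc_smooth_add *)
    then show "p + q \<in> dirac_core"
      by (simp add: * abs_spinor_add cc_smooth_sq_integrable cc_smooth_dirac_field dirac_field_add cc_smooth_imp_smooth)
  next
    fix c p assume "p \<in> dirac_core"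
    then obtain \<Phi> where *: "cc_smooth \<Phi>" "p = (abs_spinor_L2 \<Phi>, abs_spinor_L2 (dirac_field \<Phi>))"
      by (auto simp: dirac_core_def)
    have "(abs_spinor_L2 (\<lambda>x. c *\<^sub>R \<Phi> x), abs_spinor_L2 (dirac_field (\<lambda>x. c *\<^sub>R \<Phi> x))) \<in> dirac_core"
      by (intro dirac_coreI cc_smooth_scaleR *)
    then show "c *\<^sub>R p \<in> dirac_core"
      by (simp add: * abs_spinor_scaleR cc_smooth_sq_integrable cc_smooth_dirac_field dirac_field_scaleR cc_smooth_imp_smooth)
  qed
  show "linear (scaleC_spinor \<i>)"
    by (rule linearI) (simp_all add: scaleC_spinor_add scaleC_spinor_scaleR)
  fix x y :: spinor_L2
  obtain u v where uv: "u \<in> sq_integrable lebesgue" "x = abs_spinor_L2 u" "v \<in> sq_integrable lebesgue" "y = abs_spinor_L2 v"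
    by (metis abs_spinor_cases)
  show "scaleC_spinor \<i> x \<bullet> scaleC_spinor \<i> y = x \<bullet> y"
    by (simp add: uv abs_spinor_scaleC abs_spinor_inner sq_integrable_intros scaleC_inner)
  show "scaleC_spinor \<i> (scaleC_spinor \<i> x) = - x"
    unfolding uv(2) abs_spinor_scaleC[OF uv(1)] abs_spinor_uminus[OF uv(1)]
    by (subst abs_spinor_scaleC) (simp_all add: uv sq_integrable_intros scaleC_scaleC del: vector_smult_assoc)
next
  fix x y assume "(x, y) \<in> dirac_core"
  then obtain \<Phi> where *: "cc_smooth \<Phi>" "x = abs_spinor_L2 \<Phi>" "y = abs_spinor_L2 (dirac_field \<Phi>)"
    by (rule dirac_coreE)
  then show "(scaleC_spinor \<i> x, scaleC_spinor \<i> y) \<in> dirac_core"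
    using dirac_coreI[OF cc_smooth_scaleC[OF *(1), of \<i>]]
    by (simp add: abs_spinor_scaleC cc_smooth_sq_integrable cc_smooth_dirac_field dirac_field_scaleC cc_smooth_imp_smooth)
next
  fix x y x' y' assume "(x, y) \<in> dirac_core" "(x', y') \<in> dirac_core"
  then show "y \<bullet> x' = x \<bullet> y'"
    by (auto elim!: dirac_coreE simp: abs_spinor_inner cc_smooth_sq_integrable cc_smooth_dirac_field dirac_field_sym)
qed (fact dirac_core_dense dirac_core_kernel)+

section \<open>Weak derivatives and the Sobolev domain\<close>

lemma integrable_scaleR_sq_integrable:
  fixes u :: "'a \<Rightarrow> 'b::euclidean_space"
  assumes "\<psi> \<in> sq_integrable M" "u \<in> sq_integrable M"
  shows "integrable M (\<lambda>x. \<psi> x *\<^sub>R u x :: 'b)"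
proof (rule Bochner_Integration.integrable_bound)
  show "integrable M (\<lambda>x. (norm (\<psi> x))\<^sup>2 + (norm (u x))\<^sup>2)"
    using assms by (auto simp: sq_integrable_def)
  show "(\<lambda>x. \<psi> x *\<^sub>R u x) \<in> borel_measurable M"
    using assms by (auto simp: sq_integrable_def)
  show "AE x in M. norm (\<psi> x *\<^sub>R u x) \<le> norm ((norm (\<psi> x))\<^sup>2 + (norm (u x))\<^sup>2)"
  proof (rule AE_I2)
    fix x
    have "2 * norm (\<psi> x) * norm (u x) \<le> (norm (\<psi> x))\<^sup>2 + (norm (u x))\<^sup>2" by (rule sum_squares_bound)
    moreover have "0 \<le> norm (\<psi> x) * norm (u x)" by simp
    ultimately have "norm (\<psi> x) * norm (u x) \<le> (norm (\<psi> x))\<^sup>2 + (norm (u x))\<^sup>2" by linarith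
    then show "norm (\<psi> x *\<^sub>R u x) \<le> norm ((norm (\<psi> x))\<^sup>2 + (norm (u x))\<^sup>2)" by simp
  qed
qed

text \<open>The definition tests with scalar functions and integrates vectors; here vector fields
  are paired by the inner product, as in the spinor space. The two are compared component by
  component.\<close>

lemma has_weak_pd_iff:
  fixes u g :: "real^2 \<Rightarrow> 'b::euclidean_space"
  assumes u: "u \<in> sq_integrable lebesgue" and g: "g \<in> sq_integrable lebesgue"
  shows "has_weak_pd UNIV i u g \<longleftrightarrow>
    (\<forall>\<Phi>. cc_smooth \<Phi> \<longrightarrow> (LINT x|lebesgue. pd i \<Phi> x \<bullet> u x) = - (LINT x|lebesgue. \<Phi> x \<bullet> g x))"
proof (intro iffI allI impI)
  have int: "integrable lebesgue (\<lambda>x. \<psi> x *\<^sub>R v x)" if "cc_smooth \<psi>" "v \<in> sq_integrable lebesgue"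
    for \<psi> and v :: "real^2 \<Rightarrow> 'b"
    by (rule integrable_scaleR_sq_integrable[OF cc_smooth_sq_integrable[OF that(1)] that(2)])
  have pull: "e \<bullet> (LINT x|lebesgue. \<psi> x *\<^sub>R v x) = (LINT x|lebesgue. \<psi> x * (e \<bullet> v x))"
    if "cc_smooth \<psi>" "v \<in> sq_integrable lebesgue" for e \<psi> and v :: "real^2 \<Rightarrow> 'b"
    using integral_inner_right[OF int[OF that], of e] by simp
  {
    assume w: "has_weak_pd UNIV i u g"
    fix \<Phi> :: "real^2 \<Rightarrow> 'b" assume \<Phi>: "cc_smooth \<Phi>"
    have cc: "cc_smooth (\<lambda>x. e \<bullet> \<Phi> x)" "cc_smooth (\<lambda>x. e \<bullet> pd i \<Phi> x)" for e
      by (intro cc_smooth_linear[OF bounded_linear_inner_right] \<Phi> cc_smooth_pd)+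
    have pd: "pd i (\<lambda>x. e \<bullet> \<Phi> x) = (\<lambda>x. e \<bullet> pd i \<Phi> x)" for e
      using \<Phi> by (auto intro!: pd_linear[OF bounded_linear_inner_right] smooth_differentiable cc_smooth_imp_smooth)
    have sum: "(LINT x|lebesgue. \<Psi> x \<bullet> v x) = (\<Sum>e\<in>Basis. LINT x|lebesgue. (e \<bullet> \<Psi> x) * (e \<bullet> v x))"
      if "\<And>e. cc_smooth (\<lambda>x. e \<bullet> \<Psi> x)" "v \<in> sq_integrable lebesgue" for \<Psi> v :: "real^2 \<Rightarrow> 'b"
    proof -
      have "integrable lebesgue (\<lambda>x. (e \<bullet> \<Psi> x) * (e \<bullet> v x))" for e
        by (intro integrable_times_sq_integrable cc_smooth_sq_integrable that inner_sq_integrable)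
      then have "(\<Sum>e\<in>Basis. LINT x|lebesgue. (e \<bullet> \<Psi> x) * (e \<bullet> v x)) = (LINT x|lebesgue. (\<Sum>e\<in>Basis. (e \<bullet> \<Psi> x) * (e \<bullet> v x)))"
        by simp
      then show ?thesis by (subst euclidean_inner) (simp add: inner_commute)
    qed
    have "(LINT x|lebesgue. (e \<bullet> pd i \<Phi> x) * (e \<bullet> u x)) = - (LINT x|lebesgue. (e \<bullet> \<Phi> x) * (e \<bullet> g x))" for e
    proof -
      have "(LINT x|lebesgue. pd i (\<lambda>x. e \<bullet> \<Phi> x) x *\<^sub>R u x) = - (LINT x|lebesgue. (e \<bullet> \<Phi> x) *\<^sub>R g x)"
        using w cc unfolding has_weak_pd_def test_functions_UNIV lebesgue_on_UNIV_eq by blast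
      then have "e \<bullet> (LINT x|lebesgue. (e \<bullet> pd i \<Phi> x) *\<^sub>R u x) = - (e \<bullet> (LINT x|lebesgue. (e \<bullet> \<Phi> x) *\<^sub>R g x))"
        by (simp add: pd)
      then show ?thesis by (simp only: pull cc u g)
    qed
    then show "(LINT x|lebesgue. pd i \<Phi> x \<bullet> u x) = - (LINT x|lebesgue. \<Phi> x \<bullet> g x)"
      using sum[OF cc(1) g] sum[OF cc(2) u] by (simp add: sum_negf)
  next
    assume w: "\<forall>\<Phi>. cc_smooth \<Phi> \<longrightarrow> (LINT x|lebesgue. pd i \<Phi> x \<bullet> u x) = - (LINT x|lebesgue. \<Phi> x \<bullet> g x)"
    show "has_weak_pd UNIV i u g"
      unfolding has_weak_pd_def test_functions_UNIV lebesgue_on_UNIV_eq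
    proof clarify
      fix \<psi> :: "real^2 \<Rightarrow> real" assume \<psi>: "cc_smooth \<psi>"
      show "(LINT x|lebesgue. pd i \<psi> x *\<^sub>R u x) = - (LINT x|lebesgue. \<psi> x *\<^sub>R g x)"
      proof (rule euclidean_eqI)
        fix e :: 'b
        have "(LINT x|lebesgue. pd i \<psi> x * (e \<bullet> u x)) = - (LINT x|lebesgue. \<psi> x * (e \<bullet> g x))"
          using w[rule_format, OF cc_smooth_scale_const[OF \<psi>, of e]]
          by (simp add: pd_scale_const cc_smooth_imp_smooth \<psi>)
        then have "e \<bullet> (LINT x|lebesgue. pd i \<psi> x *\<^sub>R u x) = e \<bullet> - (LINT x|lebesgue. \<psi> x *\<^sub>R g x)"
          using pull[OF cc_smooth_pd[OF \<psi>] u, of e i] pull[OF \<psi> g, of e] by simp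
        then show "(LINT x|lebesgue. pd i \<psi> x *\<^sub>R u x) \<bullet> e = - (LINT x|lebesgue. \<psi> x *\<^sub>R g x) \<bullet> e"
          by (simp add: inner_commute)
      qed
    qed
  }
qed

lemma wpd_UNIV:
  assumes "u \<in> H1 UNIV"
  shows "wpd UNIV i u \<in> sq_integrable lebesgue" "has_weak_pd UNIV i u (wpd UNIV i u)"
proof -
  have "\<exists>g. g \<in> sq_integrable (lebesgue_on UNIV) \<and> has_weak_pd UNIV i u g"
    using assms by (auto simp: H1_def)
  from someI_ex[OF this] show "wpd UNIV i u \<in> sq_integrable lebesgue" "has_weak_pd UNIV i u (wpd UNIV i u)"
    by (auto simp: wpd_def lebesgue_on_UNIV_eq)
qed

text \<open>The constant matrices commute with differentiation, so the weak derivatives of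
  \<open>u\<close> may be tested with the fields \<open>dirac_coeff j\<close> applied to a core
  element, and skewness brings the matrices over to \<open>u\<close>.\<close>

lemma H1_imp_weak_domain:
  assumes u: "rep_spinor_L2 u \<in> H1 UNIV"
  shows "(u, abs_spinor_L2 (\<lambda>x. dirac_coeff 1 (wpd UNIV 1 (rep_spinor_L2 u) x) +
      dirac_coeff 2 (wpd UNIV 2 (rep_spinor_L2 u) x))) \<in> free_dirac.W"
  unfolding free_dirac.W_def
proof clarify
  let ?u = "rep_spinor_L2 u"
  let ?w = "\<lambda>j. wpd UNIV j ?u"
  note w = wpd_UNIV[OF u]
  note us = rep_spinor_sq_integrable[of u]
  have sq: "(\<lambda>x. dirac_coeff j (?w j x)) \<in> sq_integrable lebesgue" for j
    by (rule sq_integrable_linear_image[OF w(1) dirac_coeff_linear])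
  fix x y assume "(x, y) \<in> dirac_core"
  then obtain \<Phi> where \<Phi>: "cc_smooth \<Phi>" "x = abs_spinor_L2 \<Phi>" "y = abs_spinor_L2 (dirac_field \<Phi>)"
    by (rule dirac_coreE)
  have cc: "cc_smooth (\<lambda>x. dirac_coeff j (\<Phi> x))" "cc_smooth (\<lambda>x. dirac_coeff j (pd j \<Phi> x))" for j
    by (intro cc_smooth_linear[OF dirac_coeff_linear] cc_smooth_pd \<Phi>)+
  have 1: "(LINT x|lebesgue. dirac_coeff j (pd j \<Phi> x) \<bullet> ?u x) = (LINT x|lebesgue. \<Phi> x \<bullet> dirac_coeff j (?w j x))" for j
  proof -
    have "pd j (\<lambda>x. dirac_coeff j (\<Phi> x)) = (\<lambda>x. dirac_coeff j (pd j \<Phi> x))"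
      using \<Phi> by (auto intro!: pd_linear[OF dirac_coeff_linear] smooth_differentiable cc_smooth_imp_smooth)
    then have "(LINT x|lebesgue. dirac_coeff j (pd j \<Phi> x) \<bullet> ?u x) = - (LINT x|lebesgue. dirac_coeff j (\<Phi> x) \<bullet> ?w j x)"
      using w(2)[of j, unfolded has_weak_pd_iff[OF us w(1)], rule_format, OF cc(1)[of j]] by simp
    then show ?thesis by (simp add: dirac_coeff_skew)
  qed
  have "y \<bullet> u = (LINT x|lebesgue. dirac_field \<Phi> x \<bullet> ?u x)"
    unfolding \<Phi> by (intro abs_inner_rep cc_smooth_sq_integrable cc_smooth_dirac_field \<Phi>)
  also have "\<dots> = (LINT x|lebesgue. dirac_coeff 1 (pd 1 \<Phi> x) \<bullet> ?u x) + (LINT x|lebesgue. dirac_coeff 2 (pd 2 \<Phi> x) \<bullet> ?u x)"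
    using cc_smooth_inner_integrable[OF cc(2) us] by (simp add: dirac_field_def inner_add_left)
  also have "\<dots> = (LINT x|lebesgue. \<Phi> x \<bullet> (dirac_coeff 1 (?w 1 x) + dirac_coeff 2 (?w 2 x)))"
    using cc_smooth_inner_integrable[OF \<Phi>(1) sq] by (simp add: 1 inner_add_right)
  also have "\<dots> = x \<bullet> abs_spinor_L2 (\<lambda>x. dirac_coeff 1 (?w 1 x) + dirac_coeff 2 (?w 2 x))"
    unfolding \<Phi> by (intro abs_spinor_inner[symmetric] cc_smooth_sq_integrable sq_integrable_add sq \<Phi>)
  finally show "y \<bullet> u = x \<bullet> abs_spinor_L2 (\<lambda>x. dirac_coeff 1 (?w 1 x) + dirac_coeff 2 (?w 2 x))" .
qed

lemma pd_diff:
  assumes "smooth f" "smooth g" shows "pd i (\<lambda>x. f x - g x) = (\<lambda>x. pd i f x - pd i g x)"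
proof
  fix x
  have s: "smooth (\<lambda>x. - g x)"
    by (rule smooth_linear[OF bounded_linear_minus[OF bounded_linear_ident] assms(2)])
  show "pd i (\<lambda>x. f x - g x) x = pd i f x - pd i g x"
    using pd_add[OF smooth_differentiable[OF assms(1)] smooth_differentiable[OF s], of i x]
      pd_linear[OF bounded_linear_minus[OF bounded_linear_ident] smooth_differentiable[OF assms(2)], of i x]
    by simp
qed

lemma cc_smooth_diff: "cc_smooth f \<Longrightarrow> cc_smooth g \<Longrightarrow> cc_smooth (\<lambda>x. f x - g x)"
  using cc_smooth_add[OF _ cc_smooth_linear[OF bounded_linear_minus[OF bounded_linear_ident]], of f g] by simp

lemma pd_norm_le_dirac_field:
  assumes \<Phi>: "cc_smooth \<Phi>"
  shows "norm (abs_spinor_L2 (pd i \<Phi>)) \<le> norm (abs_spinor_L2 (dirac_field \<Phi>))"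
proof (rule power2_le_imp_le)
  have "(norm (abs_spinor_L2 (pd i \<Phi>)))\<^sup>2 = (LINT x|lebesgue. (norm (pd i \<Phi> x))\<^sup>2)"
    by (intro abs_spinor_norm cc_smooth_sq_integrable cc_smooth_pd \<Phi>)
  also have "\<dots> \<le> (\<Sum>i\<in>UNIV. LINT x|lebesgue. (norm (pd i \<Phi> x))\<^sup>2)"
    by (intro member_le_sum) auto
  also have "\<dots> = (norm (abs_spinor_L2 (dirac_field \<Phi>)))\<^sup>2"
    by (simp add: dirac_field_norm \<Phi> abs_spinor_norm cc_smooth_sq_integrable cc_smooth_dirac_field)
  finally show "(norm (abs_spinor_L2 (pd i \<Phi>)))\<^sup>2 \<le> (norm (abs_spinor_L2 (dirac_field \<Phi>)))\<^sup>2" .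
qed simp

text \<open>Along a core sequence converging in graph norm the partial derivatives are Cauchy,
  because the Dirac image dominates them; their limits are the weak derivatives of the
  limit.\<close>

lemma weak_domain_imp_H1:
  assumes W: "(u, F) \<in> free_dirac.W" shows "rep_spinor_L2 u \<in> H1 UNIV"
proof -
  obtain x y where xy: "\<And>n. (x n, y n) \<in> dirac_core" "x \<longlonglongrightarrow> u" "y \<longlonglongrightarrow> F"
    by (rule free_dirac.W_core[OF W]) (rule that)
  have "\<forall>n. \<exists>\<Phi>. cc_smooth \<Phi> \<and> x n = abs_spinor_L2 \<Phi> \<and> y n = abs_spinor_L2 (dirac_field \<Phi>)"
    using xy(1) by (metis dirac_coreE)
  then obtain \<Phi> where \<Phi>: "\<And>n. cc_smooth (\<Phi> n)" "\<And>n. x n = abs_spinor_L2 (\<Phi> n)" "\<And>n. y n = abs_spinor_L2 (dirac_field (\<Phi> n))"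
    by metis
  note sm = cc_smooth_imp_smooth[OF \<Phi>(1)]
  have sq: "pd i (\<Phi> n) \<in> sq_integrable lebesgue" for i n by (intro cc_smooth_sq_integrable cc_smooth_pd \<Phi>)
  have "\<exists>g. g \<in> sq_integrable lebesgue \<and> has_weak_pd UNIV i (rep_spinor_L2 u) g" for i
  proof -
    define p where "p n = abs_spinor_L2 (pd i (\<Phi> n))" for n
    have "Cauchy p"
    proof (rule Cauchy_dominated[OF LIMSEQ_imp_Cauchy[OF xy(3)], of _ 1])
      fix m n
      have d: "cc_smooth (\<lambda>x. \<Phi> m x - \<Phi> n x)" by (intro cc_smooth_diff \<Phi>)
      have "dirac_field (\<lambda>x. \<Phi> m x - \<Phi> n x) = (\<lambda>x. dirac_field (\<Phi> m) x - dirac_field (\<Phi> n) x)"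
        using linear_diff[OF bounded_linear.linear[OF dirac_coeff_linear]]
        by (simp add: fun_eq_iff dirac_field_def pd_diff[OF sm sm])
      then have "y m - y n = abs_spinor_L2 (dirac_field (\<lambda>x. \<Phi> m x - \<Phi> n x))"
        by (simp add: \<Phi> abs_spinor_diff cc_smooth_sq_integrable cc_smooth_dirac_field)
      moreover have "p m - p n = abs_spinor_L2 (pd i (\<lambda>x. \<Phi> m x - \<Phi> n x))"
        by (simp add: p_def abs_spinor_diff sq pd_diff[OF sm sm])
      ultimately show "norm (p m - p n) \<le> 1 * norm (y m - y n)"
        using pd_norm_le_dirac_field[OF d, of i] by simp
    qed simp
    then obtain G where G: "p \<longlonglongrightarrow> G" using Cauchy_convergent[of p] unfolding convergent_def by auto
    have "has_weak_pd UNIV i (rep_spinor_L2 u) (rep_spinor_L2 G)"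
      unfolding has_weak_pd_iff[OF rep_spinor_sq_integrable rep_spinor_sq_integrable]
    proof (intro allI impI)
      fix \<Psi> :: "real^2 \<Rightarrow> complex^2" assume \<Psi>: "cc_smooth \<Psi>"
      have s: "\<Psi> \<in> sq_integrable lebesgue" "pd i \<Psi> \<in> sq_integrable lebesgue"
        by (intro cc_smooth_sq_integrable cc_smooth_pd \<Psi>)+
      have "(\<lambda>n. abs_spinor_L2 (pd i \<Psi>) \<bullet> x n) \<longlonglongrightarrow> abs_spinor_L2 (pd i \<Psi>) \<bullet> u"
        by (intro tendsto_intros xy)
      moreover have "abs_spinor_L2 (pd i \<Psi>) \<bullet> x n = - (abs_spinor_L2 \<Psi> \<bullet> p n)" for n
        by (simp add: \<Phi> p_def abs_spinor_inner s sq cc_smooth_sq_integrable integration_by_parts_inner \<Psi>)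
      moreover have "(\<lambda>n. - (abs_spinor_L2 \<Psi> \<bullet> p n)) \<longlonglongrightarrow> - (abs_spinor_L2 \<Psi> \<bullet> G)"
        by (intro tendsto_intros G)
      ultimately have "abs_spinor_L2 (pd i \<Psi>) \<bullet> u = - (abs_spinor_L2 \<Psi> \<bullet> G)"
        using LIMSEQ_unique by simp
      then show "(LINT x|lebesgue. pd i \<Psi> x \<bullet> rep_spinor_L2 u x) = - (LINT x|lebesgue. \<Psi> x \<bullet> rep_spinor_L2 G x)"
        by (simp add: abs_inner_rep s)
    qed
    with rep_spinor_sq_integrable show ?thesis by blast
  qed
  then show ?thesis by (auto simp: H1_def lebesgue_on_UNIV_eq rep_spinor_sq_integrable)
qed

section \<open>Multiplication operators\<close>

text \<open>Acts on a chosen representative. For bounded measurable \<open>M\<close> the class of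
  the result does not depend on it, see \<open>mult_op_abs\<close>.\<close>

definition mult_op :: "(real^2 \<Rightarrow> real) \<Rightarrow> spinor_L2 \<Rightarrow> spinor_L2" where
  "mult_op M u = abs_spinor_L2 (\<lambda>x. M x *\<^sub>R rep_spinor_L2 u x)"

definition sigma_op :: "spinor_L2 \<Rightarrow> spinor_L2" where
  "sigma_op u = abs_spinor_L2 (\<lambda>x. sigma3 *v rep_spinor_L2 u x)"

lemma sq_integrable_mult:
  fixes u :: "'a \<Rightarrow> 'b::euclidean_space"
  assumes M: "M \<in> borel_measurable N" "\<And>x. \<bar>M x\<bar> \<le> K" and u: "u \<in> sq_integrable N"
  shows "(\<lambda>x. M x *\<^sub>R u x) \<in> sq_integrable N"
proof -
  have "integrable N (\<lambda>x. (norm (M x *\<^sub>R u x))\<^sup>2)"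
  proof (rule Bochner_Integration.integrable_bound)
    show "integrable N (\<lambda>x. K\<^sup>2 * (norm (u x))\<^sup>2)" using u by (auto simp: sq_integrable_def)
    show "(\<lambda>x. (norm (M x *\<^sub>R u x))\<^sup>2) \<in> borel_measurable N" using M u by (auto simp: sq_integrable_def)
    show "AE x in N. norm ((norm (M x *\<^sub>R u x))\<^sup>2) \<le> norm (K\<^sup>2 * (norm (u x))\<^sup>2)"
    proof (rule AE_I2)
      fix x
      have "\<bar>M x\<bar>\<^sup>2 \<le> K\<^sup>2" using M(2)[of x] by (intro power_mono) auto
      then show "norm ((norm (M x *\<^sub>R u x))\<^sup>2) \<le> norm (K\<^sup>2 * (norm (u x))\<^sup>2)"
        by (simp add: power_mult_distrib mult_right_mono)
    qed
  qed
  then show ?thesis using M u by (auto simp: sq_integrable_def)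
qed

lemma sigma_sq_integrable:
  "u \<in> sq_integrable N \<Longrightarrow> (\<lambda>x. sigma3 *v u x) \<in> sq_integrable N" for u :: "_ \<Rightarrow> complex^2"
  by (rule sq_integrable_linear_image[OF _ sigma3_linear])

lemma sigma_op_abs:
  assumes "u \<in> sq_integrable lebesgue" shows "sigma_op (abs_spinor_L2 u) = abs_spinor_L2 (\<lambda>x. sigma3 *v u x)"
  unfolding sigma_op_def
proof (intro abs_spinor_eqI sigma_sq_integrable rep_spinor_sq_integrable assms)
  show "AE x in lebesgue. sigma3 *v rep_spinor_L2 (abs_spinor_L2 u) x = sigma3 *v u x"
    using rep_abs_spinor[OF assms] by eventually_elim simp
qed

lemma sigma_op_add: "sigma_op (x + y) = sigma_op x + sigma_op y"
proof -
  obtain u v where uv: "u \<in> sq_integrable lebesgue" "x = abs_spinor_L2 u" "v \<in> sq_integrable lebesgue" "y = abs_spinor_L2 v"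
    by (metis abs_spinor_cases)
  then show ?thesis
    using linear_add[OF bounded_linear.linear[OF sigma3_linear]]
    by (simp add: abs_spinor_add sigma_op_abs sq_integrable_add sigma_sq_integrable)
qed

lemma sigma_op_scaleR: "sigma_op (r *\<^sub>R x) = r *\<^sub>R sigma_op x"
proof -
  obtain u where uv: "u \<in> sq_integrable lebesgue" "x = abs_spinor_L2 u" by (metis abs_spinor_cases)
  then show ?thesis
    using linear_scale[OF bounded_linear.linear[OF sigma3_linear]]
    by (simp add: abs_spinor_scaleR sigma_op_abs sq_integrable_intros sigma_sq_integrable)
qed

lemma sigma_op_inner: "sigma_op x \<bullet> y = x \<bullet> sigma_op y"
proof -
  obtain u v where uv: "u \<in> sq_integrable lebesgue" "x = abs_spinor_L2 u" "v \<in> sq_integrable lebesgue" "y = abs_spinor_L2 v"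
    by (metis abs_spinor_cases)
  then show ?thesis by (simp add: sigma_op_abs abs_spinor_inner sigma_sq_integrable sigma3_inner)
qed

lemma sigma_op_norm: "norm (sigma_op x) = norm x"
proof -
  obtain u where uv: "u \<in> sq_integrable lebesgue" "x = abs_spinor_L2 u" by (metis abs_spinor_cases)
  then have "(norm (sigma_op x))\<^sup>2 = (norm x)\<^sup>2"
    by (simp add: sigma_op_abs abs_spinor_norm sigma_sq_integrable sigma3_norm)
  then show ?thesis by simp
qed

lemma sigma_op_bounded_linear: "bounded_linear sigma_op"
  by (rule bounded_linear_intro[where K = 1]) (simp_all add: sigma_op_add sigma_op_scaleR sigma_op_norm)

lemma sigma_op_scaleC: "sigma_op (scaleC_spinor c x) = scaleC_spinor c (sigma_op x)"
proof -
  obtain u where uv: "u \<in> sq_integrable lebesgue" "x = abs_spinor_L2 u" by (metis abs_spinor_cases)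
  then show ?thesis
    by (simp add: abs_spinor_scaleC sigma_op_abs sq_integrable_intros sigma_sq_integrable sigma3_scaleC)
qed

context
  fixes M :: "real^2 \<Rightarrow> real" and K :: real
  assumes M: "M \<in> borel_measurable lebesgue" "\<And>x. \<bar>M x\<bar> \<le> K"
begin

lemma mult_op_sq: "u \<in> sq_integrable lebesgue \<Longrightarrow> (\<lambda>x. M x *\<^sub>R (u x :: complex^2)) \<in> sq_integrable lebesgue"
  by (rule sq_integrable_mult[OF M])

lemma mult_op_abs:
  assumes "u \<in> sq_integrable lebesgue" shows "mult_op M (abs_spinor_L2 u) = abs_spinor_L2 (\<lambda>x. M x *\<^sub>R u x)"
  unfolding mult_op_def
proof (intro abs_spinor_eqI mult_op_sq rep_spinor_sq_integrable assms)
  show "AE x in lebesgue. M x *\<^sub>R rep_spinor_L2 (abs_spinor_L2 u) x = M x *\<^sub>R u x"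
    using rep_abs_spinor[OF assms] by eventually_elim simp
qed

lemma mult_op_bounded_linear: "bounded_linear (mult_op M)"
proof (rule bounded_linear_intro[where K = K])
  fix x y :: spinor_L2 and r :: real
  obtain u v where uv: "u \<in> sq_integrable lebesgue" "x = abs_spinor_L2 u" "v \<in> sq_integrable lebesgue" "y = abs_spinor_L2 v"
    by (metis abs_spinor_cases)
  then show "mult_op M (x + y) = mult_op M x + mult_op M y"
    by (simp add: abs_spinor_add mult_op_abs sq_integrable_add mult_op_sq scaleR_right_distrib)
  show "mult_op M (r *\<^sub>R x) = r *\<^sub>R mult_op M x"
    using uv by (simp add: abs_spinor_scaleR mult_op_abs sq_integrable_intros mult_op_sq mult.commute)
  have K: "0 \<le> K" using M(2)[of 0] by linarith
  have "(norm (mult_op M x))\<^sup>2 = (LINT x|lebesgue. (norm (M x *\<^sub>R u x))\<^sup>2)"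
    using uv by (simp add: mult_op_abs abs_spinor_norm[OF mult_op_sq])
  also have "\<dots> \<le> (LINT x|lebesgue. K\<^sup>2 * (norm (u x))\<^sup>2)"
  proof (rule integral_mono)
    show "integrable lebesgue (\<lambda>x. (norm (M x *\<^sub>R u x))\<^sup>2)" "integrable lebesgue (\<lambda>x. K\<^sup>2 * (norm (u x))\<^sup>2)"
      using uv mult_op_sq[OF uv(1)] by (auto simp: sq_integrable_def)
    fix x
    have "\<bar>M x\<bar>\<^sup>2 \<le> K\<^sup>2" using M(2)[of x] by (intro power_mono) auto
    then show "(norm (M x *\<^sub>R u x))\<^sup>2 \<le> K\<^sup>2 * (norm (u x))\<^sup>2"
      by (simp add: power_mult_distrib mult_right_mono)
  qed
  also have "\<dots> = (norm x * K)\<^sup>2" using uv by (simp add: abs_spinor_norm power_mult_distrib)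
  finally show "norm (mult_op M x) \<le> norm x * K" by (rule power2_le_imp_le) (use K in simp)
qed

lemma mult_op_inner_abs:
  assumes "u \<in> sq_integrable lebesgue" "v \<in> sq_integrable lebesgue"
  shows "mult_op M (abs_spinor_L2 u) \<bullet> abs_spinor_L2 v = (LINT x|lebesgue. M x * (u x \<bullet> v x))"
  by (simp add: mult_op_abs abs_spinor_inner mult_op_sq assms)

lemma mult_op_inner: "mult_op M x \<bullet> y = x \<bullet> mult_op M y"
proof -
  obtain u v where uv: "u \<in> sq_integrable lebesgue" "x = abs_spinor_L2 u" "v \<in> sq_integrable lebesgue" "y = abs_spinor_L2 v"
    by (metis abs_spinor_cases)
  then show ?thesis by (simp add: mult_op_abs abs_spinor_inner mult_op_sq)
qed

lemma mult_op_scaleC: "mult_op M (scaleC_spinor c x) = scaleC_spinor c (mult_op M x)"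
proof -
  obtain u where uv: "u \<in> sq_integrable lebesgue" "x = abs_spinor_L2 u" by (metis abs_spinor_cases)
  moreover have "M x *\<^sub>R (c *s v) = c *s (M x *\<^sub>R (v::complex^2))" for v x by (simp add: vec_eq_iff)
  ultimately show ?thesis
    by (simp add: abs_spinor_scaleC mult_op_abs sq_integrable_intros mult_op_sq)
qed

lemma mult_op_sigma_op: "mult_op M (sigma_op x) = sigma_op (mult_op M x)"
proof -
  obtain u where uv: "u \<in> sq_integrable lebesgue" "x = abs_spinor_L2 u" by (metis abs_spinor_cases)
  then show ?thesis
    using linear_scale[OF bounded_linear.linear[OF sigma3_linear]]
    by (simp add: sigma_op_abs mult_op_abs sigma_sq_integrable mult_op_sq)
qed

lemma mult_op_nonneg:
  assumes "\<And>x. 0 \<le> M x" shows "0 \<le> mult_op M x \<bullet> x"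
proof -
  obtain u where uv: "u \<in> sq_integrable lebesgue" "x = abs_spinor_L2 u" by (metis abs_spinor_cases)
  then show ?thesis using assms by (simp add: mult_op_inner_abs)
qed

text \<open>Pointwise \<open>M\<^sup>2 \<le> K M\<close>. Bounding by the form instead of the
  squared norm saves a factor \<open>K\<close>, on which the final rate depends.\<close>

lemma mult_op_norm:
  assumes nn: "\<And>x. 0 \<le> M x" shows "(norm (mult_op M x))\<^sup>2 \<le> K * (mult_op M x \<bullet> x)"
proof -
  obtain u where uv: "u \<in> sq_integrable lebesgue" "x = abs_spinor_L2 u" by (metis abs_spinor_cases)
  have "(norm (mult_op M x))\<^sup>2 = (LINT x|lebesgue. (norm (M x *\<^sub>R u x))\<^sup>2)"
    using uv by (simp add: mult_op_abs abs_spinor_norm[OF mult_op_sq])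
  also have "\<dots> \<le> (LINT x|lebesgue. K * (M x * (u x \<bullet> u x)))"
  proof (rule integral_mono)
    show "integrable lebesgue (\<lambda>x. (norm (M x *\<^sub>R u x))\<^sup>2)"
      using mult_op_sq[OF uv(1)] by (auto simp: sq_integrable_def)
    show "integrable lebesgue (\<lambda>x. K * (M x * (u x \<bullet> u x)))"
      using integrable_inner_sq_integrable[OF mult_op_sq[OF uv(1)] uv(1)] by simp
    fix x
    have "M x * M x \<le> K * M x" using M(2)[of x] nn[of x] by (intro mult_right_mono) auto
    then have "M x * M x * (u x \<bullet> u x) \<le> K * M x * (u x \<bullet> u x)" by (rule mult_right_mono) simp
    then show "(norm (M x *\<^sub>R u x))\<^sup>2 \<le> K * (M x * (u x \<bullet> u x))"
      by (simp only: power2_norm_eq_inner inner_scaleR_left inner_scaleR_right mult.assoc)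
  qed
  also have "\<dots> = K * (mult_op M x \<bullet> x)" using uv by (simp add: mult_op_inner_abs)
  finally show ?thesis .
qed

section \<open>The resolvent of the Dirac operator\<close>

abbreviation mass_op :: "spinor_L2 \<Rightarrow> spinor_L2" where
  "mass_op u \<equiv> sigma_op (mult_op M u)"

lemma mass_op: "bounded_linear mass_op" "mass_op x \<bullet> y = x \<bullet> mass_op y"
    "mass_op (scaleC_spinor \<i> x) = scaleC_spinor \<i> (mass_op x)"
  using bounded_linear_compose[OF sigma_op_bounded_linear mult_op_bounded_linear]
  by (simp_all add: mult_op_scaleC sigma_op_scaleC sigma_op_inner mult_op_inner mult_op_sigma_op[symmetric])

lemma dirac_expr_eq:
  "dirac_expr M u x = (dirac_coeff 1 (wpd UNIV 1 u x) + dirac_coeff 2 (wpd UNIV 2 u x)) + sigma3 *v (M x *\<^sub>R u x)"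
  by (simp add: dirac_expr_def spinor_simps) (simp add: scaleR_conv_of_real algebra_simps)

text \<open>H1 is exactly the domain of the adjoint of the core operator, so the abstract results on
  shifted operators apply to \<open>dirac M\<close>.\<close>

lemma dirac_domain: "u \<in> fst (dirac M) \<longleftrightarrow> (\<exists>F. (u, F) \<in> free_dirac.W)"
  using H1_imp_weak_domain weak_domain_imp_H1 by (auto simp: dirac_def)

lemma dirac_apply:
  assumes W: "(u, F) \<in> free_dirac.W" shows "snd (dirac M) u = F + mass_op u"
proof -
  let ?u = "rep_spinor_L2 u"
  let ?F = "\<lambda>x. dirac_coeff 1 (wpd UNIV 1 ?u x) + dirac_coeff 2 (wpd UNIV 2 ?u x)"
  have H1: "?u \<in> H1 UNIV" by (rule weak_domain_imp_H1[OF W])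
  have F: "F = abs_spinor_L2 ?F"
    by (rule free_dirac.W_unique[OF W H1_imp_weak_domain[OF H1]])
  have sq: "?F \<in> sq_integrable lebesgue"
    by (intro sq_integrable_add sq_integrable_linear_image[OF wpd_UNIV(1)[OF H1] dirac_coeff_linear])
  have "snd (dirac M) u = abs_spinor_L2 (\<lambda>x. ?F x + sigma3 *v (M x *\<^sub>R ?u x))"
    by (simp add: dirac_def dirac_expr_eq[abs_def])
  also have "\<dots> = F + abs_spinor_L2 (\<lambda>x. sigma3 *v (M x *\<^sub>R ?u x))"
    unfolding F by (intro abs_spinor_add[symmetric] sq sigma_sq_integrable mult_op_sq rep_spinor_sq_integrable)
  also have "abs_spinor_L2 (\<lambda>x. sigma3 *v (M x *\<^sub>R ?u x)) = mass_op u"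
    by (simp add: mult_op_def sigma_op_abs mult_op_sq rep_spinor_sq_integrable)
  finally show ?thesis .
qed

lemma dirac_shifted:
  assumes W: "(u, F) \<in> free_dirac.W"
  shows "snd (dirac M) u - scaleC_spinor z u = free_dirac.shifted mass_op (Re z) (Im z) u F"
  unfolding dirac_apply[OF W] scaleC_spinor_decompose[of z] free_dirac.shifted_def by simp

lemma shifted_linear:
  "free_dirac.shifted mass_op a b (u + v) (F + G) = free_dirac.shifted mass_op a b u F + free_dirac.shifted mass_op a b v G"
  "free_dirac.shifted mass_op a b (r *\<^sub>R u) (r *\<^sub>R F) = r *\<^sub>R free_dirac.shifted mass_op a b u F"
  "free_dirac.shifted mass_op a b (u - v) (F - G) = free_dirac.shifted mass_op a b u F - free_dirac.shifted mass_op a b v G"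
proof -
  interpret B: bounded_linear mass_op by (rule mass_op)
  interpret J: bounded_linear "scaleC_spinor \<i>" by (rule free_dirac.J_bounded_linear)
  show "free_dirac.shifted mass_op a b (u + v) (F + G) = free_dirac.shifted mass_op a b u F + free_dirac.shifted mass_op a b v G"
    by (simp add: free_dirac.shifted_def B.add J.add algebra_simps)
  show "free_dirac.shifted mass_op a b (r *\<^sub>R u) (r *\<^sub>R F) = r *\<^sub>R free_dirac.shifted mass_op a b u F"
    by (simp add: free_dirac.shifted_def B.scaleR J.scaleR algebra_simps)
  show "free_dirac.shifted mass_op a b (u - v) (F - G) = free_dirac.shifted mass_op a b u F - free_dirac.shifted mass_op a b v G"
    by (simp add: free_dirac.shifted_def B.diff J.diff algebra_simps)
qed

context
  fixes z :: complex
  assumes z: "Im z \<noteq> 0"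
begin

lemma dirac_bij: "bij_betw (\<lambda>u. snd (dirac M) u - scaleC_spinor z u) (fst (dirac M)) UNIV"
  unfolding bij_betw_def
proof (intro conjI inj_onI)
  fix u v assume uv: "u \<in> fst (dirac M)" "v \<in> fst (dirac M)"
    and eq: "snd (dirac M) u - scaleC_spinor z u = snd (dirac M) v - scaleC_spinor z v"
  obtain F G where W: "(u, F) \<in> free_dirac.W" "(v, G) \<in> free_dirac.W" using uv dirac_domain by auto
  have "free_dirac.shifted mass_op (Re z) (Im z) (u - v) (F - G) = 0"
    using eq by (simp add: shifted_linear dirac_shifted[OF W(1)] dirac_shifted[OF W(2)])
  with free_dirac.shifted_bound[OF mass_op(2,3) free_dirac.W_diff[OF W], of "Im z" "Re z"] z
  show "u = v" by (simp add: mult_le_0_iff)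
next
  show "(\<lambda>u. snd (dirac M) u - scaleC_spinor z u) ` fst (dirac M) = UNIV"
  proof (intro equalityI subset_UNIV subsetI)
    fix f
    obtain u F where W: "(u, F) \<in> free_dirac.W" "free_dirac.shifted mass_op (Re z) (Im z) u F = f"
      by (rule free_dirac.shifted_surj[OF mass_op z]) (rule that)
    have "f = snd (dirac M) u - scaleC_spinor z u" by (simp add: dirac_shifted[OF W(1)] W(2))
    moreover have "u \<in> fst (dirac M)" using W(1) dirac_domain by blast
    ultimately show "f \<in> (\<lambda>u. snd (dirac M) u - scaleC_spinor z u) ` fst (dirac M)" by (rule image_eqI)
  qed
qed

lemma resolvent_dirac:
  obtains F where "(resolvent (dirac M) z f, F) \<in> free_dirac.W"
    "free_dirac.shifted mass_op (Re z) (Im z) (resolvent (dirac M) z f) F = f"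
proof -
  let ?T = "\<lambda>u. snd (dirac M) u - scaleC_spinor z u"
  have "f \<in> ?T ` fst (dirac M)" using dirac_bij by (auto simp: bij_betw_def)
  then have 1: "resolvent (dirac M) z f \<in> fst (dirac M)" "?T (resolvent (dirac M) z f) = f"
    unfolding resolvent_def by (rule inv_into_into, rule f_inv_into_f)
  then obtain F where "(resolvent (dirac M) z f, F) \<in> free_dirac.W" using dirac_domain by blast
  with 1 dirac_shifted that show thesis by metis
qed

lemma resolvent_dirac_unique:
  assumes "(u, F) \<in> free_dirac.W" shows "resolvent (dirac M) z (free_dirac.shifted mass_op (Re z) (Im z) u F) = u"
proof -
  have "u \<in> fst (dirac M)" using assms dirac_domain by blast
  then show ?thesis
    unfolding dirac_shifted[OF assms, symmetric] resolvent_def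
    using dirac_bij by (intro inv_into_f_f) (auto simp: bij_betw_def)
qed

lemma resolvent_dirac_norm: "norm (resolvent (dirac M) z f) \<le> norm f * (1 / \<bar>Im z\<bar>)"
proof -
  obtain F where W: "(resolvent (dirac M) z f, F) \<in> free_dirac.W"
    "free_dirac.shifted mass_op (Re z) (Im z) (resolvent (dirac M) z f) F = f"
    by (rule resolvent_dirac) (rule that)
  from free_dirac.shifted_bound[OF mass_op(2,3) W(1), of "Im z" "Re z"] z
  show ?thesis unfolding W(2) by (simp add: field_simps)
qed

lemma resolvent_dirac_bounded_linear: "bounded_linear (resolvent (dirac M) z)"
proof (rule bounded_linear_intro[OF _ _ resolvent_dirac_norm])
  fix f g :: spinor_L2 and r :: real
  obtain F where W: "(resolvent (dirac M) z f, F) \<in> free_dirac.W"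
    "free_dirac.shifted mass_op (Re z) (Im z) (resolvent (dirac M) z f) F = f"
    by (rule resolvent_dirac) (rule that)
  obtain G where W': "(resolvent (dirac M) z g, G) \<in> free_dirac.W"
    "free_dirac.shifted mass_op (Re z) (Im z) (resolvent (dirac M) z g) G = g"
    by (rule resolvent_dirac) (rule that)
  show "resolvent (dirac M) z (f + g) = resolvent (dirac M) z f + resolvent (dirac M) z g"
    using resolvent_dirac_unique[OF free_dirac.W_add[OF W(1) W'(1)]] by (simp add: shifted_linear W W')
  show "resolvent (dirac M) z (r *\<^sub>R f) = r *\<^sub>R resolvent (dirac M) z f"
    using resolvent_dirac_unique[OF free_dirac.W_scale[OF W(1)]] by (simp add: shifted_linear W)
qed

lemma resolvent_set_dirac: "z \<in> resolvent_set (dirac M)"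
  using dirac_bij resolvent_dirac_bounded_linear by (simp add: resolvent_set_def)

end

end

section \<open>Estimates on a square\<close>

text \<open>Extended nonnegative integrals prevail in these estimates, so that orders of integration
  can be exchanged by Tonelli's theorem with measurability alone.\<close>

lemma path_difference:
  fixes F f :: "real \<Rightarrow> 'a::euclidean_space"
  assumes "a \<le> b" and F: "\<And>x. (F has_vector_derivative f x) (at x)" and f: "continuous_on UNIV f"
  shows "ennreal (norm (F b - F a)) \<le> (\<integral>\<^sup>+s. indicator {a..b} s * ennreal (norm (f s)) \<partial>lborel)"
proof -
  have fc: "continuous_on {a..b} f" using f continuous_on_subset by blast
  have "integrable lborel (\<lambda>x. indicator {a..b} x *\<^sub>R f x)"
    by (intro borel_integrable_compact fc) auto
  moreover have "integral\<^sup>L lborel (\<lambda>x. indicator {a..b} x *\<^sub>R f x) = F b - F a"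
    using F by (intro integral_FTC_atLeastAtMost assms fc) (auto intro: has_vector_derivative_at_within)
  ultimately have "ennreal (norm (F b - F a)) \<le> (\<integral>\<^sup>+s. ennreal (norm (indicator {a..b} s *\<^sub>R f s)) \<partial>lborel)"
    by (metis integral_norm_bound_ennreal)
  also have "\<dots> = (\<integral>\<^sup>+s. indicator {a..b} s * ennreal (norm (f s)) \<partial>lborel)"
    by (intro nn_integral_cong) (auto simp: indicator_def)
  finally show ?thesis .
qed

lemma smooth_path_derivative:
  assumes "smooth f"
  shows "((\<lambda>s. f (c + s *\<^sub>R v)) has_vector_derivative (\<Sum>i\<in>UNIV. v $ i *\<^sub>R pd i f (c + s *\<^sub>R v))) (at s)"
proof -
  have "((\<lambda>t. c + t *\<^sub>R v) has_derivative (\<lambda>h. h *\<^sub>R v)) (at s)"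
    by (auto intro!: derivative_eq_intros)
  from has_derivative_compose[OF this has_derivative_pd[OF smooth_differentiable[OF assms]]]
  show ?thesis
    unfolding has_vector_derivative_def
    by (rule has_derivative_eq_rhs) (auto simp: scaleR_sum_right)
qed

lemma nn_integral_scale:
  fixes f :: "real^2 \<Rightarrow> ennreal"
  assumes [measurable]: "f \<in> borel_measurable borel" and s: "0 < s"
  shows "(\<integral>\<^sup>+x. f x \<partial>lborel) = ennreal (s\<^sup>2) * (\<integral>\<^sup>+y. f (c + s *\<^sub>R (y - c)) \<partial>lborel)"
proof -
  have "(\<integral>\<^sup>+x. f x \<partial>lborel) = (\<integral>\<^sup>+x. f x \<partial>density (distr lborel borel (\<lambda>x. (c - s *\<^sub>R c) + s *\<^sub>R x)) (\<lambda>_. \<bar>s\<bar>^DIM(real^2)))"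
    using lborel_affine[of s "c - s *\<^sub>R c"] s by simp
  also have "\<dots> = (\<integral>\<^sup>+x. ennreal (\<bar>s\<bar> ^ 2) * f ((c - s *\<^sub>R c) + s *\<^sub>R x) \<partial>lborel)"
    by (subst nn_integral_density) (auto simp: nn_integral_distr)
  also have "\<dots> = ennreal (\<bar>s\<bar>\<^sup>2) * (\<integral>\<^sup>+x. f ((c - s *\<^sub>R c) + s *\<^sub>R x) \<partial>lborel)"
    by (rule nn_integral_cmult) measurable
  finally show ?thesis by (simp add: algebra_simps)
qed

lemma nn_integral_translate:
  fixes f :: "'a::euclidean_space \<Rightarrow> ennreal"
  assumes [measurable]: "f \<in> borel_measurable borel"
  shows "(\<integral>\<^sup>+x. f (x + a) \<partial>lborel) = (\<integral>\<^sup>+x. f x \<partial>lborel)"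
proof -
  have "(\<integral>\<^sup>+x. f x \<partial>lborel) = (\<integral>\<^sup>+x. f x \<partial>distr lborel borel ((+) a))"
    by (simp add: lborel_distr_plus)
  also have "\<dots> = (\<integral>\<^sup>+x. f (a + x) \<partial>lborel)" by (subst nn_integral_distr) auto
  finally show ?thesis by (simp add: add.commute)
qed

lemma nn_integral_swap:
  fixes f :: "real \<Rightarrow> 'a::euclidean_space \<Rightarrow> ennreal"
  assumes "case_prod f \<in> borel_measurable (borel \<Otimes>\<^sub>M borel)"
  shows "(\<integral>\<^sup>+y. \<integral>\<^sup>+s. f s y \<partial>lborel \<partial>lborel) = (\<integral>\<^sup>+s. \<integral>\<^sup>+y. f s y \<partial>lborel \<partial>lborel)"
  by (rule lborel_pair.Fubini') (use assms in simp)

text \<open>The integral over the contraction parameter that remains in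
  \<open>homothety_difference\<close> after the change of variables.\<close>

lemma nn_integral_inverse_cube:
  fixes r :: real
  assumes r: "0 < r"
  shows "(\<integral>\<^sup>+s. indicator {r..1} s * ennreal (1 / s ^ 3) \<partial>lborel) \<le> ennreal (1 / (2 * r\<^sup>2))"
proof (cases "r \<le> 1")
  case True
  have "(\<integral>\<^sup>+s. ennreal (1 / s ^ 3) * indicator {r..1} s \<partial>lborel) = ennreal (- 1 / (2 * 1\<^sup>2) - (- 1 / (2 * r\<^sup>2)))"
  proof (rule nn_integral_FTC_Icc)
    fix x assume "x \<in> {r..1}"
    then have x: "r \<le> x" "x \<le> 1" by auto
    show "((\<lambda>s. - 1 / (2 * s\<^sup>2)) has_real_derivative 1 / x ^ 3) (at x)"
      using x r by (auto intro!: derivative_eq_intros simp: power2_eq_square power3_eq_cube field_simps)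
    show "0 \<le> 1 / x ^ 3" using x r by simp
  qed (use True in auto)
  also have "\<dots> \<le> ennreal (1 / (2 * r\<^sup>2))" by (intro ennreal_leI) simp
  finally show ?thesis by (simp add: mult.commute)
qed simp

lemma nn_integral_inverse:
  fixes r :: real
  assumes r: "0 < r" "r \<le> 1"
  shows "(\<integral>\<^sup>+s. indicator {r..1} s * ennreal (1 / s) \<partial>lborel) = ennreal (ln (1 / r))"
proof -
  have "(\<integral>\<^sup>+s. ennreal (1 / s) * indicator {r..1} s \<partial>lborel) = ennreal (ln 1 - ln r)"
  proof (rule nn_integral_FTC_Icc)
    fix x assume "x \<in> {r..1}"
    then have x: "r \<le> x" "x \<le> 1" by auto
    show "(ln has_real_derivative 1 / x) (at x)"
      using x r by (auto intro!: derivative_eq_intros simp: field_simps)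
    show "0 \<le> 1 / x" using x r by simp
  qed (use r in auto)
  then show ?thesis using r by (simp add: mult.commute ln_div)
qed


definition square :: "real^2 \<Rightarrow> real \<Rightarrow> (real^2) set" where
  "square l \<epsilon> = {y. \<forall>i. l $ i < y $ i \<and> y $ i < l $ i + \<epsilon>}"

lemma square_eq_box: "square l \<epsilon> = box l (\<chi> i. l $ i + \<epsilon>)"
  by (auto simp: square_def mem_box_cart)

lemma square_borel [measurable]: "square l \<epsilon> \<in> sets borel"
  by (simp add: square_eq_box)

definition grad_sq :: "(real^2 \<Rightarrow> 'b::real_normed_vector) \<Rightarrow> real^2 \<Rightarrow> real" where
  "grad_sq \<Phi> x = (\<Sum>i\<in>UNIV. (norm (pd i \<Phi> x))\<^sup>2)"

lemma grad_sq_nonneg: "0 \<le> grad_sq \<Phi> x"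
  by (simp add: grad_sq_def sum_nonneg)

lemma grad_sq_measurable: "smooth \<Phi> \<Longrightarrow> grad_sq \<Phi> \<in> borel_measurable borel"
  unfolding grad_sq_def[abs_def]
  by (intro borel_measurable_continuous_onI continuous_intros smooth_continuous smooth_pd)

lemma directional_norm_le:
  fixes \<Phi> :: "real^2 \<Rightarrow> 'b::real_normed_vector"
  shows "norm (\<Sum>i\<in>UNIV. v $ i *\<^sub>R pd i \<Phi> x) \<le> norm v * sqrt (grad_sq \<Phi> x)"
proof -
  have "norm (\<Sum>i\<in>UNIV. v $ i *\<^sub>R pd i \<Phi> x) \<le> (\<Sum>i\<in>UNIV. \<bar>v $ i\<bar> * norm (pd i \<Phi> x))"
    by (rule order_trans[OF norm_sum]) simp
  also have "\<dots> \<le> L2_set (\<lambda>i. \<bar>v $ i\<bar>) UNIV * L2_set (\<lambda>i. norm (pd i \<Phi> x)) UNIV"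
    using L2_set_mult_ineq[of "\<lambda>i. \<bar>v $ i\<bar>" "\<lambda>i. norm (pd i \<Phi> x)" UNIV] by simp
  also have "\<dots> = norm v * sqrt (grad_sq \<Phi> x)"
    by (simp add: L2_set_def norm_vec_def grad_sq_def)
  finally show ?thesis .
qed

section \<open>A function and its contraction towards a point\<close>

text \<open>Cauchy-Schwarz along the segment with the weights s^(-1/2) and s^(1/2): the first one
  integrates to the logarithm, the second one leaves a factor s that the later change of variables
  uses up.\<close>

lemma homothety_path:
  fixes \<Phi> :: "real^2 \<Rightarrow> 'b::euclidean_space"
  assumes sm: "smooth \<Phi>" and \<theta>: "0 < \<theta>" "\<theta> \<le> 1"
  shows "ennreal ((norm (\<Phi> y - \<Phi> (c + \<theta> *\<^sub>R (y - c))))\<^sup>2) \<le>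
    ennreal (ln (1 / \<theta>)) * (\<integral>\<^sup>+s. indicator {\<theta>..1} s * ennreal (s * (norm (y - c))\<^sup>2 * grad_sq \<Phi> (c + s *\<^sub>R (y - c))) \<partial>lborel)"
proof -
  note [measurable] = grad_sq_measurable[OF sm]
  let ?I = "indicator {\<theta>..1} :: real \<Rightarrow> ennreal" and ?g = "\<lambda>s. grad_sq \<Phi> (c + s *\<^sub>R (y - c))"
  let ?G = "\<lambda>s. \<Sum>i\<in>UNIV. (y - c) $ i *\<^sub>R pd i \<Phi> (c + s *\<^sub>R (y - c))"
  have "continuous_on UNIV ?G"
    by (intro continuous_intros continuous_on_compose2[OF smooth_continuous[OF smooth_pd[OF sm], of UNIV]]) auto
  from path_difference[OF \<theta>(2) smooth_path_derivative[OF sm] this]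
  have "ennreal (norm (\<Phi> y - \<Phi> (c + \<theta> *\<^sub>R (y - c)))) \<le> (\<integral>\<^sup>+s. ?I s * ennreal (norm (?G s)) \<partial>lborel)"
    by simp
  also have "\<dots> \<le> (\<integral>\<^sup>+s. (?I s * ennreal (sqrt (1 / s))) * (?I s * ennreal (sqrt (s * (norm (y - c))\<^sup>2 * ?g s))) \<partial>lborel)"
  proof (intro nn_integral_mono)
    fix s
    show "?I s * ennreal (norm (?G s)) \<le> (?I s * ennreal (sqrt (1 / s))) * (?I s * ennreal (sqrt (s * (norm (y - c))\<^sup>2 * ?g s)))"
    proof (cases "s \<in> {\<theta>..1}")
      case True
      then have s: "0 < s" using \<theta> by auto
      have "sqrt (1 / s) * sqrt (s * (norm (y - c))\<^sup>2 * ?g s) = norm (y - c) * sqrt (?g s)"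
        using s by (simp add: real_sqrt_mult real_sqrt_divide)
      with directional_norm_le[of "y - c" \<Phi> "c + s *\<^sub>R (y - c)"]
      have "norm (?G s) \<le> sqrt (1 / s) * sqrt (s * (norm (y - c))\<^sup>2 * ?g s)" by simp
      then have "ennreal (norm (?G s)) \<le> ennreal (sqrt (1 / s)) * ennreal (sqrt (s * (norm (y - c))\<^sup>2 * ?g s))"
        using s grad_sq_nonneg[of \<Phi>] by (simp add: ennreal_mult[symmetric] ennreal_leI)
      with True show ?thesis by simp
    qed simp
  qed
  finally have "(ennreal (norm (\<Phi> y - \<Phi> (c + \<theta> *\<^sub>R (y - c)))))\<^sup>2 \<le>
     (\<integral>\<^sup>+s. (?I s * ennreal (sqrt (1 / s))) * (?I s * ennreal (sqrt (s * (norm (y - c))\<^sup>2 * ?g s))) \<partial>lborel)\<^sup>2"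
    by (intro power_mono) auto
  also have "\<dots> \<le> (\<integral>\<^sup>+s. (?I s * ennreal (sqrt (1 / s)))\<^sup>2 \<partial>lborel) *
      (\<integral>\<^sup>+s. (?I s * ennreal (sqrt (s * (norm (y - c))\<^sup>2 * ?g s)))\<^sup>2 \<partial>lborel)"
    by (rule Cauchy_Schwarz_nn_integral) measurable
  also have "(\<integral>\<^sup>+s. (?I s * ennreal (sqrt (1 / s)))\<^sup>2 \<partial>lborel) = (\<integral>\<^sup>+s. ?I s * ennreal (1 / s) \<partial>lborel)"
    using \<theta> by (intro nn_integral_cong) (auto simp: indicator_def ennreal_power)
  also have "\<dots> = ennreal (ln (1 / \<theta>))" by (rule nn_integral_inverse[OF \<theta>])
  also have "(\<integral>\<^sup>+s. (?I s * ennreal (sqrt (s * (norm (y - c))\<^sup>2 * ?g s)))\<^sup>2 \<partial>lborel) =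
      (\<integral>\<^sup>+s. ?I s * ennreal (s * (norm (y - c))\<^sup>2 * ?g s) \<partial>lborel)"
    using \<theta> grad_sq_nonneg[of \<Phi>] by (intro nn_integral_cong) (auto simp: indicator_def ennreal_power)
  finally show ?thesis by (simp add: ennreal_power)
qed

text \<open>\<open>z\<close> is a convex combination of \<open>c\<close> and a point of the square,
  and the latter is at most a diagonal \<open>sqrt 2 * \<epsilon>\<close> away from
  \<open>c\<close>.\<close>

lemma homothety_in_square:
  assumes c: "\<And>i. l $ i \<le> c $ i" "\<And>i. c $ i \<le> l $ i + \<epsilon>" and s: "0 < s" "s \<le> 1"
    and w: "c + (1 / s) *\<^sub>R (z - c) \<in> square l \<epsilon>"
  shows "z \<in> square l \<epsilon>" "norm (z - c) \<le> s * (sqrt 2 * \<epsilon>)"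
proof -
  let ?w = "c + (1 / s) *\<^sub>R (z - c)"
  have z: "z $ i = (1 - s) * c $ i + s * ?w $ i" for i using s by (simp add: algebra_simps)
  have w': "l $ i < ?w $ i" "?w $ i < l $ i + \<epsilon>" for i using w by (auto simp: square_def)
  show "z \<in> square l \<epsilon>"
    unfolding square_def
  proof (clarify, intro conjI)
    fix i
    have "(1 - s) * l $ i \<le> (1 - s) * c $ i" "s * l $ i < s * ?w $ i"
      using c(1)[of i] w'(1)[of i] s by (auto intro: mult_left_mono)
    then show "l $ i < z $ i" unfolding z[of i] by (simp add: algebra_simps)
    have "(1 - s) * c $ i \<le> (1 - s) * (l $ i + \<epsilon>)" "s * ?w $ i < s * (l $ i + \<epsilon>)"
      using c(2)[of i] w'(2)[of i] s by (auto intro: mult_left_mono)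
    then show "z $ i < l $ i + \<epsilon>" unfolding z[of i] by (simp add: algebra_simps)
  qed
  have \<epsilon>: "0 \<le> \<epsilon>" using c[of 1] by linarith
  have "\<bar>(?w - c) $ i\<bar> \<le> \<epsilon>" for i using w'[of i] c[of i] by (simp add: abs_le_iff)
  then have "((?w - c) $ i)\<^sup>2 \<le> \<epsilon>\<^sup>2" for i
    using power_mono[of "\<bar>(?w - c) $ i\<bar>" \<epsilon> 2] unfolding power2_abs by simp
  then have "norm (?w - c) \<le> sqrt (\<epsilon>\<^sup>2 + \<epsilon>\<^sup>2)"
    unfolding norm_vec_def L2_set_def real_norm_def power2_abs sum_2
    by (intro real_sqrt_le_mono add_mono)
  also have "\<dots> = sqrt 2 * \<epsilon>" using \<epsilon> by (simp add: real_sqrt_mult flip: mult_2)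
  finally have "norm (?w - c) \<le> sqrt 2 * \<epsilon>" .
  moreover have "norm (?w - c) = norm (z - c) / s" using s by simp
  ultimately have "norm (z - c) / s \<le> sqrt 2 * \<epsilon>" by (simp only:)
  then show "norm (z - c) \<le> s * (sqrt 2 * \<epsilon>)"
    using s by (simp add: pos_divide_le_eq mult.commute)
qed

text \<open>Let z = c + s (y - c). For fixed z only parameters s of at least |z - c| / (sqrt 2
  \<epsilon>) contribute, since y lies in the square. Over them s^(-3) integrates to at most
  \<epsilon>^2 / |z - c|^2, which cancels the weight |z - c|^2, so no second logarithm
  arises.\<close>

lemma homothety_difference:
  fixes \<Phi> :: "real^2 \<Rightarrow> 'b::euclidean_space"
  assumes sm: "smooth \<Phi>" and \<theta>: "0 < \<theta>" "\<theta> \<le> 1" and \<epsilon>: "0 < \<epsilon>"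
    and c: "\<And>i. l $ i \<le> c $ i" "\<And>i. c $ i \<le> l $ i + \<epsilon>"
  shows "(\<integral>\<^sup>+y. indicator (square l \<epsilon>) y * ennreal ((norm (\<Phi> y - \<Phi> (c + \<theta> *\<^sub>R (y - c))))\<^sup>2) \<partial>lborel) \<le>
    ennreal (\<epsilon>\<^sup>2 * ln (1 / \<theta>)) * (\<integral>\<^sup>+y. indicator (square l \<epsilon>) y * ennreal (grad_sq \<Phi> y) \<partial>lborel)"
proof -
  note [measurable] = grad_sq_measurable[OF sm]
  let ?I = "indicator {\<theta>..1} :: real \<Rightarrow> ennreal" and ?Y = "indicator (square l \<epsilon>) :: real^2 \<Rightarrow> ennreal"
  let ?g = "grad_sq \<Phi>"
  let ?L = "ennreal (ln (1 / \<theta>))"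
  let ?r = "\<lambda>z. norm (z - c) / (sqrt 2 * \<epsilon>)"
  have "(\<integral>\<^sup>+y. ?Y y * ennreal ((norm (\<Phi> y - \<Phi> (c + \<theta> *\<^sub>R (y - c))))\<^sup>2) \<partial>lborel) \<le>
     (\<integral>\<^sup>+y. ?Y y * (?L * (\<integral>\<^sup>+s. ?I s * ennreal (s * (norm (y - c))\<^sup>2 * ?g (c + s *\<^sub>R (y - c))) \<partial>lborel)) \<partial>lborel)"
    by (intro nn_integral_mono mult_left_mono homothety_path[OF sm \<theta>]) simp
  also have "\<dots> = ?L * (\<integral>\<^sup>+y. \<integral>\<^sup>+s. ?Y y * (?I s * ennreal (s * (norm (y - c))\<^sup>2 * ?g (c + s *\<^sub>R (y - c)))) \<partial>lborel \<partial>lborel)"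
    by (simp add: nn_integral_cmult[symmetric] mult.left_commute)
  also have "(\<integral>\<^sup>+y. \<integral>\<^sup>+s. ?Y y * (?I s * ennreal (s * (norm (y - c))\<^sup>2 * ?g (c + s *\<^sub>R (y - c)))) \<partial>lborel \<partial>lborel) =
     (\<integral>\<^sup>+s. \<integral>\<^sup>+y. ?Y y * (?I s * ennreal (s * (norm (y - c))\<^sup>2 * ?g (c + s *\<^sub>R (y - c)))) \<partial>lborel \<partial>lborel)"
    by (rule nn_integral_swap) measurable
  also have "\<dots> \<le> (\<integral>\<^sup>+s. \<integral>\<^sup>+z. (?Y z * ennreal ((norm (z - c))\<^sup>2 * ?g z)) * (indicator {p. ?r (snd p) \<le> fst p \<and> fst p \<le> 1} (s, z) * ennreal (1 / s ^ 3)) \<partial>lborel \<partial>lborel)"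
  proof (rule nn_integral_mono)
    fix s
    show "(\<integral>\<^sup>+y. ?Y y * (?I s * ennreal (s * (norm (y - c))\<^sup>2 * ?g (c + s *\<^sub>R (y - c)))) \<partial>lborel) \<le>
      (\<integral>\<^sup>+z. (?Y z * ennreal ((norm (z - c))\<^sup>2 * ?g z)) * (indicator {p. ?r (snd p) \<le> fst p \<and> fst p \<le> 1} (s, z) * ennreal (1 / s ^ 3)) \<partial>lborel)"
    proof (cases "s \<in> {\<theta>..1}")
      case True
      then have s: "0 < s" "s \<le> 1" using \<theta> by auto
      \<comment> \<open>The integrand in the variable z = c + s (y - c): the factor s |y - c|^2
        becomes |z - c|^2 / s. The Jacobian contributes the remaining
        \<open>1 / s\<^sup>2\<close>.\<close>
      define h where "h z = ?Y (c + (1 / s) *\<^sub>R (z - c)) * ennreal ((norm (z - c))\<^sup>2 * ?g z / s)" for z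
      have [measurable]: "h \<in> borel_measurable borel" unfolding h_def by measurable
      have eq: "?Y y * (?I s * ennreal (s * (norm (y - c))\<^sup>2 * ?g (c + s *\<^sub>R (y - c)))) = h (c + s *\<^sub>R (y - c))" for y
        using True s by (simp add: h_def power_mult_distrib power2_eq_square mult_ac)
      have "ennreal (s\<^sup>2) * (\<integral>\<^sup>+y. ?Y y * (?I s * ennreal (s * (norm (y - c))\<^sup>2 * ?g (c + s *\<^sub>R (y - c)))) \<partial>lborel) = (\<integral>\<^sup>+z. h z \<partial>lborel)"
        unfolding eq by (rule nn_integral_scale[symmetric]) (use s in auto)
      then have "ennreal (1 / s\<^sup>2) * (ennreal (s\<^sup>2) * (\<integral>\<^sup>+y. ?Y y * (?I s * ennreal (s * (norm (y - c))\<^sup>2 * ?g (c + s *\<^sub>R (y - c)))) \<partial>lborel)) = ennreal (1 / s\<^sup>2) * (\<integral>\<^sup>+z. h z \<partial>lborel)"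
        by simp
      moreover have "ennreal (1 / s\<^sup>2) * ennreal (s\<^sup>2) = 1" using s by (simp add: ennreal_mult[symmetric])
      ultimately have "(\<integral>\<^sup>+y. ?Y y * (?I s * ennreal (s * (norm (y - c))\<^sup>2 * ?g (c + s *\<^sub>R (y - c)))) \<partial>lborel) = ennreal (1 / s\<^sup>2) * (\<integral>\<^sup>+z. h z \<partial>lborel)"
        by (simp add: mult.assoc[symmetric])
      also have "\<dots> = (\<integral>\<^sup>+z. ennreal (1 / s\<^sup>2) * h z \<partial>lborel)" by (rule nn_integral_cmult[symmetric]) measurable
      also have "\<dots> \<le> (\<integral>\<^sup>+z. (?Y z * ennreal ((norm (z - c))\<^sup>2 * ?g z)) * (indicator {p. ?r (snd p) \<le> fst p \<and> fst p \<le> 1} (s, z) * ennreal (1 / s ^ 3)) \<partial>lborel)"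
      proof (intro nn_integral_mono)
        fix z
        show "ennreal (1 / s\<^sup>2) * h z \<le> (?Y z * ennreal ((norm (z - c))\<^sup>2 * ?g z)) * (indicator {p. ?r (snd p) \<le> fst p \<and> fst p \<le> 1} (s, z) * ennreal (1 / s ^ 3))"
        proof (cases "c + (1 / s) *\<^sub>R (z - c) \<in> square l \<epsilon>")
          case in_Y: True
          from homothety_in_square[OF c s in_Y] \<epsilon> have "z \<in> square l \<epsilon>" "?r z \<le> s"
            by (auto simp: field_simps)
          with in_Y s \<theta> show ?thesis
            by (simp add: h_def ennreal_mult[symmetric] grad_sq_nonneg power2_eq_square power3_eq_cube)
        qed (simp add: h_def)
      qed
      finally show ?thesis .
    qed simp
  qed
  also have "\<dots> = (\<integral>\<^sup>+z. \<integral>\<^sup>+s. (?Y z * ennreal ((norm (z - c))\<^sup>2 * ?g z)) * (indicator {p. ?r (snd p) \<le> fst p \<and> fst p \<le> 1} (s, z) * ennreal (1 / s ^ 3)) \<partial>lborel \<partial>lborel)"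
    by (rule nn_integral_swap[symmetric]) measurable
  also have "\<dots> \<le> (\<integral>\<^sup>+z. ennreal (\<epsilon>\<^sup>2) * (?Y z * ennreal (?g z)) \<partial>lborel)"
  proof (intro nn_integral_mono)
    fix z
    have "(\<integral>\<^sup>+s. (?Y z * ennreal ((norm (z - c))\<^sup>2 * ?g z)) * (indicator {p. ?r (snd p) \<le> fst p \<and> fst p \<le> 1} (s, z) * ennreal (1 / s ^ 3)) \<partial>lborel) =
       (\<integral>\<^sup>+s. (?Y z * ennreal ((norm (z - c))\<^sup>2 * ?g z)) * (indicator {?r z..1} s * ennreal (1 / s ^ 3)) \<partial>lborel)"
      by (intro nn_integral_cong) (auto simp: indicator_def)
    also have "\<dots> = (?Y z * ennreal ((norm (z - c))\<^sup>2 * ?g z)) * (\<integral>\<^sup>+s. indicator {?r z..1} s * ennreal (1 / s ^ 3) \<partial>lborel)"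
      by (rule nn_integral_cmult) measurable
    also have "\<dots> \<le> ennreal (\<epsilon>\<^sup>2) * (?Y z * ennreal (?g z))"
    proof (cases "z = c")
      case False
      then have "0 < ?r z" using \<epsilon> by simp
      from nn_integral_inverse_cube[OF this]
      have "(?Y z * ennreal ((norm (z - c))\<^sup>2 * ?g z)) * (\<integral>\<^sup>+s. indicator {?r z..1} s * ennreal (1 / s ^ 3) \<partial>lborel)
         \<le> (?Y z * ennreal ((norm (z - c))\<^sup>2 * ?g z)) * ennreal (1 / (2 * (?r z)\<^sup>2))"
        by (intro mult_left_mono) auto
      also have "\<dots> = ?Y z * ennreal ((norm (z - c))\<^sup>2 * ?g z * (1 / (2 * (?r z)\<^sup>2)))"
        by (subst ennreal_mult) (auto simp: grad_sq_nonneg mult.assoc)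
      also have "(norm (z - c))\<^sup>2 * ?g z * (1 / (2 * (?r z)\<^sup>2)) = \<epsilon>\<^sup>2 * ?g z"
        using False by (simp add: power_divide power_mult_distrib field_simps)
      finally show ?thesis by (simp add: ennreal_mult' mult.left_commute)
    qed simp
    finally show "(\<integral>\<^sup>+s. (?Y z * ennreal ((norm (z - c))\<^sup>2 * ?g z)) * (indicator {p. ?r (snd p) \<le> fst p \<and> fst p \<le> 1} (s, z) * ennreal (1 / s ^ 3)) \<partial>lborel) \<le> ennreal (\<epsilon>\<^sup>2) * (?Y z * ennreal (?g z))" .
  qed
  also have "\<dots> = ennreal (\<epsilon>\<^sup>2) * (\<integral>\<^sup>+z. ?Y z * ennreal (?g z) \<partial>lborel)"
    by (rule nn_integral_cmult) measurable
  finally show ?thesis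
    using \<theta> by (simp add: ennreal_mult' mult.assoc mult.left_commute mult_left_mono)
qed

text \<open>The change of variables yields the area factor \<open>\<theta>\<^sup>2\<close>;
  replacing the contracted function by the original one costs the factor 2 and the difference just
  estimated.\<close>

lemma homothety_estimate:
  fixes \<Phi> :: "real^2 \<Rightarrow> 'b::euclidean_space"
  assumes sm: "smooth \<Phi>" and \<theta>: "0 < \<theta>" "\<theta> \<le> 1" and \<epsilon>: "0 < \<epsilon>"
    and c: "\<And>i. l $ i \<le> c $ i" "\<And>i. c $ i \<le> l $ i + \<epsilon>"
  shows "(\<integral>\<^sup>+x. indicator (square l \<epsilon>) (c + (1 / \<theta>) *\<^sub>R (x - c)) * ennreal ((norm (\<Phi> x))\<^sup>2) \<partial>lborel) \<le>
    ennreal (2 * \<theta>\<^sup>2) * ((\<integral>\<^sup>+y. indicator (square l \<epsilon>) y * ennreal ((norm (\<Phi> y))\<^sup>2) \<partial>lborel) +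
      ennreal (\<epsilon>\<^sup>2 * ln (1 / \<theta>)) * (\<integral>\<^sup>+y. indicator (square l \<epsilon>) y * ennreal (grad_sq \<Phi> y) \<partial>lborel))"
proof -
  let ?Y = "indicator (square l \<epsilon>) :: real^2 \<Rightarrow> ennreal"
  have [measurable]: "\<Phi> \<in> borel_measurable borel"
    by (intro borel_measurable_continuous_onI smooth_continuous sm)
  let ?A = "\<integral>\<^sup>+y. ?Y y * ennreal ((norm (\<Phi> y))\<^sup>2) \<partial>lborel"
  let ?B = "\<integral>\<^sup>+y. ?Y y * ennreal ((norm (\<Phi> y - \<Phi> (c + \<theta> *\<^sub>R (y - c))))\<^sup>2) \<partial>lborel"
  have "(\<integral>\<^sup>+x. ?Y (c + (1 / \<theta>) *\<^sub>R (x - c)) * ennreal ((norm (\<Phi> x))\<^sup>2) \<partial>lborel) =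
     ennreal (\<theta>\<^sup>2) * (\<integral>\<^sup>+y. ?Y y * ennreal ((norm (\<Phi> (c + \<theta> *\<^sub>R (y - c))))\<^sup>2) \<partial>lborel)"
    by (subst nn_integral_scale[OF _ \<theta>(1), of _ c]) (use \<theta> in auto)
  also have "(\<integral>\<^sup>+y. ?Y y * ennreal ((norm (\<Phi> (c + \<theta> *\<^sub>R (y - c))))\<^sup>2) \<partial>lborel) \<le>
      (\<integral>\<^sup>+y. 2 * (?Y y * ennreal ((norm (\<Phi> y))\<^sup>2)) + 2 * (?Y y * ennreal ((norm (\<Phi> y - \<Phi> (c + \<theta> *\<^sub>R (y - c))))\<^sup>2)) \<partial>lborel)"
  proof (intro nn_integral_mono)
    fix y
    let ?v = "\<Phi> (c + \<theta> *\<^sub>R (y - c))"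
    have "norm ?v \<le> norm (\<Phi> y) + norm (\<Phi> y - ?v)"
      using norm_triangle_ineq4[of "\<Phi> y" "\<Phi> y - ?v"] by simp
    then have "(norm ?v)\<^sup>2 \<le> (norm (\<Phi> y) + norm (\<Phi> y - ?v))\<^sup>2" by (intro power_mono) auto
    also have "\<dots> \<le> 2 * (norm (\<Phi> y))\<^sup>2 + 2 * (norm (\<Phi> y - ?v))\<^sup>2"
      using sum_squares_bound[of "norm (\<Phi> y)" "norm (\<Phi> y - ?v)"] by (simp add: power2_sum)
    finally have "ennreal ((norm ?v)\<^sup>2) \<le> ennreal (2 * (norm (\<Phi> y))\<^sup>2 + 2 * (norm (\<Phi> y - ?v))\<^sup>2)"
      by (rule ennreal_leI)
    also have "\<dots> = 2 * ennreal ((norm (\<Phi> y))\<^sup>2) + 2 * ennreal ((norm (\<Phi> y - ?v))\<^sup>2)"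
      by (simp add: ennreal_mult')
    finally show "?Y y * ennreal ((norm ?v)\<^sup>2) \<le> 2 * (?Y y * ennreal ((norm (\<Phi> y))\<^sup>2)) + 2 * (?Y y * ennreal ((norm (\<Phi> y - ?v))\<^sup>2))"
      by (auto simp: indicator_def)
  qed
  also have "\<dots> = 2 * ?A + 2 * ?B"
    by (simp add: nn_integral_add nn_integral_cmult)
  also have "\<dots> \<le> 2 * ?A + 2 * (ennreal (\<epsilon>\<^sup>2 * ln (1 / \<theta>)) * (\<integral>\<^sup>+y. ?Y y * ennreal (grad_sq \<Phi> y) \<partial>lborel))"
    by (intro add_left_mono mult_left_mono homothety_difference assms) auto
  finally have "(\<integral>\<^sup>+x. ?Y (c + (1 / \<theta>) *\<^sub>R (x - c)) * ennreal ((norm (\<Phi> x))\<^sup>2) \<partial>lborel) \<le>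
     ennreal (\<theta>\<^sup>2) * (2 * ?A + 2 * (ennreal (\<epsilon>\<^sup>2 * ln (1 / \<theta>)) * (\<integral>\<^sup>+y. ?Y y * ennreal (grad_sq \<Phi> y) \<partial>lborel)))"
    by (simp add: mult_left_mono)
  also have "\<dots> = ennreal (2 * \<theta>\<^sup>2) * (?A + ennreal (\<epsilon>\<^sup>2 * ln (1 / \<theta>)) * (\<integral>\<^sup>+y. ?Y y * ennreal (grad_sq \<Phi> y) \<partial>lborel))"
    by (simp add: ennreal_mult' distrib_left mult_ac)
  finally show ?thesis .
qed

section \<open>Averages along axis-parallel lines\<close>

text \<open>A given point z is reached from \<open>A\<close> only by translations t in an interval
  of length \<open>\<omega> - \<alpha>\<close>, so Tonelli's theorem gains the extent of
  \<open>A\<close> in the direction of the lines.\<close>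

lemma line_average:
  fixes u :: "real^2 \<Rightarrow> ennreal"
  assumes [measurable]: "u \<in> borel_measurable borel" "A \<in> sets borel"
    and A: "\<And>x. x \<in> A \<Longrightarrow> \<alpha> \<le> x $ i \<and> x $ i \<le> \<omega>"
  shows "(\<integral>\<^sup>+x. indicator A x * (\<integral>\<^sup>+t. u (x + t *\<^sub>R axis i 1) \<partial>lborel) \<partial>lborel) \<le> ennreal (\<omega> - \<alpha>) * (\<integral>\<^sup>+x. u x \<partial>lborel)"
proof -
  let ?e = "axis i 1 :: real^2" and ?A = "indicator A :: real^2 \<Rightarrow> ennreal"
  have "(\<integral>\<^sup>+x. ?A x * (\<integral>\<^sup>+t. u (x + t *\<^sub>R ?e) \<partial>lborel) \<partial>lborel) =
      (\<integral>\<^sup>+x. \<integral>\<^sup>+t. ?A x * u (x + t *\<^sub>R ?e) \<partial>lborel \<partial>lborel)"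
    by (intro nn_integral_cong nn_integral_cmult[symmetric]) measurable
  also have "\<dots> = (\<integral>\<^sup>+t. \<integral>\<^sup>+x. ?A x * u (x + t *\<^sub>R ?e) \<partial>lborel \<partial>lborel)"
    by (rule nn_integral_swap) measurable
  also have "\<dots> = (\<integral>\<^sup>+t. \<integral>\<^sup>+z. ?A (z - t *\<^sub>R ?e) * u z \<partial>lborel \<partial>lborel)"
  proof (rule nn_integral_cong)
    fix t :: real
    have "(\<integral>\<^sup>+x. (\<lambda>z. ?A (z - t *\<^sub>R ?e) * u z) (x + t *\<^sub>R ?e) \<partial>lborel) = (\<integral>\<^sup>+z. ?A (z - t *\<^sub>R ?e) * u z \<partial>lborel)"
      by (rule nn_integral_translate) measurable
    then show "(\<integral>\<^sup>+x. ?A x * u (x + t *\<^sub>R ?e) \<partial>lborel) = (\<integral>\<^sup>+z. ?A (z - t *\<^sub>R ?e) * u z \<partial>lborel)" by simp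
  qed
  also have "\<dots> = (\<integral>\<^sup>+z. \<integral>\<^sup>+t. ?A (z - t *\<^sub>R ?e) * u z \<partial>lborel \<partial>lborel)"
    by (rule nn_integral_swap[symmetric]) measurable
  also have "\<dots> \<le> (\<integral>\<^sup>+z. ennreal (\<omega> - \<alpha>) * u z \<partial>lborel)"
  proof (rule nn_integral_mono)
    fix z
    have "(\<integral>\<^sup>+t. ?A (z - t *\<^sub>R ?e) * u z \<partial>lborel) \<le> (\<integral>\<^sup>+t. u z * indicator {z $ i - \<omega>..z $ i - \<alpha>} t \<partial>lborel)"
    proof (rule nn_integral_mono)
      fix t
      show "?A (z - t *\<^sub>R ?e) * u z \<le> u z * indicator {z $ i - \<omega>..z $ i - \<alpha>} t"
        using A[of "z - t *\<^sub>R ?e"] by (auto simp: indicator_def axis_def)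
    qed
    also have "\<dots> = u z * emeasure lborel {z $ i - \<omega>..z $ i - \<alpha>}" by (rule nn_integral_cmult_indicator) simp
    also have "\<dots> \<le> u z * ennreal (\<omega> - \<alpha>)"
      by (intro mult_left_mono) (auto simp: emeasure_lborel_Icc_eq)
    finally show "(\<integral>\<^sup>+t. ?A (z - t *\<^sub>R ?e) * u z \<partial>lborel) \<le> ennreal (\<omega> - \<alpha>) * u z" by (simp add: mult.commute)
  qed
  also have "\<dots> = ennreal (\<omega> - \<alpha>) * (\<integral>\<^sup>+z. u z \<partial>lborel)" by (rule nn_integral_cmult) measurable
  finally show ?thesis .
qed

text \<open>The segment stays in the square by convexity, for either sign of \<open>r\<close>.
  Extending the integral to the whole line makes the bound independent of the far endpoint, so that
  it can be averaged.\<close>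

lemma line_bound:
  fixes f :: "real^2 \<Rightarrow> real"
  assumes sm: "smooth f" and y: "y \<in> square l \<epsilon>" "y + r *\<^sub>R axis i 1 \<in> square l \<epsilon>"
  shows "ennreal \<bar>f (y + r *\<^sub>R axis i 1) - f y\<bar> \<le>
    (\<integral>\<^sup>+t. (\<lambda>z. indicator (square l \<epsilon>) z * ennreal \<bar>pd i f z\<bar>) (y + t *\<^sub>R axis i 1) \<partial>lborel)"
proof -
  let ?e = "axis i 1 :: real^2"
  define a b where "a = min 0 r" and "b = max 0 r"
  have d: "((\<lambda>t. f (y + t *\<^sub>R ?e)) has_vector_derivative pd i f (y + t *\<^sub>R ?e)) (at t)" for t
    using smooth_line_derivative[OF sm, of y i t] by (simp add: has_real_derivative_iff_has_vector_derivative)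
  have c: "continuous_on UNIV (\<lambda>t. pd i f (y + t *\<^sub>R ?e))"
    by (intro continuous_intros continuous_on_compose2[OF smooth_continuous[OF smooth_pd[OF sm], of UNIV]]) auto
  have "a \<le> b" by (simp add: a_def b_def)
  from path_difference[OF this d c]
  have "ennreal (norm (f (y + b *\<^sub>R ?e) - f (y + a *\<^sub>R ?e))) \<le> (\<integral>\<^sup>+t. indicator {a..b} t * ennreal (norm (pd i f (y + t *\<^sub>R ?e))) \<partial>lborel)" .
  also have "\<dots> \<le> (\<integral>\<^sup>+t. (\<lambda>z. indicator (square l \<epsilon>) z * ennreal \<bar>pd i f z\<bar>) (y + t *\<^sub>R ?e) \<partial>lborel)"
  proof (rule nn_integral_mono)
    fix t
    have "y + t *\<^sub>R ?e \<in> square l \<epsilon>" if "t \<in> {a..b}"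
      unfolding square_def
    proof (clarify, intro conjI)
      fix j
      show "l $ j < (y + t *\<^sub>R ?e) $ j" "(y + t *\<^sub>R ?e) $ j < l $ j + \<epsilon>"
        using y that unfolding square_def a_def b_def
        by (cases "j = i"; cases "0 \<le> r"; force simp: axis_def dest: spec[of _ j])+
    qed
    then show "indicator {a..b} t * ennreal (norm (pd i f (y + t *\<^sub>R ?e))) \<le> (\<lambda>z. indicator (square l \<epsilon>) z * ennreal \<bar>pd i f z\<bar>) (y + t *\<^sub>R ?e)"
      by (auto simp: indicator_def)
  qed
  also have "norm (f (y + b *\<^sub>R ?e) - f (y + a *\<^sub>R ?e)) = \<bar>f (y + r *\<^sub>R ?e) - f y\<bar>"
    by (cases "0 \<le> r") (auto simp: a_def b_def)
  finally show ?thesis .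
qed

lemma measure_square: "0 < \<epsilon> \<Longrightarrow> emeasure lborel (square l \<epsilon>) = ennreal (\<epsilon>\<^sup>2)"
proof -
  assume \<epsilon>: "0 < \<epsilon>"
  let ?h = "\<chi> i. l $ i + \<epsilon>"
  have "(\<Prod>b\<in>Basis. (?h - l) \<bullet> b) = \<epsilon>\<^sup>2"
    by (simp add: Basis_vec_def inner_axis UNIV_2 axis_eq_axis power2_eq_square)
  moreover have "l \<bullet> b \<le> ?h \<bullet> b" if "b \<in> Basis" for b :: "real^2"
    using that \<epsilon> by (auto simp: Basis_vec_def inner_axis)
  ultimately show ?thesis
    unfolding square_eq_box by (subst emeasure_lborel_box) auto
qed

text \<open>A point x of \<open>D\<close> and a point y of the square are joined through a corner:
  vertically from x, then horizontally to y. After integration over both, the vertical part costs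
  the extent \<open>2 * r\<close> of \<open>D\<close> times the area
  \<open>\<epsilon>\<^sup>2\<close> of the square, the horizontal part costs \<epsilon> times the
  area of \<open>D\<close>.\<close>

lemma square_average:
  fixes f :: "real^2 \<Rightarrow> real"
  assumes f: "cc_smooth f" and D: "D \<in> sets borel" "D \<subseteq> square l \<epsilon>" "D \<subseteq> ball p r" and \<epsilon>: "0 < \<epsilon>" and r: "0 < r"
  shows "\<bar>\<epsilon>\<^sup>2 * (LINT x:D|lborel. f x) - measure lborel D * (LINT x:square l \<epsilon>|lborel. f x)\<bar> \<le>
    \<epsilon>\<^sup>2 * (2 * r) * (LINT x:square l \<epsilon>|lborel. \<bar>pd 2 f x\<bar>) +
    measure lborel D * \<epsilon> * (LINT x:square l \<epsilon>|lborel. \<bar>pd 1 f x\<bar>)"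
proof -
  note sm = cc_smooth_imp_smooth[OF f]
  note [measurable] = D(1) cc_smooth_measurable[OF f] cc_smooth_measurable[OF cc_smooth_pd[OF f]]
  let ?Y = "square l \<epsilon>"
  define u where "u i z = indicator ?Y z * ennreal \<bar>pd i f z\<bar>" for i z
  have [measurable]: "u i \<in> borel_measurable borel" for i unfolding u_def by measurable
  define G where "G i x = (\<integral>\<^sup>+t. u i (x + t *\<^sub>R axis i 1) \<partial>lborel)" for i x
  have [measurable]: "G i \<in> borel_measurable borel" for i unfolding G_def by measurable
  define \<mu> where "\<mu> = measure lborel D"
  have emD: "emeasure lborel D = ennreal \<mu>"
  proof -
    have "emeasure lborel D \<le> emeasure lborel ?Y" by (intro emeasure_mono D) simp
    also have "\<dots> < \<infinity>" by (simp add: measure_square \<epsilon>)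
    finally show ?thesis unfolding \<mu>_def by (intro emeasure_eq_ennreal_measure) simp
  qed
  have \<mu>0: "0 \<le> \<mu>" by (simp add: \<mu>_def)
  have mY: "measure lborel ?Y = \<epsilon>\<^sup>2" using measure_square[OF \<epsilon>, of l] by (simp add: measure_def)
  have intf: "integrable lborel f" by (rule cc_smooth_integrable[OF f])
  have intpd: "integrable lborel (pd i f)" for i by (rule cc_smooth_integrable[OF cc_smooth_pd[OF f]])
  have iY: "integrable lborel (\<lambda>x. indicator ?Y x *\<^sub>R f x)" and iD: "integrable lborel (\<lambda>x. indicator D x *\<^sub>R f x)"
    by (intro integrable_mult_indicator intf; simp)+
  have cY: "integrable lborel (\<lambda>x. indicator ?Y x *\<^sub>R c)" and cD: "integrable lborel (\<lambda>x. indicator D x *\<^sub>R c)" for c :: real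
    using \<epsilon> emD by (auto simp: measure_square less_top[symmetric])
  have I: "(\<integral>\<^sup>+x. u i x \<partial>lborel) = ennreal (LINT x:?Y|lborel. \<bar>pd i f x\<bar>)" for i
  proof -
    have "integrable lborel (\<lambda>x. indicator ?Y x *\<^sub>R \<bar>pd i f x\<bar>)"
      using integrable_abs[OF intpd] by (intro integrable_mult_indicator) auto
    then have "(\<integral>\<^sup>+x. ennreal (indicator ?Y x *\<^sub>R \<bar>pd i f x\<bar>) \<partial>lborel) = ennreal (LINT x:?Y|lborel. \<bar>pd i f x\<bar>)"
      unfolding set_lebesgue_integral_def by (intro nn_integral_eq_integral) auto
    moreover have "(\<integral>\<^sup>+x. u i x \<partial>lborel) = (\<integral>\<^sup>+x. ennreal (indicator ?Y x *\<^sub>R \<bar>pd i f x\<bar>) \<partial>lborel)"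
      by (intro nn_integral_cong) (auto simp: u_def indicator_def)
    ultimately show ?thesis by simp
  qed
  have pt: "ennreal \<bar>f x - f y\<bar> \<le> G 2 x + G 1 y" if x: "x \<in> ?Y" and y: "y \<in> ?Y" for x y
  proof -
    define z where "z = x + (y $ 2 - x $ 2) *\<^sub>R axis 2 1"
    have z': "z = y + (x $ 1 - y $ 1) *\<^sub>R axis 1 1"
      by (simp add: z_def vec_eq_iff forall_2 axis_def)
    have zY: "z \<in> ?Y" using x y by (auto simp: z_def square_def forall_2 axis_def)
    have "ennreal \<bar>f z - f x\<bar> \<le> G 2 x"
      using line_bound[OF sm x, of "y $ 2 - x $ 2" 2] zY by (simp add: G_def u_def z_def)
    moreover have "ennreal \<bar>f z - f y\<bar> \<le> G 1 y"
      using line_bound[OF sm y, of "x $ 1 - y $ 1" 1] zY by (simp add: G_def u_def z')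
    moreover have "ennreal \<bar>f x - f y\<bar> \<le> ennreal \<bar>f z - f x\<bar> + ennreal \<bar>f z - f y\<bar>"
      by (subst ennreal_plus[symmetric]) (auto simp del: ennreal_plus intro!: ennreal_leI)
    ultimately show ?thesis by (meson add_mono order_trans)
  qed
  define b where "b = (LINT x:?Y|lborel. f x)"
  have inner: "ennreal \<bar>\<epsilon>\<^sup>2 * f x - b\<bar> \<le> ennreal (\<epsilon>\<^sup>2) * G 2 x + (\<integral>\<^sup>+y. indicator ?Y y * G 1 y \<partial>lborel)" if x: "x \<in> D" for x
  proof -
    have "\<epsilon>\<^sup>2 * f x - b = (LINT y|lborel. indicator ?Y y *\<^sub>R f x - indicator ?Y y *\<^sub>R f y)"
      unfolding b_def set_lebesgue_integral_def using cY iY by (simp add: mY mult.commute)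
    then have "ennreal \<bar>\<epsilon>\<^sup>2 * f x - b\<bar> \<le> (\<integral>\<^sup>+y. ennreal (norm (indicator ?Y y *\<^sub>R f x - indicator ?Y y *\<^sub>R f y)) \<partial>lborel)"
      using integral_norm_bound_ennreal[OF Bochner_Integration.integrable_diff[OF cY[of "f x"] iY]] by simp
    also have "\<dots> \<le> (\<integral>\<^sup>+y. G 2 x * indicator ?Y y + indicator ?Y y * G 1 y \<partial>lborel)"
    proof (rule nn_integral_mono)
      fix y
      show "ennreal (norm (indicator ?Y y *\<^sub>R f x - indicator ?Y y *\<^sub>R f y)) \<le> G 2 x * indicator ?Y y + indicator ?Y y * G 1 y"
        using pt[of x y] x D by (cases "y \<in> ?Y") auto
    qed
    also have "\<dots> = G 2 x * ennreal (\<epsilon>\<^sup>2) + (\<integral>\<^sup>+y. indicator ?Y y * G 1 y \<partial>lborel)"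
      by (subst nn_integral_add) (auto simp: nn_integral_cmult_indicator measure_square \<epsilon>)
    finally show ?thesis by (simp add: mult.commute)
  qed
  have G1: "(\<integral>\<^sup>+y. indicator ?Y y * G 1 y \<partial>lborel) \<le> ennreal \<epsilon> * ennreal (LINT x:?Y|lborel. \<bar>pd 1 f x\<bar>)"
    using line_average[of "u 1" ?Y "l $ 1" 1 "l $ 1 + \<epsilon>"] I[of 1]
    by (auto simp: G_def square_def intro: less_imp_le)
  have G2: "(\<integral>\<^sup>+y. indicator D y * G 2 y \<partial>lborel) \<le> ennreal (2 * r) * ennreal (LINT x:?Y|lborel. \<bar>pd 2 f x\<bar>)"
  proof -
    have "p $ 2 - r \<le> x $ 2 \<and> x $ 2 \<le> p $ 2 + r" if "x \<in> D" for x
    proof -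
      have "norm (p - x) < r" using that D by (auto simp: dist_norm)
      then show ?thesis using component_le_norm_cart[of "p - x" 2] by (simp add: abs_le_iff)
    qed
    then show ?thesis using line_average[of "u 2" D "p $ 2 - r" 2 "p $ 2 + r"] I[of 2] by (simp add: G_def)
  qed
  have "\<epsilon>\<^sup>2 * (LINT x:D|lborel. f x) - \<mu> * b = (LINT x|lborel. \<epsilon>\<^sup>2 * (indicator D x *\<^sub>R f x) - indicator D x *\<^sub>R b)"
    unfolding set_lebesgue_integral_def using cD iD by (simp add: \<mu>_def mult.commute)
  then have "ennreal \<bar>\<epsilon>\<^sup>2 * (LINT x:D|lborel. f x) - \<mu> * b\<bar> \<le> (\<integral>\<^sup>+x. ennreal (norm (\<epsilon>\<^sup>2 * (indicator D x *\<^sub>R f x) - indicator D x *\<^sub>R b)) \<partial>lborel)"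
    using integral_norm_bound_ennreal[OF Bochner_Integration.integrable_diff[OF integrable_mult_right[OF iD, of "\<epsilon>\<^sup>2"] cD[of b]]] by simp
  also have "\<dots> \<le> (\<integral>\<^sup>+x. ennreal (\<epsilon>\<^sup>2) * (indicator D x * G 2 x) + (\<integral>\<^sup>+y. indicator ?Y y * G 1 y \<partial>lborel) * indicator D x \<partial>lborel)"
  proof (rule nn_integral_mono)
    fix x
    show "ennreal (norm (\<epsilon>\<^sup>2 * (indicator D x *\<^sub>R f x) - indicator D x *\<^sub>R b)) \<le>
       ennreal (\<epsilon>\<^sup>2) * (indicator D x * G 2 x) + (\<integral>\<^sup>+y. indicator ?Y y * G 1 y \<partial>lborel) * indicator D x"
      using inner[of x] by (cases "x \<in> D") auto
  qed
  also have "\<dots> = ennreal (\<epsilon>\<^sup>2) * (\<integral>\<^sup>+x. indicator D x * G 2 x \<partial>lborel) + (\<integral>\<^sup>+y. indicator ?Y y * G 1 y \<partial>lborel) * ennreal \<mu>"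
    by (subst nn_integral_add) (auto simp: nn_integral_cmult_indicator nn_integral_cmult emD)
  also have "\<dots> \<le> ennreal (\<epsilon>\<^sup>2) * (ennreal (2 * r) * ennreal (LINT x:?Y|lborel. \<bar>pd 2 f x\<bar>)) +
      (ennreal \<epsilon> * ennreal (LINT x:?Y|lborel. \<bar>pd 1 f x\<bar>)) * ennreal \<mu>"
    by (intro add_mono mult_left_mono mult_right_mono G1 G2) auto
  also have "\<dots> = ennreal (\<epsilon>\<^sup>2 * (2 * r) * (LINT x:?Y|lborel. \<bar>pd 2 f x\<bar>) + \<mu> * \<epsilon> * (LINT x:?Y|lborel. \<bar>pd 1 f x\<bar>))"
  proof -
    have nn: "0 \<le> (LINT x:?Y|lborel. \<bar>pd i f x\<bar>)" for i
      unfolding set_lebesgue_integral_def by (intro integral_nonneg_AE) auto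
    show ?thesis using nn[of 1] nn[of 2] \<mu>0 \<epsilon> r
      by (simp add: ennreal_mult[symmetric] ennreal_plus[symmetric] mult_ac del: ennreal_plus)
  qed
  finally have "\<bar>\<epsilon>\<^sup>2 * (LINT x:D|lborel. f x) - \<mu> * b\<bar> \<le> \<epsilon>\<^sup>2 * (2 * r) * (LINT x:?Y|lborel. \<bar>pd 2 f x\<bar>) + \<mu> * \<epsilon> * (LINT x:?Y|lborel. \<bar>pd 1 f x\<bar>)"
  proof (subst (asm) ennreal_le_iff)
    have nn: "0 \<le> (LINT x:?Y|lborel. \<bar>pd i f x\<bar>)" for i
      unfolding set_lebesgue_integral_def by (intro integral_nonneg_AE) auto
    show "0 \<le> \<epsilon>\<^sup>2 * (2 * r) * (LINT x:?Y|lborel. \<bar>pd 2 f x\<bar>) + \<mu> * \<epsilon> * (LINT x:?Y|lborel. \<bar>pd 1 f x\<bar>)"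
      using nn[of 1] nn[of 2] \<mu>0 \<epsilon> r by simp
  qed
  then show ?thesis by (simp add: \<mu>_def b_def)
qed

text \<open>One coordinate of the centre of contraction: the interval from \<open>l\<close> to
  \<open>l + \<epsilon>\<close>, shrunk by the ratio \<theta> about \<open>c\<close>, has to contain
  the open interval between \<alpha> and \<omega>.\<close>

lemma homothety_center:
  fixes l \<epsilon> \<theta> \<alpha> \<omega> :: real
  assumes "0 < \<theta>" "\<theta> < 1" "0 < \<epsilon>" "l \<le> \<alpha>" "\<omega> \<le> l + \<epsilon>" "\<omega> - \<alpha> \<le> \<theta> * \<epsilon>"
  shows "\<exists>c. l \<le> c \<and> c \<le> l + \<epsilon> \<and> (\<forall>x. \<alpha> < x \<and> x < \<omega> \<longrightarrow> l < c + (1 / \<theta>) * (x - c) \<and> c + (1 / \<theta>) * (x - c) < l + \<epsilon>)"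
proof -
  define q where "q = \<epsilon> - (\<omega> - \<alpha>)"
  have "\<theta> * \<epsilon> < \<epsilon>" using assms by simp
  then have "0 < q" unfolding q_def using assms by linarith
  moreover have "(1 - \<theta>) * \<epsilon> \<le> q" using assms by (simp add: q_def algebra_simps)
  ultimately have q: "0 < q" "(1 - \<theta>) * \<epsilon> \<le> q" by auto
  \<comment> \<open>\<open>c\<close> divides the large interval in the proportion of the two gaps
    beside the small one; \<open>q\<close> is the sum of the gaps.\<close>
  define c where "c = l + \<epsilon> * (\<alpha> - l) / q"
  have c1: "l \<le> c" using assms q by (simp add: c_def)
  have c2': "l + \<epsilon> - c = \<epsilon> * (l + \<epsilon> - \<omega>) / q" using q by (simp add: c_def q_def field_simps)
  have c2: "c \<le> l + \<epsilon>"
  proof -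
    have "0 \<le> \<epsilon> * (l + \<epsilon> - \<omega>) / q" using assms q by simp
    then show ?thesis using c2' by linarith
  qed
  \<comment> \<open>The contracted interval begins at l + (1 - \<theta>) (c - l), which must not
    exceed \<alpha>; its right end is treated symmetrically.\<close>
  have "(1 - \<theta>) * (c - l) \<le> \<alpha> - l"
  proof -
    have "(1 - \<theta>) * (c - l) = ((1 - \<theta>) * \<epsilon>) * ((\<alpha> - l) / q)" by (simp add: c_def)
    also have "\<dots> \<le> q * ((\<alpha> - l) / q)" using q assms by (intro mult_right_mono) auto
    finally show ?thesis using q by simp
  qed
  moreover have "(1 - \<theta>) * (l + \<epsilon> - c) \<le> l + \<epsilon> - \<omega>"
  proof -
    have "(1 - \<theta>) * (l + \<epsilon> - c) = ((1 - \<theta>) * \<epsilon>) * ((l + \<epsilon> - \<omega>) / q)" by (simp add: c2')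
    also have "\<dots> \<le> q * ((l + \<epsilon> - \<omega>) / q)" using q assms by (intro mult_right_mono) auto
    finally show ?thesis using q by simp
  qed
  ultimately have "l < c + (1 / \<theta>) * (x - c) \<and> c + (1 / \<theta>) * (x - c) < l + \<epsilon>" if "\<alpha> < x" "x < \<omega>" for x
  proof -
    have "\<theta> * (l - c) < x - c" "x - c < \<theta> * (l + \<epsilon> - c)"
      using that \<open>(1 - \<theta>) * (c - l) \<le> \<alpha> - l\<close> \<open>(1 - \<theta>) * (l + \<epsilon> - c) \<le> l + \<epsilon> - \<omega>\<close> by (simp_all add: algebra_simps)
    then have "l - c < (x - c) / \<theta>" "(x - c) / \<theta> < l + \<epsilon> - c"
      using assms(1) by (simp_all add: pos_less_divide_eq pos_divide_less_eq mult.commute)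
    then show ?thesis by simp
  qed
  with c1 c2 show ?thesis by blast
qed

lemma square_form_bound:
  fixes \<Phi> :: "real^2 \<Rightarrow> 'b::euclidean_space"
  assumes \<Phi>: "smooth \<Phi>" and D: "D \<in> sets borel" "D \<subseteq> square l \<epsilon>" "D \<subseteq> ball p (2 * d)"
    and d: "0 < d" and \<epsilon>: "0 < \<epsilon>" and L: "0 \<le> L" "ln (\<epsilon> / d) \<le> L"
  shows "(\<integral>\<^sup>+x. indicator D x * ennreal ((norm (\<Phi> x))\<^sup>2) \<partial>lborel) \<le>
    ennreal (32 * d\<^sup>2 / \<epsilon>\<^sup>2) * ((\<integral>\<^sup>+y. indicator (square l \<epsilon>) y * ennreal ((norm (\<Phi> y))\<^sup>2) \<partial>lborel) +
      ennreal (\<epsilon>\<^sup>2 * L) * (\<integral>\<^sup>+y. indicator (square l \<epsilon>) y * ennreal (grad_sq \<Phi> y) \<partial>lborel))"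
proof -
  \<comment> \<open>\<open>D\<close> extends over at most \<open>4 * d\<close> in each coordinate,
    so a square of side \<theta> \<epsilon> = 4 d can hold it; the minimum covers inclusions too
    large for that. The constant 32 is 2 times the square of 4.\<close>
  define \<theta> where "\<theta> = min 1 (4 * d / \<epsilon>)"
  have \<theta>: "0 < \<theta>" "\<theta> \<le> 1" "\<theta> \<le> 4 * d / \<epsilon>" using d \<epsilon> by (auto simp: \<theta>_def)
  have "\<exists>c. \<forall>i. l $ i \<le> c $ i \<and> c $ i \<le> l $ i + \<epsilon> \<and> (\<forall>x\<in>D. l $ i < c $ i + (1 / \<theta>) * (x $ i - c $ i) \<and> c $ i + (1 / \<theta>) * (x $ i - c $ i) < l $ i + \<epsilon>)"
  proof (cases "\<theta> = 1")
    case True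
    \<comment> \<open>With ratio 1 the contraction is the identity, so the corner serves as
      centre.\<close>
    then show ?thesis using \<epsilon> D by (intro exI[of _ l]) (auto simp: square_def)
  next
    case False
    then have \<theta>1: "\<theta> < 1" "\<theta> * \<epsilon> = 4 * d" using \<theta> \<epsilon> by (auto simp: \<theta>_def min_def split: if_splits)
    have "\<exists>c. l $ i \<le> c \<and> c \<le> l $ i + \<epsilon> \<and> (\<forall>x\<in>D. l $ i < c + (1 / \<theta>) * (x $ i - c) \<and> c + (1 / \<theta>) * (x $ i - c) < l $ i + \<epsilon>)" for i
    proof -
      let ?\<alpha> = "max (l $ i) (p $ i - 2 * d)" and ?\<omega> = "min (l $ i + \<epsilon>) (p $ i + 2 * d)"
      obtain c where c: "l $ i \<le> c" "c \<le> l $ i + \<epsilon>" "\<forall>x. ?\<alpha> < x \<and> x < ?\<omega> \<longrightarrow> l $ i < c + (1 / \<theta>) * (x - c) \<and> c + (1 / \<theta>) * (x - c) < l $ i + \<epsilon>"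
      proof -
        have "?\<omega> - ?\<alpha> \<le> \<theta> * \<epsilon>" unfolding \<theta>1(2) by (simp add: min_def max_def)
        from homothety_center[OF \<theta>(1) \<theta>1(1) \<epsilon> max.cobounded1 min.cobounded1 this] that
        show thesis by blast
      qed
      have "?\<alpha> < x $ i \<and> x $ i < ?\<omega>" if "x \<in> D" for x
      proof -
        have "norm (p - x) < 2 * d" using that D by (auto simp: dist_norm)
        then have "\<bar>p $ i - x $ i\<bar> < 2 * d" using component_le_norm_cart[of "p - x" i] by simp
        moreover have "l $ i < x $ i" "x $ i < l $ i + \<epsilon>" using that D by (auto simp: square_def)
        ultimately show ?thesis by (auto simp: abs_less_iff)
      qed
      with c show ?thesis by blast
    qed
    then obtain c where "\<And>i. l $ i \<le> c i \<and> c i \<le> l $ i + \<epsilon> \<and> (\<forall>x\<in>D. l $ i < c i + (1 / \<theta>) * (x $ i - c i) \<and> c i + (1 / \<theta>) * (x $ i - c i) < l $ i + \<epsilon>)"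
      by metis
    then show ?thesis by (intro exI[of _ "\<chi> i. c i"]) simp
  qed
  then obtain c where c: "\<And>i. l $ i \<le> c $ i" "\<And>i. c $ i \<le> l $ i + \<epsilon>" "\<And>x. x \<in> D \<Longrightarrow> c + (1 / \<theta>) *\<^sub>R (x - c) \<in> square l \<epsilon>"
    by (auto simp: square_def)
  let ?A = "\<integral>\<^sup>+y. indicator (square l \<epsilon>) y * ennreal ((norm (\<Phi> y))\<^sup>2) \<partial>lborel"
  let ?B = "\<integral>\<^sup>+y. indicator (square l \<epsilon>) y * ennreal (grad_sq \<Phi> y) \<partial>lborel"
  have "(\<integral>\<^sup>+x. indicator D x * ennreal ((norm (\<Phi> x))\<^sup>2) \<partial>lborel) \<le>
     (\<integral>\<^sup>+x. indicator (square l \<epsilon>) (c + (1 / \<theta>) *\<^sub>R (x - c)) * ennreal ((norm (\<Phi> x))\<^sup>2) \<partial>lborel)"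
    by (intro nn_integral_mono mult_right_mono) (auto simp: indicator_def c)
  also have "\<dots> \<le> ennreal (2 * \<theta>\<^sup>2) * (?A + ennreal (\<epsilon>\<^sup>2 * ln (1 / \<theta>)) * ?B)"
    by (rule homothety_estimate[OF \<Phi> \<theta>(1,2) \<epsilon> c(1,2)])
  also have "\<dots> \<le> ennreal (32 * d\<^sup>2 / \<epsilon>\<^sup>2) * (?A + ennreal (\<epsilon>\<^sup>2 * L) * ?B)"
  proof (intro mult_mono add_mono order_refl ennreal_leI)
    have "\<theta>\<^sup>2 \<le> (4 * d / \<epsilon>)\<^sup>2" using \<theta> by (intro power_mono) auto
    then show "2 * \<theta>\<^sup>2 \<le> 32 * d\<^sup>2 / \<epsilon>\<^sup>2" by (simp add: power_divide power_mult_distrib)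
    show "ln (1 / \<theta>) \<le> L"
    proof (cases "4 * d / \<epsilon> \<le> 1")
      case True
      then have "ln (1 / \<theta>) \<le> ln (\<epsilon> / d)"
        using d \<epsilon> by (subst ln_le_cancel_iff) (auto simp: \<theta>_def min_def field_simps)
      with L show ?thesis by simp
    next
      case False
      then show ?thesis using L by (simp add: \<theta>_def)
    qed
  qed (use \<theta> in auto)
  finally show ?thesis .
qed

section \<open>The cells\<close>

definition corner :: "real \<Rightarrow> int^2 \<Rightarrow> real^2" where
  "corner \<epsilon> k = (\<chi> i. \<epsilon> * (of_int (k $ i) - 1 / 2))"

lemma cell_eq_square:
  assumes "0 < \<epsilon>" shows "cell \<epsilon> k = square (corner \<epsilon> k) \<epsilon>"
proof (intro equalityI subsetI)
  fix x assume "x \<in> cell \<epsilon> k"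
  then obtain y where y: "x = \<epsilon> *\<^sub>R y + \<epsilon> *\<^sub>R (\<chi> i. of_int (k $ i))" "\<And>i. - 1/2 < y $ i" "\<And>i. y $ i < 1/2"
    by (auto simp: cell_def unit_cell_def)
  have "corner \<epsilon> k $ i < x $ i \<and> x $ i < corner \<epsilon> k $ i + \<epsilon>" for i
  proof -
    have "\<epsilon> * (- 1/2) < \<epsilon> * y $ i" "\<epsilon> * y $ i < \<epsilon> * (1/2)"
      using y(2,3)[of i] assms by (intro mult_strict_left_mono; simp)+
    moreover have "corner \<epsilon> k $ i = \<epsilon> * of_int (k $ i) - \<epsilon> / 2" "x $ i = \<epsilon> * y $ i + \<epsilon> * of_int (k $ i)"
      by (simp_all add: corner_def y(1) algebra_simps)
    ultimately show ?thesis by simp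
  qed
  then show "x \<in> square (corner \<epsilon> k) \<epsilon>" by (simp add: square_def)
next
  fix x assume x: "x \<in> square (corner \<epsilon> k) \<epsilon>"
  define y where "y = (1 / \<epsilon>) *\<^sub>R x - (\<chi> i. of_int (k $ i))"
  have "x = \<epsilon> *\<^sub>R y + \<epsilon> *\<^sub>R (\<chi> i. of_int (k $ i))" using assms by (simp add: y_def scaleR_right_diff_distrib)
  moreover have "y \<in> unit_cell"
    using x assms by (auto simp: unit_cell_def y_def square_def corner_def field_simps)
  ultimately show "x \<in> cell \<epsilon> k" by (auto simp: cell_def)
qed

text \<open>Adding 1/2 turns the centred cells into open unit intervals with integer ends, so that
  the floor recovers the index.\<close>

lemma cell_iff:
  assumes "0 < \<epsilon>"
  shows "x \<in> cell \<epsilon> k \<longleftrightarrow> (\<forall>i. of_int (k $ i) < x $ i / \<epsilon> + 1 / 2 \<and> x $ i / \<epsilon> + 1 / 2 < of_int (k $ i) + 1)"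
  using assms by (auto simp: cell_eq_square square_def corner_def field_simps)

lemma cell_unique:
  assumes "0 < \<epsilon>" "x \<in> cell \<epsilon> k" shows "k = (\<chi> i. \<lfloor>x $ i / \<epsilon> + 1 / 2\<rfloor>)"
proof -
  have "k $ i = \<lfloor>x $ i / \<epsilon> + 1 / 2\<rfloor>" for i
    using assms by (intro floor_unique[symmetric]) (auto simp: cell_iff less_imp_le)
  then show ?thesis by (simp add: vec_eq_iff)
qed

text \<open>The exceptional points lie on countably many grid lines.\<close>

lemma AE_in_cell:
  assumes \<epsilon>: "0 < \<epsilon>" shows "AE x in lborel. x \<in> cell \<epsilon> (\<chi> i. \<lfloor>x $ i / \<epsilon> + 1 / 2\<rfloor>)"
proof -
  have ae: "AE x :: real^2 in lborel. x $ i \<noteq> c" for i :: 2 and c :: real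
  proof -
    have b: "{x :: real^2. x $ i = c} \<in> sets borel" by measurable
    have "negligible {x :: real^2. x \<bullet> axis i 1 = c}"
      by (rule negligible_standard_hyperplane) (simp add: axis_in_Basis_iff)
    then have "{x :: real^2. x $ i = c} \<in> null_sets lebesgue"
      by (simp add: inner_axis negligible_iff_null_sets)
    then have "{x :: real^2. x $ i = c} \<in> null_sets lborel"
      using b by (auto simp: null_sets_def)
    then show ?thesis by (rule AE_I') auto
  qed
  have "AE x :: real^2 in lborel. \<forall>i. \<forall>n :: int. x $ i \<noteq> \<epsilon> * (of_int n - 1 / 2)"
    unfolding AE_all_countable by (intro allI ae)
  then show ?thesis
  proof eventually_elim
    case (elim x)
    have "of_int n \<noteq> x $ i / \<epsilon> + 1 / 2" for i and n :: int
    proof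
      assume "of_int n = x $ i / \<epsilon> + 1 / 2"
      then have "x $ i / \<epsilon> = of_int n - 1 / 2" by simp
      then have "x $ i = (of_int n - 1 / 2) * \<epsilon>" using \<epsilon> by (simp add: divide_eq_eq)
      with elim show False by (simp add: mult.commute)
    qed
    then have "of_int \<lfloor>x $ i / \<epsilon> + 1 / 2\<rfloor> < x $ i / \<epsilon> + 1 / 2 \<and> x $ i / \<epsilon> + 1 / 2 < of_int \<lfloor>x $ i / \<epsilon> + 1 / 2\<rfloor> + 1" for i
      using of_int_floor_le[of "x $ i / \<epsilon> + 1 / 2"] floor_correct[of "x $ i / \<epsilon> + 1 / 2"] by (simp add: less_le)
    then show ?case by (simp add: cell_iff[OF \<epsilon>])
  qed
qed

text \<open>A finite set of indices for all cells that meet a given ball; for compactly supported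
  integrands it replaces the sum over all cells.\<close>

definition index_box :: "int \<Rightarrow> (int^2) set" where
  "index_box N = {k. \<forall>i. \<bar>k $ i\<bar> \<le> N}"

lemma finite_index_box: "finite (index_box N)"
proof (rule finite_subset)
  show "index_box N \<subseteq> (\<lambda>(a, b). \<chi> i. if i = 1 then a else b) ` ({- N..N} \<times> {- N..N})"
  proof
    fix k :: "int^2" assume k: "k \<in> index_box N"
    have "k = (\<lambda>(a, b). \<chi> i. if i = 1 then a else b) (k $ 1, k $ 2)" by (simp add: vec_eq_iff forall_2)
    moreover have "(k $ 1, k $ 2) \<in> {- N..N} \<times> {- N..N}" using k by (auto simp: index_box_def abs_le_iff minus_le_iff)
    ultimately show "k \<in> (\<lambda>(a, b). \<chi> i. if i = 1 then a else b) ` ({- N..N} \<times> {- N..N})" by (rule image_eqI)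
  qed
qed simp

lemma cell_index_box:
  assumes \<epsilon>: "0 < \<epsilon>" and x: "x \<in> cell \<epsilon> k" "norm x \<le> R" shows "k \<in> index_box (\<lceil>R / \<epsilon>\<rceil> + 1)"
proof -
  have "\<bar>k $ i\<bar> \<le> \<lceil>R / \<epsilon>\<rceil> + 1" for i
  proof -
    have "\<bar>x $ i\<bar> \<le> R" using component_le_norm_cart[of x i] x(2) by linarith
    then have "\<bar>x $ i / \<epsilon>\<bar> \<le> R / \<epsilon>" using \<epsilon> by (simp add: divide_right_mono)
    moreover have "of_int (k $ i) < x $ i / \<epsilon> + 1 / 2" "x $ i / \<epsilon> + 1 / 2 < of_int (k $ i) + 1"
      using x(1) by (auto simp: cell_iff[OF \<epsilon>])
    ultimately have "\<bar>real_of_int (k $ i)\<bar> \<le> R / \<epsilon> + 1" by linarith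
    also have "\<dots> \<le> real_of_int (\<lceil>R / \<epsilon>\<rceil> + 1)" using le_of_int_ceiling[of "R / \<epsilon>"] by simp
    finally show ?thesis by linarith
  qed
  then show ?thesis by (simp add: index_box_def)
qed

lemma integral_sum_cells:
  fixes f :: "real^2 \<Rightarrow> real"
  assumes \<epsilon>: "0 < \<epsilon>" and f: "integrable lborel f" and R: "\<And>x. R < norm x \<Longrightarrow> f x = 0"
  shows "(LINT x|lborel. f x) = (\<Sum>k\<in>index_box (\<lceil>R / \<epsilon>\<rceil> + 1). LINT x:square (corner \<epsilon> k) \<epsilon>|lborel. f x)"
proof -
  let ?F = "index_box (\<lceil>R / \<epsilon>\<rceil> + 1)" and ?Y = "\<lambda>k. square (corner \<epsilon> k) \<epsilon>"
  have "AE x in lborel. f x = (\<Sum>k\<in>?F. indicator (?Y k) x *\<^sub>R f x)"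
    using AE_in_cell[OF \<epsilon>]
  proof eventually_elim
    case (elim x)
    then obtain j where j: "x \<in> cell \<epsilon> j" by blast
    show ?case
    proof (cases "f x = 0")
      case False
      then have "norm x \<le> R" using R[of x] by linarith
      then have jF: "j \<in> ?F" using cell_index_box[OF \<epsilon> j] by blast
      have "x \<in> ?Y k \<longleftrightarrow> k = j" for k
        unfolding cell_eq_square[OF \<epsilon>, symmetric] using cell_unique[OF \<epsilon>] j by metis
      then have "indicator (?Y k) x *\<^sub>R f x = (if k = j then f x else 0)" for k
        by (simp add: indicator_def)
      then show ?thesis using jF finite_index_box by simp
    qed simp
  qed
  moreover have i: "integrable lborel (\<lambda>x. indicator (?Y k) x *\<^sub>R f x)" for k
    by (intro integrable_mult_indicator f) simp
  ultimately have "(LINT x|lborel. f x) = (LINT x|lborel. (\<Sum>k\<in>?F. indicator (?Y k) x *\<^sub>R f x))"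
    using f by (intro integral_cong_AE) auto
  also have "\<dots> = (\<Sum>k\<in>?F. LINT x:?Y k|lborel. f x)"
    unfolding set_lebesgue_integral_def by (rule Bochner_Integration.integral_sum[OF i])
  finally show ?thesis .
qed

section \<open>The mass density of a family of inclusions\<close>

text \<open>\<open>r k\<close> is the circumradius of \<open>D k\<close>, and the doubled radius
  spares the attainment of the infimum defining it. In the application \<alpha> is
  \<open>\<rho>\<^sup>2\<close>, from the disk inside each upscaled inclusion.\<close>

locale inclusions =
  fixes \<epsilon> d m \<alpha> :: real and D :: "int^2 \<Rightarrow> (real^2) set" and r :: "int^2 \<Rightarrow> real" and p :: "int^2 \<Rightarrow> real^2"
  assumes \<epsilon>: "0 < \<epsilon>" and d: "0 < d" "d \<le> \<epsilon>" and m: "0 < m" and \<alpha>: "0 < \<alpha>"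
    and D_borel: "\<And>k. D k \<in> sets borel" and D_cell: "\<And>k. D k \<subseteq> cell \<epsilon> k" and D_ball: "\<And>k. D k \<subseteq> ball (p k) (2 * r k)"
    and r: "\<And>k. d \<le> r k" and D_measure: "\<And>k. \<alpha> * (r k)\<^sup>2 \<le> measure lborel (D k)"
begin

definition weight :: "int^2 \<Rightarrow> real" where "weight k = m * (\<epsilon>\<^sup>2 / measure lborel (D k))"

definition mass_density :: "real^2 \<Rightarrow> real" where "mass_density x = (\<Sum>\<^sub>\<infinity>k. weight k * indicator (D k) x)"

lemma r_pos: "0 < r k" using r[of k] d by linarith

lemma measure_D: "0 < measure lborel (D k)"
proof -
  have "0 < \<alpha> * (r k)\<^sup>2" using \<alpha> r_pos[of k] by simp
  then show ?thesis using D_measure[of k] by linarith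
qed

lemma weight_bounds: "0 \<le> weight k" "weight k \<le> m * \<epsilon>\<^sup>2 / (\<alpha> * (r k)\<^sup>2)" "weight k \<le> m * \<epsilon>\<^sup>2 / (\<alpha> * d\<^sup>2)"
proof -
  show "0 \<le> weight k" using m measure_D[of k] by (simp add: weight_def)
  have "m * \<epsilon>\<^sup>2 / measure lborel (D k) \<le> m * \<epsilon>\<^sup>2 / (\<alpha> * (r k)\<^sup>2)"
    using D_measure[of k] \<alpha> r_pos[of k] m measure_D[of k] by (intro divide_left_mono) auto
  then show 1: "weight k \<le> m * \<epsilon>\<^sup>2 / (\<alpha> * (r k)\<^sup>2)" by (simp add: weight_def)
  have "d\<^sup>2 \<le> (r k)\<^sup>2" using r[of k] d by (intro power_mono) auto
  then have "m * \<epsilon>\<^sup>2 / (\<alpha> * (r k)\<^sup>2) \<le> m * \<epsilon>\<^sup>2 / (\<alpha> * d\<^sup>2)"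
    using \<alpha> r_pos[of k] m d by (intro divide_left_mono mult_left_mono) auto
  with 1 show "weight k \<le> m * \<epsilon>\<^sup>2 / (\<alpha> * d\<^sup>2)" by linarith
qed

lemma density_sum:
  assumes "finite F" "\<And>k. x \<in> D k \<Longrightarrow> k \<in> F"
  shows "mass_density x = (\<Sum>k\<in>F. weight k * indicator (D k) x)"
proof -
  have "mass_density x = (\<Sum>\<^sub>\<infinity>k\<in>F. weight k * indicator (D k) x)"
    unfolding mass_density_def using assms(2) by (intro infsum_cong_neutral) (auto simp: indicator_def)
  then show ?thesis using assms(1) by simp
qed

lemma density_cases:
  obtains "mass_density x = 0" | k where "mass_density x = weight k" "x \<in> D k"
proof (cases "\<exists>k. x \<in> D k")
  case True
  then obtain k where k: "x \<in> D k" by blast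
  have "k' = k" if "x \<in> D k'" for k'
    using cell_unique[OF \<epsilon>] k that D_cell by blast
  then have "mass_density x = (\<Sum>k\<in>{k}. weight k * indicator (D k) x)" by (intro density_sum) auto
  with k that(2)[of k] show thesis by simp
next
  case False
  then have "mass_density x = (\<Sum>k\<in>{}. weight k * indicator (D k) x)" by (intro density_sum) auto
  with that(1) show thesis by simp
qed

lemma density_bounds: "0 \<le> mass_density x" "mass_density x \<le> m * \<epsilon>\<^sup>2 / (\<alpha> * d\<^sup>2)"
proof -
  have "0 \<le> m * \<epsilon>\<^sup>2 / (\<alpha> * d\<^sup>2)" using m \<alpha> d by simp
  then show "0 \<le> mass_density x" "mass_density x \<le> m * \<epsilon>\<^sup>2 / (\<alpha> * d\<^sup>2)"
    using weight_bounds by (cases rule: density_cases[of x]; force)+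
qed

lemma density_on_ball:
  assumes "norm x \<le> R"
  shows "mass_density x = (\<Sum>k\<in>index_box (\<lceil>R / \<epsilon>\<rceil> + 1). weight k * indicator (D k) x)"
  using assms D_cell cell_index_box[OF \<epsilon>] by (intro density_sum finite_index_box) blast

text \<open>At each point the finite partial sums over growing index boxes are eventually constant,
  so the density is their pointwise limit.\<close>

lemma density_measurable: "mass_density \<in> borel_measurable borel"
proof (rule borel_measurable_LIMSEQ_real)
  fix x :: "real^2"
  show "(\<lambda>n. \<Sum>k\<in>index_box (\<lceil>real n / \<epsilon>\<rceil> + 1). weight k * indicator (D k) x) \<longlonglongrightarrow> mass_density x"
  proof (rule tendsto_eventually)
    obtain n0 where n0: "norm x \<le> real n0" using real_arch_simple by blast
    show "\<forall>\<^sub>F n in sequentially. (\<Sum>k\<in>index_box (\<lceil>real n / \<epsilon>\<rceil> + 1). weight k * indicator (D k) x) = mass_density x"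
      unfolding eventually_sequentially
    proof (intro exI[of _ n0] allI impI)
      fix n assume "n0 \<le> n"
      then have "norm x \<le> real n" using n0 by linarith
      from density_on_ball[OF this] show "(\<Sum>k\<in>index_box (\<lceil>real n / \<epsilon>\<rceil> + 1). weight k * indicator (D k) x) = mass_density x" by simp
    qed
  qed
next
  fix n
  show "(\<lambda>x. \<Sum>k\<in>index_box (\<lceil>real n / \<epsilon>\<rceil> + 1). weight k * indicator (D k) x) \<in> borel_measurable borel"
    using D_borel by measurable
qed

lemma density_borel: "mass_density \<in> borel_measurable lebesgue" "\<bar>mass_density x\<bar> \<le> m * \<epsilon>\<^sup>2 / (\<alpha> * d\<^sup>2)"
proof -
  have "mass_density \<in> borel_measurable lborel" using density_measurable by simp
  then show "mass_density \<in> borel_measurable lebesgue" by (rule measurable_completion)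
  show "\<bar>mass_density x\<bar> \<le> m * \<epsilon>\<^sup>2 / (\<alpha> * d\<^sup>2)" using density_bounds[of x] by (simp only: abs_of_nonneg)
qed

lemma integral_density:
  fixes f :: "real^2 \<Rightarrow> real"
  assumes f: "integrable lborel f" and R: "\<And>x. R < norm x \<Longrightarrow> f x = 0"
  shows "(LINT x|lborel. mass_density x * f x) = (\<Sum>k\<in>index_box (\<lceil>R / \<epsilon>\<rceil> + 1). weight k * (LINT x:D k|lborel. f x))"
proof -
  let ?F = "index_box (\<lceil>R / \<epsilon>\<rceil> + 1)"
  have i: "integrable lborel (\<lambda>x. indicator (D k) x *\<^sub>R f x)" for k
    using D_borel by (intro integrable_mult_indicator f) simp
  have "mass_density x * f x = (\<Sum>k\<in>?F. weight k * (indicator (D k) x *\<^sub>R f x))" for x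
  proof (cases "norm x \<le> R")
    case True
    then show ?thesis by (simp add: density_on_ball sum_distrib_right mult.assoc)
  qed (use R in simp)
  then have "(LINT x|lborel. mass_density x * f x) = (LINT x|lborel. (\<Sum>k\<in>?F. weight k * (indicator (D k) x *\<^sub>R f x)))" by simp
  also have "\<dots> = (\<Sum>k\<in>?F. weight k * (LINT x:D k|lborel. f x))"
    unfolding set_lebesgue_integral_def using i by simp
  finally show ?thesis .
qed

lemma D_square: "D k \<subseteq> square (corner \<epsilon> k) \<epsilon>"
  using D_cell cell_eq_square[OF \<epsilon>] by simp

text \<open>The weight is at most of order \<epsilon>^2 / r^2 and cancels the factor r^2 /
  \<epsilon>^2 of \<open>square_form_bound\<close>. The individual radius survives only in the
  logarithm, where \<open>d\<close> bounds it from below.\<close>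

lemma density_form_bound:
  fixes \<Phi> :: "real^2 \<Rightarrow> 'b::euclidean_space"
  assumes \<Phi>: "cc_smooth \<Phi>" and L: "0 \<le> L" "ln (\<epsilon> / d) \<le> L"
  shows "(LINT x|lborel. mass_density x * (norm (\<Phi> x))\<^sup>2) \<le>
    32 * m / \<alpha> * ((LINT x|lborel. (norm (\<Phi> x))\<^sup>2) + \<epsilon>\<^sup>2 * L * (LINT x|lborel. grad_sq \<Phi> x))"
proof -
  note sm = cc_smooth_imp_smooth[OF \<Phi>]
  let ?Y = "\<lambda>k. square (corner \<epsilon> k) \<epsilon>"
  obtain R where R: "\<And>x. R < norm x \<Longrightarrow> \<Phi> x = 0" "\<And>x i. R < norm x \<Longrightarrow> pd i \<Phi> x = 0"
  proof -
    obtain R0 where "\<And>x. R0 < norm x \<Longrightarrow> \<Phi> x = 0" using \<Phi> by (auto simp: cc_smooth_def)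
    moreover obtain R1 where "\<And>x. R1 < norm x \<Longrightarrow> pd 1 \<Phi> x = 0" using cc_smooth_pd[OF \<Phi>, of 1] by (auto simp: cc_smooth_def)
    moreover obtain R2 where "\<And>x. R2 < norm x \<Longrightarrow> pd 2 \<Phi> x = 0" using cc_smooth_pd[OF \<Phi>, of 2] by (auto simp: cc_smooth_def)
    ultimately show thesis
    proof (intro that[of "max R0 (max R1 R2)"])
      fix x :: "real^2" and i :: 2
      assume *: "\<And>x. R1 < norm x \<Longrightarrow> pd 1 \<Phi> x = 0" "\<And>x. R2 < norm x \<Longrightarrow> pd 2 \<Phi> x = 0"
        "max R0 (max R1 R2) < norm x"
      then show "pd i \<Phi> x = 0" using exhaust_2[of i] by auto
    qed auto
  qed
  let ?F = "index_box (\<lceil>R / \<epsilon>\<rceil> + 1)"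
  let ?f = "\<lambda>x. (norm (\<Phi> x))\<^sup>2" and ?g = "grad_sq \<Phi>"
  have sq: "integrable lborel (\<lambda>x. (norm (\<Psi> x))\<^sup>2)" if "cc_smooth \<Psi>" for \<Psi> :: "real^2 \<Rightarrow> 'b"
    using cc_smooth_integrable[OF cc_smooth_bilinear1[OF bounded_bilinear_inner that cc_smooth_imp_smooth[OF that]]]
    by (simp add: power2_norm_eq_inner)
  have if': "integrable lborel ?f" by (rule sq[OF \<Phi>])
  have ig: "integrable lborel ?g" unfolding grad_sq_def[abs_def]
    by (intro Bochner_Integration.integrable_sum sq cc_smooth_pd \<Phi>)
  have nn: "(\<integral>\<^sup>+x. indicator A x * ennreal (h x) \<partial>lborel) = ennreal (LINT x:A|lborel. h x)"
      "0 \<le> (LINT x:A|lborel. h x)"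
    if "A \<in> sets borel" "integrable lborel h" "\<And>x. 0 \<le> h x" for A :: "(real^2) set" and h
  proof -
    have "integrable lborel (\<lambda>x. indicator A x *\<^sub>R h x)" using that by (intro integrable_mult_indicator) auto
    then have "(\<integral>\<^sup>+x. ennreal (indicator A x *\<^sub>R h x) \<partial>lborel) = ennreal (LINT x:A|lborel. h x)"
      unfolding set_lebesgue_integral_def using that by (intro nn_integral_eq_integral) auto
    moreover have "(\<integral>\<^sup>+x. indicator A x * ennreal (h x) \<partial>lborel) = (\<integral>\<^sup>+x. ennreal (indicator A x *\<^sub>R h x) \<partial>lborel)"
      by (intro nn_integral_cong) (auto simp: indicator_def)
    ultimately show "(\<integral>\<^sup>+x. indicator A x * ennreal (h x) \<partial>lborel) = ennreal (LINT x:A|lborel. h x)" by simp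
    show "0 \<le> (LINT x:A|lborel. h x)"
      unfolding set_lebesgue_integral_def using that by (intro integral_nonneg_AE) auto
  qed
  have cellk: "weight k * (LINT x:D k|lborel. ?f x) \<le> 32 * m / \<alpha> * ((LINT x:?Y k|lborel. ?f x) + \<epsilon>\<^sup>2 * L * (LINT x:?Y k|lborel. ?g x))" for k
  proof -
    have "ln (\<epsilon> / r k) \<le> L"
    proof -
      have "\<epsilon> / r k \<le> \<epsilon> / d" using r[of k] r_pos[of k] d \<epsilon> by (intro divide_left_mono) auto
      then have "ln (\<epsilon> / r k) \<le> ln (\<epsilon> / d)" using \<epsilon> d r_pos[of k] by (subst ln_le_cancel_iff) auto
      with L show ?thesis by linarith
    qed
    from square_form_bound[OF sm D_borel D_square D_ball r_pos \<epsilon> L(1) this]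
    have "ennreal (LINT x:D k|lborel. ?f x) \<le> ennreal (32 * (r k)\<^sup>2 / \<epsilon>\<^sup>2) * (ennreal (LINT x:?Y k|lborel. ?f x) + ennreal (\<epsilon>\<^sup>2 * L) * ennreal (LINT x:?Y k|lborel. ?g x))"
      by (simp add: nn D_borel if' ig grad_sq_nonneg)
    also have "\<dots> = ennreal (32 * (r k)\<^sup>2 / \<epsilon>\<^sup>2 * ((LINT x:?Y k|lborel. ?f x) + \<epsilon>\<^sup>2 * L * (LINT x:?Y k|lborel. ?g x)))"
      using nn(2)[of "?Y k" ?f] nn(2)[of "?Y k" ?g] L
      by (simp add: if' ig grad_sq_nonneg ennreal_mult[symmetric] ennreal_plus[symmetric] del: ennreal_plus)
    finally have "(LINT x:D k|lborel. ?f x) \<le> 32 * (r k)\<^sup>2 / \<epsilon>\<^sup>2 * ((LINT x:?Y k|lborel. ?f x) + \<epsilon>\<^sup>2 * L * (LINT x:?Y k|lborel. ?g x))"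
      using nn(2)[of "?Y k" ?f] nn(2)[of "?Y k" ?g] L
      by (subst (asm) ennreal_le_iff) (auto simp: if' ig grad_sq_nonneg)
    then have "weight k * (LINT x:D k|lborel. ?f x) \<le> m * \<epsilon>\<^sup>2 / (\<alpha> * (r k)\<^sup>2) * (32 * (r k)\<^sup>2 / \<epsilon>\<^sup>2 * ((LINT x:?Y k|lborel. ?f x) + \<epsilon>\<^sup>2 * L * (LINT x:?Y k|lborel. ?g x)))"
      using weight_bounds[of k] nn(2)[of "D k" ?f] m \<alpha> by (intro mult_mono) (auto simp: if' D_borel)
    also have "\<dots> = 32 * m / \<alpha> * ((LINT x:?Y k|lborel. ?f x) + \<epsilon>\<^sup>2 * L * (LINT x:?Y k|lborel. ?g x))"
      using \<epsilon> r_pos[of k] \<alpha> by (simp add: field_simps)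
    finally show ?thesis .
  qed
  have "(LINT x|lborel. mass_density x * ?f x) = (\<Sum>k\<in>?F. weight k * (LINT x:D k|lborel. ?f x))"
    by (rule integral_density[OF if']) (simp add: R)
  also have "\<dots> \<le> (\<Sum>k\<in>?F. 32 * m / \<alpha> * ((LINT x:?Y k|lborel. ?f x) + \<epsilon>\<^sup>2 * L * (LINT x:?Y k|lborel. ?g x)))"
    by (intro sum_mono cellk)
  also have "\<dots> = 32 * m / \<alpha> * ((\<Sum>k\<in>?F. LINT x:?Y k|lborel. ?f x) + \<epsilon>\<^sup>2 * L * (\<Sum>k\<in>?F. LINT x:?Y k|lborel. ?g x))"
    by (simp only: sum_distrib_left[symmetric] sum.distrib)
  also have "(\<Sum>k\<in>?F. LINT x:?Y k|lborel. ?f x) = (LINT x|lborel. ?f x)"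
    by (rule integral_sum_cells[OF \<epsilon> if', symmetric]) (simp add: R)
  also have "(\<Sum>k\<in>?F. LINT x:?Y k|lborel. ?g x) = (LINT x|lborel. ?g x)"
    by (rule integral_sum_cells[OF \<epsilon> ig, symmetric]) (simp add: R grad_sq_def)
  finally show ?thesis .
qed

text \<open>After division by the area of \<open>D k\<close>, at least \<alpha> r^2, the vertical
  term of \<open>square_average\<close> carries \<epsilon>^2 / r and the horizontal one \<epsilon>.
  As \<open>d\<close> is at most \<open>r k\<close> and at most \<epsilon>, both are bounded by
  multiples of \<open>\<epsilon>\<^sup>2 / d\<close>.\<close>

lemma density_averaging:
  fixes f :: "real^2 \<Rightarrow> real"
  assumes f: "cc_smooth f"
  shows "\<bar>(LINT x|lborel. mass_density x * f x) - m * (LINT x|lborel. f x)\<bar> \<le>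
    m * (4 / \<alpha> + 1) * (\<epsilon>\<^sup>2 / d) * ((LINT x|lborel. \<bar>pd 1 f x\<bar>) + (LINT x|lborel. \<bar>pd 2 f x\<bar>))"
proof -
  let ?Y = "\<lambda>k. square (corner \<epsilon> k) \<epsilon>"
  obtain R where R: "\<And>x. R < norm x \<Longrightarrow> f x = 0" "\<And>x. R < norm x \<Longrightarrow> pd 1 f x = 0" "\<And>x. R < norm x \<Longrightarrow> pd 2 f x = 0"
  proof -
    obtain R0 where "\<And>x. R0 < norm x \<Longrightarrow> f x = 0" using f by (auto simp: cc_smooth_def)
    moreover obtain R1 where "\<And>x. R1 < norm x \<Longrightarrow> pd 1 f x = 0" using cc_smooth_pd[OF f, of 1] by (auto simp: cc_smooth_def)
    moreover obtain R2 where "\<And>x. R2 < norm x \<Longrightarrow> pd 2 f x = 0" using cc_smooth_pd[OF f, of 2] by (auto simp: cc_smooth_def)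
    ultimately show thesis by (intro that[of "max R0 (max R1 R2)"]) auto
  qed
  let ?F = "index_box (\<lceil>R / \<epsilon>\<rceil> + 1)"
  let ?I = "\<lambda>i k. LINT x:?Y k|lborel. \<bar>pd i f x\<bar>"
  have intf: "integrable lborel f" by (rule cc_smooth_integrable[OF f])
  have inta: "integrable lborel (\<lambda>x. \<bar>pd i f x\<bar>)" for i by (intro integrable_abs cc_smooth_integrable cc_smooth_pd f)
  have nn: "0 \<le> ?I i k" for i k
    unfolding set_lebesgue_integral_def by (intro integral_nonneg_AE) auto
  have cellk: "\<bar>weight k * (LINT x:D k|lborel. f x) - m * (LINT x:?Y k|lborel. f x)\<bar> \<le> m * (4 / \<alpha> + 1) * (\<epsilon>\<^sup>2 / d) * (?I 1 k + ?I 2 k)" for k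
  proof -
    let ?\<mu> = "measure lborel (D k)"
    have eq: "m * (c * e * a + c * e * b) = m * c * e * (b + a)" for c e a b :: real
      by (simp add: algebra_simps)
    have \<mu>: "0 < ?\<mu>" by (rule measure_D)
    have "weight k * (LINT x:D k|lborel. f x) - m * (LINT x:?Y k|lborel. f x) =
        m / ?\<mu> * (\<epsilon>\<^sup>2 * (LINT x:D k|lborel. f x) - ?\<mu> * (LINT x:?Y k|lborel. f x))"
      using \<mu> by (simp add: weight_def field_simps)
    then have "\<bar>weight k * (LINT x:D k|lborel. f x) - m * (LINT x:?Y k|lborel. f x)\<bar> =
        m / ?\<mu> * \<bar>\<epsilon>\<^sup>2 * (LINT x:D k|lborel. f x) - ?\<mu> * (LINT x:?Y k|lborel. f x)\<bar>"
      using \<mu> m by (simp add: abs_mult)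
    also have "\<dots> \<le> m / ?\<mu> * (\<epsilon>\<^sup>2 * (2 * (2 * r k)) * ?I 2 k + ?\<mu> * \<epsilon> * ?I 1 k)"
      using \<mu> m r_pos[of k] by (intro mult_left_mono square_average[OF f D_borel D_square D_ball \<epsilon>]) auto
    also have "\<dots> = m * (\<epsilon>\<^sup>2 * (4 * r k / ?\<mu>) * ?I 2 k + \<epsilon> * ?I 1 k)"
      using \<mu> by (simp add: field_simps)
    also have "\<dots> \<le> m * ((4 / \<alpha> + 1) * (\<epsilon>\<^sup>2 / d) * ?I 2 k + (4 / \<alpha> + 1) * (\<epsilon>\<^sup>2 / d) * ?I 1 k)"
    proof (intro mult_left_mono add_mono mult_right_mono nn)
      have "4 * r k / ?\<mu> \<le> 4 * r k / (\<alpha> * (r k)\<^sup>2)"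
        using D_measure[of k] r_pos[of k] \<alpha> \<mu> by (intro divide_left_mono) auto
      also have "\<dots> = 4 / \<alpha> * (1 / r k)" using r_pos[of k] \<alpha> by (simp add: power2_eq_square field_simps)
      also have "\<dots> \<le> 4 / \<alpha> * (1 / d)" using r[of k] d \<alpha> r_pos[of k] by (intro mult_left_mono divide_left_mono) auto
      also have "\<dots> \<le> (4 / \<alpha> + 1) * (1 / d)" using d by (intro mult_right_mono) auto
      finally have "\<epsilon>\<^sup>2 * (4 * r k / ?\<mu>) \<le> \<epsilon>\<^sup>2 * ((4 / \<alpha> + 1) * (1 / d))" by (intro mult_left_mono) auto
      then show "\<epsilon>\<^sup>2 * (4 * r k / ?\<mu>) \<le> (4 / \<alpha> + 1) * (\<epsilon>\<^sup>2 / d)" by (simp add: mult_ac)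
      have "\<epsilon> \<le> \<epsilon>\<^sup>2 / d" using d \<epsilon> by (simp add: power2_eq_square field_simps)
      also have "\<dots> \<le> (4 / \<alpha> + 1) * (\<epsilon>\<^sup>2 / d)"
        using mult_right_mono[of 1 "4 / \<alpha> + 1" "\<epsilon>\<^sup>2 / d"] \<alpha> d by simp
      finally show "\<epsilon> \<le> (4 / \<alpha> + 1) * (\<epsilon>\<^sup>2 / d)" .
    qed (use m in auto)
    also have "\<dots> = m * (4 / \<alpha> + 1) * (\<epsilon>\<^sup>2 / d) * (?I 1 k + ?I 2 k)" by (rule eq)
    finally show ?thesis .
  qed
  have eq: "(LINT x|lborel. mass_density x * f x) - m * (LINT x|lborel. f x) =
      (\<Sum>k\<in>?F. weight k * (LINT x:D k|lborel. f x) - m * (LINT x:?Y k|lborel. f x))"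
    using integral_density[OF intf R(1)] integral_sum_cells[OF \<epsilon> intf R(1)]
    by (simp add: sum_subtractf sum_distrib_left)
  have "\<bar>(LINT x|lborel. mass_density x * f x) - m * (LINT x|lborel. f x)\<bar> \<le> (\<Sum>k\<in>?F. m * (4 / \<alpha> + 1) * (\<epsilon>\<^sup>2 / d) * (?I 1 k + ?I 2 k))"
    unfolding eq by (rule order_trans[OF sum_abs sum_mono[OF cellk]])
  also have "\<dots> = m * (4 / \<alpha> + 1) * (\<epsilon>\<^sup>2 / d) * ((\<Sum>k\<in>?F. ?I 1 k) + (\<Sum>k\<in>?F. ?I 2 k))"
    unfolding sum.distrib[symmetric] by (rule sum_distrib_left[symmetric])
  also have "(\<Sum>k\<in>?F. ?I 1 k) = (LINT x|lborel. \<bar>pd 1 f x\<bar>)"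
    by (rule integral_sum_cells[OF \<epsilon> inta, symmetric]) (simp add: R)
  also have "(\<Sum>k\<in>?F. ?I 2 k) = (LINT x|lborel. \<bar>pd 2 f x\<bar>)"
    by (rule integral_sum_cells[OF \<epsilon> inta, symmetric]) (simp add: R)
  finally show ?thesis .
qed

end

section \<open>The resolvent difference\<close>

lemma integral_norm_mult_le:
  fixes a b :: "real^2 \<Rightarrow> complex^2"
  assumes a: "cc_smooth a" and b: "cc_smooth b"
  shows "integrable lborel (\<lambda>x. norm (a x) * norm (b x))"
    and "(LINT x|lborel. norm (a x) * norm (b x)) \<le> norm (abs_spinor_L2 a) * norm (abs_spinor_L2 b)"
proof -
  have [measurable]: "a \<in> borel_measurable borel" "b \<in> borel_measurable borel" using a b by (auto intro: cc_smooth_measurable)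
  have sq: "integrable lborel (\<lambda>x. (norm (f x))\<^sup>2)" if "cc_smooth f" for f :: "real^2 \<Rightarrow> complex^2"
    using cc_smooth_integrable[OF cc_smooth_bilinear1[OF bounded_bilinear_inner that cc_smooth_imp_smooth[OF that]]]
    by (simp add: power2_norm_eq_inner)
  show i: "integrable lborel (\<lambda>x. norm (a x) * norm (b x))"
  proof (rule Bochner_Integration.integrable_bound)
    show "integrable lborel (\<lambda>x. (norm (a x))\<^sup>2 + (norm (b x))\<^sup>2)" using sq a b by auto
    show "AE x in lborel. norm (norm (a x) * norm (b x)) \<le> norm ((norm (a x))\<^sup>2 + (norm (b x))\<^sup>2)"
    proof (rule AE_I2)
      fix x
      have "2 * norm (a x) * norm (b x) \<le> (norm (a x))\<^sup>2 + (norm (b x))\<^sup>2" by (rule sum_squares_bound)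
      moreover have "0 \<le> norm (a x) * norm (b x)" by simp
      ultimately have "norm (a x) * norm (b x) \<le> (norm (a x))\<^sup>2 + (norm (b x))\<^sup>2" by linarith
      then show "norm (norm (a x) * norm (b x)) \<le> norm ((norm (a x))\<^sup>2 + (norm (b x))\<^sup>2)" by simp
    qed
  qed simp
  have nrm: "(\<integral>\<^sup>+x. ennreal (norm (f x)) ^ 2 \<partial>lborel) = ennreal ((norm (abs_spinor_L2 f))\<^sup>2)" if "cc_smooth f" for f
    using abs_spinor_norm_ennreal[OF cc_smooth_sq_integrable[OF that]]
    by (simp add: nn_integral_completion ennreal_power)
  let ?I = "LINT x|lborel. norm (a x) * norm (b x)"
  have I0: "0 \<le> ?I" by (intro integral_nonneg_AE) auto
  have "ennreal (?I\<^sup>2) = (\<integral>\<^sup>+x. ennreal (norm (a x)) * ennreal (norm (b x)) \<partial>lborel)\<^sup>2"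
    using i I0 by (subst ennreal_power[symmetric]) (auto simp: nn_integral_eq_integral ennreal_mult[symmetric])
  also have "\<dots> \<le> (\<integral>\<^sup>+x. ennreal (norm (a x)) ^ 2 \<partial>lborel) * (\<integral>\<^sup>+x. ennreal (norm (b x)) ^ 2 \<partial>lborel)"
    by (rule Cauchy_Schwarz_nn_integral) measurable
  also have "\<dots> = ennreal ((norm (abs_spinor_L2 a) * norm (abs_spinor_L2 b))\<^sup>2)"
    by (simp add: nrm a b ennreal_mult[symmetric] power_mult_distrib)
  finally have "?I\<^sup>2 \<le> (norm (abs_spinor_L2 a) * norm (abs_spinor_L2 b))\<^sup>2" by simp
  then show "?I \<le> norm (abs_spinor_L2 a) * norm (abs_spinor_L2 b)" by (rule power2_le_imp_le) simp
qed

text \<open>The constant of \<open>resolvent_difference\<close> at the parameters of the inclusions,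
  with \<open>ln (sqrt 2)\<close> as lower bound of the logarithm. The last summand serves the case
  of large \<eta>. Only \<open>m\<close>, \<alpha> and \<open>z\<close> enter.\<close>

definition resolvent_rate :: "real \<Rightarrow> real \<Rightarrow> complex \<Rightarrow> real" where
  "resolvent_rate m \<alpha> z =
    (let a = Re z; b = Im z; A = 32 * m / \<alpha>; k = m / \<alpha>; A' = 2 * m * (4 / \<alpha> + 1) / sqrt (ln (sqrt 2));
      n = m + \<bar>a\<bar> + \<bar>b\<bar>; \<beta> = 1 / \<bar>b\<bar>; c = \<beta> + 1 + n * \<beta> in
     A' * c\<^sup>2 * (1 + m * \<beta>) +
     sqrt (A * (A'\<^sup>2 * c ^ 4 + 3 * (k * A * c\<^sup>2 + m\<^sup>2 * c\<^sup>2 + n\<^sup>2 * A'\<^sup>2 * c ^ 4))) *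
     sqrt (2 * A * (\<beta>\<^sup>2 + 3 + 3 * n\<^sup>2 * \<beta>\<^sup>2)) + 2 * \<beta> * (1 + 6 * A * k))"

context inclusions
begin

text \<open>Averaging is applied to the scalar function \<langle>\<sigma>3 \<Phi>, \<Psi>\<rangle>.
  The product rule splits its derivatives, the Dirac images dominate the partial derivatives in
  norm, and the factor 2 in front counts the two directions.\<close>

lemma mult_density_core:
  assumes L: "0 \<le> L" "ln (\<epsilon> / d) \<le> L"
  shows "perturbed_core dirac_core (scaleC_spinor \<i>) (mult_op mass_density) sigma_op m (32 * m / \<alpha>)
    (m * \<epsilon>\<^sup>2 / (\<alpha> * d\<^sup>2)) (\<epsilon>\<^sup>2 * L) (2 * m * (4 / \<alpha> + 1) * (\<epsilon>\<^sup>2 / d))"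
proof (intro perturbed_core.intro perturbed_core_axioms.intro)
  show "symmetric_core dirac_core (scaleC_spinor \<i>)" by (rule free_dirac.symmetric_core_axioms)
  show "bounded_linear (mult_op mass_density)" by (rule mult_op_bounded_linear[OF density_borel])
  show "bounded_linear sigma_op" by (rule sigma_op_bounded_linear)
  show "0 < m" by (rule m)
  show "0 \<le> 32 * m / \<alpha>" "0 \<le> m * \<epsilon>\<^sup>2 / (\<alpha> * d\<^sup>2)" "0 \<le> \<epsilon>\<^sup>2 * L" "0 \<le> 2 * m * (4 / \<alpha> + 1) * (\<epsilon>\<^sup>2 / d)"
    using m \<alpha> d L by auto
  fix x y :: spinor_L2
  show "mult_op mass_density x \<bullet> y = x \<bullet> mult_op mass_density y" by (rule mult_op_inner[OF density_borel])
  show "mult_op mass_density (scaleC_spinor \<i> x) = scaleC_spinor \<i> (mult_op mass_density x)"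
    by (rule mult_op_scaleC[OF density_borel])
  show "0 \<le> mult_op mass_density x \<bullet> x" by (rule mult_op_nonneg[OF density_borel density_bounds(1)])
  show "sigma_op x \<bullet> y = x \<bullet> sigma_op y" by (rule sigma_op_inner)
  show "sigma_op (scaleC_spinor \<i> x) = scaleC_spinor \<i> (sigma_op x)" by (rule sigma_op_scaleC)
  show "norm (sigma_op x) = norm x" by (rule sigma_op_norm)
  show "mult_op mass_density (sigma_op x) = sigma_op (mult_op mass_density x)"
    by (rule mult_op_sigma_op[OF density_borel])
  show "(norm (mult_op mass_density x))\<^sup>2 \<le> m * \<epsilon>\<^sup>2 / (\<alpha> * d\<^sup>2) * (mult_op mass_density x \<bullet> x)"
    by (rule mult_op_norm[OF density_borel density_bounds(1)])
next
  fix x y assume "(x, y) \<in> dirac_core"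
  then obtain \<Phi> where \<Phi>: "cc_smooth \<Phi>" "x = abs_spinor_L2 \<Phi>" "y = abs_spinor_L2 (dirac_field \<Phi>)" by (rule dirac_coreE)
  note sq = cc_smooth_sq_integrable[OF \<Phi>(1)]
  have [measurable]: "mass_density \<in> borel_measurable borel" by (rule density_measurable)
  have cc2: "cc_smooth (\<lambda>x. (norm (\<Psi> x))\<^sup>2)" if "cc_smooth \<Psi>" for \<Psi> :: "real^2 \<Rightarrow> complex^2"
    unfolding power2_norm_eq_inner using cc_smooth_bilinear1[OF bounded_bilinear_inner that cc_smooth_imp_smooth[OF that]] .
  have nrm: "(norm (abs_spinor_L2 \<Psi>))\<^sup>2 = (LINT x|lborel. (norm (\<Psi> x))\<^sup>2)" if "cc_smooth \<Psi>" for \<Psi> :: "real^2 \<Rightarrow> complex^2"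
    by (simp add: abs_spinor_norm cc_smooth_sq_integrable that lebesgue_integral_cc[OF cc2])
  have "mult_op mass_density x \<bullet> x = (LINT x|lebesgue. mass_density x * (norm (\<Phi> x))\<^sup>2)"
    unfolding \<Phi> by (subst mult_op_inner_abs[OF density_borel sq sq]) (simp add: power2_norm_eq_inner)
  also have "\<dots> = (LINT x|lborel. mass_density x * (norm (\<Phi> x))\<^sup>2)"
    using cc_smooth_measurable[OF cc2[OF \<Phi>(1)]] by (intro integral_completion) simp
  also have "\<dots> \<le> 32 * m / \<alpha> * ((LINT x|lborel. (norm (\<Phi> x))\<^sup>2) + \<epsilon>\<^sup>2 * L * (LINT x|lborel. grad_sq \<Phi> x))"
    by (rule density_form_bound[OF \<Phi>(1) L])
  also have "(LINT x|lborel. grad_sq \<Phi> x) = (\<Sum>i\<in>UNIV. LINT x|lebesgue. (norm (pd i \<Phi> x))\<^sup>2)"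
    unfolding grad_sq_def using cc2[OF cc_smooth_pd[OF \<Phi>(1)]]
    by (simp add: cc_smooth_integrable lebesgue_integral_cc)
  also have "\<dots> = (norm y)\<^sup>2"
    by (simp add: \<Phi> dirac_field_norm[symmetric] abs_spinor_norm cc_smooth_sq_integrable cc_smooth_dirac_field)
  also have "(LINT x|lborel. (norm (\<Phi> x))\<^sup>2) = (norm x)\<^sup>2" by (simp add: \<Phi> nrm)
  finally show "mult_op mass_density x \<bullet> x \<le> 32 * m / \<alpha> * ((norm x)\<^sup>2 + \<epsilon>\<^sup>2 * L * (norm y)\<^sup>2)" .
next
  fix x y x' y' assume "(x, y) \<in> dirac_core" "(x', y') \<in> dirac_core"
  then obtain \<Phi> \<Psi> where \<Phi>: "cc_smooth \<Phi>" "x = abs_spinor_L2 \<Phi>" "y = abs_spinor_L2 (dirac_field \<Phi>)"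
    and \<Psi>: "cc_smooth \<Psi>" "x' = abs_spinor_L2 \<Psi>" "y' = abs_spinor_L2 (dirac_field \<Psi>)"
    by (auto elim!: dirac_coreE)
  note sq = cc_smooth_sq_integrable[OF \<Phi>(1)] cc_smooth_sq_integrable[OF \<Psi>(1)]
  have [measurable]: "mass_density \<in> borel_measurable borel" by (rule density_measurable)
  have S\<Phi>: "cc_smooth (\<lambda>x. sigma3 *v \<Phi> x)" by (rule cc_smooth_linear[OF sigma3_linear \<Phi>(1)])
  let ?f = "\<lambda>x. (sigma3 *v \<Phi> x) \<bullet> \<Psi> x"
  have f: "cc_smooth ?f" by (rule cc_smooth_bilinear1[OF bounded_bilinear_inner S\<Phi> cc_smooth_imp_smooth[OF \<Psi>(1)]])
  have "(sigma_op (mult_op mass_density x) - m *\<^sub>R sigma_op x) \<bullet> x' = mult_op mass_density (sigma_op x) \<bullet> x' - m * (sigma_op x \<bullet> x')"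
    by (simp add: inner_diff_left mult_op_sigma_op[OF density_borel])
  also have "\<dots> = (LINT x|lebesgue. mass_density x * ?f x) - m * (LINT x|lebesgue. ?f x)"
    by (simp add: \<Phi> \<Psi> sigma_op_abs sq mult_op_inner_abs[OF density_borel] sigma_sq_integrable abs_spinor_inner)
  also have "(LINT x|lebesgue. mass_density x * ?f x) = (LINT x|lborel. mass_density x * ?f x)"
    using cc_smooth_measurable[OF f] by (intro integral_completion) simp
  also have "(LINT x|lebesgue. ?f x) = (LINT x|lborel. ?f x)" by (rule lebesgue_integral_cc[OF f])
  finally have eq: "(sigma_op (mult_op mass_density x) - m *\<^sub>R sigma_op x) \<bullet> x' =
      (LINT x|lborel. mass_density x * ?f x) - m * (LINT x|lborel. ?f x)" .
  have pd: "(LINT x|lborel. \<bar>pd i ?f x\<bar>) \<le> norm x * norm y' + norm y * norm x'" for i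
  proof -
    have cc: "cc_smooth (pd i \<Phi>)" "cc_smooth (pd i \<Psi>)" by (intro cc_smooth_pd \<Phi> \<Psi>)+
    have pdf: "pd i ?f x = (sigma3 *v \<Phi> x) \<bullet> pd i \<Psi> x + (sigma3 *v pd i \<Phi> x) \<bullet> \<Psi> x" for x
      using pd_bilinear[OF bounded_bilinear_inner smooth_differentiable[OF cc_smooth_imp_smooth[OF S\<Phi>]]
          smooth_differentiable[OF cc_smooth_imp_smooth[OF \<Psi>(1)]], where i = i and x = x]
        pd_linear[OF sigma3_linear smooth_differentiable[OF cc_smooth_imp_smooth[OF \<Phi>(1)]], where i = i and x = x] by simp
    have "(LINT x|lborel. \<bar>pd i ?f x\<bar>) \<le> (LINT x|lborel. norm (\<Phi> x) * norm (pd i \<Psi> x) + norm (pd i \<Phi> x) * norm (\<Psi> x))"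
    proof (rule integral_mono)
      show "integrable lborel (\<lambda>x. \<bar>pd i ?f x\<bar>)" by (intro integrable_abs cc_smooth_integrable cc_smooth_pd f)
      show "integrable lborel (\<lambda>x. norm (\<Phi> x) * norm (pd i \<Psi> x) + norm (pd i \<Phi> x) * norm (\<Psi> x))"
        by (intro Bochner_Integration.integrable_add integral_norm_mult_le cc \<Phi> \<Psi>)
      fix x
      show "\<bar>pd i ?f x\<bar> \<le> norm (\<Phi> x) * norm (pd i \<Psi> x) + norm (pd i \<Phi> x) * norm (\<Psi> x)"
        unfolding pdf using Cauchy_Schwarz_ineq2[of "sigma3 *v \<Phi> x" "pd i \<Psi> x"]
          Cauchy_Schwarz_ineq2[of "sigma3 *v pd i \<Phi> x" "\<Psi> x"] by (simp add: sigma3_norm)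
    qed
    also have "\<dots> = (LINT x|lborel. norm (\<Phi> x) * norm (pd i \<Psi> x)) + (LINT x|lborel. norm (pd i \<Phi> x) * norm (\<Psi> x))"
      by (intro Bochner_Integration.integral_add integral_norm_mult_le cc \<Phi> \<Psi>)
    also have "\<dots> \<le> norm x * norm (abs_spinor_L2 (pd i \<Psi>)) + norm (abs_spinor_L2 (pd i \<Phi>)) * norm x'"
      unfolding \<Phi> \<Psi> by (intro add_mono integral_norm_mult_le cc \<Phi> \<Psi>)
    also have "\<dots> \<le> norm x * norm y' + norm y * norm x'"
      unfolding \<Phi> \<Psi> by (intro add_mono mult_left_mono mult_right_mono pd_norm_le_dirac_field \<Phi> \<Psi>) auto
    finally show ?thesis .
  qed
  have C: "0 \<le> m * (4 / \<alpha> + 1) * (\<epsilon>\<^sup>2 / d)" using m \<alpha> d by auto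
  have "\<bar>(sigma_op (mult_op mass_density x) - m *\<^sub>R sigma_op x) \<bullet> x'\<bar> \<le>
     m * (4 / \<alpha> + 1) * (\<epsilon>\<^sup>2 / d) * ((LINT x|lborel. \<bar>pd 1 ?f x\<bar>) + (LINT x|lborel. \<bar>pd 2 ?f x\<bar>))"
    unfolding eq by (rule density_averaging[OF f])
  also have "\<dots> \<le> m * (4 / \<alpha> + 1) * (\<epsilon>\<^sup>2 / d) * (2 * ((norm x + norm y) * (norm x' + norm y')))"
  proof (intro mult_left_mono C)
    have nn: "0 \<le> norm x * norm x'" "0 \<le> norm y * norm y'" by auto
    have eq: "2 * ((s + t) * (u + v)) = 2 * (s * v + t * u) + 2 * (s * u) + 2 * (t * v)" for s t u v :: real
      by (simp add: algebra_simps)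
    show "(LINT x|lborel. \<bar>pd 1 ?f x\<bar>) + (LINT x|lborel. \<bar>pd 2 ?f x\<bar>) \<le> 2 * ((norm x + norm y) * (norm x' + norm y'))"
      by (rule order_trans[OF add_mono[OF pd pd]]) (use nn in \<open>simp add: eq\<close>)
  qed
  also have "\<dots> = 2 * m * (4 / \<alpha> + 1) * (\<epsilon>\<^sup>2 / d) * (norm x + norm y) * (norm x' + norm y')" by simp
  finally show "\<bar>(sigma_op (mult_op mass_density x) - m *\<^sub>R sigma_op x) \<bullet> x'\<bar> \<le>
     2 * m * (4 / \<alpha> + 1) * (\<epsilon>\<^sup>2 / d) * (norm x + norm y) * (norm x' + norm y')" .
qed

lemma mult_op_const: "mult_op (\<lambda>x. c) u = c *\<^sub>R u"
  using abs_spinor_scaleR[OF rep_spinor_sq_integrable[of u], of c] by (simp add: mult_op_def abs_rep_spinor)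

lemma resolvent_estimate:
  assumes z: "Im z \<noteq> 0" and d2: "d \<le> \<epsilon> / sqrt 2"
  shows "norm (resolvent (dirac mass_density) z f - resolvent (dirac (\<lambda>x. m)) z f) \<le>
    resolvent_rate m \<alpha> z * (\<epsilon>\<^sup>2 / d * sqrt (ln (\<epsilon> / d))) * norm f"
proof -
  define L where "L = ln (\<epsilon> / d)"
  define \<eta> where "\<eta> = \<epsilon>\<^sup>2 / d * sqrt L"
  define A k A' a b n \<beta> c where "A = 32 * m / \<alpha>" and "k = m / \<alpha>" and "A' = 2 * m * (4 / \<alpha> + 1) / sqrt (ln (sqrt 2))"
    and "a = Re z" and "b = Im z" and "n = m + \<bar>a\<bar> + \<bar>b\<bar>" and "\<beta> = 1 / \<bar>b\<bar>" and "c = \<beta> + 1 + n * \<beta>"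
  define K where "K = A' * c\<^sup>2 * (1 + m * \<beta>) +
     sqrt (A * (A'\<^sup>2 * c ^ 4 + 3 * (k * A * c\<^sup>2 + m\<^sup>2 * c\<^sup>2 + n\<^sup>2 * A'\<^sup>2 * c ^ 4))) *
     sqrt (2 * A * (\<beta>\<^sup>2 + 3 + 3 * n\<^sup>2 * \<beta>\<^sup>2))"
  have rate: "resolvent_rate m \<alpha> z = K + 2 * \<beta> * (1 + 6 * A * k)"
    unfolding resolvent_rate_def K_def Let_def A_def k_def A'_def a_def b_def n_def \<beta>_def c_def by simp
  have s2: "1 < sqrt 2" by simp
  then have l2: "0 < ln (sqrt 2)" by (rule ln_gt_zero)
  \<comment> \<open>A positive lower bound for the logarithm: otherwise \<eta> could be small while
    \<open>\<epsilon>\<^sup>2 / d\<close> is not.\<close>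
  have "sqrt 2 \<le> \<epsilon> / d" using d2 d s2 by (simp add: field_simps)
  then have L2: "ln (sqrt 2) \<le> L" unfolding L_def using s2 \<epsilon> d by (subst ln_le_cancel_iff) auto
  then have L0: "0 < L" using l2 by linarith
  have \<eta>0: "0 < \<eta>" using \<epsilon> d L0 by (simp add: \<eta>_def)
  have pos: "0 < A" "0 < k" "0 \<le> A'" "0 \<le> n" "0 < \<beta>"
    using m \<alpha> l2 z by (auto simp: A_def k_def A'_def n_def \<beta>_def b_def intro!: divide_nonneg_nonneg)
  have K0: "0 \<le> K" using pos m by (auto simp: K_def)
  let ?u' = "resolvent (dirac mass_density) z f" and ?u = "resolvent (dirac (\<lambda>x. m)) z f"
  have cm: "(\<lambda>x::real^2. m) \<in> borel_measurable lebesgue" "\<bar>m\<bar> \<le> m" using m by auto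
  have "norm (?u' - ?u) \<le> (K + 2 * \<beta> * (1 + 6 * A * k)) * \<eta> * norm f"
  proof (cases "\<eta> \<le> 1 \<and> 3 * A * k * \<eta>\<^sup>2 \<le> 1 / 2")
    case True
    interpret pc: perturbed_core dirac_core "scaleC_spinor \<i>" "mult_op mass_density" sigma_op m "32 * m / \<alpha>"
      "m * \<epsilon>\<^sup>2 / (\<alpha> * d\<^sup>2)" "\<epsilon>\<^sup>2 * L" "2 * m * (4 / \<alpha> + 1) * (\<epsilon>\<^sup>2 / d)"
      by (rule mult_density_core) (use L0 in \<open>auto simp: L_def\<close>)
    obtain F' where u': "(?u', F') \<in> free_dirac.W" "free_dirac.shifted (\<lambda>x. sigma_op (mult_op mass_density x)) a b ?u' F' = f"
      by (rule resolvent_dirac[OF density_borel z]) (rule that, simp_all add: a_def b_def)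
    obtain F where u: "(?u, F) \<in> free_dirac.W" "free_dirac.shifted (\<lambda>x. sigma_op (mult_op (\<lambda>x. m) x)) a b ?u F = f"
      by (rule resolvent_dirac[OF cm z]) (rule that, simp_all add: a_def b_def)
    have "(\<lambda>x. sigma_op (mult_op (\<lambda>x. m) x)) = (\<lambda>x. m *\<^sub>R sigma_op x)"
      by (simp add: mult_op_const sigma_op_scaleR)
    with u(2) have u2: "free_dirac.shifted (\<lambda>x. m *\<^sub>R sigma_op x) a b ?u F = f" by simp
    \<comment> \<open>Since \<open>d \<le> \<epsilon>\<close>, inserting the factor
      \<open>(\<epsilon> / d)\<^sup>2\<close> only enlarges the left side.\<close>
    have e1: "\<epsilon>\<^sup>2 * L \<le> \<eta>\<^sup>2"
    proof -
      have "1 \<le> (\<epsilon> / d)\<^sup>2" using d by (intro one_le_power) (simp add: le_divide_eq)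
      then have "(\<epsilon>\<^sup>2 * L) * 1 \<le> (\<epsilon>\<^sup>2 * L) * (\<epsilon> / d)\<^sup>2" using L0 by (intro mult_left_mono) auto
      then show ?thesis using L0 by (simp add: \<eta>_def power_mult_distrib power_divide mult_ac power2_eq_square)
    qed
    \<comment> \<open>In fact an equality; it is the identity from which \<eta> originates.\<close>
    have e2: "\<epsilon>\<^sup>2 * L * (m * \<epsilon>\<^sup>2 / (\<alpha> * d\<^sup>2)) \<le> k * \<eta>\<^sup>2"
      using L0 by (simp add: \<eta>_def k_def power_mult_distrib power_divide mult_ac power2_eq_square)
    have e3: "2 * m * (4 / \<alpha> + 1) * (\<epsilon>\<^sup>2 / d) \<le> A' * \<eta>"
    proof -
      have "1 \<le> sqrt L / sqrt (ln (sqrt 2))" using L2 l2 by (simp add: le_divide_eq)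
      then have "2 * m * (4 / \<alpha> + 1) * (\<epsilon>\<^sup>2 / d) * 1 \<le> 2 * m * (4 / \<alpha> + 1) * (\<epsilon>\<^sup>2 / d) * (sqrt L / sqrt (ln (sqrt 2)))"
        using m \<alpha> d by (intro mult_left_mono) auto
      then show ?thesis by (simp add: A'_def \<eta>_def mult_ac)
    qed
    have "norm (?u' - ?u) \<le> K * \<eta> * norm f"
      using pc.resolvent_difference[OF _ \<eta>0 _ e1 e2 e3 _ _ _ u(1) u2 u'] True pos z
      by (simp add: K_def pc.resolvent_const_def a_def b_def n_def \<beta>_def c_def A_def less_imp_le)
    also have "\<dots> \<le> (K + 2 * \<beta> * (1 + 6 * A * k)) * \<eta> * norm f"
      using pos \<eta>0 by (intro mult_right_mono) auto
    finally show ?thesis .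
  next
    case False
    \<comment> \<open>When \<eta> is not small, a multiple of it exceeds 1, and the trivial bound 2
      / |Im z| for the difference of the resolvents suffices.\<close>
    have "1 \<le> (1 + 6 * A * k) * \<eta>"
    proof (cases "\<eta> \<le> 1")
      case True
      then have "1 < 6 * A * k * \<eta>\<^sup>2" using False by simp
      also have "\<dots> \<le> 6 * A * k * \<eta>" using True \<eta>0 pos by (intro mult_left_mono) (auto simp: power2_eq_square mult_left_le)
      finally show ?thesis using \<eta>0 by (simp add: algebra_simps)
    next
      case f: False
      have "1 * 1 \<le> (1 + 6 * A * k) * \<eta>" using f pos by (intro mult_mono) auto
      then show ?thesis by simp
    qed
    then have "2 * \<beta> * norm f * 1 \<le> 2 * \<beta> * norm f * ((1 + 6 * A * k) * \<eta>)"
      using pos by (intro mult_left_mono) auto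
    moreover have "norm (?u' - ?u) \<le> 2 * \<beta> * norm f"
      using norm_triangle_ineq4[of ?u' ?u] resolvent_dirac_norm[OF density_borel z, of f] resolvent_dirac_norm[OF cm z, of f]
      by (simp add: \<beta>_def b_def)
    moreover have "0 \<le> K * \<eta> * norm f" using K0 \<eta>0 by simp
    ultimately show ?thesis by (simp add: algebra_simps)
  qed
  then show ?thesis unfolding rate by (simp add: \<eta>_def L_def)
qed

end

section \<open>Admissible families\<close>

lemma circumradius_bounds:
  fixes A :: "(real^2) set"
  assumes A: "A \<noteq> {}" "A \<subseteq> cball c r"
  shows "0 \<le> circumradius A" "circumradius A \<le> r"
    "0 < circumradius A \<Longrightarrow> \<exists>p. A \<subseteq> ball p (2 * circumradius A)"
proof -
  let ?R = "{r. 0 \<le> r \<and> (\<exists>c. A \<subseteq> cball c r)}"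
  have r: "r \<in> ?R"
  proof -
    obtain x where "x \<in> A" using A by blast
    then have "dist c x \<le> r" using A by auto
    then have "0 \<le> r" using zero_le_dist[of c x] by linarith
    then show ?thesis using A by auto
  qed
  have bdd: "bdd_below ?R" by (auto intro: bdd_belowI[of _ 0])
  show "0 \<le> circumradius A" unfolding circumradius_def using r by (intro cInf_greatest) auto
  show "circumradius A \<le> r" unfolding circumradius_def by (rule cInf_lower[OF r bdd])
  show "\<exists>p. A \<subseteq> ball p (2 * circumradius A)" if "0 < circumradius A"
  proof -
    have "Inf ?R < 2 * circumradius A" using that by (simp add: circumradius_def)
    then obtain s where "s \<in> ?R" "s < 2 * circumradius A" using cInf_lessD[of ?R] r by blast
    then obtain p where "A \<subseteq> cball p s" "s < 2 * circumradius A" by auto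
    then have "A \<subseteq> ball p (2 * circumradius A)" by (force simp: subset_eq)
    then show ?thesis by blast
  qed
qed

text \<open>The radius is half the diagonal; this is the source of the bound
  \<open>\<epsilon> / sqrt 2\<close> for all circumradii.\<close>

lemma cell_subset_cball:
  assumes \<epsilon>: "0 < \<epsilon>" shows "cell \<epsilon> k \<subseteq> cball (\<epsilon> *\<^sub>R (\<chi> i. of_int (k $ i))) (\<epsilon> / sqrt 2)"
proof
  fix x assume "x \<in> cell \<epsilon> k"
  then obtain y where y: "x = \<epsilon> *\<^sub>R y + \<epsilon> *\<^sub>R (\<chi> i. of_int (k $ i))" "\<And>i. - 1/2 < y $ i" "\<And>i. y $ i < 1/2"
    by (auto simp: cell_def unit_cell_def)
  have "(y $ i)\<^sup>2 \<le> (1/2)\<^sup>2" for i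
    using y(2,3)[of i] by (intro power2_le_iff_abs_le[THEN iffD2]) (auto simp: abs_le_iff)
  then have "norm y \<le> sqrt ((1/2)\<^sup>2 + (1/2)\<^sup>2)"
    unfolding norm_vec_def L2_set_def real_norm_def power2_abs sum_2 by (intro real_sqrt_le_mono add_mono)
  also have "\<dots> = 1 / sqrt 2" by (simp add: power2_eq_square real_sqrt_divide)
  finally have "\<epsilon> * norm y \<le> \<epsilon> * (1 / sqrt 2)" using \<epsilon> by (intro mult_left_mono) auto
  then show "x \<in> cball (\<epsilon> *\<^sub>R (\<chi> i. of_int (k $ i))) (\<epsilon> / sqrt 2)" using \<epsilon> by (simp add: y(1) dist_norm norm_minus_commute)
qed

text \<open>A square of side \<rho> times the circumradius, inscribed in the rescaled disk, has an
  elementary area and costs only a constant factor.\<close>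

lemma upscaled_ball_measure:
  assumes D: "D \<in> sets borel" "bounded D" and r: "0 < circumradius D" and \<rho>: "0 < \<rho>" "ball x \<rho> \<subseteq> upscaled D"
  shows "\<rho>\<^sup>2 * (circumradius D)\<^sup>2 \<le> measure lborel D"
proof -
  let ?r = "circumradius D"
  define s where "s = \<rho> * ?r"
  have s: "0 < s" using \<rho> r by (simp add: s_def)
  let ?l = "?r *\<^sub>R x - (\<chi> i. s / 2)"
  have "square ?l s \<subseteq> D"
  proof
    fix y assume y: "y \<in> square ?l s"
    have "\<bar>(y - ?r *\<^sub>R x) $ i\<bar> < s / 2" for i
    proof -
      have "?r * x $ i - s / 2 < y $ i" "y $ i < ?r * x $ i - s / 2 + s" using y by (simp_all add: square_def)
      moreover have "(y - ?r *\<^sub>R x) $ i = y $ i - ?r * x $ i" by simp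
      ultimately show ?thesis by linarith
    qed
    from this[of 1] this[of 2] have "norm (y - ?r *\<^sub>R x) < s"
      using norm_le_l1_cart[of "y - ?r *\<^sub>R x"] by (simp add: UNIV_2)
    moreover have "norm (y /\<^sub>R ?r - x) = norm (y - ?r *\<^sub>R x) / ?r"
    proof -
      have "y /\<^sub>R ?r - x = (1 / ?r) *\<^sub>R (y - ?r *\<^sub>R x)" using r by (simp add: scaleR_right_diff_distrib divide_inverse)
      then show ?thesis using r by simp
    qed
    ultimately have "norm (y /\<^sub>R ?r - x) < \<rho>" using r by (simp add: s_def pos_divide_less_eq)
    then have "y /\<^sub>R ?r \<in> upscaled D" using \<rho> by (auto simp: dist_norm norm_minus_commute)
    then show "y \<in> D" using r by (auto simp: upscaled_def)
  qed
  then have "measure lborel (square ?l s) \<le> measure lborel D"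
    using D emeasure_bounded_finite[of D] by (intro measure_mono_fmeasurable) (auto simp: fmeasurable_def)
  moreover have "measure lborel (square ?l s) = s\<^sup>2" using measure_square[OF s, of ?l] by (simp add: measure_def)
  ultimately show ?thesis by (simp add: s_def power_mult_distrib)
qed

text \<open>The geometric assumptions in the form of the locale, with \<alpha> =
  \<open>\<rho>\<^sup>2\<close>. Cells and inclusions are open, so their Lebesgue and Borel measures
  agree and \<open>mass\<close> is the density of the locale.\<close>

lemma admissible_inclusions:
  assumes adm: "admissible \<epsilon>\<^sub>0 \<rho> C\<^sub>t\<^sub>r \<Lambda> D" and \<epsilon>: "0 < \<epsilon>" "\<epsilon> \<le> \<epsilon>\<^sub>0" and pos: "0 < m" "0 < \<rho>"
  obtains p where "inclusions \<epsilon> (d_inf D \<epsilon>) m (\<rho>\<^sup>2) (D \<epsilon>) (\<lambda>k. circumradius (D \<epsilon> k)) p"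
    "mass m D \<epsilon> = inclusions.mass_density \<epsilon> m (D \<epsilon>)" "d_inf D \<epsilon> \<le> \<epsilon> / sqrt 2"
proof -
  let ?D = "D \<epsilon>" and ?r = "\<lambda>k. circumradius (D \<epsilon> k)"
  have d: "0 < d_inf D \<epsilon>" using adm \<epsilon> by (auto simp: admissible_def)
  have op: "open (?D k)" "?D k \<noteq> {}" "?D k \<subseteq> cell \<epsilon> k" "\<exists>x. ball x \<rho> \<subseteq> upscaled (?D k)" for k
    using adm \<epsilon> unfolding admissible_def C21_domain_def by (auto 0 4)
  note cr = circumradius_bounds[OF op(2) order_trans[OF op(3) cell_subset_cball[OF \<epsilon>(1)]]]
  have dr: "d_inf D \<epsilon> \<le> ?r k" for k
    unfolding d_inf_def by (intro cINF_lower) (auto intro!: bdd_belowI[of _ 0] cr)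
  have r: "0 < ?r k" for k using dr[of k] d by linarith
  from cr(3)[OF r] obtain p where p: "\<And>k. ?D k \<subseteq> ball (p k) (2 * ?r k)" by metis
  have borel: "?D k \<in> sets borel" for k using op(1) by simp
  have bdd: "bounded (?D k)" for k using p[of k] bounded_ball bounded_subset by blast
  have d2: "d_inf D \<epsilon> \<le> \<epsilon> / sqrt 2" using dr[of 0] cr(2)[of 0] by linarith
  have "\<epsilon> / sqrt 2 \<le> \<epsilon>" using \<epsilon> by (simp add: divide_le_eq)
  with d2 have d1: "d_inf D \<epsilon> \<le> \<epsilon>" by linarith
  have meas: "\<rho>\<^sup>2 * (?r k)\<^sup>2 \<le> measure lborel (?D k)" for k
    using op(4)[of k] upscaled_ball_measure[OF borel bdd r pos(2)] by blast
  have inc: "inclusions \<epsilon> (d_inf D \<epsilon>) m (\<rho>\<^sup>2) ?D ?r p"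
    by (unfold_locales) (use \<epsilon> d d1 pos borel op p dr meas in auto)
  interpret inclusions \<epsilon> "d_inf D \<epsilon>" m "\<rho>\<^sup>2" ?D ?r p by (rule inc)
  have "measure lebesgue (cell \<epsilon> k) = \<epsilon>\<^sup>2" for k
    using measure_square[OF \<epsilon>(1), of "corner \<epsilon> k"] by (simp add: cell_eq_square[OF \<epsilon>(1)] measure_def)
  moreover have "measure lebesgue (?D k) = measure lborel (?D k)" for k
    using borel by (simp add: measure_def)
  ultimately have eq: "mass m D \<epsilon> = mass_density"
    by (simp add: fun_eq_iff mass_def mass_density_def weight_def)
  show thesis by (rule that[OF inc eq d2])
qed

theorem theorem2p4:
  fixes \<epsilon>\<^sub>0 m \<rho> C\<^sub>t\<^sub>r \<Lambda> :: real
  assumes "0 < \<epsilon>\<^sub>0" "\<epsilon>\<^sub>0 < 1" "0 < m" "0 < \<rho>" "\<rho> < 1" "0 < C\<^sub>t\<^sub>r" "0 < \<Lambda>"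
  shows "\<exists>C>0. \<forall>D. admissible \<epsilon>\<^sub>0 \<rho> C\<^sub>t\<^sub>r \<Lambda> D \<longrightarrow>
    ((\<lambda>\<epsilon>. \<epsilon>\<^sup>2 / d_inf D \<epsilon> * sqrt (ln (\<epsilon> / d_inf D \<epsilon>))) \<longlongrightarrow> 0) (at_right 0) \<longrightarrow>
    norm_resolvent_convergence (\<lambda>\<epsilon>. dirac (mass m D \<epsilon>)) (dirac (\<lambda>x. m)) (at_right 0) \<and>
    \<i> \<in> resolvent_set (dirac (\<lambda>x. m)) \<and>
    (\<forall>\<epsilon>\<in>{0<..\<epsilon>\<^sub>0}.
       \<i> \<in> resolvent_set (dirac (mass m D \<epsilon>)) \<and>
       onorm (\<lambda>f. resolvent (dirac (mass m D \<epsilon>)) \<i> f - resolvent (dirac (\<lambda>x. m)) \<i> f)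
         \<le> C * (\<epsilon>\<^sup>2 / d_inf D \<epsilon> * sqrt (ln (\<epsilon> / d_inf D \<epsilon>))))"
proof (intro exI[of _ "\<bar>resolvent_rate m (\<rho>\<^sup>2) \<i>\<bar> + 1"] conjI allI impI)
  \<comment> \<open>The constant is chosen before the family, from \<open>m\<close> and \<rho>
    alone; the summand 1 makes it positive.\<close>
  fix D :: "real \<Rightarrow> int^2 \<Rightarrow> (real^2) set"
  assume adm: "admissible \<epsilon>\<^sub>0 \<rho> C\<^sub>t\<^sub>r \<Lambda> D"
    and lim: "((\<lambda>\<epsilon>. \<epsilon>\<^sup>2 / d_inf D \<epsilon> * sqrt (ln (\<epsilon> / d_inf D \<epsilon>))) \<longlongrightarrow> 0) (at_right 0)"
  define \<eta> where "\<eta> \<epsilon> = \<epsilon>\<^sup>2 / d_inf D \<epsilon> * sqrt (ln (\<epsilon> / d_inf D \<epsilon>))" for \<epsilon>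
  define \<Delta> where "\<Delta> z \<epsilon> f = resolvent (dirac (mass m D \<epsilon>)) z f - resolvent (dirac (\<lambda>x. m)) z f" for z \<epsilon> f
  have const: "(\<lambda>x::real^2. m) \<in> borel_measurable lebesgue" "\<bar>m\<bar> \<le> m" using assms by auto
  \<comment> \<open>The estimate is available at every non-real \<open>z\<close>, with a constant
    depending on \<open>z\<close>, so convergence of all resolvents follows without a transfer from
    one point to another.\<close>
  have key: "z \<in> resolvent_set (dirac (mass m D \<epsilon>))" "bounded_linear (\<Delta> z \<epsilon>)"
      "onorm (\<Delta> z \<epsilon>) \<le> (\<bar>resolvent_rate m (\<rho>\<^sup>2) z\<bar> + 1) * \<eta> \<epsilon>" if \<epsilon>: "0 < \<epsilon>" "\<epsilon> \<le> \<epsilon>\<^sub>0" and z: "Im z \<noteq> 0" for z \<epsilon>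
  proof -
    obtain p where inc: "inclusions \<epsilon> (d_inf D \<epsilon>) m (\<rho>\<^sup>2) (D \<epsilon>) (\<lambda>k. circumradius (D \<epsilon> k)) p"
      and mass: "mass m D \<epsilon> = inclusions.mass_density \<epsilon> m (D \<epsilon>)" and d2: "d_inf D \<epsilon> \<le> \<epsilon> / sqrt 2"
      by (rule admissible_inclusions[OF adm \<epsilon> assms(3,4)]) (rule that)
    interpret inclusions \<epsilon> "d_inf D \<epsilon>" m "\<rho>\<^sup>2" "D \<epsilon>" "\<lambda>k. circumradius (D \<epsilon> k)" p by (rule inc)
    show "z \<in> resolvent_set (dirac (mass m D \<epsilon>))"
      unfolding mass by (rule resolvent_set_dirac[OF density_borel z])
    show bl: "bounded_linear (\<Delta> z \<epsilon>)"
      unfolding \<Delta>_def mass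
      by (intro bounded_linear_sub resolvent_dirac_bounded_linear[OF density_borel z] resolvent_dirac_bounded_linear[OF const z])
    have "1 \<le> \<epsilon> / d_inf D \<epsilon>" using d by (simp add: le_divide_eq)
    then have \<eta>: "0 \<le> \<eta> \<epsilon>" using d by (simp add: \<eta>_def)
    show "onorm (\<Delta> z \<epsilon>) \<le> (\<bar>resolvent_rate m (\<rho>\<^sup>2) z\<bar> + 1) * \<eta> \<epsilon>"
    proof (rule onorm_bound)
      fix f
      have "norm (\<Delta> z \<epsilon> f) \<le> resolvent_rate m (\<rho>\<^sup>2) z * \<eta> \<epsilon> * norm f"
        unfolding \<Delta>_def \<eta>_def mass by (rule resolvent_estimate[OF z d2])
      also have "\<dots> \<le> (\<bar>resolvent_rate m (\<rho>\<^sup>2) z\<bar> + 1) * \<eta> \<epsilon> * norm f"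
        using \<eta> by (intro mult_right_mono) auto
      finally show "norm (\<Delta> z \<epsilon> f) \<le> (\<bar>resolvent_rate m (\<rho>\<^sup>2) z\<bar> + 1) * \<eta> \<epsilon> * norm f" .
    qed (use \<eta> in simp)
  qed
  have ev: "\<forall>\<^sub>F \<epsilon> in at_right 0. 0 < \<epsilon> \<and> \<epsilon> \<le> \<epsilon>\<^sub>0"
    using assms(1) by (auto simp: eventually_at_right_field intro!: exI[of _ \<epsilon>\<^sub>0])
  show "norm_resolvent_convergence (\<lambda>\<epsilon>. dirac (mass m D \<epsilon>)) (dirac (\<lambda>x. m)) (at_right 0)"
    unfolding norm_resolvent_convergence_def
  proof (intro allI impI conjI)
    fix z :: complex assume z: "Im z \<noteq> 0"
    show "z \<in> resolvent_set (dirac (\<lambda>x. m))" by (rule resolvent_set_dirac[OF const z])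
    show "\<forall>\<^sub>F \<epsilon> in at_right 0. z \<in> resolvent_set (dirac (mass m D \<epsilon>))"
      using ev by eventually_elim (use key(1) z in blast)
    have "((\<lambda>\<epsilon>. onorm (\<Delta> z \<epsilon>)) \<longlongrightarrow> 0) (at_right 0)"
    proof (rule tendsto_sandwich[OF _ _ tendsto_const])
      show "\<forall>\<^sub>F \<epsilon> in at_right 0. 0 \<le> onorm (\<Delta> z \<epsilon>)"
        using ev by eventually_elim (use key(2) z onorm_pos_le in blast)
      show "\<forall>\<^sub>F \<epsilon> in at_right 0. onorm (\<Delta> z \<epsilon>) \<le> (\<bar>resolvent_rate m (\<rho>\<^sup>2) z\<bar> + 1) * \<eta> \<epsilon>"
        using ev by eventually_elim (use key(3) z in blast)
      show "((\<lambda>\<epsilon>. (\<bar>resolvent_rate m (\<rho>\<^sup>2) z\<bar> + 1) * \<eta> \<epsilon>) \<longlongrightarrow> 0) (at_right 0)"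
        unfolding \<eta>_def by (rule tendsto_mult_right_zero[OF lim])
    qed
    then show "((\<lambda>\<epsilon>. onorm (\<lambda>f. resolvent (dirac (mass m D \<epsilon>)) z f - resolvent (dirac (\<lambda>x. m)) z f)) \<longlongrightarrow> 0) (at_right 0)"
      by (simp add: \<Delta>_def[abs_def])
  qed
  show "\<i> \<in> resolvent_set (dirac (\<lambda>x. m))" by (rule resolvent_set_dirac[OF const]) simp
  show "\<forall>\<epsilon>\<in>{0<..\<epsilon>\<^sub>0}. \<i> \<in> resolvent_set (dirac (mass m D \<epsilon>)) \<and>
       onorm (\<lambda>f. resolvent (dirac (mass m D \<epsilon>)) \<i> f - resolvent (dirac (\<lambda>x. m)) \<i> f)
         \<le> (\<bar>resolvent_rate m (\<rho>\<^sup>2) \<i>\<bar> + 1) * (\<epsilon>\<^sup>2 / d_inf D \<epsilon> * sqrt (ln (\<epsilon> / d_inf D \<epsilon>)))"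
    using key[of _ \<i>] by (auto simp: \<Delta>_def[abs_def] \<eta>_def)
qed simp

end
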